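(* Let $p$ be a prime number, let $\Gamma$ be a finite simplicial graph and let $\mathcal{G} = \{G_v \mid v \in V\Gamma\}$ be a family of non-trivial finitely generated residually $p$-finite groups. Assume that $G_v$ is $p$-IAS whenever $v$ is central in $\Gamma$. Then the graph product $\Gamma\mathcal{G}$ is $p$-IAS and, consequently, $\operatorname{Out}_p(\Gamma\mathcal{G})$ is residually $p$-finite and $\operatorname{Out}(\Gamma\mathcal{G})$ is virtually residually $p$-finite.
   Context: Graphs are simplicial: $V\Gamma$ is a set and $E\Gamma \subseteq \binom{V\Gamma}{2}$. The graph product $\Gamma\mathcal{G}$ of a family of groups $\mathcal{G} = \{G_v \mid v\in V\Gamma\}$ is the quotient of the free product $\ast_{v \in V\Gamma} G_v$ by the relations $g_u g_v = g_v g_u$ for all $g_u \in G_u$, $g_v \in G_v$ whenever $\{u,v\}\in E\Gamma$. A vertex $v \in V\Gamma$ is central in $\Gamma$ if $\{u,v\}\in E\Gamma$ for all $u \in V\Gamma\setminus\{v\}$. A group $G$ is residually $p$-finite if for every $g \in G\setminus\{1\}$ there is $N \unlhd G$ with $G/N$ a finite $p$-group and $g\notin N$. A group is virtually residually $p$-finite if it has a finite-index subgroup that is residually $p$-finite. A group $G$ is $p$-inner automorphism separable ($p$-IAS) if for every $\phi \in \operatorname{Aut}(G)\setminus\operatorname{Inn}(G)$ there is a characteristic subgroup $K$ of $G$ with $G/K$ a finite $p$-group such that $\tilde{\kappa}(\phi)\notin \operatorname{Inn}(G/K)$, where $\tilde{\kappa}\colon\operatorname{Aut}(G)\to\operatorname{Aut}(G/K)$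 is given by $\tilde{\kappa}(\psi)(gK) = \psi(g)K$. For a group $G$, let $K_p = [G,G]G_p$, where $G_p$ is the subgroup generated by all $g^p$, $g \in G$. Then $\operatorname{Aut}_p(G)$ is the kernel of the natural homomorphism $\operatorname{Aut}(G)\to\operatorname{Aut}(G/K_p)$; it contains $\operatorname{Inn}(G)$, and $\operatorname{Out}_p(G) = \operatorname{Aut}_p(G)/\operatorname{Inn}(G) \leq \operatorname{Out}(G)= \operatorname{Aut}(G)/\operatorname{Inn}(G)$. *)

theory Defs
  imports "HOL-Algebra.Algebra"
begin

section \<open>Simplicial graphs\<close>

definition simplicial_graph :: "'v set \<Rightarrow> 'v set set \<Rightarrow> bool" where
  "simplicial_graph V E \<longleftrightarrow> E \<subseteq> {e. e \<subseteq> V \<and> card e = 2}"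

definition central_vertex :: "'v set \<Rightarrow> 'v set set \<Rightarrow> 'v \<Rightarrow> bool" where
  "central_vertex V E v \<longleftrightarrow> v \<in> V \<and> (\<forall>u\<in>V - {v}. {u, v} \<in> E)"


section \<open>Free products and graph products\<close>

text \<open>The free product of the family \<open>G v\<close> (\<open>v \<in> V\<close>) is realised as the monoid of words in
  the disjoint union of the groups, modulo the congruence generated by multiplying adjacent
  letters from the same group and deleting identity letters.\<close>

definition free_words :: "'v set \<Rightarrow> ('v \<Rightarrow> ('a, 'b) monoid_scheme) \<Rightarrow> ('v \<times> 'a) list set" where
  "free_words V G = lists (SIGMA v:V. carrier (G v))"

inductive_set free_cong ::
    "'v set \<Rightarrow> ('v \<Rightarrow> ('a, 'b) monoid_scheme) \<Rightarrow> (('v \<times> 'a) list \<times> ('v \<times> 'a) list) set"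
  for V G where
  refl: "w \<in> free_words V G \<Longrightarrow> (w, w) \<in> free_cong V G"
| sym: "(w, w') \<in> free_cong V G \<Longrightarrow> (w', w) \<in> free_cong V G"
| trans: "(w, w') \<in> free_cong V G \<Longrightarrow> (w', w'') \<in> free_cong V G \<Longrightarrow> (w, w'') \<in> free_cong V G"
| mult: "xs \<in> free_words V G \<Longrightarrow> ys \<in> free_words V G \<Longrightarrow> v \<in> V \<Longrightarrow>
    g \<in> carrier (G v) \<Longrightarrow> h \<in> carrier (G v) \<Longrightarrow>
    (xs @ [(v, g), (v, h)] @ ys, xs @ [(v, g \<otimes>\<^bsub>G v\<^esub> h)] @ ys) \<in> free_cong V G"
| one: "xs \<in> free_words V G \<Longrightarrow> ys \<in> free_words V G \<Longrightarrow> v \<in> V \<Longrightarrow>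
    (xs @ [(v, \<one>\<^bsub>G v\<^esub>)] @ ys, xs @ ys) \<in> free_cong V G"

definition free_product ::
    "'v set \<Rightarrow> ('v \<Rightarrow> ('a, 'b) monoid_scheme) \<Rightarrow> ('v \<times> 'a) list set monoid" where
  "free_product V G =
    \<lparr>carrier = free_words V G // free_cong V G,
     monoid.mult = \<lambda>A B. \<Union>a\<in>A. \<Union>b\<in>B. free_cong V G `` {a @ b},
     one = free_cong V G `` {[]}\<rparr>"

definition free_incl ::
    "'v set \<Rightarrow> ('v \<Rightarrow> ('a, 'b) monoid_scheme) \<Rightarrow> 'v \<Rightarrow> 'a \<Rightarrow> ('v \<times> 'a) list set" where
  "free_incl V G v g = free_cong V G `` {[(v, g)]}"

definition normal_closure :: "('a, 'b) monoid_scheme \<Rightarrow> 'a set \<Rightarrow> 'a set" where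
  "normal_closure G R = \<Inter>{N. N \<lhd> G \<and> R \<subseteq> N}"

definition graph_product_relators ::
    "'v set \<Rightarrow> 'v set set \<Rightarrow> ('v \<Rightarrow> ('a, 'b) monoid_scheme) \<Rightarrow> ('v \<times> 'a) list set set" where
  "graph_product_relators V E G =
    {x \<otimes>\<^bsub>F\<^esub> y \<otimes>\<^bsub>F\<^esub> inv\<^bsub>F\<^esub> (y \<otimes>\<^bsub>F\<^esub> x) |F x y.
      F = free_product V G \<and>
      (\<exists>u v. {u, v} \<in> E \<and> x \<in> free_incl V G u ` carrier (G u) \<and>
             y \<in> free_incl V G v ` carrier (G v))}"

definition graph_product ::
    "'v set \<Rightarrow> 'v set set \<Rightarrow> ('v \<Rightarrow> ('a, 'b) monoid_scheme) \<Rightarrow> ('v \<times> 'a) list set set monoid" where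
  "graph_product V E G =
    free_product V G Mod normal_closure (free_product V G) (graph_product_relators V E G)"


section \<open>Residual properties\<close>

definition finitely_generated_group :: "('a, 'b) monoid_scheme \<Rightarrow> bool" where
  "finitely_generated_group G \<longleftrightarrow>
    group G \<and> (\<exists>S. finite S \<and> S \<subseteq> carrier G \<and> generate G S = carrier G)"

definition finite_p_group :: "nat \<Rightarrow> ('a, 'b) monoid_scheme \<Rightarrow> bool" where
  "finite_p_group p G \<longleftrightarrow> group G \<and> finite (carrier G) \<and> (\<exists>n. order G = p ^ n)"

definition residually_p_finite :: "nat \<Rightarrow> ('a, 'b) monoid_scheme \<Rightarrow> bool" where
  "residually_p_finite p G \<longleftrightarrow>
    group G \<and>
    (\<forall>g\<in>carrier G - {\<one>\<^bsub>G\<^esub>}. \<exists>N. N \<lhd> G \<and> finite_p_group p (G Mod N) \<and> g \<notin> N)"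

definition virtually_residually_p_finite :: "nat \<Rightarrow> ('a, 'b) monoid_scheme \<Rightarrow> bool" where
  "virtually_residually_p_finite p G \<longleftrightarrow>
    group G \<and>
    (\<exists>H. subgroup H G \<and> finite (rcosets\<^bsub>G\<^esub> H) \<and> residually_p_finite p (G\<lparr>carrier := H\<rparr>))"


section \<open>Automorphisms\<close>

definition Inn :: "('a, 'b) monoid_scheme \<Rightarrow> ('a \<Rightarrow> 'a) set" where
  "Inn G = (\<lambda>g. \<lambda>x\<in>carrier G. g \<otimes>\<^bsub>G\<^esub> x \<otimes>\<^bsub>G\<^esub> inv\<^bsub>G\<^esub> g) ` carrier G"

definition OutGroup :: "('a, 'b) monoid_scheme \<Rightarrow> ('a \<Rightarrow> 'a) set monoid" where
  "OutGroup G = AutoGroup G Mod Inn G"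

definition characteristic_subgroup :: "'a set \<Rightarrow> ('a, 'b) monoid_scheme \<Rightarrow> bool" where
  "characteristic_subgroup K G \<longleftrightarrow> subgroup K G \<and> (\<forall>\<phi>\<in>auto G. \<phi> ` K = K)"

text \<open>The map on \<open>G Mod K\<close> sending the coset of \<open>g\<close> to the coset of \<open>\<phi> g\<close>. For characteristic
  \<open>K\<close> it does not depend on the representative, see \<open>induced_auto_coset\<close>. The right cosets
  used by \<open>Mod\<close> coincide with left cosets, as \<open>K\<close> is then normal.\<close>

definition induced_auto :: "('a, 'b) monoid_scheme \<Rightarrow> 'a set \<Rightarrow> ('a \<Rightarrow> 'a) \<Rightarrow> 'a set \<Rightarrow> 'a set" where
  "induced_auto G K \<phi> =
    (\<lambda>C\<in>carrier (G Mod K). K #>\<^bsub>G\<^esub> \<phi> (SOME g. g \<in> carrier G \<and> C = K #>\<^bsub>G\<^esub> g))"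

definition p_IAS :: "nat \<Rightarrow> ('a, 'b) monoid_scheme \<Rightarrow> bool" where
  "p_IAS p G \<longleftrightarrow>
    group G \<and>
    (\<forall>\<phi>\<in>auto G - Inn G.
      \<exists>K. characteristic_subgroup K G \<and> finite_p_group p (G Mod K) \<and>
          induced_auto G K \<phi> \<notin> Inn (G Mod K))"

definition K_p :: "nat \<Rightarrow> ('a, 'b) monoid_scheme \<Rightarrow> 'a set" where
  "K_p p G =
    derived G (carrier G) <#>\<^bsub>G\<^esub> generate G {g [^]\<^bsub>G\<^esub> p |g. g \<in> carrier G}"

definition Aut_p :: "nat \<Rightarrow> ('a, 'b) monoid_scheme \<Rightarrow> ('a \<Rightarrow> 'a) set" where
  "Aut_p p G = kernel (AutoGroup G) (AutoGroup (G Mod K_p p G)) (induced_auto G (K_p p G))"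

definition Out_p :: "nat \<Rightarrow> ('a, 'b) monoid_scheme \<Rightarrow> ('a \<Rightarrow> 'a) set monoid" where
  "Out_p p G = (AutoGroup G)\<lparr>carrier := Aut_p p G\<rparr> Mod Inn G"


section \<open>Well-definedness\<close>

lemma free_cong_words:
  assumes "\<And>v. v \<in> V \<Longrightarrow> group (G v)" "(w, w') \<in> free_cong V G"
  shows "w \<in> free_words V G \<and> w' \<in> free_words V G"
  using assms(2)
proof induction
  case (mult xs ys v g h)
  interpret group "G v" using assms(1) mult by blast
  show ?case using mult by (auto simp: free_words_def)
next
  case (one xs ys v)
  interpret group "G v" using assms(1) one by blast
  show ?case using one by (auto simp: free_words_def)
qed auto

lemma equiv_free_cong:
  assumes "\<And>v. v \<in> V \<Longrightarrow> group (G v)"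
  shows "equiv (free_words V G) (free_cong V G)"
proof (rule equivI)
  show "free_cong V G \<subseteq> free_words V G \<times> free_words V G"
  proof (intro subsetI)
    fix x assume "x \<in> free_cong V G"
    then have "(fst x, snd x) \<in> free_cong V G" by simp
    from free_cong_words[OF assms this] show "x \<in> free_words V G \<times> free_words V G"
      by (simp add: mem_Times_iff)
  qed
  show "refl_on (free_words V G) (free_cong V G)"
    by (rule refl_onI) (rule free_cong.refl)
  show "sym (free_cong V G)"
    by (rule symI) (rule free_cong.sym)
  show "trans (free_cong V G)"
    by (rule transI) (rule free_cong.trans)
qed

lemma free_words_append [simp]:
  "xs @ ys \<in> free_words V G \<longleftrightarrow> xs \<in> free_words V G \<and> ys \<in> free_words V G"
  by (auto simp: free_words_def)

lemma free_cong_append_context: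
  assumes "(w, w') \<in> free_cong V G" "a \<in> free_words V G" "b \<in> free_words V G"
  shows "(a @ w @ b, a @ w' @ b) \<in> free_cong V G"
  using assms(1)
proof induction
  case (mult xs ys v g h)
  show ?case
    using free_cong.mult[of "a @ xs" V G "ys @ b" v g h] mult assms by simp
next
  case (one xs ys v)
  show ?case
    using free_cong.one[of "a @ xs" V G "ys @ b" v] one assms by simp
next
  case (refl w)
  then show ?case using assms by (intro free_cong.refl) simp
next
  case (sym w w')
  then show ?case by (blast intro: free_cong.sym)
next
  case (trans w w' w'')
  then show ?case by (blast intro: free_cong.trans)
qed

lemma free_product_mult:
  assumes G: "\<And>v. v \<in> V \<Longrightarrow> group (G v)"
    and a: "a \<in> free_words V G" and b: "b \<in> free_words V G"
  shows "free_cong V G `` {a} \<otimes>\<^bsub>free_product V G\<^esub> free_cong V G `` {b} = free_cong V G `` {a @ b}"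
proof -
  have eq: "equiv (free_words V G) (free_cong V G)"
    by (rule equiv_free_cong) (rule G)
  have "congruent2 (free_cong V G) (free_cong V G) (\<lambda>a b. free_cong V G `` {a @ b})"
  proof (rule congruent2I')
    fix a a' b b' assume A: "(a, a') \<in> free_cong V G" and B: "(b, b') \<in> free_cong V G"
    have w: "a' \<in> free_words V G" "b \<in> free_words V G"
      using equiv_type[OF eq] A B by auto
    have nil: "[] \<in> free_words V G" by (simp add: free_words_def)
    have "(a @ b, a' @ b) \<in> free_cong V G"
      using free_cong_append_context[OF A nil w(2)] by simp
    moreover have "(a' @ b, a' @ b') \<in> free_cong V G"
      using free_cong_append_context[OF B w(1) nil] by simp
    ultimately have "(a @ b, a' @ b') \<in> free_cong V G"
      by (rule free_cong.trans)
    then show "free_cong V G `` {a @ b} = free_cong V G `` {a' @ b'}"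
      by (rule equiv_class_eq[OF eq])
  qed
  from UN_equiv_class2[OF eq eq this a b] show ?thesis
    by (simp add: free_product_def)
qed

lemma free_word_inverse:
  assumes G: "\<And>v. v \<in> V \<Longrightarrow> group (G v)" and "w \<in> free_words V G"
  shows "\<exists>w'\<in>free_words V G. (w' @ w, []) \<in> free_cong V G"
  using assms(2)
proof (induction w)
  case Nil
  then show ?case by (auto intro!: bexI[of _ "[]"] free_cong.refl)
next
  case (Cons x w)
  obtain v g where x: "x = (v, g)" by fastforce
  have v: "v \<in> V" "g \<in> carrier (G v)" and w: "w \<in> free_words V G"
    using Cons.prems x by (auto simp: free_words_def)
  interpret group "G v" using G v by blast
  obtain w' where w': "w' \<in> free_words V G" "(w' @ w, []) \<in> free_cong V G"
    using Cons.IH w by blast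
  let ?u = "w' @ [(v, inv\<^bsub>G v\<^esub> g)]"
  have "(w' @ [(v, inv\<^bsub>G v\<^esub> g), (v, g)] @ w, w' @ [(v, inv\<^bsub>G v\<^esub> g \<otimes>\<^bsub>G v\<^esub> g)] @ w) \<in> free_cong V G"
    using v w w' by (intro free_cong.mult) auto
  moreover have "(w' @ [(v, \<one>\<^bsub>G v\<^esub>)] @ w, w' @ w) \<in> free_cong V G"
    using v w w' by (intro free_cong.one) auto
  ultimately have "(?u @ x # w, []) \<in> free_cong V G"
    using w' v x by (auto intro: free_cong.trans)
  moreover have "?u \<in> free_words V G"
    using w' v by (auto simp: free_words_def)
  ultimately show ?case by blast
qed

lemma group_free_product:
  assumes G: "\<And>v. v \<in> V \<Longrightarrow> group (G v)"
  shows "group (free_product V G)"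
proof (rule groupI)
  have carr: "carrier (free_product V G) = free_words V G // free_cong V G"
    and one: "\<one>\<^bsub>free_product V G\<^esub> = free_cong V G `` {[]}"
    by (simp_all add: free_product_def)
  have nil: "[] \<in> free_words V G" by (simp add: free_words_def)
  have eq: "equiv (free_words V G) (free_cong V G)"
    by (rule equiv_free_cong) (rule G)
  have m: "free_cong V G `` {a} \<otimes>\<^bsub>free_product V G\<^esub> free_cong V G `` {b} = free_cong V G `` {a @ b}"
    if "a \<in> free_words V G" "b \<in> free_words V G" for a b
    using free_product_mult[of V G a b] G that by blast
  show "\<one>\<^bsub>free_product V G\<^esub> \<in> carrier (free_product V G)"
    using nil by (simp add: carr one quotientI)
  fix x assume "x \<in> carrier (free_product V G)"
  then obtain a where a: "a \<in> free_words V G" "x = free_cong V G `` {a}"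
    by (auto simp: carr elim: quotientE)
  show "\<one>\<^bsub>free_product V G\<^esub> \<otimes>\<^bsub>free_product V G\<^esub> x = x"
    using m[OF nil a(1)] a by (simp add: one)
  obtain a' where a': "a' \<in> free_words V G" "(a' @ a, []) \<in> free_cong V G"
    using free_word_inverse[of V G a] G a(1) by blast
  then show "\<exists>y\<in>carrier (free_product V G). y \<otimes>\<^bsub>free_product V G\<^esub> x = \<one>\<^bsub>free_product V G\<^esub>"
    using m[OF a'(1) a(1)] a equiv_class_eq[OF eq a'(2)]
    by (intro bexI[of _ "free_cong V G `` {a'}"]) (auto simp: one carr quotientI)
  fix y assume "y \<in> carrier (free_product V G)"
  then obtain b where b: "b \<in> free_words V G" "y = free_cong V G `` {b}"
    by (auto simp: carr elim: quotientE)
  show "x \<otimes>\<^bsub>free_product V G\<^esub> y \<in> carrier (free_product V G)"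
    using m[OF a(1) b(1)] a b by (simp add: carr quotientI)
  fix z assume "z \<in> carrier (free_product V G)"
  then obtain c where c: "c \<in> free_words V G" "z = free_cong V G `` {c}"
    by (auto simp: carr elim: quotientE)
  show "x \<otimes>\<^bsub>free_product V G\<^esub> y \<otimes>\<^bsub>free_product V G\<^esub> z =
        x \<otimes>\<^bsub>free_product V G\<^esub> (y \<otimes>\<^bsub>free_product V G\<^esub> z)"
    using a b c by (simp add: m)
qed

lemma graph_product_relators_subset:
  assumes "\<And>v. v \<in> V \<Longrightarrow> group (G v)" "simplicial_graph V E"
  shows "graph_product_relators V E G \<subseteq> carrier (free_product V G)"
proof -
  interpret F: group "free_product V G" by (rule group_free_product[OF assms(1)])
  have "free_incl V G v g \<in> carrier (free_product V G)" if "v \<in> V" "g \<in> carrier (G v)" for v g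
    using that unfolding free_incl_def free_product_def
    by (auto intro!: quotientI simp: free_words_def)
  moreover have "u \<in> V \<and> v \<in> V" if "{u, v} \<in> E" for u v
    using that assms(2) by (auto simp: simplicial_graph_def)
  ultimately show ?thesis
    by (auto simp: graph_product_relators_def)
qed

lemma (in group) normal_closure_normal:
  assumes "R \<subseteq> carrier G"
  shows "normal_closure G R \<lhd> G"
proof -
  have G: "carrier G \<lhd> G"
    by (simp add: normal_inv_iff subgroup_self)
  show ?thesis
    unfolding normal_closure_def normal_inv_iff
  proof (intro conjI ballI)
    show "subgroup (\<Inter>{N. (subgroup N G \<and> (\<forall>x\<in>carrier G. \<forall>h\<in>N. x \<otimes> h \<otimes> inv x \<in> N)) \<and> R \<subseteq> N}) G"
      using G assms by (intro subgroups_Inter) (auto simp: normal_inv_iff)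
  qed auto
qed

lemma group_graph_product:
  assumes "\<And>v. v \<in> V \<Longrightarrow> group (G v)" "simplicial_graph V E"
  shows "group (graph_product V E G)"
proof -
  interpret F: group "free_product V G" by (rule group_free_product[OF assms(1)])
  show ?thesis
    unfolding graph_product_def
    by (rule normal.factorgroup_is_group[OF F.normal_closure_normal[OF
          graph_product_relators_subset[OF assms]]])
qed

lemma (in group) induced_auto_coset:
  assumes K: "characteristic_subgroup K G" and \<phi>: "\<phi> \<in> auto G" and g: "g \<in> carrier G"
  shows "induced_auto G K \<phi> (K #> g) = K #> \<phi> g"
proof -
  have sub: "subgroup K G" and im: "\<phi> ` K = K"
    using K \<phi> by (auto simp: characteristic_subgroup_def)
  have hom: "\<phi> \<in> hom G G" using \<phi> by (simp add: auto_def)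
  define h where "h = (SOME h. h \<in> carrier G \<and> K #> g = K #> h)"
  have h: "h \<in> carrier G" "K #> g = K #> h"
    using someI[of "\<lambda>h. h \<in> carrier G \<and> K #> g = K #> h" g] g by (auto simp: h_def)
  obtain k where k: "k \<in> K" "h = k \<otimes> g"
    using rcos_self[OF h(1) sub] h(2) by (auto simp: r_coset_def)
  have "\<phi> h = \<phi> k \<otimes> \<phi> g"
    using k g hom sub by (auto simp: hom_def subgroup.mem_carrier)
  moreover have "\<phi> k \<in> K" using im k by blast
  moreover have "\<phi> g \<in> carrier G" "\<phi> h \<in> carrier G" using hom g h by (auto simp: hom_def)
  ultimately have "K #> \<phi> h = K #> \<phi> g"
    using repr_independence[of "\<phi> h" K "\<phi> g"] sub by (auto simp: r_coset_def)
  then show ?thesis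
    using g by (auto simp: induced_auto_def FactGroup_def RCOSETS_def h_def)
qed

end

theory Submission
  imports Defs "HOL-Library.Sublist" "HOL-Computational_Algebra.Polynomial"
begin

text \<open>Call an automorphism approximately inner if modulo every normal subgroup whose quotient is a
  finite \<open>p\<close>-group it agrees with some conjugation. Every such normal subgroup of a finitely
  generated group contains a characteristic one, so it is enough to show that the approximately
  inner automorphisms of the graph product are inner.

  From finite \<open>p\<close>-quotients \<open>G v / N v\<close> one builds an integral representation of the graph product
  with a parameter \<open>t\<close>: on the sum of the permutation modules of the \<open>G v / N v\<close>, a letter of type
  \<open>v\<close> permutes the block of \<open>v\<close> and adds \<open>t\<close> times a rank one map from each block of a
  non-neighbour. If \<open>p\<close> divides \<open>t\<close>, the image modulo \<open>p ^ k\<close> is a \<open>p\<close>-group, so approximately inner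
  automorphisms preserve all traces. The trace is a polynomial in \<open>t\<close> whose coefficients count
  cyclic subwords with consecutive letters not commuting, whence an approximately inner
  automorphism cannot lengthen such subwords of cyclically reduced words. This forces the image of
  a vertex group to be a conjugate of itself, then, through words \<open>s h z h\<inverse>\<close> with \<open>s\<close> a closed walk
  in the complement graph, one conjugator to serve all vertices of a component of the complement,
  and the quadratic coefficient then makes the automorphism inner there. The central vertices
  are the isolated vertices of the complement, for which \<open>p\<close>-IAS is assumed.

  For \<open>Out\<close>, the point is that automorphisms of a finite \<open>p\<close>-group that are trivial modulo \<open>K_p\<close>
  have \<open>p\<close>-power order.\<close>

section \<open>Words and closed walks\<close>

text \<open>The obstacle is cancellation: a coefficient of the trace polynomial sums over subwords,
  and those with repeated types may contribute negatively, as a single letter already can in degree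
  zero. Everything is therefore read off at a degree where this cannot happen. In a cyclically
  reduced word a closed walk that stands still somewhere can be made to move more often, so the
  largest number of moves is reached only by walks that never stand still, and these contribute
  products of positive weights. The parameter \<open>t\<close> separates the degrees: traces that
  agree for all multiples of \<open>p\<close> give equal polynomials. The quotients and the weights
  are chosen anew for each word, because residual \<open>p\<close>-finiteness handles only finitely
  many letters at a time. A conjugate \<open>h z h\<inverse>\<close> alone shows nothing of
  \<open>h\<close>, as a trace does not see conjugation; a closed walk \<open>s\<close> in front, on
  which the automorphism is already controlled, makes \<open>h\<close> visible, and \<open>s\<close>
  has to be closed so that nothing merges where the ends of the cycle meet.\<close>

fun changes :: "'v list \<Rightarrow> nat" where
  "changes (x # y # ys) = (if x = y then 0 else 1) + changes (y # ys)"
| "changes _ = 0"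

lemma changes_append: "changes (xs @ x # ys) = changes (xs @ [x]) + changes (x # ys)"
proof (induction xs)
  case (Cons a xs)
  show ?case
  proof (cases xs)
    case (Cons b zs)
    then show ?thesis using Cons.IH by simp
  qed simp
qed simp

lemma changes_length: "changes xs \<le> length xs - 1"
  by (induction xs rule: changes.induct) auto

lemma successively_append_Cons:
  "successively P (xs @ x # ys) \<longleftrightarrow> successively P (xs @ [x]) \<and> successively P (x # ys)"
  by (auto simp: successively_append_iff)

lemma not_successively_split:
  assumes "\<not> successively P xs"
  obtains us x y vs where "xs = us @ x # y # vs" "\<not> P x y"
proof -
  have "\<not> successively P xs \<Longrightarrow> \<exists>us x y vs. xs = us @ x # y # vs \<and> \<not> P x y"
  proof (induction P xs rule: successively.induct)
    case (3 P x y xs)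
    show ?case
    proof (cases "P x y")
      case True
      then have "\<not> successively P (y # xs)" using 3 by simp
      then obtain us a b vs where "y # xs = us @ a # b # vs" "\<not> P a b" using 3 True by blast
      then have "x # y # xs = (x # us) @ a # b # vs \<and> \<not> P a b" by simp
      then show ?thesis by blast
    next
      case False
      have "x # y # xs = [] @ x # y # xs" by simp
      then show ?thesis using False by blast
    qed
  qed auto
  then show ?thesis using assms that by blast
qed

text \<open>The first type is repeated at the end so that the closing pair of the cycle becomes
  adjacent. On the empty word this is a one-element list, so the empty word is
  \<open>admissible\<close> without changes, and \<open>proper\<close> has to exclude it by
  hand.\<close>

definition cyc :: "('v \<times> 'a) list \<Rightarrow> 'v list" where
  "cyc s = map fst s @ [fst (hd s)]"

locale simplicial =
  fixes V :: "'v set" and E :: "'v set set"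
  assumes simplicial: "simplicial_graph V E"
begin

text \<open>Adjacency in the complement graph.\<close>

definition nc :: "'v \<Rightarrow> 'v \<Rightarrow> bool" where
  "nc u v \<longleftrightarrow> u \<noteq> v \<and> {u, v} \<notin> E"

lemma nc_sym: "nc u v \<Longrightarrow> nc v u"
  by (auto simp: nc_def insert_commute)

lemma nc_irrefl [simp]: "\<not> nc v v"
  by (simp add: nc_def)

lemma loop_free [simp]: "{v} \<notin> E"
  using simplicial by (auto simp: simplicial_graph_def)

text \<open>Closed walks in the complement graph that may stand still: a repeated type passes the
  test because \<open>E\<close> contains no singleton. Among nonempty subwords only these can have a
  nonzero term in the trace expansion. The variant \<open>proper\<close> forbids standing
  still.\<close>

definition admissible :: "('v \<times> 'a) list \<Rightarrow> bool" where
  "admissible s \<longleftrightarrow> successively (\<lambda>u v. {u, v} \<notin> E) (cyc s)"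

definition proper :: "('v \<times> 'a) list \<Rightarrow> bool" where
  "proper s \<longleftrightarrow> s \<noteq> [] \<and> successively nc (cyc s)"

text \<open>Letters of one type cannot be brought together along either arc of the cycle: neither
  through \<open>W2\<close> nor around the ends through \<open>W3\<close> and
  \<open>W1\<close>.\<close>

definition cyclically_reduced :: "('v \<times> 'a) list \<Rightarrow> bool" where
  "cyclically_reduced w \<longleftrightarrow> (\<forall>W1 a W2 b W3. w = W1 @ a # W2 @ b # W3 \<longrightarrow> fst a = fst b \<longrightarrow>
     (\<exists>m\<in>set W2. nc (fst m) (fst a)) \<and> (\<exists>m\<in>set W1 \<union> set W3. nc (fst m) (fst a)))"

lemma proper_admissible: "proper s \<Longrightarrow> admissible s"
  unfolding proper_def admissible_def by (auto elim: successively_mono simp: nc_def)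

lemma proper_changes:
  assumes "proper s"
  shows "changes (cyc s) = length s"
proof -
  have *: "successively nc xs \<Longrightarrow> changes xs = length xs - 1" for xs
    by (induction xs rule: changes.induct) auto
  show ?thesis using assms *[of "cyc s"] by (simp add: proper_def cyc_def)
qed

lemma changes_cyc_le: "changes (cyc s) \<le> length s"
  using changes_length[of "cyc s"] by (simp add: cyc_def)

text \<open>A repetition in the closed walk comes from two letters of one type, and cyclic
  reducedness provides a letter \<open>m\<close> of \<open>w\<close> on the arc between them that is
  joined to their type in the complement graph. Inserting it keeps the walk admissible and adds two
  changes. A single letter is cyclically adjacent only to itself, whence the bound on the
  length.\<close>

lemma admissible_improve:
  assumes cr: "cyclically_reduced w" and s: "subseq s w" "admissible s" "\<not> proper s" "length s \<ge> 2"
  shows "\<exists>s'. subseq s' w \<and> admissible s' \<and> changes (cyc s') > changes (cyc s)"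
proof -
  have "s \<noteq> []" using s by auto
  then have "\<not> successively nc (cyc s)" using s by (simp add: proper_def)
  then obtain us x y vs where uv: "cyc s = us @ x # y # vs" "\<not> nc x y"
    by (rule not_successively_split)
  have "{x, y} \<notin> E"
    using s(2) uv(1) unfolding admissible_def by (auto simp: successively_append_iff)
  then have y: "y = x" using uv(2) by (auto simp: nc_def)
  \<comment> \<open>The repetition is the closing pair of the cycle exactly when \<open>vs\<close>
    is empty; otherwise its two letters are consecutive in \<open>s\<close>.\<close>
  show ?thesis
  proof (cases "vs = []")
    case False
    then have "map fst s = us @ x # y # butlast vs"
      using uv(1) unfolding cyc_def by (metis append_is_Nil_conv butlast.simps(2) butlast_append butlast_snoc list.discI)
    then obtain xs a b zs where sd: "s = xs @ a # b # zs" "fst a = x" "fst b = x"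
      using y by (auto simp: map_eq_append_conv map_eq_Cons_conv)
    obtain W1 W' where W: "w = W1 @ W'" "subseq xs W1" "subseq (a # b # zs) W'"
      using list_emb_appendD[of "(=)" xs "a # b # zs" w] s(1) sd by auto
    obtain W1' W'' where W': "W' = W1' @ a # W''" "subseq (b # zs) W''"
      using list_emb_ConsD[OF W(3)] by auto
    obtain W2 W3 where W3: "W'' = W2 @ b # W3" "subseq zs W3"
      using list_emb_ConsD[OF W'(2)] by auto
    have w: "w = (W1 @ W1') @ a # W2 @ b # W3" using W W' W3 by simp
    then obtain m where m: "m \<in> set W2" "nc (fst m) x"
      using cr sd unfolding cyclically_reduced_def by metis
    define s' where "s' = xs @ a # m # b # zs"
    have "subseq [m] W2" using m by (simp add: subseq_singleton_left)
    then have "subseq (([m] @ [b]) @ zs) ((W2 @ [b]) @ W3)"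
      using W3 by (intro list_emb_append_mono) auto
    then have "subseq (xs @ a # m # b # zs) ((W1 @ W1') @ a # W2 @ b # W3)"
      using W(2) by (intro list_emb_append_mono) (auto intro: subseq_rev_drop_many)
    then have 1: "subseq s' w" by (simp add: s'_def w)
    have hd: "hd s' = hd s" by (simp add: s'_def sd hd_append)
    have c: "cyc s = map fst xs @ x # x # (map fst zs @ [fst (hd s)])"
      "cyc s' = map fst xs @ x # fst m # x # (map fst zs @ [fst (hd s)])"
      using hd by (auto simp: cyc_def sd s'_def)
    have 2: "admissible s'" using s(2) m unfolding admissible_def c
      by (subst (asm) successively_append_Cons, subst successively_append_Cons)
        (auto simp: nc_def insert_commute)
    have 3: "changes (cyc s') > changes (cyc s)" using m unfolding c
      by (subst (2) changes_append, subst changes_append) (auto simp: nc_def)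
    show ?thesis using 1 2 3 by blast
  next
    case True
    then have e: "map fst s = us @ [x]" "fst (hd s) = x"
      using uv(1) y unfolding cyc_def by auto
    then have "us \<noteq> []" using s(4) by (cases us) (auto simp: Suc_le_eq dest: arg_cong[where f = length])
    then obtain b zs a where sd: "s = b # zs @ [a]" "fst a = x" "fst b = x"
      using e by (cases s; cases "tl s" rule: rev_cases) auto
    obtain W1 W' where W: "w = W1 @ b # W'" "subseq (zs @ [a]) W'"
      using list_emb_ConsD[of "(=)" b "zs @ [a]" w] s(1) sd by auto
    obtain W2 W'' where W': "W' = W2 @ W''" "subseq zs W2" "subseq [a] W''"
      using list_emb_appendD[OF W(2)] by auto
    obtain W2' W3 where W3: "W'' = W2' @ a # W3"
      using list_emb_ConsD[OF W'(3)] by auto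
    have w: "w = W1 @ b # (W2 @ W2') @ a # W3" using W W' W3 by simp
    then obtain m where m: "m \<in> set W1 \<union> set W3" "nc (fst m) x"
      using cr sd unfolding cyclically_reduced_def by metis
    have base: "subseq (b # zs @ [a]) (b # (W2 @ W2') @ [a])"
      using W'(2) by (auto intro!: list_emb_append_mono)
    \<comment> \<open>The arc around the ends runs through \<open>W3\<close> and \<open>W1\<close>,
      so \<open>m\<close> goes either before or after the whole of \<open>s\<close>.\<close>
    show ?thesis
    proof (cases "m \<in> set W1")
      case True
      then have "subseq ([m] @ (b # zs @ [a])) (W1 @ (b # (W2 @ W2') @ [a]))"
        using base by (intro list_emb_append_mono) (auto simp: subseq_singleton_left)
      then have "subseq (([m] @ (b # zs @ [a])) @ []) ((W1 @ (b # (W2 @ W2') @ [a])) @ W3)"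
        by (rule list_emb_append_mono) simp
      then have 1: "subseq (m # s) w" by (simp add: sd w)
      have c: "cyc s = (x # map fst zs) @ x # [x]" "cyc (m # s) = fst m # (x # map fst zs) @ x # [fst m]"
        by (auto simp: cyc_def sd)
      have 2: "admissible (m # s)" using s(2) m unfolding admissible_def c
        by (subst (asm) successively_append_Cons, subst append_Cons[symmetric], subst successively_append_Cons)
          (auto simp: nc_def insert_commute)
      have 3: "changes (cyc (m # s)) > changes (cyc s)" using m unfolding c
        by (subst append_Cons[symmetric], subst (2) changes_append, subst changes_append) (auto simp: nc_def)
      show ?thesis using 1 2 3 by blast
    next
      case False
      then have "m \<in> set W3" using m by auto
      then have "subseq ((b # zs @ [a]) @ [m]) ((b # (W2 @ W2') @ [a]) @ W3)"
        using base by (intro list_emb_append_mono) (auto simp: subseq_singleton_left)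
      then have "subseq ([] @ (b # zs @ [a]) @ [m]) (W1 @ (b # (W2 @ W2') @ [a]) @ W3)"
        by (intro list_emb_append_mono[of "(=)" "[]"]) auto
      then have 1: "subseq (s @ [m]) w" by (simp add: sd w)
      have c: "cyc s = (x # map fst zs) @ x # [x]" "cyc (s @ [m]) = (x # map fst zs) @ x # [fst m, x]"
        by (auto simp: cyc_def sd)
      have 2: "admissible (s @ [m])" using s(2) m unfolding admissible_def c
        by (subst (asm) successively_append_Cons, subst successively_append_Cons)
          (auto simp: nc_def insert_commute)
      have 3: "changes (cyc (s @ [m])) > changes (cyc s)" using m unfolding c
        by (subst (2) changes_append, subst changes_append) (auto simp: nc_def)
      show ?thesis using 1 2 3 by blast
    qed
  qed
qed

text \<open>Take \<open>d\<close> to be the largest number of changes of an admissible subword. By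
  \<open>admissible_improve\<close> only proper subwords attain it, so no term of unknown sign
  enters the coefficient of degree \<open>d\<close>.\<close>

lemma exists_maximal_proper:
  assumes cr: "cyclically_reduced w" and s0: "subseq s0 w" "proper s0"
  obtains d s where "d \<ge> length s0" "subseq s w" "proper s" "length s = d"
    "\<And>s'. subseq s' w \<Longrightarrow> admissible s' \<Longrightarrow> changes (cyc s') = d \<Longrightarrow> proper s'"
proof -
  let ?A = "{s. subseq s w \<and> admissible s}"
  let ?R = "(\<lambda>s. changes (cyc s)) ` ?A"
  have fin: "finite ?A" by (rule finite_subset[of _ "set (subseqs w)"]) auto
  have s0A: "length s0 \<in> ?R" using s0 proper_admissible proper_changes by (metis (mono_tags, lifting) image_eqI mem_Collect_eq)
  define d where "d = Max ?R"
  have d: "d \<ge> length s0" unfolding d_def using s0A fin by (intro Max_ge) auto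
  \<comment> \<open>A one-letter proper word would need a loop of \<open>nc\<close>. The bound
    passes to every maximiser through \<open>changes_cyc_le\<close>.\<close>
  have "length s0 \<ge> 2" using s0(2) by (cases s0; cases "tl s0") (auto simp: proper_def cyc_def)
  have imp: "proper s'" if s': "subseq s' w" "admissible s'" "changes (cyc s') = d" for s'
  proof (rule ccontr)
    assume "\<not> proper s'"
    moreover have "length s' \<ge> 2" using changes_cyc_le[of s'] s' d \<open>length s0 \<ge> 2\<close> by linarith
    ultimately obtain s'' where s'': "subseq s'' w" "admissible s''" "changes (cyc s'') > d"
      using admissible_improve[OF cr s'(1,2)] s'(3) by auto
    then have "changes (cyc s'') \<le> d" unfolding d_def using fin by (intro Max_ge) auto
    then show False using s'' by simp
  qed
  have "d \<in> ?R" unfolding d_def using fin s0A by (intro Max_in) auto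
  then obtain s where s: "subseq s w" "admissible s" "changes (cyc s) = d" by auto
  have "proper s" using imp[OF s] .
  moreover have "length s = d" using proper_changes[OF \<open>proper s\<close>] s(3) by (rule back_subst[of "\<lambda>x. x = d", rotated])
  ultimately show ?thesis using that[OF d s(1)] imp by blast
qed

end

section \<open>Trace polynomials of unipotent matrices\<close>

definition mat_mult :: "'i set \<Rightarrow> ('i \<Rightarrow> 'i \<Rightarrow> int) \<Rightarrow> ('i \<Rightarrow> 'i \<Rightarrow> int) \<Rightarrow> 'i \<Rightarrow> 'i \<Rightarrow> int" where
  "mat_mult I A B = (\<lambda>i j. \<Sum>k\<in>I. A i k * B k j)"

definition mat_one :: "'i set \<Rightarrow> 'i \<Rightarrow> 'i \<Rightarrow> int" where
  "mat_one I = (\<lambda>i j. of_bool (i = j \<and> i \<in> I))"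

definition mat_trace :: "'i set \<Rightarrow> ('i \<Rightarrow> 'i \<Rightarrow> int) \<Rightarrow> int" where
  "mat_trace I A = (\<Sum>i\<in>I. A i i)"

text \<open>Matrices are functions on the whole index type that vanish outside \<open>I\<close>, so
  that equality is plain equality of functions and \<open>mat_one I\<close> is a neutral
  element.\<close>

definition mats :: "'i set \<Rightarrow> ('i \<Rightarrow> 'i \<Rightarrow> int) set" where
  "mats I = {A. \<forall>i j. A i j \<noteq> 0 \<longrightarrow> i \<in> I \<and> j \<in> I}"

definition mat_monoid :: "'i set \<Rightarrow> ('i \<Rightarrow> 'i \<Rightarrow> int) monoid" where
  "mat_monoid I = \<lparr>carrier = mats I, monoid.mult = mat_mult I, one = mat_one I\<rparr>"

definition mat_cong :: "'i set \<Rightarrow> int \<Rightarrow> ('i \<Rightarrow> 'i \<Rightarrow> int) \<Rightarrow> ('i \<Rightarrow> 'i \<Rightarrow> int) \<Rightarrow> bool" where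
  "mat_cong I q A B \<longleftrightarrow> (\<forall>i\<in>I. \<forall>j\<in>I. q dvd A i j - B i j)"

lemma mat_mult_assoc: "mat_mult I (mat_mult I A B) C = mat_mult I A (mat_mult I B C)"
proof (intro ext)
  fix i j
  have "(\<Sum>k\<in>I. (\<Sum>l\<in>I. A i l * B l k) * C k j) = (\<Sum>k\<in>I. \<Sum>l\<in>I. A i l * (B l k * C k j))"
    by (simp add: sum_distrib_right mult.assoc)
  also have "\<dots> = (\<Sum>l\<in>I. \<Sum>k\<in>I. A i l * (B l k * C k j))" by (rule sum.swap)
  also have "\<dots> = (\<Sum>l\<in>I. A i l * (\<Sum>k\<in>I. B l k * C k j))" by (simp add: sum_distrib_left)
  finally show "mat_mult I (mat_mult I A B) C i j = mat_mult I A (mat_mult I B C) i j"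
    by (simp add: mat_mult_def)
qed

lemma mat_mult_closed: "A \<in> mats I \<Longrightarrow> B \<in> mats I \<Longrightarrow> mat_mult I A B \<in> mats I"
  unfolding mats_def mat_mult_def mem_Collect_eq
  by (metis (no_types, lifting) mult_eq_0_iff sum.neutral)

lemma mat_one_closed: "mat_one I \<in> mats I"
  by (auto simp: mats_def mat_one_def)

lemma mat_one_left: "finite I \<Longrightarrow> A \<in> mats I \<Longrightarrow> mat_mult I (mat_one I) A = A"
proof (intro ext)
  fix i j assume I: "finite I" and A: "A \<in> mats I"
  have "mat_mult I (mat_one I) A i j = (\<Sum>k\<in>I. if k = i then A i j else 0)"
    unfolding mat_mult_def mat_one_def by (intro sum.cong) auto
  also have "\<dots> = A i j" using I A by (auto simp: mats_def)
  finally show "mat_mult I (mat_one I) A i j = A i j" .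
qed

lemma mat_one_right: "finite I \<Longrightarrow> A \<in> mats I \<Longrightarrow> mat_mult I A (mat_one I) = A"
proof (intro ext)
  fix i j assume I: "finite I" and A: "A \<in> mats I"
  have "mat_mult I A (mat_one I) i j = (\<Sum>k\<in>I. if k = j then A i j else 0)"
    unfolding mat_mult_def mat_one_def by (intro sum.cong) auto
  also have "\<dots> = A i j" using I A by (auto simp: mats_def)
  finally show "mat_mult I A (mat_one I) i j = A i j" .
qed

lemma monoid_mat_monoid: "finite I \<Longrightarrow> Group.monoid (mat_monoid I)"
  by (rule monoidI)
    (auto simp: mat_monoid_def mat_mult_closed mat_one_closed mat_mult_assoc mat_one_left mat_one_right)

lemma mat_trace_commute: "mat_trace I (mat_mult I A B) = mat_trace I (mat_mult I B A)"
  unfolding mat_trace_def mat_mult_def by (subst sum.swap) (simp add: mult.commute)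

lemma mat_cong_refl: "mat_cong I q A A"
  by (simp add: mat_cong_def)

lemma mat_cong_trans: "mat_cong I q A B \<Longrightarrow> mat_cong I q B C \<Longrightarrow> mat_cong I q A C"
  unfolding mat_cong_def by (metis (no_types, opaque_lifting) diff_add_cancel add_diff_eq dvd_add)

lemma mat_cong_sym: "mat_cong I q A B \<Longrightarrow> mat_cong I q B A"
  unfolding mat_cong_def by (metis dvd_minus_iff minus_diff_eq)

lemma mat_cong_mult:
  assumes "mat_cong I q A A'" "mat_cong I q B B'"
  shows "mat_cong I q (mat_mult I A B) (mat_mult I A' B')"
  unfolding mat_cong_def
proof (intro ballI)
  fix i j assume "i \<in> I" "j \<in> I"
  have "mat_mult I A B i j - mat_mult I A' B' i j =
      (\<Sum>k\<in>I. (A i k - A' i k) * B k j + A' i k * (B k j - B' k j))"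
    unfolding mat_mult_def sum_subtractf[symmetric] by (intro sum.cong) (auto simp: algebra_simps)
  also have "q dvd \<dots>"
    using assms \<open>i \<in> I\<close> \<open>j \<in> I\<close> by (intro dvd_sum dvd_add) (auto simp: mat_cong_def)
  finally show "q dvd mat_mult I A B i j - mat_mult I A' B' i j" .
qed

lemma mat_cong_trace: "mat_cong I q A B \<Longrightarrow> q dvd mat_trace I A - mat_trace I B"
  unfolding mat_cong_def mat_trace_def sum_subtractf[symmetric] by (intro dvd_sum) auto

text \<open>With \<open>A = 1 + B\<close> the square of \<open>B\<close> is divisible by
  \<open>q ^ (2 * j)\<close>, so the \<open>n\<close>-th power of \<open>A\<close> is
  \<open>1 + n B\<close> to that precision; at \<open>n = q\<close> the linear term gains a factor
  \<open>q\<close>. Iterated, this shows that matrices congruent to one modulo \<open>p\<close> have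
  \<open>p\<close>-power order modulo every \<open>p ^ k\<close>.\<close>

lemma mat_power_cong_one:
  assumes I: "finite I" and A: "A \<in> mats I" "mat_cong I (q ^ j) A (mat_one I)" and j: "j \<ge> 1" and q: "q \<ge> 0"
  shows "mat_cong I (q ^ Suc j) (A [^]\<^bsub>mat_monoid I\<^esub> nat q) (mat_one I)"
proof -
  interpret M: Group.monoid "mat_monoid I" by (rule monoid_mat_monoid[OF I])
  define B where "B = (\<lambda>i j. A i j - mat_one I i j)"
  have dv: "q ^ j dvd B a b" if "a \<in> I" "b \<in> I" for a b
    using A that by (auto simp: mat_cong_def B_def)
  have *: "mat_cong I (q ^ (2 * j)) (A [^]\<^bsub>mat_monoid I\<^esub> n) (\<lambda>a b. mat_one I a b + int n * B a b)"
    for n :: nat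
  proof (induction n)
    case 0
    then show ?case by (simp add: mat_monoid_def mat_cong_def)
  next
    case (Suc n)
    have B: "B \<in> mats I" using A(1) mat_one_closed[of I]
      unfolding mats_def B_def mem_Collect_eq by (metis diff_self)
    have "mat_mult I (\<lambda>a b. mat_one I a b + int n * B a b) A a b
        = A a b + int n * (\<Sum>k\<in>I. B a k * A k b)" for a b
    proof -
      have "mat_mult I (\<lambda>a b. mat_one I a b + int n * B a b) A a b
         = mat_mult I (mat_one I) A a b + int n * (\<Sum>k\<in>I. B a k * A k b)"
        by (simp add: mat_mult_def distrib_right sum.distrib sum_distrib_left mult.assoc)
      then show ?thesis using mat_one_left[OF I A(1)] by simp
    qed
    moreover have "(\<Sum>k\<in>I. B a k * A k b) = B a b + (\<Sum>k\<in>I. B a k * B k b)" for a b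
    proof -
      have "(\<Sum>k\<in>I. B a k * A k b) = (\<Sum>k\<in>I. B a k * B k b + B a k * mat_one I k b)"
        by (intro sum.cong) (auto simp: B_def algebra_simps)
      also have "\<dots> = (\<Sum>k\<in>I. B a k * B k b) + mat_mult I B (mat_one I) a b"
        by (simp add: sum.distrib mat_mult_def)
      finally show ?thesis using mat_one_right[OF I B] by simp
    qed
    moreover have "A a b = mat_one I a b + B a b" for a b by (simp add: B_def)
    ultimately have eq: "mat_mult I (\<lambda>a b. mat_one I a b + int n * B a b) A a b
        - (mat_one I a b + int (Suc n) * B a b) = int n * (\<Sum>k\<in>I. B a k * B k b)" for a b
      by (simp only: of_nat_Suc distrib_left distrib_right)
    have "q ^ (2 * j) dvd int n * (\<Sum>k\<in>I. B a k * B k b)" if "a \<in> I" "b \<in> I" for a b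
      using that dv by (intro dvd_mult[OF dvd_sum]) (simp add: mult_2 power_add mult_dvd_mono)
    then have "mat_cong I (q ^ (2 * j)) (mat_mult I (\<lambda>a b. mat_one I a b + int n * B a b) A)
       (\<lambda>a b. mat_one I a b + int (Suc n) * B a b)"
      unfolding mat_cong_def eq by blast
    moreover have "mat_cong I (q ^ (2 * j)) (mat_mult I (A [^]\<^bsub>mat_monoid I\<^esub> n) A)
        (mat_mult I (\<lambda>a b. mat_one I a b + int n * B a b) A)"
      by (rule mat_cong_mult[OF Suc mat_cong_refl])
    ultimately have "mat_cong I (q ^ (2 * j)) (mat_mult I (A [^]\<^bsub>mat_monoid I\<^esub> n) A)
        (\<lambda>a b. mat_one I a b + int (Suc n) * B a b)"
      by (rule mat_cong_trans[rotated])
    moreover have "A [^]\<^bsub>mat_monoid I\<^esub> Suc n = mat_mult I (A [^]\<^bsub>mat_monoid I\<^esub> n) A"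
      by (simp add: mat_monoid_def)
    ultimately show ?case by simp
  qed
  \<comment> \<open>Here \<open>j \<ge> 1\<close> enters: the available precision
    \<open>2 * j\<close> is at least \<open>Suc j\<close>.\<close>
  have "q ^ Suc j dvd q ^ (2 * j)" using j by (intro le_imp_power_dvd) auto
  then have "mat_cong I (q ^ Suc j) (A [^]\<^bsub>mat_monoid I\<^esub> nat q) (\<lambda>a b. mat_one I a b + q * B a b)"
    using *[of "nat q"] q unfolding mat_cong_def by (auto intro: dvd_trans)
  moreover have "mat_cong I (q ^ Suc j) (\<lambda>a b. mat_one I a b + q * B a b) (mat_one I)"
    using dv by (auto simp: mat_cong_def)
  ultimately show ?thesis by (rule mat_cong_trans)
qed

lemma sum_list_swap: "(\<Sum>k\<in>I. \<Sum>s\<leftarrow>xs. f k s) = (\<Sum>s\<leftarrow>xs. \<Sum>k\<in>I. (f k s :: int))"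
  by (induction xs) (auto simp: sum.distrib)

lemma mult_of_bool_diff:
  "a * (of_bool P - of_bool Q) = (if P then a else 0) - (if Q then a else (0 :: int))"
  by (cases P; cases Q) auto

text \<open>\<open>Q v\<close> stands for a finite quotient of \<open>G v\<close> acted on by
  translation, \<open>b0 v\<close> for its base point, and \<open>F v\<close> for a linear form on
  the permutation module, given by its values on the basis.\<close>

locale trace_rep = simplicial V E
  for V :: "'v set" and E :: "'v set set" +
  fixes G :: "'v \<Rightarrow> ('a, 'b) monoid_scheme" and Q :: "'v \<Rightarrow> 'q set"
    and act :: "'v \<Rightarrow> 'a \<Rightarrow> 'q \<Rightarrow> 'q" and b0 :: "'v \<Rightarrow> 'q" and F :: "'v \<Rightarrow> 'q \<Rightarrow> int"
  assumes finite_V: "finite V" and finite_X: "v \<in> V \<Longrightarrow> finite (Q v)"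
    and b0: "v \<in> V \<Longrightarrow> b0 v \<in> Q v"
    and act_closed: "v \<in> V \<Longrightarrow> g \<in> carrier (G v) \<Longrightarrow> x \<in> Q v \<Longrightarrow> act v g x \<in> Q v"
    and act_one: "v \<in> V \<Longrightarrow> x \<in> Q v \<Longrightarrow> act v \<one>\<^bsub>G v\<^esub> x = x"
    and act_mult: "v \<in> V \<Longrightarrow> g \<in> carrier (G v) \<Longrightarrow> h \<in> carrier (G v) \<Longrightarrow> x \<in> Q v \<Longrightarrow>
      act v (g \<otimes>\<^bsub>G v\<^esub> h) x = act v g (act v h x)"
    and F_b0: "v \<in> V \<Longrightarrow> F v (b0 v) = 0"
    and F_nonneg: "v \<in> V \<Longrightarrow> F v x \<ge> 0"
begin

definition idx :: "('v \<times> 'q) set" where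
  "idx = Sigma V Q"

lemma finite_idx [simp]: "finite idx"
  by (simp add: idx_def finite_V finite_X)

text \<open>The difference of a letter and the identity in the representation: a letter of
  type \<open>v\<close> permutes the block of \<open>v\<close>, fixes the blocks of the neighbours of \<open>v\<close>, and adds \<open>t\<close>
  times a rank one map from every other block.\<close>

definition jump :: "'v \<times> 'a \<Rightarrow> 'q \<Rightarrow> int" where
  "jump l c = of_bool (c = act (fst l) (snd l) (b0 (fst l))) - of_bool (c = b0 (fst l))"

definition D :: "int \<Rightarrow> 'v \<times> 'a \<Rightarrow> 'v \<times> 'q \<Rightarrow> 'v \<times> 'q \<Rightarrow> int" where
  "D t l i j =
    (if i \<in> idx \<and> j \<in> idx \<and> fst i = fst l then
       if fst j = fst l then of_bool (snd i = act (fst l) (snd l) (snd j)) - of_bool (snd i = snd j)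
       else if {fst j, fst l} \<in> E then 0
       else t * F (fst j) (snd j) * jump l (snd i)
     else 0)"

definition R :: "int \<Rightarrow> 'v \<times> 'a \<Rightarrow> 'v \<times> 'q \<Rightarrow> 'v \<times> 'q \<Rightarrow> int" where
  "R t l = (\<lambda>i j. mat_one idx i j + D t l i j)"

fun prodD :: "int \<Rightarrow> ('v \<times> 'a) list \<Rightarrow> 'v \<times> 'q \<Rightarrow> 'v \<times> 'q \<Rightarrow> int" where
  "prodD t [] = mat_one idx"
| "prodD t (l # w) = mat_mult idx (D t l) (prodD t w)"

fun prodR :: "int \<Rightarrow> ('v \<times> 'a) list \<Rightarrow> 'v \<times> 'q \<Rightarrow> 'v \<times> 'q \<Rightarrow> int" where
  "prodR t [] = mat_one idx"
| "prodR t (l # w) = mat_mult idx (R t l) (prodR t w)"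

text \<open>The value of the linear form \<open>F\<close> on the vector \<open>jump l\<close>, since
  \<open>F\<close> vanishes at the base point.\<close>

definition letter_weight :: "'v \<times> 'a \<Rightarrow> int" where
  "letter_weight l = F (fst l) (act (fst l) (snd l) (b0 (fst l)))"

lemma D_mats: "D t l \<in> mats idx"
  by (auto simp: D_def mats_def split: if_splits)

lemma R_mats: "R t l \<in> mats idx"
  using D_mats[of t l] mat_one_closed[of idx]
  unfolding R_def mats_def mem_Collect_eq by (metis add.right_neutral)

lemma prodR_mats: "prodR t w \<in> mats idx"
  by (induction w) (auto intro: mat_one_closed mat_mult_closed R_mats)

lemma R_mult_left: "A \<in> mats idx \<Longrightarrow> mat_mult idx (R t l) A = (\<lambda>i j. A i j + mat_mult idx (D t l) A i j)"
proof (intro ext)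
  fix i j assume A: "A \<in> mats idx"
  have "mat_mult idx (R t l) A i j = mat_mult idx (mat_one idx) A i j + mat_mult idx (D t l) A i j"
    by (simp add: mat_mult_def R_def distrib_right sum.distrib)
  then show "mat_mult idx (R t l) A i j = A i j + mat_mult idx (D t l) A i j"
    using mat_one_left[OF finite_idx A] by simp
qed

text \<open>Expanding a product of factors \<open>1 + D\<close> means choosing one summand in each
  factor, so the terms are the subwords, counted with their positions.\<close>

lemma prodR_expand: "prodR t w i j = (\<Sum>s\<leftarrow>subseqs w. prodD t s i j)"
proof (induction w arbitrary: i j)
  case (Cons l w)
  have "mat_mult idx (D t l) (prodR t w) i j = (\<Sum>s\<leftarrow>subseqs w. prodD t (l # s) i j)"
    by (simp add: mat_mult_def Cons sum_list_swap sum_list_const_mult[symmetric])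
  then show ?case
    by (simp add: R_mult_left[OF prodR_mats] Cons Let_def o_def)
qed simp

lemma idx_block: "(\<Sum>k\<in>idx. f k) = (\<Sum>c\<in>Q v. f (v, c))"
  if "v \<in> V" "\<And>k. k \<in> idx \<Longrightarrow> fst k \<noteq> v \<Longrightarrow> f k = 0" for f :: "'v \<times> 'q \<Rightarrow> int"
proof -
  have "(\<Sum>k\<in>idx. f k) = (\<Sum>k\<in>Pair v ` Q v. f k)"
  proof (intro sum.mono_neutral_right ballI)
    fix k assume "k \<in> idx - Pair v ` Q v"
    then have "k \<in> idx" "fst k \<noteq> v" by (auto simp: idx_def)
    then show "f k = 0" by (rule that(2))
  qed (use that in \<open>auto simp: idx_def finite_V finite_X\<close>)
  also have "\<dots> = (\<Sum>c\<in>Q v. f (v, c))"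
    by (subst sum.reindex) (auto simp: inj_on_def)
  finally show ?thesis .
qed

lemma D_scale: "D t l i j = t ^ (if fst l = fst j then 0 else 1) * D 1 l i j"
  by (auto simp: D_def)

lemma prodD_row: "prodD t (l # w) i j \<noteq> 0 \<Longrightarrow> fst i = fst l"
  unfolding prodD.simps mat_mult_def by (rule ccontr) (simp add: D_def)

text \<open>\<open>D\<close> of a letter has rows only in the block of that letter, so each
  summation index is forced into the block of the next letter. Then \<open>t\<close> occurs once for
  every change of block, the last possible one being the passage to the column
  \<open>j\<close>.\<close>

lemma prodD_scale: "prodD t w i j = t ^ changes (map fst w @ [fst j]) * prodD 1 w i j"
proof (induction w arbitrary: i)
  case (Cons l w)
  show ?case
  proof (cases w)
    case Nil
    then show ?thesis
      using mat_one_right[OF finite_idx D_mats, of t l] mat_one_right[OF finite_idx D_mats, of 1 l]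
      by (auto simp: D_scale[of t])
  next
    case (Cons m w')
    have "D t l i k * prodD t w k j = t ^ changes (map fst (l # w) @ [fst j]) * (D 1 l i k * prodD 1 w k j)"
      for k
    proof (cases "fst k = fst m")
      case True
      have "D t l i k = t ^ (if fst l = fst m then 0 else 1) * D 1 l i k"
        using D_scale[of t l i k] True by simp
      moreover have "changes (map fst (l # w) @ [fst j]) =
          (if fst l = fst m then 0 else 1) + changes (map fst w @ [fst j])"
        using Cons by simp
      ultimately show ?thesis using Cons.IH[of k] by (simp add: power_add)
    next
      case False
      then have "prodD t' w k j = 0" for t' using prodD_row[of t' m w' k j] Cons by auto
      then show ?thesis by simp
    qed
    then show ?thesis by (simp add: mat_mult_def sum_distrib_left)
  qed
qed simp

definition kappa :: "('v \<times> 'a) list \<Rightarrow> int" where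
  "kappa s = mat_trace idx (prodD 1 s)"

definition degr :: "('v \<times> 'a) list \<Rightarrow> nat" where
  "degr s = (if s = [] then 0 else changes (cyc s))"

text \<open>A diagonal entry can be nonzero only if its column lies in the block of the first
  letter; this closes the list of types to \<open>cyc s\<close>.\<close>

lemma trace_prodD: "mat_trace idx (prodD t s) = kappa s * t ^ degr s"
proof (cases s)
  case Nil
  then show ?thesis by (simp add: kappa_def degr_def)
next
  case (Cons l w)
  have "prodD t s i i = t ^ degr s * prodD 1 s i i" for i
  proof (cases "fst i = fst l")
    case True
    then show ?thesis using prodD_scale[of t s i i] Cons by (simp add: degr_def cyc_def)
  next
    case False
    then have "prodD t' s i i = 0" for t' using prodD_row[of t' l w i i] Cons by auto
    then show ?thesis by simp
  qed
  then show ?thesis by (simp add: mat_trace_def kappa_def sum_distrib_left mult.commute)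
qed

lemma trace_prodR: "mat_trace idx (prodR t w) = (\<Sum>s\<leftarrow>subseqs w. kappa s * t ^ degr s)"
  unfolding trace_prodD[symmetric] by (simp add: mat_trace_def prodR_expand sum_list_swap)

text \<open>A step between vertices joined by an edge of the graph meets a zero block of
  \<open>D\<close>.\<close>

lemma prodD_inadmissible:
  assumes "\<not> successively (\<lambda>u v. {u, v} \<notin> E) (map fst w @ [fst j])"
  shows "prodD 1 w i j = 0"
  using assms
proof (induction w arbitrary: i)
  case (Cons l w)
  show ?case
  proof (cases w)
    case Nil
    then have "{fst j, fst l} \<in> E" using Cons.prems by (simp add: insert_commute)
    then show ?thesis
      using mat_one_right[OF finite_idx D_mats, of 1 l] loop_free by (auto simp: Nil D_def)
  next
    case (Cons m w')
    show ?thesis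
    proof (cases "{fst l, fst m} \<in> E")
      case True
      then have "D 1 l i k * prodD 1 w k j = 0" for k
        using prodD_row[of 1 m w' k j] Cons loop_free by (cases "fst k = fst m") (auto simp: D_def insert_commute)
      then show ?thesis by (simp add: mat_mult_def del: mult_eq_0_iff)
    next
      case False
      then have "\<not> successively (\<lambda>u v. {u, v} \<notin> E) (map fst w @ [fst j])"
        using Cons.prems Cons by simp
      then have "prodD 1 w k j = 0" for k using Cons.IH by blast
      then show ?thesis by (simp add: mat_mult_def)
    qed
  qed
qed simp

lemma kappa_inadmissible:
  assumes "s \<noteq> []" "\<not> admissible s"
  shows "kappa s = 0"
proof -
  obtain l w where s: "s = l # w" using assms by (cases s) auto
  have "prodD 1 s i i = 0" for i
  proof (cases "fst i = fst l")
    case True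
    then show ?thesis using assms s by (intro prodD_inadmissible) (simp add: admissible_def cyc_def)
  next
    case False
    then show ?thesis using prodD_row[of 1 l w i i] s by auto
  qed
  then show ?thesis by (simp add: kappa_def mat_trace_def)
qed

lemma sum_jump:
  assumes "fst l \<in> V" "snd l \<in> carrier (G (fst l))"
  shows "(\<Sum>c\<in>Q (fst l). F (fst l) c * jump l c) = letter_weight l"
proof -
  let ?v = "fst l" let ?a = "act ?v (snd l) (b0 ?v)"
  have "(\<Sum>c\<in>Q ?v. F ?v c * jump l c) =
      (\<Sum>c\<in>Q ?v. (if c = ?a then F ?v c else 0) - (if c = b0 ?v then F ?v c else 0))"
    by (intro sum.cong) (auto simp: jump_def)
  also have "\<dots> = F ?v ?a - F ?v (b0 ?v)"
    unfolding sum_subtractf using assms finite_X[of ?v] act_closed b0 by simp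
  finally show ?thesis using F_b0 assms by (simp add: letter_weight_def)
qed

text \<open>Along a walk without repetition every factor is a rank one map, the vector
  \<open>jump\<close> of its letter times the form of the next block. The product collapses into the
  pairings of each \<open>jump\<close> with the form on its own block, which are the letter weights;
  the first \<open>jump\<close> and the last form stay unpaired until the trace closes the
  walk.\<close>

lemma prodD_proper:
  assumes "set (l # w) \<subseteq> (SIGMA v:V. carrier (G v))" "successively nc (map fst (l # w) @ [fst j])"
    and "i \<in> idx" "j \<in> idx"
  shows "prodD 1 (l # w) i j =
    of_bool (fst i = fst l) * jump l (snd i) * (\<Prod>m\<leftarrow>w. letter_weight m) * F (fst j) (snd j)"
  using assms
proof (induction w arbitrary: l i)
  case Nil
  then show ?case
    using mat_one_right[OF finite_idx D_mats, of 1 l] by (auto simp: D_def nc_def insert_commute)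
next
  case (Cons m w)
  let ?P = "\<Prod>m\<leftarrow>w. letter_weight m"
  have m: "fst m \<in> V" "snd m \<in> carrier (G (fst m))" using Cons.prems by auto
  have lm: "nc (fst l) (fst m)" using Cons.prems by simp
  have IH: "prodD 1 (m # w) k j = of_bool (fst k = fst m) * jump m (snd k) * ?P * F (fst j) (snd j)"
    if "k \<in> idx" for k
    using Cons.prems that by (intro Cons.IH) auto
  have "prodD 1 (l # m # w) i j = (\<Sum>k\<in>idx. D 1 l i k * prodD 1 (m # w) k j)"
    by (simp add: mat_mult_def)
  also have "\<dots> = (\<Sum>c\<in>Q (fst m). D 1 l i (fst m, c) * prodD 1 (m # w) (fst m, c) j)"
    using m IH by (intro idx_block[of "fst m" "\<lambda>k. D 1 l i k * prodD 1 (m # w) k j"]) auto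
  also have "\<dots> = (\<Sum>c\<in>Q (fst m). (of_bool (fst i = fst l) * jump l (snd i) * ?P * F (fst j) (snd j))
      * (F (fst m) c * jump m c))"
  proof (rule sum.cong[OF HOL.refl])
    fix c assume c: "c \<in> Q (fst m)"
    then have k: "(fst m, c) \<in> idx" using m by (simp add: idx_def)
    have "D 1 l i (fst m, c) = of_bool (fst i = fst l) * (F (fst m) c * jump l (snd i))"
      using k Cons.prems(3) lm by (auto simp: D_def nc_def insert_commute)
    then show "D 1 l i (fst m, c) * prodD 1 (m # w) (fst m, c) j =
       (of_bool (fst i = fst l) * jump l (snd i) * ?P * F (fst j) (snd j)) * (F (fst m) c * jump m c)"
      using IH[OF k] by simp
  qed
  also have "\<dots> = (of_bool (fst i = fst l) * jump l (snd i) * ?P * F (fst j) (snd j)) * letter_weight m"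
    using sum_jump[OF m] by (simp add: sum_distrib_left[symmetric])
  finally show ?case by simp
qed

lemma kappa_proper:
  assumes "proper s" "set s \<subseteq> (SIGMA v:V. carrier (G v))"
  shows "kappa s = (\<Prod>m\<leftarrow>s. letter_weight m)"
proof -
  obtain l w where s: "s = l # w" using assms by (cases s) (auto simp: proper_def)
  have l: "fst l \<in> V" "snd l \<in> carrier (G (fst l))" using assms s by auto
  have "kappa s = (\<Sum>i\<in>idx. prodD 1 (l # w) i i)" by (simp add: kappa_def mat_trace_def s)
  also have "\<dots> = (\<Sum>c\<in>Q (fst l). prodD 1 (l # w) (fst l, c) (fst l, c))"
    using l prodD_row[of 1 l w] by (intro idx_block[of "fst l" "\<lambda>i. prodD 1 (l # w) i i"]) auto
  also have "\<dots> = (\<Sum>c\<in>Q (fst l). (\<Prod>m\<leftarrow>w. letter_weight m) * (F (fst l) c * jump l c))"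
  proof (rule sum.cong[OF HOL.refl])
    fix c assume "c \<in> Q (fst l)"
    then have "(fst l, c) \<in> idx" using l by (simp add: idx_def)
    moreover have "successively nc (map fst (l # w) @ [fst (fst l, c)])"
      using assms(1) by (simp add: proper_def cyc_def s)
    ultimately show "prodD 1 (l # w) (fst l, c) (fst l, c) = (\<Prod>m\<leftarrow>w. letter_weight m) * (F (fst l) c * jump l c)"
      using prodD_proper[of l w "(fst l, c)" "(fst l, c)"] assms(2) s by simp
  qed
  also have "\<dots> = (\<Prod>m\<leftarrow>w. letter_weight m) * letter_weight l"
    using sum_jump[OF l] by (simp add: sum_distrib_left[symmetric])
  finally show ?thesis by (simp add: s mult.commute)
qed

definition trace_poly :: "('v \<times> 'a) list \<Rightarrow> int poly" where
  "trace_poly w = (\<Sum>s\<leftarrow>subseqs w. Polynomial.monom (kappa s) (degr s))"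

lemma poly_trace_poly: "poly (trace_poly w) t = mat_trace idx (prodR t w)"
proof -
  have "poly (\<Sum>s\<leftarrow>xs. Polynomial.monom (kappa s) (degr s)) t = (\<Sum>s\<leftarrow>xs. kappa s * t ^ degr s)" for xs
    by (induction xs) (auto simp: poly_monom)
  then show ?thesis by (simp add: trace_poly_def trace_prodR)
qed

lemma coeff_trace_poly:
  "Polynomial.coeff (trace_poly w) d = (\<Sum>s\<leftarrow>subseqs w. if degr s = d then kappa s else 0)"
proof -
  have "Polynomial.coeff (\<Sum>s\<leftarrow>xs. Polynomial.monom (kappa s) (degr s)) d =
      (\<Sum>s\<leftarrow>xs. if degr s = d then kappa s else 0)" for xs
    by (induction xs) auto
  then show ?thesis by (simp add: trace_poly_def)
qed

lemma degr_le: "degr s \<le> length s"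
  using changes_cyc_le[of s] by (simp add: degr_def)

lemma coeff_trace_poly_zero:
  assumes "length w < d"
  shows "Polynomial.coeff (trace_poly w) d = 0"
proof -
  have "degr s \<noteq> d" if "subseq s w" for s
    using degr_le[of s] assms list_emb_length[OF that] by linarith
  then have "(\<Sum>s\<leftarrow>subseqs w. if degr s = d then kappa s else 0) = (\<Sum>s\<leftarrow>subseqs w. 0)"
    by (intro arg_cong[where f = sum_list] map_cong) auto
  then show ?thesis by (simp add: coeff_trace_poly)
qed

text \<open>At the degree of \<open>exists_maximal_proper\<close> every nonzero term belongs to a
  proper subword and is a product of positive weights, so nothing cancels. That degree may exceed
  \<open>length s0\<close>.\<close>

lemma coeff_trace_poly_pos:
  assumes w: "set w \<subseteq> (SIGMA v:V. carrier (G v))" "cyclically_reduced w"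
    and pos: "\<And>l. l \<in> set w \<Longrightarrow> letter_weight l > 0"
    and s0: "subseq s0 w" "proper s0"
  shows "\<exists>d\<ge>length s0. Polynomial.coeff (trace_poly w) d > 0"
proof -
  obtain d s where d: "d \<ge> length s0" and s: "subseq s w" "proper s" "length s = d"
    and max: "\<And>s'. subseq s' w \<Longrightarrow> admissible s' \<Longrightarrow> changes (cyc s') = d \<Longrightarrow> proper s'"
    using exists_maximal_proper[OF w(2) s0] by blast
  have d0: "d > 0" using d s0(2) by (cases s0) (auto simp: proper_def)
  let ?f = "\<lambda>s. if degr s = d then kappa s else 0"
  have proper_pos: "kappa s' > 0" if "subseq s' w" "proper s'" for s'
  proof -
    have sub: "set s' \<subseteq> set w" using that by (auto elim: list_emb_set)
    have "(\<Prod>m\<leftarrow>xs. letter_weight m) > 0" if "set xs \<subseteq> set w" for xs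
      using that pos by (induction xs) auto
    then show ?thesis using kappa_proper[of s'] that sub w by auto
  qed
  have nonneg: "?f s' \<ge> 0" if "subseq s' w" for s'
  proof (cases "degr s' = d \<and> kappa s' \<noteq> 0")
    case True
    then have ne: "s' \<noteq> []" using d0 by (auto simp: degr_def)
    then have "admissible s'" using True kappa_inadmissible by blast
    then have "proper s'" using max that True ne by (simp add: degr_def)
    then show ?thesis using proper_pos that by fastforce
  qed auto
  have sl: "(\<Sum>x\<leftarrow>xs. ?f x) \<ge> ?f y" if "y \<in> set xs" "\<forall>x\<in>set xs. ?f x \<ge> 0" for xs y
    using that
  proof (induction xs)
    case (Cons a xs)
    have "(\<Sum>x\<leftarrow>xs. ?f x) \<ge> 0" using Cons.prems(2) by (intro sum_list_nonneg) auto
    moreover have "?f a \<ge> 0" using Cons.prems(2) by (meson list.set_intros(1))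
    ultimately show ?case using Cons.IH Cons.prems by (cases "y = a") auto
  qed simp
  have "s \<noteq> []" using s(2) by (auto simp: proper_def)
  moreover have "changes (cyc s) = d" using proper_changes[OF s(2)] unfolding s(3) .
  ultimately have "?f s > 0" using proper_pos[OF s(1,2)] by (simp add: degr_def)
  moreover have "(\<Sum>x\<leftarrow>subseqs w. ?f x) \<ge> ?f s"
    using s nonneg by (intro sl) auto
  ultimately show ?thesis using d unfolding coeff_trace_poly by (intro exI[of _ d]) linarith
qed

text \<open>All other subwords are shorter, and a degree is at most the length of its subword, so
  the whole word alone contributes.\<close>

lemma coeff_trace_poly_length:
  assumes w: "set w \<subseteq> (SIGMA v:V. carrier (G v))" "proper w"
  shows "Polynomial.coeff (trace_poly w) (length w) = (\<Prod>m\<leftarrow>w. letter_weight m)"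
proof -
  have *: "\<exists>ys. subseqs w = w # ys \<and> (\<forall>s\<in>set ys. length s < length w)" for w :: "('v \<times> 'a) list"
  proof (induction w)
    case (Cons a w)
    then obtain ys where "subseqs w = w # ys" "\<forall>s\<in>set ys. length s < length w" by blast
    then show ?case by (auto simp: Let_def)
  qed simp
  obtain ys where ys: "subseqs w = w # ys" "\<forall>s\<in>set ys. length s < length w" using *[of w] by blast
  have "(\<Sum>s\<leftarrow>ys. if degr s = length w then kappa s else 0) = (\<Sum>s\<leftarrow>ys. 0)"
  proof (intro arg_cong[where f = sum_list] map_cong HOL.refl if_not_P)
    show "degr x \<noteq> length w" if "x \<in> set ys" for x using ys(2) degr_le[of x] that by fastforce
  qed
  moreover have "degr w = length w" using w(2) proper_changes by (auto simp: degr_def proper_def)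
  ultimately show ?thesis using kappa_proper[OF w(2,1)] ys by (simp add: coeff_trace_poly)
qed

lemma R_one: "v \<in> V \<Longrightarrow> R t (v, \<one>\<^bsub>G v\<^esub>) = mat_one idx"
  by (intro ext) (auto simp: R_def D_def jump_def act_one b0 idx_def split: if_splits)

text \<open>Equivalently, \<open>D\<close> of a product is the sum of both \<open>D\<close> parts
  and of their matrix product. On the block of \<open>v\<close> this is multiplicativity of the
  permutation action; on the other blocks it is the cocycle identity for the vectors
  \<open>jump\<close>.\<close>

lemma R_mult:
  assumes v: "v \<in> V" and g: "g \<in> carrier (G v)" and h: "h \<in> carrier (G v)"
    and gh: "g \<otimes>\<^bsub>G v\<^esub> h \<in> carrier (G v)"
  shows "mat_mult idx (R t (v, g)) (R t (v, h)) = R t (v, g \<otimes>\<^bsub>G v\<^esub> h)"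
proof (intro ext)
  fix i j
  have "mat_mult idx (D t (v, g)) (R t (v, h)) i j =
      mat_mult idx (D t (v, g)) (mat_one idx) i j + mat_mult idx (D t (v, g)) (D t (v, h)) i j"
    by (simp add: mat_mult_def R_def distrib_left sum.distrib)
  then have 1: "mat_mult idx (R t (v, g)) (R t (v, h)) i j =
      mat_one idx i j + D t (v, h) i j + D t (v, g) i j + mat_mult idx (D t (v, g)) (D t (v, h)) i j"
    using R_mult_left[OF R_mats, of t "(v, g)"] mat_one_right[OF finite_idx D_mats] by (simp add: R_def)
  have "mat_mult idx (D t (v, g)) (D t (v, h)) i j =
      D t (v, g \<otimes>\<^bsub>G v\<^esub> h) i j - D t (v, g) i j - D t (v, h) i j"
  proof (cases "i \<in> idx \<and> j \<in> idx \<and> fst i = v")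
    case False
    then have "D t (v, g) i k * D t (v, h) k j = 0" "D t (v, x) i j = 0" for k x
      by (auto simp: D_def)
    then show ?thesis by (simp add: mat_mult_def del: mult_eq_0_iff)
  next
    case True
    obtain c u b where ij: "i = (v, c)" "j = (u, b)" using True by (cases i; cases j) auto
    have c: "c \<in> Q v" and ub: "u \<in> V" "b \<in> Q u" using True ij by (auto simp: idx_def)
    have blk: "mat_mult idx (D t (v, g)) (D t (v, h)) i j =
        (\<Sum>d\<in>Q v. (of_bool (c = act v g d) - of_bool (c = d)) * D t (v, h) (v, d) j)"
    proof -
      have "mat_mult idx (D t (v, g)) (D t (v, h)) i j =
          (\<Sum>d\<in>Q v. D t (v, g) i (v, d) * D t (v, h) (v, d) j)"
        unfolding mat_mult_def
        using v by (intro idx_block[of v "\<lambda>k. D t (v, g) i k * D t (v, h) k j"]) (auto simp: D_def)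
      also have "\<dots> = (\<Sum>d\<in>Q v. (of_bool (c = act v g d) - of_bool (c = d)) * D t (v, h) (v, d) j)"
        using True v by (intro sum.cong) (auto simp: D_def ij idx_def)
      finally show ?thesis .
    qed
    \<comment> \<open>Used twice: with \<open>y\<close> the column itself inside the block of
      \<open>v\<close>, and with \<open>y = b0 v\<close> for columns in the blocks of
      non-neighbours.\<close>
    have key: "(\<Sum>d\<in>Q v. (of_bool (c = act v g d) - of_bool (c = d)) * (of_bool (d = act v h y) - of_bool (d = y)))
        = of_bool (c = act v (g \<otimes>\<^bsub>G v\<^esub> h) y) - of_bool (c = act v g y) - of_bool (c = act v h y) + (of_bool (c = y) :: int)"
      if y: "y \<in> Q v" for y
    proof -
      have "(\<Sum>d\<in>Q v. (of_bool (c = act v g d) - of_bool (c = d)) * (of_bool (d = act v h y) - of_bool (d = y)))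
        = (\<Sum>d\<in>Q v. (if d = act v h y then of_bool (c = act v g d) - of_bool (c = d) else (0 :: int))
             - (if d = y then of_bool (c = act v g d) - of_bool (c = d) else 0))"
        unfolding mult_of_bool_diff ..
      also have "\<dots> = (of_bool (c = act v g (act v h y)) - of_bool (c = act v h y)) -
          (of_bool (c = act v g y) - of_bool (c = y))"
        unfolding sum_subtractf using finite_X[OF v] act_closed[OF v h y] y by (simp only: sum.delta if_True)
      finally show ?thesis unfolding act_mult[OF v g h y] by linarith
    qed
    show ?thesis
    proof (cases "u = v")
      case True
      have "D t (v, h) (v, d) j = of_bool (d = act v h b) - of_bool (d = b)" if "d \<in> Q v" for d
        using that True ub v by (auto simp: D_def ij idx_def)
      then have "mat_mult idx (D t (v, g)) (D t (v, h)) i j = (\<Sum>d\<in>Q v.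
          (of_bool (c = act v g d) - of_bool (c = d)) * (of_bool (d = act v h b) - of_bool (d = b)))"
        unfolding blk by (intro sum.cong[OF HOL.refl]) (simp only:)
      then show ?thesis using key[of b] ub True v c by (simp add: D_def ij idx_def)
    next
      case False
      show ?thesis
      proof (cases "{u, v} \<in> E")
        case True
        then have "D t (v, x) z j = 0" for x z using False by (simp add: D_def ij)
        then show ?thesis unfolding blk by simp
      next
        case nE: False
        have "D t (v, h) (v, d) j = t * F u b * (of_bool (d = act v h (b0 v)) - of_bool (d = b0 v))"
          if "d \<in> Q v" for d
          using that False nE ub v by (auto simp: D_def ij idx_def jump_def)
        then have "mat_mult idx (D t (v, g)) (D t (v, h)) i j = (\<Sum>d\<in>Q v. t * F u b *
            ((of_bool (c = act v g d) - of_bool (c = d)) * (of_bool (d = act v h (b0 v)) - of_bool (d = b0 v))))"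
          unfolding blk by (intro sum.cong[OF HOL.refl]) (simp only: mult_ac)
        then show ?thesis using key[OF b0[OF v]] ub False nE v c
          by (simp add: D_def ij idx_def jump_def sum_distrib_left[symmetric] right_diff_distrib[symmetric])
      qed
    qed
  qed
  then show "mat_mult idx (R t (v, g)) (R t (v, h)) i j = R t (v, g \<otimes>\<^bsub>G v\<^esub> h) i j"
    using 1 by (simp add: R_def)
qed

text \<open>For adjacent vertices the product of the two \<open>D\<close> parts vanishes in either
  order, because each part is zero on the block in which the other has its rows. Both sides are then
  the identity plus the two \<open>D\<close> parts.\<close>

lemma R_commute:
  assumes uv: "{u, v} \<in> E"
  shows "mat_mult idx (R t (u, g)) (R t (v, h)) = mat_mult idx (R t (v, h)) (R t (u, g))"
proof (intro ext)
  fix i j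
  have D0: "mat_mult idx (D t (x, a)) (D t (y, b)) i j = 0" if "{x, y} \<in> E" for x y a b
  proof -
    have "x \<noteq> y" using that by auto
    then have "D t (x, a) i k * D t (y, b) k j = 0" for k
      using that by (auto simp: D_def insert_commute)
    then show ?thesis by (simp add: mat_mult_def del: mult_eq_0_iff)
  qed
  have *: "mat_mult idx (R t (x, a)) (R t (y, b)) i j =
      mat_one idx i j + D t (y, b) i j + D t (x, a) i j" if xy: "{x, y} \<in> E" for x y a b
  proof -
    have "mat_mult idx (D t (x, a)) (R t (y, b)) i j =
      mat_mult idx (D t (x, a)) (mat_one idx) i j + mat_mult idx (D t (x, a)) (D t (y, b)) i j"
      by (simp add: mat_mult_def R_def distrib_left sum.distrib)
    then show ?thesis
      using R_mult_left[OF R_mats, of t "(x, a)"] mat_one_right[OF finite_idx D_mats] D0[OF xy]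
      by (simp add: R_def)
  qed
  show "mat_mult idx (R t (u, g)) (R t (v, h)) i j = mat_mult idx (R t (v, h)) (R t (u, g)) i j"
    using *[OF uv] *[of v u] uv by (simp add: insert_commute)
qed

end

section \<open>Graph products\<close>

fun word_val :: "('g, 'c) monoid_scheme \<Rightarrow> ('v \<Rightarrow> 'a \<Rightarrow> 'g) \<Rightarrow> ('v \<times> 'a) list \<Rightarrow> 'g" where
  "word_val H f [] = \<one>\<^bsub>H\<^esub>"
| "word_val H f (l # w) = f (fst l) (snd l) \<otimes>\<^bsub>H\<^esub> word_val H f w"

locale graph_prod = simplicial V E
  for V :: "'v set" and E :: "'v set set" +
  fixes G :: "'v \<Rightarrow> ('a, 'b) monoid_scheme"
  assumes groups: "v \<in> V \<Longrightarrow> group (G v)"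
begin

abbreviation FP where "FP \<equiv> free_product V G"
abbreviation GP where "GP \<equiv> graph_product V E G"
abbreviation W where "W \<equiv> free_words V G"
abbreviation NC where "NC \<equiv> normal_closure FP (graph_product_relators V E G)"

definition incl :: "'v \<Rightarrow> 'a \<Rightarrow> ('v \<times> 'a) list set set" where
  "incl v g = NC #>\<^bsub>FP\<^esub> free_incl V G v g"

sublocale FP: group FP
  by (rule group_free_product) (rule groups)

sublocale GP: group GP
  using groups simplicial by (rule group_graph_product)

lemma NC_normal: "NC \<lhd> FP"
  by (rule FP.normal_closure_normal[OF graph_product_relators_subset[OF groups simplicial]])

lemma W_Cons [simp]: "l # w \<in> W \<longleftrightarrow> fst l \<in> V \<and> snd l \<in> carrier (G (fst l)) \<and> w \<in> W"
  by (cases l) (auto simp: free_words_def)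

lemma W_Nil [simp]: "[] \<in> W"
  by (simp add: free_words_def)

lemma cong_class_mult:
  "a \<in> W \<Longrightarrow> b \<in> W \<Longrightarrow>
    free_cong V G `` {a} \<otimes>\<^bsub>FP\<^esub> free_cong V G `` {b} = free_cong V G `` {a @ b}"
  by (rule free_product_mult[OF groups])

lemma cong_class_eq: "(a, b) \<in> free_cong V G \<Longrightarrow> free_cong V G `` {a} = free_cong V G `` {b}"
  by (rule equiv_class_eq[OF equiv_free_cong[OF groups]])

lemma cong_class_carrier [simp]: "a \<in> W \<Longrightarrow> free_cong V G `` {a} \<in> carrier FP"
  by (auto simp: free_product_def intro!: quotientI)

lemma free_incl_carrier [simp]: "v \<in> V \<Longrightarrow> g \<in> carrier (G v) \<Longrightarrow> free_incl V G v g \<in> carrier FP"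
  by (simp add: free_incl_def)

lemma free_incl_hom: "v \<in> V \<Longrightarrow> free_incl V G v \<in> hom (G v) FP"
proof (rule homI)
  fix x y assume v: "v \<in> V" and xy: "x \<in> carrier (G v)" "y \<in> carrier (G v)"
  have "([] @ [(v, x), (v, y)] @ [], [] @ [(v, x \<otimes>\<^bsub>G v\<^esub> y)] @ []) \<in> free_cong V G"
    using v xy by (intro free_cong.mult) auto
  then show "free_incl V G v (x \<otimes>\<^bsub>G v\<^esub> y) = free_incl V G v x \<otimes>\<^bsub>FP\<^esub> free_incl V G v y"
    using v xy cong_class_eq by (simp add: free_incl_def cong_class_mult)
qed simp

lemma quot_hom: "(\<lambda>a. NC #>\<^bsub>FP\<^esub> a) \<in> hom FP GP"
  unfolding graph_product_def by (rule normal.r_coset_hom_Mod[OF NC_normal])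

lemma incl_hom: "v \<in> V \<Longrightarrow> incl v \<in> hom (G v) GP"
  using Group.hom_compose[OF free_incl_hom quot_hom] by (simp add: incl_def[abs_def] o_def)

lemma incl_group_hom: "v \<in> V \<Longrightarrow> group_hom (G v) GP (incl v)"
  by (simp add: group_hom_def group_hom_axioms_def groups incl_hom GP.group_axioms)

lemma incl_closed [simp]: "v \<in> V \<Longrightarrow> g \<in> carrier (G v) \<Longrightarrow> incl v g \<in> carrier GP"
  using incl_hom by (auto simp: hom_def)

lemma incl_mult: "v \<in> V \<Longrightarrow> g \<in> carrier (G v) \<Longrightarrow> h \<in> carrier (G v) \<Longrightarrow>
    incl v (g \<otimes>\<^bsub>G v\<^esub> h) = incl v g \<otimes>\<^bsub>GP\<^esub> incl v h"
  using incl_hom by (auto simp: hom_def)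

lemma incl_one [simp]: "v \<in> V \<Longrightarrow> incl v \<one>\<^bsub>G v\<^esub> = \<one>\<^bsub>GP\<^esub>"
  using group_hom.hom_one[OF incl_group_hom] .

lemma incl_inv: "v \<in> V \<Longrightarrow> g \<in> carrier (G v) \<Longrightarrow> incl v (inv\<^bsub>G v\<^esub> g) = inv\<^bsub>GP\<^esub> (incl v g)"
  using group_hom.hom_inv[OF incl_group_hom] .

lemma edge_vertices: "{u, v} \<in> E \<Longrightarrow> u \<in> V \<and> v \<in> V"
  using simplicial by (auto simp: simplicial_graph_def)

lemma incl_commute:
  assumes e: "{u, v} \<in> E" and g: "g \<in> carrier (G u)" and h: "h \<in> carrier (G v)"
  shows "incl u g \<otimes>\<^bsub>GP\<^esub> incl v h = incl v h \<otimes>\<^bsub>GP\<^esub> incl u g"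
proof -
  let ?x = "free_incl V G u g" and ?y = "free_incl V G v h"
  note uv = edge_vertices[OF e]
  have x: "?x \<in> carrier FP" "?y \<in> carrier FP" using uv g h by auto
  interpret q: group_hom FP GP "\<lambda>a. NC #>\<^bsub>FP\<^esub> a"
    by (simp add: group_hom_def group_hom_axioms_def quot_hom FP.group_axioms GP.group_axioms)
  have "?x \<otimes>\<^bsub>FP\<^esub> ?y \<otimes>\<^bsub>FP\<^esub> inv\<^bsub>FP\<^esub> (?y \<otimes>\<^bsub>FP\<^esub> ?x) \<in> graph_product_relators V E G"
    unfolding graph_product_relators_def using e g h by blast
  then have mem: "?x \<otimes>\<^bsub>FP\<^esub> ?y \<otimes>\<^bsub>FP\<^esub> inv\<^bsub>FP\<^esub> (?y \<otimes>\<^bsub>FP\<^esub> ?x) \<in> NC"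
    unfolding normal_closure_def by blast
  have "NC #>\<^bsub>FP\<^esub> (?x \<otimes>\<^bsub>FP\<^esub> ?y \<otimes>\<^bsub>FP\<^esub> inv\<^bsub>FP\<^esub> (?y \<otimes>\<^bsub>FP\<^esub> ?x)) = \<one>\<^bsub>GP\<^esub>"
    using FP.coset_join2[OF _ normal_imp_subgroup[OF NC_normal] mem] x by (simp add: graph_product_def)
  then have "incl u g \<otimes>\<^bsub>GP\<^esub> incl v h \<otimes>\<^bsub>GP\<^esub> inv\<^bsub>GP\<^esub> (incl v h \<otimes>\<^bsub>GP\<^esub> incl u g) = \<one>\<^bsub>GP\<^esub>"
    using x by (simp add: incl_def)
  then show ?thesis
    using uv g h by (metis GP.inv_equality GP.inv_inv GP.inv_closed GP.m_closed incl_closed)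
qed

abbreviation val where "val \<equiv> word_val GP incl"

lemma val_closed [simp]: "w \<in> W \<Longrightarrow> val w \<in> carrier GP"
  by (induction w) auto

lemma val_append: "w \<in> W \<Longrightarrow> w' \<in> W \<Longrightarrow> val (w @ w') = val w \<otimes>\<^bsub>GP\<^esub> val w'"
  by (induction w) (auto simp: GP.m_assoc)

lemma val_class: "w \<in> W \<Longrightarrow> NC #>\<^bsub>FP\<^esub> (free_cong V G `` {w}) = val w"
proof (induction w)
  case Nil
  have "free_cong V G `` {[]} = \<one>\<^bsub>FP\<^esub>" by (simp add: free_product_def)
  moreover have "NC #>\<^bsub>FP\<^esub> \<one>\<^bsub>FP\<^esub> = \<one>\<^bsub>GP\<^esub>"
    using FP.coset_mult_one[of NC] normal_imp_subgroup[OF NC_normal] by (simp add: graph_product_def subgroup.subset)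
  ultimately show ?case by simp
next
  case (Cons l w)
  have "free_cong V G `` {l # w} = free_incl V G (fst l) (snd l) \<otimes>\<^bsub>FP\<^esub> free_cong V G `` {w}"
    using Cons.prems by (simp add: free_incl_def cong_class_mult)
  then show ?case
    using Cons quot_hom by (simp add: hom_def incl_def)
qed

lemma carrier_GP: "carrier GP = val ` W"
proof
  show "carrier GP \<subseteq> val ` W"
  proof
    fix x assume "x \<in> carrier GP"
    then obtain c where c: "c \<in> carrier FP" "x = NC #>\<^bsub>FP\<^esub> c"
      by (auto simp: graph_product_def carrier_FactGroup)
    then obtain w where "w \<in> W" "c = free_cong V G `` {w}"
      by (auto simp: free_product_def elim: quotientE)
    then show "x \<in> val ` W" using c val_class by auto
  qed
qed auto

text \<open>The universal property of the graph product. Evaluation of words respects the moves that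
  generate \<open>free_cong\<close>, and the commutation hypothesis puts the relators, hence their
  normal closure, into the kernel.\<close>

lemma lift:
  assumes H: "group H" and f: "\<And>v. v \<in> V \<Longrightarrow> f v \<in> hom (G v) H"
    and comm: "\<And>u v g h. {u, v} \<in> E \<Longrightarrow> g \<in> carrier (G u) \<Longrightarrow> h \<in> carrier (G v) \<Longrightarrow>
      f u g \<otimes>\<^bsub>H\<^esub> f v h = f v h \<otimes>\<^bsub>H\<^esub> f u g"
  obtains \<theta> where "\<theta> \<in> hom GP H" "\<And>v g. v \<in> V \<Longrightarrow> g \<in> carrier (G v) \<Longrightarrow> \<theta> (incl v g) = f v g"
proof -
  interpret H: group H by (rule H)
  have fc [simp]: "f v g \<in> carrier H" if "v \<in> V" "g \<in> carrier (G v)" for v g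
    using f[OF that(1)] that by (auto simp: hom_def)
  let ?w = "word_val H f"
  have wc [simp]: "?w w \<in> carrier H" if "w \<in> W" for w
    using that by (induction w) auto
  have wa: "?w (a @ b) = ?w a \<otimes>\<^bsub>H\<^esub> ?w b" if "a \<in> W" "b \<in> W" for a b
    using that by (induction a) (auto simp: H.m_assoc)
  have f1: "f v \<one>\<^bsub>G v\<^esub> = \<one>\<^bsub>H\<^esub>" if "v \<in> V" for v
    using f[OF that] groups[OF that] H hom_one by metis
  have fm: "f v (g \<otimes>\<^bsub>G v\<^esub> h) = f v g \<otimes>\<^bsub>H\<^esub> f v h"
    if "v \<in> V" "g \<in> carrier (G v)" "h \<in> carrier (G v)" for v g h
    using f[OF that(1)] that by (auto simp: hom_def)
  have resp: "?w a = ?w b" if "(a, b) \<in> free_cong V G" for a b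
    using that
  proof induction
    case (mult xs ys v g h)
    have "g \<otimes>\<^bsub>G v\<^esub> h \<in> carrier (G v)"
      using mult groups by (meson group.is_monoid monoid.m_closed)
    then show ?case using mult by (simp add: wa fm H.m_assoc)
  next
    case (one xs ys v)
    have "\<one>\<^bsub>G v\<^esub> \<in> carrier (G v)"
      using one groups by (meson group.is_monoid monoid.one_closed)
    then show ?case using one by (simp add: wa f1)
  qed auto
  \<comment> \<open>A class is evaluated at a chosen representative; \<open>resp\<close> makes the
    choice immaterial.\<close>
  define h where "h C = ?w (SOME w. w \<in> C)" for C
  have h: "h (free_cong V G `` {w}) = ?w w" if "w \<in> W" for w
  proof -
    have "w \<in> free_cong V G `` {w}" using that by (auto intro: free_cong.refl)
    then have "(SOME w'. w' \<in> free_cong V G `` {w}) \<in> free_cong V G `` {w}" by (rule someI)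
    then show ?thesis using resp unfolding h_def by fastforce
  qed
  have hh: "h \<in> hom FP H"
  proof (rule homI)
    fix x assume "x \<in> carrier FP"
    then obtain a where a: "a \<in> W" "x = free_cong V G `` {a}"
      by (auto simp: free_product_def elim: quotientE)
    then show "h x \<in> carrier H" by (simp add: h)
    fix y assume "y \<in> carrier FP"
    then obtain b where b: "b \<in> W" "y = free_cong V G `` {b}"
      by (auto simp: free_product_def elim: quotientE)
    show "h (x \<otimes>\<^bsub>FP\<^esub> y) = h x \<otimes>\<^bsub>H\<^esub> h y"
      using a b by (simp add: cong_class_mult h wa)
  qed
  interpret hh: group_hom FP H h
    by (simp add: group_hom_def group_hom_axioms_def hh FP.group_axioms H)
  have hi: "h (free_incl V G v g) = f v g" if "v \<in> V" "g \<in> carrier (G v)" for v g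
    using that by (simp add: free_incl_def h)
  have "graph_product_relators V E G \<subseteq> kernel FP H h"
  proof
    fix r assume "r \<in> graph_product_relators V E G"
    then obtain u v g k where r: "{u, v} \<in> E" "g \<in> carrier (G u)" "k \<in> carrier (G v)"
      "r = free_incl V G u g \<otimes>\<^bsub>FP\<^esub> free_incl V G v k \<otimes>\<^bsub>FP\<^esub>
        inv\<^bsub>FP\<^esub> (free_incl V G v k \<otimes>\<^bsub>FP\<^esub> free_incl V G u g)"
      by (auto simp: graph_product_relators_def)
    have "h r = f u g \<otimes>\<^bsub>H\<^esub> f v k \<otimes>\<^bsub>H\<^esub> inv\<^bsub>H\<^esub> (f v k \<otimes>\<^bsub>H\<^esub> f u g)"
      using r edge_vertices[OF r(1)] by (simp add: hi del: H.inv_mult_group)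
    also have "\<dots> = \<one>\<^bsub>H\<^esub>"
      using comm[OF r(1-3)] r edge_vertices[OF r(1)] by simp
    finally show "r \<in> kernel FP H h"
      using r edge_vertices[OF r(1)] by (simp add: kernel_def)
  qed
  then have "NC \<subseteq> kernel FP H h"
    unfolding normal_closure_def using hh.normal_kernel by blast
  then obtain \<theta> where th: "\<theta> \<in> hom (FP Mod NC) H" "\<And>x. x \<in> carrier FP \<Longrightarrow> \<theta> (NC #>\<^bsub>FP\<^esub> x) = h x"
    using hh.FactGroup_universal_kernel[OF NC_normal] by blast
  show ?thesis
  proof
    show "\<theta> \<in> hom GP H" using th by (simp add: graph_product_def)
    show "\<theta> (incl v g) = f v g" if "v \<in> V" "g \<in> carrier (G v)" for v g
      using th(2)[of "free_incl V G v g"] that by (simp add: incl_def hi)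
  qed
qed

end

section \<open>Approximately inner automorphisms\<close>

definition p_normal :: "nat \<Rightarrow> 'a set \<Rightarrow> ('a, 'b) monoid_scheme \<Rightarrow> bool" where
  "p_normal p N G \<longleftrightarrow> N \<lhd> G \<and> finite_p_group p (G Mod N)"

definition approximately_inner :: "nat \<Rightarrow> ('a, 'b) monoid_scheme \<Rightarrow> ('a \<Rightarrow> 'a) \<Rightarrow> bool" where
  "approximately_inner p G \<phi> \<longleftrightarrow> \<phi> \<in> auto G \<and>
    (\<forall>N. p_normal p N G \<longrightarrow>
      (\<exists>g\<in>carrier G. \<forall>x\<in>carrier G. \<phi> x \<otimes>\<^bsub>G\<^esub> inv\<^bsub>G\<^esub> (g \<otimes>\<^bsub>G\<^esub> x \<otimes>\<^bsub>G\<^esub> inv\<^bsub>G\<^esub> g) \<in> N))"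

text \<open>Cauchy's theorem: Sylow with exponent one gives a subgroup of order \<open>q\<close>,
  and any nontrivial element of it will do.\<close>

lemma (in group) exists_element_of_prime_order:
  assumes fin: "finite (carrier G)" and q: "Factorial_Ring.prime q" "q dvd Coset.order G"
  shows "\<exists>y\<in>carrier G. y \<noteq> \<one> \<and> y [^] q = \<one>"
proof -
  obtain m where m: "Coset.order G = q ^ 1 * m" using q by (auto elim: dvdE)
  obtain H where H: "subgroup H G" "card H = q ^ 1"
    using sylow_thm[OF q(1) is_group m fin] by blast
  interpret H: group "G\<lparr>carrier := H\<rparr>" using H(1) by (simp add: subgroup_imp_group)
  have finH: "finite H" using fin H(1) by (meson finite_subset subgroup.subset)
  have "card H > 1" using H(2) q(1) prime_gt_1_nat by simp
  then obtain y where y: "y \<in> H" "y \<noteq> \<one>"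
    by (metis One_nat_def card_le_Suc0_iff_eq finH not_le)
  have "y [^]\<^bsub>G\<lparr>carrier := H\<rparr>\<^esub> Coset.order (G\<lparr>carrier := H\<rparr>) = \<one>\<^bsub>G\<lparr>carrier := H\<rparr>\<^esub>"
    using finH y by (intro H.pow_order_eq_1) auto
  then have "y [^] q = \<one>" using H(2) by (simp add: Coset.order_def nat_pow_consistent[symmetric])
  then show ?thesis using y H(1) subgroup.mem_carrier by fast
qed

lemma (in group) prime_power_pow_eq_one:
  assumes "Factorial_Ring.prime p" "Factorial_Ring.prime q" "q \<noteq> p" "y \<in> carrier G"
    and "y [^] (q :: nat) = \<one>" "y [^] (p ^ m :: nat) = \<one>"
  shows "y = \<one>"
proof -
  have "coprime q (p ^ m)" using assms(1-3) by (simp add: primes_coprime)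
  moreover have "ord y dvd q" "ord y dvd p ^ m" using assms pow_eq_id by auto
  ultimately have "ord y = 1" using coprime_common_divisor_nat by blast
  then show ?thesis using ord_eq_1 assms by blast
qed

text \<open>By Cauchy's theorem a prime divisor \<open>q\<close> of the order yields a nontrivial
  element killed both by \<open>q\<close> and by a power of \<open>p\<close>, which forces
  \<open>q = p\<close>.\<close>

lemma (in group) finite_p_groupI:
  assumes p: "Factorial_Ring.prime p" and fin: "finite (carrier G)"
    and pow: "\<And>x. x \<in> carrier G \<Longrightarrow> \<exists>m. x [^] (p ^ m :: nat) = \<one>"
  shows "finite_p_group p G"
proof -
  have *: "q = p" if "Factorial_Ring.prime q" "q dvd Coset.order G" for q
    using exists_element_of_prime_order[OF fin that] pow prime_power_pow_eq_one[OF p that(1)] by metis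
  have "Coset.order G \<noteq> 0" using fin by (simp add: order_gt_0_iff_finite[symmetric])
  then obtain m where m: "Coset.order G = p ^ multiplicity p (Coset.order G) * m" "\<not> p dvd m"
    using multiplicity_decompose'[of "Coset.order G" p] p by (metis not_prime_unit)
  have "m = 1"
  proof (rule ccontr)
    assume "m \<noteq> 1"
    then obtain q where "Factorial_Ring.prime q" "q dvd m" using prime_factor_nat by blast
    then show False using * m by (metis dvd_mult)
  qed
  then show ?thesis unfolding finite_p_group_def using fin m is_group by auto
qed

lemma (in normal) rcos_eq_iff:
  "x \<in> carrier G \<Longrightarrow> y \<in> carrier G \<Longrightarrow> H #> x = H #> y \<longleftrightarrow> x \<otimes> inv y \<in> H"
  by (metis is_group rcos_self repr_independence rcos_module subgroup_axioms)

lemma (in normal) rcos_eq_self_iff: "x \<in> carrier G \<Longrightarrow> H #> x = H \<longleftrightarrow> x \<in> H"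
  by (metis coset_join1 coset_join2 subgroup_axioms)

text \<open>The map \<open>\<kappa>\<close> is any invariant with finitely many values that
  separates the cosets of \<open>N\<close>; it bounds the quotient without a description of its
  elements.\<close>

lemma (in group) p_normalI:
  assumes p: "Factorial_Ring.prime p" and N: "N \<lhd> G" and fin: "finite (\<kappa> ` carrier G)"
    and \<kappa>: "\<And>x y. x \<in> carrier G \<Longrightarrow> y \<in> carrier G \<Longrightarrow> \<kappa> x = \<kappa> y \<Longrightarrow> x \<otimes> inv y \<in> N"
    and pow: "\<And>x. x \<in> carrier G \<Longrightarrow> \<exists>m. x [^] (p ^ m :: nat) \<in> N"
  shows "p_normal p N G"
proof -
  interpret N: normal N G by (rule N)
  interpret Q: group "G Mod N" by (rule N.factorgroup_is_group)
  have carr: "carrier (G Mod N) = (\<lambda>x. N #> x) ` carrier G" by (rule carrier_FactGroup)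
  define r where "r k = (SOME x. x \<in> carrier G \<and> \<kappa> x = k)" for k
  have "N #> x \<in> (\<lambda>k. N #> r k) ` \<kappa> ` carrier G" if x: "x \<in> carrier G" for x
  proof -
    have "r (\<kappa> x) \<in> carrier G \<and> \<kappa> (r (\<kappa> x)) = \<kappa> x"
      unfolding r_def using x by (intro someI[of "\<lambda>y. y \<in> carrier G \<and> \<kappa> y = \<kappa> x"]) simp
    then have "N #> x = N #> r (\<kappa> x)" using \<kappa>[of x "r (\<kappa> x)"] x N.rcos_eq_iff by simp
    then show ?thesis using x by blast
  qed
  then have "finite (carrier (G Mod N))"
    unfolding carr using fin by (intro finite_subset[OF _ finite_imageI[OF fin]]) blast
  moreover have "\<exists>m. C [^]\<^bsub>G Mod N\<^esub> (p ^ m :: nat) = \<one>\<^bsub>G Mod N\<^esub>" if C: "C \<in> carrier (G Mod N)" for C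
  proof -
    obtain x where x: "x \<in> carrier G" "C = N #> x" using C unfolding carr by blast
    then obtain m where "x [^] (p ^ m :: nat) \<in> N" using pow by blast
    then show ?thesis using x N.FactGroup_pow[of x] N.rcos_eq_self_iff by (intro exI[of _ m]) simp
  qed
  ultimately show ?thesis using Q.finite_p_groupI[OF p] N by (simp add: p_normal_def)
qed

lemma (in group) p_normalD:
  assumes "p_normal p N G"
  shows "N \<lhd> G" "finite ((\<lambda>x. N #> x) ` carrier G)" "\<exists>n. \<forall>x\<in>carrier G. x [^] (p ^ n :: nat) \<in> N"
proof -
  show N: "N \<lhd> G" using assms by (simp add: p_normal_def)
  interpret N: normal N G by (rule N)
  interpret Q: group "G Mod N" by (rule N.factorgroup_is_group)
  show fin: "finite ((\<lambda>x. N #> x) ` carrier G)"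
    using assms by (simp add: p_normal_def finite_p_group_def carrier_FactGroup)
  obtain n where n: "Coset.order (G Mod N) = p ^ n"
    using assms by (auto simp: p_normal_def finite_p_group_def)
  have "x [^] (p ^ n :: nat) \<in> N" if x: "x \<in> carrier G" for x
  proof -
    have "(N #> x) [^]\<^bsub>G Mod N\<^esub> (p ^ n :: nat) = \<one>\<^bsub>G Mod N\<^esub>"
      using Q.pow_order_eq_1[of "N #> x"] x fin n by (simp add: carrier_FactGroup)
    then show ?thesis using N.FactGroup_pow[OF x] N.rcos_eq_self_iff x by simp
  qed
  then show "\<exists>n. \<forall>x\<in>carrier G. x [^] (p ^ n :: nat) \<in> N" by blast
qed

text \<open>The quotient by the preimage embeds into \<open>H Mod N\<close>.\<close>

lemma (in group_hom) p_normal_vimage: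
  assumes p: "Factorial_Ring.prime p" and N: "p_normal p N H"
  shows "p_normal p {x \<in> carrier G. h x \<in> N} G"
proof -
  note ND = H.p_normalD[OF N]
  interpret N: normal N H by (rule ND(1))
  let ?M = "{x \<in> carrier G. h x \<in> N}"
  have sub: "subgroup ?M G"
    by (intro G.subgroupI) (auto intro: exI[of _ "\<one>\<^bsub>G\<^esub>"])
  have nor: "?M \<lhd> G"
    unfolding G.normal_inv_iff using sub N.inv_op_closed2 by auto
  obtain n where n: "\<forall>x\<in>carrier H. x [^]\<^bsub>H\<^esub> (p ^ n :: nat) \<in> N" using ND(3) by blast
  show ?thesis
  proof (rule G.p_normalI[OF p nor, where \<kappa> = "\<lambda>x. N #>\<^bsub>H\<^esub> h x"])
    have "(\<lambda>x. N #>\<^bsub>H\<^esub> h x) ` carrier G \<subseteq> (\<lambda>x. N #>\<^bsub>H\<^esub> x) ` carrier H" by auto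
    then show "finite ((\<lambda>x. N #>\<^bsub>H\<^esub> h x) ` carrier G)" using ND(2) finite_subset by blast
    show "x \<otimes>\<^bsub>G\<^esub> inv\<^bsub>G\<^esub> y \<in> ?M" if "x \<in> carrier G" "y \<in> carrier G" "N #>\<^bsub>H\<^esub> h x = N #>\<^bsub>H\<^esub> h y" for x y
      using that N.rcos_eq_iff[of "h x" "h y"] by simp
    show "\<exists>m. x [^]\<^bsub>G\<^esub> (p ^ m :: nat) \<in> ?M" if "x \<in> carrier G" for x
      using n that by (intro exI[of _ n]) (simp add: hom_nat_pow)
  qed
qed

lemma (in group) nat_pow_subgroup_closed:
  "subgroup H G \<Longrightarrow> x \<in> H \<Longrightarrow> x [^] (n :: nat) \<in> H"
  by (induction n) (auto intro: subgroup.one_closed subgroup.m_closed)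

text \<open>The quotient by the intersection embeds into the product of the two quotients.\<close>

lemma (in group) p_normal_Int:
  assumes p: "Factorial_Ring.prime p" and N: "p_normal p N G" and M: "p_normal p M G"
  shows "p_normal p (N \<inter> M) G"
proof -
  note ND = p_normalD[OF N] and MD = p_normalD[OF M]
  interpret N: normal N G by (rule ND(1))
  interpret M: normal M G by (rule MD(1))
  obtain n where n: "\<forall>x\<in>carrier G. x [^] (p ^ n :: nat) \<in> N" using ND(3) by blast
  obtain m where m: "\<forall>x\<in>carrier G. x [^] (p ^ m :: nat) \<in> M" using MD(3) by blast
  show ?thesis
  proof (rule p_normalI[OF p, where \<kappa> = "\<lambda>x. (N #> x, M #> x)"])
    show "N \<inter> M \<lhd> G"
      unfolding normal_inv_iff
      using subgroups_Inter_pair[OF N.subgroup_axioms M.subgroup_axioms] N.inv_op_closed2 M.inv_op_closed2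
      by auto
    have "(\<lambda>x. (N #> x, M #> x)) ` carrier G \<subseteq> (\<lambda>x. N #> x) ` carrier G \<times> (\<lambda>x. M #> x) ` carrier G"
      by auto
    then show "finite ((\<lambda>x. (N #> x, M #> x)) ` carrier G)"
      using ND(2) MD(2) by (meson finite_SigmaI finite_subset)
    show "x \<otimes> inv y \<in> N \<inter> M" if "x \<in> carrier G" "y \<in> carrier G" "(N #> x, M #> x) = (N #> y, M #> y)" for x y
      using that N.rcos_eq_iff M.rcos_eq_iff by simp
    show "\<exists>k. x [^] (p ^ k :: nat) \<in> N \<inter> M" if x: "x \<in> carrier G" for x
    proof -
      have "(x [^] (p ^ n :: nat)) [^] (p ^ m :: nat) \<in> N"
        using n x N.subgroup_axioms by (simp add: nat_pow_subgroup_closed)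
      moreover have "(x [^] (p ^ n :: nat)) [^] (p ^ m :: nat) \<in> M"
        using m x by blast
      ultimately show ?thesis using x by (intro exI[of _ "n + m"]) (simp add: nat_pow_pow power_add)
    qed
  qed
qed

lemma (in group) p_normal_carrier:
  assumes p: "Factorial_Ring.prime p"
  shows "p_normal p (carrier G) G"
  by (rule p_normalI[OF p normal_self, where \<kappa> = "\<lambda>x. ()"]) auto

text \<open>Intersecting one subgroup per element handles finitely many elements at once, such as
  the letters of a word.\<close>

lemma (in group) residually_p_finite_avoid:
  assumes p: "Factorial_Ring.prime p" and res: "residually_p_finite p G"
    and "finite A" "A \<subseteq> carrier G - {\<one>}"
  shows "\<exists>N. p_normal p N G \<and> N \<inter> A = {}"
  using assms(3,4)
proof (induction A)
  case empty
  then show ?case using p_normal_carrier[OF p] by auto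
next
  case (insert a A)
  then obtain N where N: "p_normal p N G" "N \<inter> A = {}" by auto
  obtain M where M: "p_normal p M G" "a \<notin> M"
    using res insert.prems by (auto simp: residually_p_finite_def p_normal_def)
  have "(N \<inter> M) \<inter> insert a A = {}" using N M by auto
  then show ?case using p_normal_Int[OF p N(1) M(1)] by blast
qed

lemma autoD:
  assumes "\<phi> \<in> auto G"
  shows "\<phi> \<in> hom G G" "bij_betw \<phi> (carrier G) (carrier G)" "\<phi> \<in> extensional (carrier G)"
  using assms by (auto simp: auto_def Bij_def)

lemma (in group) auto_group_hom: "\<phi> \<in> auto G \<Longrightarrow> group_hom G G \<phi>"
  by (simp add: group_hom_def group_hom_axioms_def is_group autoD(1))

lemma (in group) autoI:
  "\<phi> \<in> hom G G \<Longrightarrow> bij_betw \<phi> (carrier G) (carrier G) \<Longrightarrow> \<phi> \<in> extensional (carrier G) \<Longrightarrow> \<phi> \<in> auto G"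
  by (auto simp: auto_def Bij_def)

lemma (in group) auto_inverse:
  assumes "\<phi> \<in> auto G"
  obtains \<psi> where "\<psi> \<in> auto G" "\<And>x. x \<in> carrier G \<Longrightarrow> \<phi> (\<psi> x) = x" "\<And>x. x \<in> carrier G \<Longrightarrow> \<psi> (\<phi> x) = x"
proof
  note a = autoD[OF assms]
  let ?\<psi> = "restrict (inv_into (carrier G) \<phi>) (carrier G)"
  show "?\<psi> \<in> auto G"
    using restrict_inv_into_hom[of \<phi>] restrict_inv_into_Bij[of \<phi> "carrier G"] assms by (auto simp: auto_def)
  show "\<phi> (?\<psi> x) = x" if "x \<in> carrier G" for x
    using a(2) that by (simp add: bij_betw_inv_into_right)
  show "?\<psi> (\<phi> x) = x" if "x \<in> carrier G" for x
    using a(2) that by (simp add: bij_betw_inv_into_left bij_betwE)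
qed

lemma (in group) inv_mult_cancel: "g \<in> carrier G \<Longrightarrow> x \<in> carrier G \<Longrightarrow> inv g \<otimes> (g \<otimes> x) = x"
  by (simp add: m_assoc[symmetric])

lemma (in group) mult_inv_cancel: "g \<in> carrier G \<Longrightarrow> x \<in> carrier G \<Longrightarrow> g \<otimes> (inv g \<otimes> x) = x"
  by (simp add: m_assoc[symmetric])

lemma (in group) inner_in_auto:
  assumes g: "g \<in> carrier G"
  shows "(\<lambda>x\<in>carrier G. g \<otimes> x \<otimes> inv g) \<in> auto G"
proof (rule autoI)
  show "(\<lambda>x\<in>carrier G. g \<otimes> x \<otimes> inv g) \<in> hom G G"
    using g by (intro homI) (auto simp: m_assoc inv_solve_left)
  show "bij_betw (\<lambda>x\<in>carrier G. g \<otimes> x \<otimes> inv g) (carrier G) (carrier G)"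
    using g by (intro bij_betwI[where g = "\<lambda>x. inv g \<otimes> x \<otimes> g"])
      (auto simp: m_assoc inv_mult_cancel mult_inv_cancel)
qed auto

lemma (in group) Inn_subset_auto: "Inn G \<subseteq> auto G"
  using inner_in_auto by (auto simp: Inn_def)

lemma (in group) characteristic_normal:
  assumes "characteristic_subgroup K G"
  shows "K \<lhd> G"
  unfolding normal_inv_iff
proof (intro conjI ballI)
  show sub: "subgroup K G" using assms by (simp add: characteristic_subgroup_def)
  fix g h assume g: "g \<in> carrier G" and h: "h \<in> K"
  have "(\<lambda>x\<in>carrier G. g \<otimes> x \<otimes> inv g) ` K = K"
    using assms inner_in_auto[OF g] unfolding characteristic_subgroup_def by blast
  then show "g \<otimes> h \<otimes> inv g \<in> K" using h subgroup.mem_carrier[OF sub] by force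
qed

lemma (in group_hom) eq_on_generate:
  assumes "group_hom G H f" "S \<subseteq> carrier G" "\<And>s. s \<in> S \<Longrightarrow> h s = f s" "x \<in> generate G S"
  shows "h x = f x"
proof -
  interpret f: group_hom G H f by (rule assms(1))
  show ?thesis using assms(4)
  proof induction
    case (inv s) then show ?case using assms by (metis f.hom_inv hom_inv subsetD)
  next
    case (eng x y)
    then have "x \<in> carrier G" "y \<in> carrier G" using G.generate_in_carrier assms(2) by auto
    then show ?case using eng by simp
  qed (use assms in auto)
qed

text \<open>\<open>K\<close> is the common kernel of all homomorphisms from \<open>G\<close> to
  \<open>G Mod N\<close>. There are finitely many of them, as they are determined on a finite
  generating set, so \<open>G Mod K\<close> embeds into a finite power of a finite
  \<open>p\<close>-group. Precomposition with an automorphism permutes them, so \<open>K\<close> is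
  characteristic.\<close>

lemma (in group) characteristic_core:
  assumes p: "Factorial_Ring.prime p" and fg: "finitely_generated_group G" and N: "p_normal p N G"
  shows "\<exists>K. characteristic_subgroup K G \<and> p_normal p K G \<and> K \<subseteq> N"
proof -
  note ND = p_normalD[OF N]
  interpret N: normal N G by (rule ND(1))
  let ?P = "G Mod N"
  interpret P: group ?P by (rule N.factorgroup_is_group)
  obtain S where S: "finite S" "S \<subseteq> carrier G" "generate G S = carrier G"
    using fg by (auto simp: finitely_generated_group_def)
  have finP: "finite (carrier ?P)" using ND(2) by (simp add: carrier_FactGroup)
  \<comment> \<open>Extensionality reduces the functions to their values on the carrier; without it
    the set could be infinite.\<close>
  define \<Psi> where "\<Psi> = hom G ?P \<inter> extensional (carrier G)"
  have gh: "group_hom G ?P \<psi>" if "\<psi> \<in> \<Psi>" for \<psi>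
    using that by (simp add: \<Psi>_def group_hom_def group_hom_axioms_def is_group P.is_group)
  have "inj_on (\<lambda>\<psi>. restrict \<psi> S) \<Psi>"
  proof (rule inj_onI)
    fix \<psi> \<psi>' assume a: "\<psi> \<in> \<Psi>" "\<psi>' \<in> \<Psi>" and eq: "restrict \<psi> S = restrict \<psi>' S"
    have "\<psi> x = \<psi>' x" if "x \<in> carrier G" for x
      using group_hom.eq_on_generate[OF gh[OF a(1)] gh[OF a(2)] S(2)] eq that S(3)
      by (metis restrict_apply')
    then show "\<psi> = \<psi>'" using a by (auto simp: \<Psi>_def intro: extensionalityI)
  qed
  moreover have "(\<lambda>\<psi>. restrict \<psi> S) ` \<Psi> \<subseteq> S \<rightarrow>\<^sub>E carrier ?P"
    using S(2) by (auto simp: \<Psi>_def hom_def)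
  ultimately have fin\<Psi>: "finite \<Psi>"
    using finite_PiE[OF S(1), of "\<lambda>_. carrier ?P"] finP by (meson inj_on_finite)
  define K where "K = {x \<in> carrier G. \<forall>\<psi>\<in>\<Psi>. \<psi> x = \<one>\<^bsub>?P\<^esub>}"
  have sub: "subgroup K G"
  proof (rule subgroupI)
    have "\<one> \<in> K" unfolding K_def using group_hom.hom_one[OF gh] by blast
    then show "K \<noteq> {}" by blast
    show "inv x \<in> K" if x: "x \<in> K" for x
    proof -
      have xc: "x \<in> carrier G" using x by (simp add: K_def)
      have "\<psi> (inv x) = \<one>\<^bsub>?P\<^esub>" if "\<psi> \<in> \<Psi>" for \<psi>
        using group_hom.hom_inv[OF gh[OF that] xc] x that P.inv_one unfolding K_def by auto
      then show ?thesis using xc unfolding K_def by blast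
    qed
    show "x \<otimes> y \<in> K" if xy: "x \<in> K" "y \<in> K" for x y
    proof -
      have c: "x \<in> carrier G" "y \<in> carrier G" using xy by (simp_all add: K_def)
      have "\<psi> (x \<otimes> y) = \<one>\<^bsub>?P\<^esub> \<otimes>\<^bsub>?P\<^esub> \<one>\<^bsub>?P\<^esub>" if "\<psi> \<in> \<Psi>" for \<psi>
        using group_hom.hom_mult[OF gh[OF that] c] xy that unfolding K_def mem_Collect_eq by metis
      then show ?thesis using c P.l_one[OF P.one_closed] unfolding K_def by simp
    qed
  qed (auto simp: K_def)
  have "\<phi> ` K \<subseteq> K" if \<phi>: "\<phi> \<in> auto G" for \<phi>
  proof
    fix y assume "y \<in> \<phi> ` K"
    then obtain x where x: "x \<in> K" "y = \<phi> x" by blast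
    have y: "y \<in> carrier G" using x autoD(1)[OF \<phi>] by (auto simp: K_def hom_def)
    have "\<psi> y = \<one>\<^bsub>?P\<^esub>" if "\<psi> \<in> \<Psi>" for \<psi>
    proof -
      have "compose (carrier G) \<psi> \<phi> \<in> \<Psi>"
        using that autoD(1)[OF \<phi>] by (auto simp: \<Psi>_def hom_def compose_def Pi_iff)
      then have "compose (carrier G) \<psi> \<phi> x = \<one>\<^bsub>?P\<^esub>" using x by (simp add: K_def)
      then show ?thesis using x by (simp add: compose_def K_def)
    qed
    then show "y \<in> K" using y by (simp add: K_def)
  qed
  note imK = this
  have char: "characteristic_subgroup K G"
    unfolding characteristic_subgroup_def
  proof (intro conjI ballI sub)
    fix \<phi> assume \<phi>: "\<phi> \<in> auto G"
    obtain \<psi> where \<psi>: "\<psi> \<in> auto G" "\<And>x. x \<in> carrier G \<Longrightarrow> \<phi> (\<psi> x) = x"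
      using auto_inverse[OF \<phi>] by blast
    have "K \<subseteq> \<phi> ` K"
    proof
      fix x assume x: "x \<in> K"
      then have "\<psi> x \<in> K" using imK[OF \<psi>(1)] by blast
      moreover have "x = \<phi> (\<psi> x)" using x \<psi>(2) subgroup.mem_carrier[OF sub] by metis
      ultimately show "x \<in> \<phi> ` K" by blast
    qed
    then show "\<phi> ` K = K" using imK[OF \<phi>] by blast
  qed
  have KN: "K \<subseteq> N"
  proof
    fix x assume x: "x \<in> K"
    \<comment> \<open>The projection onto the quotient is itself one of the homomorphisms.\<close>
    have "(\<lambda>x\<in>carrier G. N #> x) \<in> \<Psi>"
      unfolding \<Psi>_def using N.r_coset_hom_Mod by (simp add: hom_def Pi_iff)
    then have "(\<lambda>x\<in>carrier G. N #> x) x = N" using x unfolding K_def one_FactGroup by blast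
    then show "x \<in> N" using x N.rcos_eq_self_iff[of x] subgroup.mem_carrier[OF sub x] by simp
  qed
  obtain n where n: "Coset.order ?P = p ^ n" using N by (auto simp: p_normal_def finite_p_group_def)
  have "p_normal p K G"
  proof (rule p_normalI[OF p characteristic_normal[OF char], where \<kappa> = "\<lambda>x. \<lambda>\<psi>\<in>\<Psi>. \<psi> x"])
    have "(\<lambda>x. \<lambda>\<psi>\<in>\<Psi>. \<psi> x) ` carrier G \<subseteq> \<Psi> \<rightarrow>\<^sub>E carrier ?P"
    proof (rule image_subsetI)
      fix x assume "x \<in> carrier G"
      then show "(\<lambda>\<psi>\<in>\<Psi>. \<psi> x) \<in> \<Psi> \<rightarrow>\<^sub>E carrier ?P"
        unfolding restrict_PiE_iff using group_hom.hom_closed[OF gh] by blast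
    qed
    then show "finite ((\<lambda>x. \<lambda>\<psi>\<in>\<Psi>. \<psi> x) ` carrier G)"
      by (rule finite_subset[OF _ finite_PiE[OF fin\<Psi> finP]])
    show "x \<otimes> inv y \<in> K" if xy: "x \<in> carrier G" "y \<in> carrier G" "(\<lambda>\<psi>\<in>\<Psi>. \<psi> x) = (\<lambda>\<psi>\<in>\<Psi>. \<psi> y)" for x y
    proof -
      have "\<psi> (x \<otimes> inv y) = \<one>\<^bsub>?P\<^esub>" if "\<psi> \<in> \<Psi>" for \<psi>
      proof -
        interpret \<psi>: group_hom G ?P \<psi> by (rule gh[OF that])
        have "\<psi> x = \<psi> y" using fun_cong[OF xy(3), of \<psi>] that by (simp only: restrict_apply if_True)
        moreover have "\<psi> (x \<otimes> inv y) = \<psi> x \<otimes>\<^bsub>?P\<^esub> inv\<^bsub>?P\<^esub> (\<psi> y)"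
          using xy by (simp only: \<psi>.hom_mult \<psi>.hom_inv inv_closed)
        ultimately show ?thesis using P.r_inv[OF \<psi>.hom_closed[OF xy(2)]] by (simp only:)
      qed
      then show ?thesis using xy unfolding K_def by blast
    qed
    show "\<exists>m. x [^] (p ^ m :: nat) \<in> K" if x: "x \<in> carrier G" for x
    proof -
      have "\<psi> (x [^] (p ^ n :: nat)) = \<one>\<^bsub>?P\<^esub>" if "\<psi> \<in> \<Psi>" for \<psi>
        using group_hom.hom_nat_pow[OF gh[OF that] x] P.pow_order_eq_1[of "\<psi> x"] n x finP
          group_hom.hom_closed[OF gh[OF that] x] by metis
      then show ?thesis using x unfolding K_def by blast
    qed
  qed
  then show ?thesis using char KN by blast
qed

lemma (in group) induced_inner_iff:
  assumes K: "characteristic_subgroup K G" and \<phi>: "\<phi> \<in> auto G"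
  shows "induced_auto G K \<phi> \<in> Inn (G Mod K) \<longleftrightarrow>
    (\<exists>g\<in>carrier G. \<forall>x\<in>carrier G. \<phi> x \<otimes> inv (g \<otimes> x \<otimes> inv g) \<in> K)"
proof -
  interpret K: normal K G by (rule characteristic_normal[OF K])
  interpret q: group_hom G "G Mod K" "\<lambda>x. K #> x"
    using K.r_coset_hom_Mod K.factorgroup_is_group is_group by (simp add: group_hom_def group_hom_axioms_def)
  have conj: "(K #> g) \<otimes>\<^bsub>G Mod K\<^esub> (K #> x) \<otimes>\<^bsub>G Mod K\<^esub> inv\<^bsub>G Mod K\<^esub> (K #> g) = K #> (g \<otimes> x \<otimes> inv g)"
    if "g \<in> carrier G" "x \<in> carrier G" for g x
    using that by (simp only: q.hom_mult q.hom_inv m_closed inv_closed)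
  have \<phi>c: "\<phi> x \<in> carrier G" if "x \<in> carrier G" for x
    using autoD(1)[OF \<phi>] that by (auto simp: hom_def)
  have iff: "induced_auto G K \<phi> = (\<lambda>C\<in>carrier (G Mod K). (K #> g) \<otimes>\<^bsub>G Mod K\<^esub> C \<otimes>\<^bsub>G Mod K\<^esub> inv\<^bsub>G Mod K\<^esub> (K #> g))
     \<longleftrightarrow> (\<forall>x\<in>carrier G. \<phi> x \<otimes> inv (g \<otimes> x \<otimes> inv g) \<in> K)" (is "?L = ?R \<longleftrightarrow> _")
    if g: "g \<in> carrier G" for g
  proof
    assume eq: "?L = ?R"
    show "\<forall>x\<in>carrier G. \<phi> x \<otimes> inv (g \<otimes> x \<otimes> inv g) \<in> K"
    proof
      fix x assume x: "x \<in> carrier G"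
      have "K #> \<phi> x = ?L (K #> x)" by (rule induced_auto_coset[OF K \<phi> x, symmetric])
      also have "\<dots> = ?R (K #> x)" by (rule fun_cong[OF eq])
      also have "\<dots> = K #> (g \<otimes> x \<otimes> inv g)"
        unfolding conj[OF g x, symmetric] using x by (simp only: restrict_apply carrier_FactGroup imageI if_True)
      finally show "\<phi> x \<otimes> inv (g \<otimes> x \<otimes> inv g) \<in> K"
        using g x \<phi>c[OF x] K.rcos_eq_iff[of "\<phi> x" "g \<otimes> x \<otimes> inv g"] by blast
    qed
  next
    assume r: "\<forall>x\<in>carrier G. \<phi> x \<otimes> inv (g \<otimes> x \<otimes> inv g) \<in> K"
    show "?L = ?R"
    proof (rule extensionalityI[of _ "carrier (G Mod K)"])
      fix C assume C: "C \<in> carrier (G Mod K)"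
      then obtain x where x: "x \<in> carrier G" "C = K #> x" unfolding carrier_FactGroup by blast
      have "?L C = K #> \<phi> x" unfolding x(2) by (rule induced_auto_coset[OF K \<phi> x(1)])
      also have "\<dots> = K #> (g \<otimes> x \<otimes> inv g)"
        using r g x \<phi>c[OF x(1)] K.rcos_eq_iff[of "\<phi> x" "g \<otimes> x \<otimes> inv g"] by blast
      also have "\<dots> = ?R C" unfolding conj[OF g x(1), symmetric] using C x(2) by (simp only: restrict_apply if_True)
      finally show "?L C = ?R C" .
    qed (auto simp: induced_auto_def)
  qed
  have "induced_auto G K \<phi> \<in> Inn (G Mod K) \<longleftrightarrow> (\<exists>g\<in>carrier G. induced_auto G K \<phi> =
      (\<lambda>C\<in>carrier (G Mod K). (K #> g) \<otimes>\<^bsub>G Mod K\<^esub> C \<otimes>\<^bsub>G Mod K\<^esub> inv\<^bsub>G Mod K\<^esub> (K #> g)))"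
    unfolding Inn_def using carrier_FactGroup[of G K] by (simp add: image_iff del: mult_FactGroup)
  then show ?thesis using iff by blast
qed

text \<open>A subgroup \<open>N\<close> that shows \<open>\<phi>\<close> not to be approximately
  inner is replaced by its characteristic core; the failure persists because the core is contained
  in \<open>N\<close>.\<close>

lemma (in group) p_IASI:
  assumes p: "Factorial_Ring.prime p" and fg: "finitely_generated_group G"
    and inner: "\<And>\<phi>. approximately_inner p G \<phi> \<Longrightarrow> \<phi> \<in> Inn G"
  shows "p_IAS p G"
  unfolding p_IAS_def
proof (intro conjI is_group ballI)
  fix \<phi> assume \<phi>: "\<phi> \<in> auto G - Inn G"
  then have "\<not> approximately_inner p G \<phi>" using inner by blast
  then obtain N where N: "p_normal p N G"
    "\<not> (\<exists>g\<in>carrier G. \<forall>x\<in>carrier G. \<phi> x \<otimes> inv (g \<otimes> x \<otimes> inv g) \<in> N)"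
    using \<phi> unfolding approximately_inner_def by blast
  obtain K where K: "characteristic_subgroup K G" "p_normal p K G" "K \<subseteq> N"
    using characteristic_core[OF p fg N(1)] by blast
  have "induced_auto G K \<phi> \<notin> Inn (G Mod K)"
    using induced_inner_iff[OF K(1), of \<phi>] \<phi> N(2) K(3) by blast
  then show "\<exists>K. characteristic_subgroup K G \<and> finite_p_group p (G Mod K) \<and> induced_auto G K \<phi> \<notin> Inn (G Mod K)"
    using K by (auto simp: p_normal_def)
qed

lemma (in group) p_IAS_approximately_inner:
  assumes ias: "p_IAS p G" and \<phi>: "approximately_inner p G \<phi>"
  shows "\<phi> \<in> Inn G"
proof (rule ccontr)
  assume "\<phi> \<notin> Inn G"
  moreover have \<phi>a: "\<phi> \<in> auto G" using \<phi> unfolding approximately_inner_def by blast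
  ultimately obtain K where K: "characteristic_subgroup K G" "finite_p_group p (G Mod K)"
    "induced_auto G K \<phi> \<notin> Inn (G Mod K)"
    using ias unfolding p_IAS_def by blast
  then have "p_normal p K G" using characteristic_normal by (simp add: p_normal_def)
  then show False using K(3) \<phi> induced_inner_iff[OF K(1) \<phi>a] unfolding approximately_inner_def by blast
qed

section \<open>Separation of conjugacy classes\<close>

text \<open>A nonzero \<open>d\<close> is smaller in absolute value than the power of
  \<open>q\<close> with exponent \<open>nat \<bar>d\<bar>\<close>.\<close>

lemma int_dvd_all_powers:
  fixes d :: int
  assumes "q \<ge> 2" "\<And>k. q ^ k dvd d"
  shows "d = 0"
proof (rule ccontr)
  assume "d \<noteq> 0"
  then have "q ^ nat \<bar>d\<bar> \<le> \<bar>d\<bar>" using dvd_imp_le_int[OF _ assms(2)[of "nat \<bar>d\<bar>"]] by linarith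
  moreover have "2 ^ nat \<bar>d\<bar> \<le> q ^ nat \<bar>d\<bar>" using assms(1) by (intro power_mono) auto
  moreover have "int n < 2 ^ n" for n by (rule of_nat_less_two_power)
  then have "int (nat \<bar>d\<bar>) < 2 ^ nat \<bar>d\<bar>" .
  ultimately show False by simp
qed

lemma mat_monoid_sel:
  "carrier (mat_monoid I) = mats I" "monoid.mult (mat_monoid I) = mat_mult I" "one (mat_monoid I) = mat_one I"
  by (simp_all add: mat_monoid_def)

lemma nat_pow_units_of: "x [^]\<^bsub>units_of M\<^esub> (n :: nat) = x [^]\<^bsub>M\<^esub> n"
  by (induction n) (auto simp: units_of_mult units_of_one)

section \<open>Retractions onto the vertex groups\<close>

context graph_prod
begin

text \<open>The universal property is applied to the identity of \<open>G v\<close> and to trivial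
  maps elsewhere. Of two adjacent vertices at most one is \<open>v\<close>, so the images
  commute.\<close>

lemma retraction_exists:
  assumes v: "v \<in> V"
  shows "\<exists>r. r \<in> hom GP (G v) \<and> (\<forall>u\<in>V. \<forall>g\<in>carrier (G u). r (incl u g) = (if u = v then g else \<one>\<^bsub>G v\<^esub>))"
proof -
  interpret Gv: group "G v" by (rule groups[OF v])
  let ?f = "\<lambda>u g. if u = v then g else \<one>\<^bsub>G v\<^esub>"
  have 1: "?f u \<in> hom (G u) (G v)" if "u \<in> V" for u
    by (rule homI) auto
  have 2: "?f u g \<otimes>\<^bsub>G v\<^esub> ?f w h = ?f w h \<otimes>\<^bsub>G v\<^esub> ?f u g"
    if "{u, w} \<in> E" "g \<in> carrier (G u)" "h \<in> carrier (G w)" for u w g h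
    using that by (cases "u = w") auto
  obtain r where "r \<in> hom GP (G v)"
    "\<And>u g. u \<in> V \<Longrightarrow> g \<in> carrier (G u) \<Longrightarrow> r (incl u g) = (if u = v then g else \<one>\<^bsub>G v\<^esub>)"
    using lift[OF Gv.is_group, of ?f] 1 2 by blast
  then show ?thesis by blast
qed

definition retr :: "'v \<Rightarrow> ('v \<times> 'a) list set set \<Rightarrow> 'a" where
  "retr v = (SOME r. r \<in> hom GP (G v) \<and>
     (\<forall>u\<in>V. \<forall>g\<in>carrier (G u). r (incl u g) = (if u = v then g else \<one>\<^bsub>G v\<^esub>)))"

lemma retr_spec:
  "v \<in> V \<Longrightarrow> retr v \<in> hom GP (G v) \<and>
     (\<forall>u\<in>V. \<forall>g\<in>carrier (G u). retr v (incl u g) = (if u = v then g else \<one>\<^bsub>G v\<^esub>))"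
  unfolding retr_def by (rule someI_ex[OF retraction_exists])

lemma retr_hom: "v \<in> V \<Longrightarrow> retr v \<in> hom GP (G v)"
  by (rule conjunct1[OF retr_spec])

lemma retr_incl: "v \<in> V \<Longrightarrow> u \<in> V \<Longrightarrow> g \<in> carrier (G u) \<Longrightarrow>
    retr v (incl u g) = (if u = v then g else \<one>\<^bsub>G v\<^esub>)"
  by (rule bspec[OF bspec[OF conjunct2[OF retr_spec]]])

lemma retr_group_hom: "v \<in> V \<Longrightarrow> group_hom GP (G v) (retr v)"
  by (simp add: group_hom_def group_hom_axioms_def GP.group_axioms groups retr_hom)

lemma retr_closed: "v \<in> V \<Longrightarrow> x \<in> carrier GP \<Longrightarrow> retr v x \<in> carrier (G v)"
  by (rule group_hom.hom_closed[OF retr_group_hom])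

lemma incl_inj:
  "v \<in> V \<Longrightarrow> g \<in> carrier (G v) \<Longrightarrow> h \<in> carrier (G v) \<Longrightarrow> incl v g = incl v h \<Longrightarrow> g = h"
  by (metis retr_incl)

end

section \<open>The integral representations and their reductions modulo powers of
  \<open>p\<close>\<close>

locale graph_rep = graph_prod V E G
  for V :: "'v set" and E :: "'v set set" and G :: "'v \<Rightarrow> ('a, 'b) monoid_scheme" +
  fixes p :: nat and N :: "'v \<Rightarrow> 'a set" and F :: "'v \<Rightarrow> 'a set \<Rightarrow> int"
  assumes prime_p: "Factorial_Ring.prime p" and finite_vertices: "finite V"
    and N: "v \<in> V \<Longrightarrow> p_normal p (N v) (G v)"
    and F_N: "v \<in> V \<Longrightarrow> F v (N v) = 0"
    and F_ge: "v \<in> V \<Longrightarrow> F v C \<ge> 0"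
begin

text \<open>Left translation on \<open>G v Mod N v\<close>, written with the product of right
  cosets.\<close>

definition acts :: "'v \<Rightarrow> 'a \<Rightarrow> 'a set \<Rightarrow> 'a set" where
  "acts v g C = (N v #>\<^bsub>G v\<^esub> g) <#>\<^bsub>G v\<^esub> C"

lemma normal_N: "v \<in> V \<Longrightarrow> N v \<lhd> G v"
  using N by (simp add: p_normal_def)

lemma acts_coset: "v \<in> V \<Longrightarrow> g \<in> carrier (G v) \<Longrightarrow> h \<in> carrier (G v) \<Longrightarrow>
    acts v g (N v #>\<^bsub>G v\<^esub> h) = N v #>\<^bsub>G v\<^esub> (g \<otimes>\<^bsub>G v\<^esub> h)"
  by (simp add: acts_def normal.rcos_sum[OF normal_N])

lemma N_coset: "v \<in> V \<Longrightarrow> N v = N v #>\<^bsub>G v\<^esub> \<one>\<^bsub>G v\<^esub>"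
  by (rule group.coset_mult_one[OF groups subgroup.subset[OF normal_imp_subgroup[OF normal_N]], symmetric])

lemma acts_base: "v \<in> V \<Longrightarrow> g \<in> carrier (G v) \<Longrightarrow> acts v g (N v) = N v #>\<^bsub>G v\<^esub> g"
  using acts_coset[of v g "\<one>\<^bsub>G v\<^esub>"] groups[of v]
  by (simp add: group.is_monoid monoid.one_closed monoid.r_one N_coset[symmetric])

sublocale trace_rep V E G "\<lambda>v. carrier (G v Mod N v)" acts N F
proof
  show "finite V" by (rule finite_vertices)
  show "finite (carrier (G v Mod N v))" if "v \<in> V" for v
    using N[OF that] by (simp add: p_normal_def finite_p_group_def)
  fix v assume v: "v \<in> V"
  interpret Gv: group "G v" by (rule groups[OF v])
  show "N v \<in> carrier (G v Mod N v)"
    using N_coset[OF v] by (auto simp: carrier_FactGroup)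
  show "F v (N v) = 0" "F v C \<ge> 0" for C using F_N F_ge v by auto
  fix C assume "C \<in> carrier (G v Mod N v)"
  then obtain c where c: "c \<in> carrier (G v)" "C = N v #>\<^bsub>G v\<^esub> c"
    unfolding carrier_FactGroup by blast
  show "acts v g C \<in> carrier (G v Mod N v)" if "g \<in> carrier (G v)" for g
    using acts_coset[OF v that c(1)] that c by (simp add: carrier_FactGroup)
  show "acts v \<one>\<^bsub>G v\<^esub> C = C" using acts_coset[OF v Gv.one_closed c(1)] c by simp
  show "acts v (g \<otimes>\<^bsub>G v\<^esub> h) C = acts v g (acts v h C)"
    if "g \<in> carrier (G v)" "h \<in> carrier (G v)" for g h
    using acts_coset[OF v] that c by (simp add: Gv.m_assoc)
qed

abbreviation MM where "MM \<equiv> mat_monoid idx"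

text \<open>This is \<open>lift\<close> fed with \<open>R_mult\<close> and \<open>R_commute\<close>.
  The target is the unit group of the matrix monoid because \<open>lift\<close> asks for a group;
  the matrix of the inverse letter is the inverse.\<close>

lemma representation_exists:
  "\<exists>\<theta>. \<theta> \<in> hom GP (units_of MM) \<and> (\<forall>v\<in>V. \<forall>g\<in>carrier (G v). \<theta> (incl v g) = R t (v, g))"
proof -
  interpret MM: Group.monoid MM by (rule monoid_mat_monoid) simp
  have mult: "x \<otimes>\<^bsub>units_of MM\<^esub> y = mat_mult idx x y" for x y
    by (simp add: units_of_mult mat_monoid_def)
  have unit: "R t (v, g) \<in> Units MM" if v: "v \<in> V" and g: "g \<in> carrier (G v)" for v g
  proof -
    interpret Gv: group "G v" by (rule groups[OF v])
    have "mat_mult idx (R t (v, g)) (R t (v, inv\<^bsub>G v\<^esub> g)) = mat_one idx"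
      "mat_mult idx (R t (v, inv\<^bsub>G v\<^esub> g)) (R t (v, g)) = mat_one idx"
      using R_mult[OF v, of g "inv\<^bsub>G v\<^esub> g"] R_mult[OF v, of "inv\<^bsub>G v\<^esub> g" g] R_one[OF v] g by simp_all
    then show ?thesis
      unfolding Units_def using R_mats by (auto simp: mat_monoid_def)
  qed
  have 1: "(\<lambda>g. R t (v, g)) \<in> hom (G v) (units_of MM)" if v: "v \<in> V" for v
  proof (rule homI)
    interpret Gv: group "G v" by (rule groups[OF v])
    show "R t (v, x) \<in> carrier (units_of MM)" if "x \<in> carrier (G v)" for x
      using unit[OF v that] by (simp add: units_of_carrier)
    show "R t (v, x \<otimes>\<^bsub>G v\<^esub> y) = R t (v, x) \<otimes>\<^bsub>units_of MM\<^esub> R t (v, y)"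
      if "x \<in> carrier (G v)" "y \<in> carrier (G v)" for x y
      using R_mult[OF v that] that by (simp add: mult)
  qed
  have 2: "R t (u, g) \<otimes>\<^bsub>units_of MM\<^esub> R t (v, h) = R t (v, h) \<otimes>\<^bsub>units_of MM\<^esub> R t (u, g)"
    if "{u, v} \<in> E" for u v g h
    using R_commute[OF that] by (simp add: mult)
  obtain \<theta> where "\<theta> \<in> hom GP (units_of MM)"
    "\<And>v g. v \<in> V \<Longrightarrow> g \<in> carrier (G v) \<Longrightarrow> \<theta> (incl v g) = R t (v, g)"
    using lift[OF MM.units_group, of "\<lambda>v g. R t (v, g)"] 1 2 by blast
  then show ?thesis by blast
qed

definition \<Theta> :: "int \<Rightarrow> ('v \<times> 'a) list set set \<Rightarrow> 'v \<times> 'a set \<Rightarrow> 'v \<times> 'a set \<Rightarrow> int" where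
  "\<Theta> t = (SOME \<theta>. \<theta> \<in> hom GP (units_of MM) \<and>
     (\<forall>v\<in>V. \<forall>g\<in>carrier (G v). \<theta> (incl v g) = R t (v, g)))"

lemma \<Theta>_spec:
  "\<Theta> t \<in> hom GP (units_of MM) \<and> (\<forall>v\<in>V. \<forall>g\<in>carrier (G v). \<Theta> t (incl v g) = R t (v, g))"
  unfolding \<Theta>_def by (rule someI_ex[OF representation_exists])

lemma \<Theta>_hom: "\<Theta> t \<in> hom GP (units_of MM)"
  by (rule conjunct1[OF \<Theta>_spec])

lemma \<Theta>_incl: "v \<in> V \<Longrightarrow> g \<in> carrier (G v) \<Longrightarrow> \<Theta> t (incl v g) = R t (v, g)"
  by (rule bspec[OF bspec[OF conjunct2[OF \<Theta>_spec]]])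

lemma \<Theta>_group_hom: "group_hom GP (units_of MM) (\<Theta> t)"
  by (intro group_hom.intro group_hom_axioms.intro GP.group_axioms \<Theta>_hom monoid.units_group
      monoid_mat_monoid finite_idx)

lemma \<Theta>_mats: "x \<in> carrier GP \<Longrightarrow> \<Theta> t x \<in> mats idx"
  using group_hom.hom_closed[OF \<Theta>_group_hom, of x t]
    monoid.Units_closed[OF monoid_mat_monoid[OF finite_idx], of "\<Theta> t x"]
  unfolding units_of_carrier mat_monoid_sel by blast

lemma \<Theta>_mult: "x \<in> carrier GP \<Longrightarrow> y \<in> carrier GP \<Longrightarrow> \<Theta> t (x \<otimes>\<^bsub>GP\<^esub> y) = mat_mult idx (\<Theta> t x) (\<Theta> t y)"
  by (simp only: group_hom.hom_mult[OF \<Theta>_group_hom] units_of_mult mat_monoid_sel)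

lemma \<Theta>_one: "\<Theta> t \<one>\<^bsub>GP\<^esub> = mat_one idx"
  by (simp only: group_hom.hom_one[OF \<Theta>_group_hom] units_of_one mat_monoid_sel)

lemma \<Theta>_pow: "x \<in> carrier GP \<Longrightarrow> \<Theta> t (x [^]\<^bsub>GP\<^esub> (n :: nat)) = \<Theta> t x [^]\<^bsub>MM\<^esub> n"
  by (simp only: group_hom.hom_nat_pow[OF \<Theta>_group_hom] nat_pow_units_of)

lemma \<Theta>_val: "w \<in> W \<Longrightarrow> \<Theta> t (val w) = prodR t w"
  by (induction w) (auto simp: \<Theta>_one \<Theta>_mult \<Theta>_incl)

lemma \<Theta>_trace_conj:
  assumes "g \<in> carrier GP" "x \<in> carrier GP"
  shows "mat_trace idx (\<Theta> t (g \<otimes>\<^bsub>GP\<^esub> x \<otimes>\<^bsub>GP\<^esub> inv\<^bsub>GP\<^esub> g)) = mat_trace idx (\<Theta> t x)"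
proof -
  have "mat_trace idx (\<Theta> t (g \<otimes>\<^bsub>GP\<^esub> x \<otimes>\<^bsub>GP\<^esub> inv\<^bsub>GP\<^esub> g)) = mat_trace idx (\<Theta> t (inv\<^bsub>GP\<^esub> g \<otimes>\<^bsub>GP\<^esub> (g \<otimes>\<^bsub>GP\<^esub> x)))"
    using assms \<Theta>_mult mat_trace_commute by simp
  then show ?thesis using assms by (simp add: GP.inv_mult_cancel)
qed

text \<open>On the block of each vertex the element acts through its retraction to that vertex. This
  is what remains of the representation at \<open>t = 0\<close>.\<close>

definition perm_mat :: "('v \<times> 'a) list \<Rightarrow> 'v \<times> 'a set \<Rightarrow> 'v \<times> 'a set \<Rightarrow> int" where
  "perm_mat w i j = of_bool (i \<in> idx \<and> j \<in> idx \<and> fst i = fst j \<and>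
     snd i = acts (fst j) (retr (fst j) (val w)) (snd j))"

text \<open>When \<open>p\<close> divides \<open>t\<close>, the rank one blocks vanish modulo
  \<open>p\<close> and only the permutation blocks are left.\<close>

lemma prodR_cong_perm_mat:
  assumes t: "int p dvd t" and w: "w \<in> W"
  shows "mat_cong idx (int p) (prodR t w) (perm_mat w)"
  using w
proof (induction w)
  case Nil
  have *: "acts (fst j) (retr (fst j) \<one>\<^bsub>GP\<^esub>) (snd j) = snd j" if "j \<in> idx" for j
    using that act_one[of "fst j" "snd j"] group_hom.hom_one[OF retr_group_hom] by (auto simp: idx_def)
  have "perm_mat [] i j = mat_one idx i j" for i j
  proof (cases "j \<in> idx")
    case True
    then show ?thesis using * by (auto simp: perm_mat_def mat_one_def prod_eq_iff)
  qed (simp add: perm_mat_def mat_one_def)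
  then have "perm_mat [] = mat_one idx" by blast
  then show ?case by (simp add: mat_cong_refl)
next
  case (Cons l w)
  obtain v g where l: "l = (v, g)" by (cases l)
  have v: "v \<in> V" and g: "g \<in> carrier (G v)" and w: "w \<in> W" using Cons.prems l by auto
  let ?R = "\<lambda>i j. of_bool (i \<in> idx \<and> j \<in> idx \<and> fst i = fst j \<and> snd i = acts (fst j) (retr (fst j) (incl v g)) (snd j)) :: int"
  have r1: "acts u (retr u (incl v g)) C = (if u = v then acts v g C else C)"
    if "u \<in> V" "C \<in> carrier (G u Mod N u)" for u C
    using that v g retr_incl act_one by simp
  have "int p dvd R t l i j - ?R i j" if ij: "i \<in> idx" "j \<in> idx" for i j
  proof -
    have j: "fst j \<in> V" "snd j \<in> carrier (G (fst j) Mod N (fst j))" using ij by (auto simp: idx_def)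
    show ?thesis
      using ij r1[OF j] t by (auto simp: R_def D_def l mat_one_def prod_eq_iff)
  qed
  then have c1: "mat_cong idx (int p) (R t l) ?R" by (simp add: mat_cong_def)
  have "mat_mult idx ?R (perm_mat w) i j = perm_mat (l # w) i j" if ij: "i \<in> idx" "j \<in> idx" for i j
  proof -
    let ?u = "fst j" let ?r = "retr ?u (val w)" let ?k = "(?u, acts ?u ?r (snd j))"
    have u: "?u \<in> V" and C: "snd j \<in> carrier (G ?u Mod N ?u)" using ij by (auto simp: idx_def)
    have rc: "?r \<in> carrier (G ?u)" "retr ?u (incl v g) \<in> carrier (G ?u)"
      using u v g w by (auto intro!: retr_closed)
    have k: "?k \<in> idx" using act_closed[OF u rc(1) C] u by (simp add: idx_def)
    have "perm_mat w k j = of_bool (k = ?k)" if "k \<in> idx" for k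
      using that ij by (cases k) (auto simp: perm_mat_def)
    then have "mat_mult idx ?R (perm_mat w) i j = (\<Sum>k\<in>idx. if k = ?k then ?R i ?k else 0)"
      unfolding mat_mult_def by (intro sum.cong) auto
    also have "\<dots> = ?R i ?k" using k by simp
    also have "\<dots> = perm_mat (l # w) i j"
      using ij k act_mult[OF u rc(2,1) C] group_hom.hom_mult[OF retr_group_hom[OF u], of "incl v g" "val w"] v g w
      by (simp add: perm_mat_def l)
    finally show ?thesis .
  qed
  then have c2: "mat_cong idx (int p) (mat_mult idx ?R (perm_mat w)) (perm_mat (l # w))"
    by (simp add: mat_cong_def)
  show ?case
    unfolding prodR.simps by (rule mat_cong_trans[OF mat_cong_mult[OF c1 Cons.IH[OF w]] c2])
qed

lemma \<Theta>_cong_one: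
  assumes t: "int p dvd t" and x: "x \<in> carrier GP" "\<And>v. v \<in> V \<Longrightarrow> retr v x \<in> N v"
  shows "mat_cong idx (int p) (\<Theta> t x) (mat_one idx)"
proof -
  obtain w where w: "w \<in> W" "x = val w" using x(1) carrier_GP by blast
  have "perm_mat w i j = mat_one idx i j" for i j
  proof (cases "j \<in> idx")
    case True
    then have j: "fst j \<in> V" "snd j \<in> carrier (G (fst j) Mod N (fst j))" by (auto simp: idx_def)
    obtain c where c: "fst j \<in> V" "c \<in> carrier (G (fst j))" "snd j = N (fst j) #>\<^bsub>G (fst j)\<^esub> c"
      using j unfolding carrier_FactGroup by blast
    let ?u = "fst j"
    interpret Gu: group "G ?u" by (rule groups[OF c(1)])
    interpret Nu: normal "N ?u" "G ?u" by (rule normal_N[OF c(1)])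
    have r: "retr ?u x \<in> N ?u" by (rule x(2)[OF c(1)])
    then have rc: "retr ?u x \<in> carrier (G ?u)" by (rule Nu.mem_carrier)
    have "acts ?u (retr ?u x) (snd j) = N ?u #>\<^bsub>G ?u\<^esub> (retr ?u x \<otimes>\<^bsub>G ?u\<^esub> c)"
      using acts_coset[OF c(1) rc c(2)] c(3) by simp
    also have "\<dots> = (N ?u #>\<^bsub>G ?u\<^esub> retr ?u x) #>\<^bsub>G ?u\<^esub> c"
      using Gu.coset_mult_assoc[OF Nu.subset rc c(2)] by simp
    also have "\<dots> = snd j" using Nu.rcos_eq_self_iff[OF rc] r c(3) by simp
    finally show ?thesis using True w by (auto simp: perm_mat_def mat_one_def prod_eq_iff)
  qed (simp add: perm_mat_def mat_one_def)
  then have "perm_mat w = mat_one idx" by blast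
  then show ?thesis using prodR_cong_perm_mat[OF t w(1)] \<Theta>_val[OF w(1)] w(2) by simp
qed

lemma common_exponent: "\<exists>n. \<forall>v\<in>V. \<forall>g\<in>carrier (G v). g [^]\<^bsub>G v\<^esub> (p ^ n :: nat) \<in> N v"
proof -
  have "\<exists>n. \<forall>g\<in>carrier (G v). g [^]\<^bsub>G v\<^esub> (p ^ n :: nat) \<in> N v" if "v \<in> V" for v
    using group.p_normalD(3)[OF groups[OF that] N[OF that]] .
  then obtain n where n: "\<And>v. v \<in> V \<Longrightarrow> \<forall>g\<in>carrier (G v). g [^]\<^bsub>G v\<^esub> (p ^ n v :: nat) \<in> N v"
    by metis
  show ?thesis
  proof (intro exI ballI)
    fix v g assume v: "v \<in> V" and g: "g \<in> carrier (G v)"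
    interpret Gv: group "G v" by (rule groups[OF v])
    have le: "n v \<le> sum n V" using member_le_sum[OF v, of n] finite_vertices by simp
    have "g [^]\<^bsub>G v\<^esub> (p ^ sum n V :: nat) = (g [^]\<^bsub>G v\<^esub> (p ^ n v :: nat)) [^]\<^bsub>G v\<^esub> (p ^ (sum n V - n v) :: nat)"
      using g le by (simp add: Gv.nat_pow_pow power_add[symmetric])
    then show "g [^]\<^bsub>G v\<^esub> (p ^ sum n V :: nat) \<in> N v"
      using n[OF v] g Gv.nat_pow_subgroup_closed[OF normal_imp_subgroup[OF normal_N[OF v]]] by simp
  qed
qed

text \<open>Modulo \<open>p\<close> the representation factors through the product of the finite
  \<open>p\<close>-groups \<open>G v Mod N v\<close>, so a common power \<open>p ^ n\<close> sends
  every element to a matrix congruent to one modulo \<open>p\<close>. From there each further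
  \<open>p\<close>-th power improves the congruence by a factor \<open>p\<close>, by
  \<open>mat_power_cong_one\<close>.\<close>

lemma \<Theta>_congruence_p_normal:
  assumes t: "int p dvd t"
  shows "p_normal p {x \<in> carrier GP. mat_cong idx (int p ^ k) (\<Theta> t x) (mat_one idx)} GP"
    (is "p_normal p ?K GP")
proof -
  let ?q = "int p ^ k"
  let ?c = "mat_cong idx ?q"
  have qpos: "?q > 0" using prime_p prime_gt_0_nat by simp
  have one: "?c (\<Theta> t \<one>\<^bsub>GP\<^esub>) (mat_one idx)" by (simp add: \<Theta>_one mat_cong_refl)
  have conj: "?c (\<Theta> t (g \<otimes>\<^bsub>GP\<^esub> x \<otimes>\<^bsub>GP\<^esub> inv\<^bsub>GP\<^esub> g)) (mat_one idx)"
    if "?c (\<Theta> t x) (mat_one idx)" "x \<in> carrier GP" "g \<in> carrier GP" for g x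
  proof -
    have "?c (mat_mult idx (mat_mult idx (\<Theta> t g) (\<Theta> t x)) (\<Theta> t (inv\<^bsub>GP\<^esub> g)))
        (mat_mult idx (mat_mult idx (\<Theta> t g) (mat_one idx)) (\<Theta> t (inv\<^bsub>GP\<^esub> g)))"
      using that by (intro mat_cong_mult mat_cong_refl)
    moreover have "mat_mult idx (mat_mult idx (\<Theta> t g) (mat_one idx)) (\<Theta> t (inv\<^bsub>GP\<^esub> g)) = mat_one idx"
      using that mat_one_right[OF finite_idx \<Theta>_mats] \<Theta>_mult[of g "inv\<^bsub>GP\<^esub> g" t] \<Theta>_one by simp
    ultimately show ?thesis using that by (simp add: \<Theta>_mult)
  qed
  have quot: "x \<otimes>\<^bsub>GP\<^esub> inv\<^bsub>GP\<^esub> y \<in> ?K"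
    if "?c (\<Theta> t x) (\<Theta> t y)" "x \<in> carrier GP" "y \<in> carrier GP" for x y
  proof -
    have "?c (mat_mult idx (\<Theta> t x) (\<Theta> t (inv\<^bsub>GP\<^esub> y))) (mat_mult idx (\<Theta> t y) (\<Theta> t (inv\<^bsub>GP\<^esub> y)))"
      using that by (intro mat_cong_mult mat_cong_refl)
    then show ?thesis using that \<Theta>_mult[of y "inv\<^bsub>GP\<^esub> y" t] \<Theta>_one by (simp add: \<Theta>_mult)
  qed
  have sub: "subgroup ?K GP"
  proof (rule GP.subgroupI)
    show "?K \<noteq> {}" using one by blast
    show "inv\<^bsub>GP\<^esub> x \<in> ?K" if "x \<in> ?K" for x
    proof -
      have "\<one>\<^bsub>GP\<^esub> \<otimes>\<^bsub>GP\<^esub> inv\<^bsub>GP\<^esub> x \<in> ?K"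
        using that by (intro quot) (auto simp: \<Theta>_one intro: mat_cong_sym)
      then show ?thesis using that by simp
    qed
    show "x \<otimes>\<^bsub>GP\<^esub> y \<in> ?K" if "x \<in> ?K" "y \<in> ?K" for x y
    proof -
      have "?c (mat_mult idx (\<Theta> t x) (\<Theta> t y)) (mat_mult idx (mat_one idx) (mat_one idx))"
        using that by (intro mat_cong_mult) auto
      then show ?thesis using that by (simp add: \<Theta>_mult mat_one_left mat_one_closed)
    qed
  qed auto
  have nor: "?K \<lhd> GP" unfolding GP.normal_inv_iff using sub conj by auto
  \<comment> \<open>The finite invariant that separates the cosets is the table of entries modulo
    \<open>p ^ k\<close>.\<close>
  show ?thesis
  proof (rule GP.p_normalI[OF prime_p nor, where \<kappa> = "\<lambda>x. \<lambda>i\<in>idx. \<lambda>j\<in>idx. \<Theta> t x i j mod ?q"])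
    have "(\<lambda>x. \<lambda>i\<in>idx. \<lambda>j\<in>idx. \<Theta> t x i j mod ?q) ` carrier GP \<subseteq> idx \<rightarrow>\<^sub>E (idx \<rightarrow>\<^sub>E {0..<?q})"
      using qpos by auto
    moreover have "finite (idx \<rightarrow>\<^sub>E (idx \<rightarrow>\<^sub>E {0..<?q}))"
      by (intro finite_PiE finite_idx) auto
    ultimately show "finite ((\<lambda>x. \<lambda>i\<in>idx. \<lambda>j\<in>idx. \<Theta> t x i j mod ?q) ` carrier GP)"
      by (rule finite_subset)
    show "x \<otimes>\<^bsub>GP\<^esub> inv\<^bsub>GP\<^esub> y \<in> ?K" if xy: "x \<in> carrier GP" "y \<in> carrier GP"
      "(\<lambda>i\<in>idx. \<lambda>j\<in>idx. \<Theta> t x i j mod ?q) = (\<lambda>i\<in>idx. \<lambda>j\<in>idx. \<Theta> t y i j mod ?q)" for x y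
    proof (rule quot[OF _ xy(1,2)])
      have "\<Theta> t x i j mod ?q = \<Theta> t y i j mod ?q" if "i \<in> idx" "j \<in> idx" for i j
        using fun_cong[OF fun_cong[OF xy(3), of i], of j] that by simp
      then show "?c (\<Theta> t x) (\<Theta> t y)" by (simp add: mat_cong_def mod_eq_dvd_iff)
    qed
    show "\<exists>m. x [^]\<^bsub>GP\<^esub> (p ^ m :: nat) \<in> ?K" if x: "x \<in> carrier GP" for x
    proof -
      obtain n where n: "\<forall>v\<in>V. \<forall>g\<in>carrier (G v). g [^]\<^bsub>G v\<^esub> (p ^ n :: nat) \<in> N v"
        using common_exponent by blast
      let ?y = "x [^]\<^bsub>GP\<^esub> (p ^ n :: nat)"
      have y: "?y \<in> carrier GP" using x by simp
      have "retr v ?y \<in> N v" if "v \<in> V" for v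
        using group_hom.hom_nat_pow[OF retr_group_hom[OF that] x] n that retr_closed[OF that x] by simp
      then have y1: "mat_cong idx (int p) (\<Theta> t ?y) (mat_one idx)" using \<Theta>_cong_one[OF t y] by blast
      have step: "mat_cong idx (int p ^ Suc j) (\<Theta> t (?y [^]\<^bsub>GP\<^esub> (p ^ j :: nat))) (mat_one idx)" for j
      proof (induction j)
        case 0
        then show ?case using y1 y by simp
      next
        case (Suc j)
        let ?z = "?y [^]\<^bsub>GP\<^esub> (p ^ j :: nat)"
        have z: "?z \<in> carrier GP" using y by simp
        have "mat_cong idx (int p ^ Suc (Suc j)) (\<Theta> t ?z [^]\<^bsub>MM\<^esub> nat (int p)) (mat_one idx)"
          using Suc by (intro mat_power_cong_one[OF finite_idx \<Theta>_mats[OF z]]) auto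
        moreover have "?y [^]\<^bsub>GP\<^esub> (p ^ Suc j :: nat) = ?z [^]\<^bsub>GP\<^esub> p"
          using y by (simp add: GP.nat_pow_pow mult.commute)
        ultimately show ?case using \<Theta>_pow[OF z] by simp
      qed
      have "mat_cong idx ?q (\<Theta> t (?y [^]\<^bsub>GP\<^esub> (p ^ k :: nat))) (mat_one idx)"
        using step[of k] unfolding mat_cong_def power_Suc by (meson dvd_mult_right)
      then have "?y [^]\<^bsub>GP\<^esub> (p ^ k :: nat) \<in> ?K" using y by simp
      moreover have "?y [^]\<^bsub>GP\<^esub> (p ^ k :: nat) = x [^]\<^bsub>GP\<^esub> (p ^ (n + k) :: nat)"
        using x by (simp add: GP.nat_pow_pow power_add)
      ultimately show ?thesis by metis
    qed
  qed
qed

text \<open>For every \<open>k\<close> the image of \<open>x\<close> acts modulo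
  \<open>p ^ k\<close> like a conjugate of \<open>x\<close>. So the two traces agree modulo all
  powers of \<open>p\<close>, and hence as integers.\<close>

lemma trace_approximately_inner:
  assumes \<phi>: "approximately_inner p GP \<phi>" and x: "x \<in> carrier GP" and t: "int p dvd t"
  shows "mat_trace idx (\<Theta> t (\<phi> x)) = mat_trace idx (\<Theta> t x)"
proof -
  have \<phi>x: "\<phi> x \<in> carrier GP" using \<phi> x autoD(1) by (auto simp: approximately_inner_def hom_def)
  have "int p ^ k dvd mat_trace idx (\<Theta> t (\<phi> x)) - mat_trace idx (\<Theta> t x)" for k
  proof -
    obtain g where g: "g \<in> carrier GP"
      "\<phi> x \<otimes>\<^bsub>GP\<^esub> inv\<^bsub>GP\<^esub> (g \<otimes>\<^bsub>GP\<^esub> x \<otimes>\<^bsub>GP\<^esub> inv\<^bsub>GP\<^esub> g)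
        \<in> {x \<in> carrier GP. mat_cong idx (int p ^ k) (\<Theta> t x) (mat_one idx)}"
      using \<phi> \<Theta>_congruence_p_normal[OF t, of k] x unfolding approximately_inner_def by blast
    let ?y = "g \<otimes>\<^bsub>GP\<^esub> x \<otimes>\<^bsub>GP\<^esub> inv\<^bsub>GP\<^esub> g"
    have y: "?y \<in> carrier GP" using g x by simp
    have "mat_cong idx (int p ^ k) (mat_mult idx (\<Theta> t (\<phi> x \<otimes>\<^bsub>GP\<^esub> inv\<^bsub>GP\<^esub> ?y)) (\<Theta> t ?y))
        (mat_mult idx (mat_one idx) (\<Theta> t ?y))"
      using g by (intro mat_cong_mult mat_cong_refl) blast
    moreover have "mat_mult idx (\<Theta> t (\<phi> x \<otimes>\<^bsub>GP\<^esub> inv\<^bsub>GP\<^esub> ?y)) (\<Theta> t ?y) = \<Theta> t (\<phi> x)"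
    proof -
      have "\<phi> x \<otimes>\<^bsub>GP\<^esub> inv\<^bsub>GP\<^esub> ?y \<otimes>\<^bsub>GP\<^esub> ?y = \<phi> x"
        using \<phi>x y by (simp only: GP.m_assoc GP.inv_closed GP.l_inv GP.r_one)
      then show ?thesis using \<Theta>_mult[of "\<phi> x \<otimes>\<^bsub>GP\<^esub> inv\<^bsub>GP\<^esub> ?y" ?y t] \<phi>x y by (simp only: GP.inv_closed GP.m_closed)
    qed
    ultimately have "mat_cong idx (int p ^ k) (\<Theta> t (\<phi> x)) (\<Theta> t ?y)"
      using mat_one_left[OF finite_idx \<Theta>_mats[OF y]] by simp
    then have "int p ^ k dvd mat_trace idx (\<Theta> t (\<phi> x)) - mat_trace idx (\<Theta> t ?y)"
      by (rule mat_cong_trace)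
    then show ?thesis unfolding \<Theta>_trace_conj[OF g(1) x] .
  qed
  moreover have "int p \<ge> 2" using prime_ge_2_nat[OF prime_p] by simp
  ultimately have "mat_trace idx (\<Theta> t (\<phi> x)) - mat_trace idx (\<Theta> t x) = 0"
    by (intro int_dvd_all_powers[of "int p"])
  then show ?thesis by simp
qed

text \<open>The two polynomials agree at every multiple of \<open>p\<close>, that is, at infinitely
  many integers.\<close>

lemma trace_poly_approximately_inner:
  assumes \<phi>: "approximately_inner p GP \<phi>" and w: "w \<in> W" "w' \<in> W"
    and g: "g \<in> carrier GP" "\<phi> (val w) = g \<otimes>\<^bsub>GP\<^esub> val w' \<otimes>\<^bsub>GP\<^esub> inv\<^bsub>GP\<^esub> g"
  shows "trace_poly w = trace_poly w'"
proof (rule ccontr)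
  assume "trace_poly w \<noteq> trace_poly w'"
  then have "finite {t. poly (trace_poly w - trace_poly w') t = 0}"
    by (intro poly_roots_finite) simp
  moreover have "range (\<lambda>j::nat. int p * int j) \<subseteq> {t. poly (trace_poly w - trace_poly w') t = 0}"
  proof
    fix t assume "t \<in> range (\<lambda>j::nat. int p * int j)"
    then have t: "int p dvd t" by auto
    have "mat_trace idx (\<Theta> t (val w)) = mat_trace idx (\<Theta> t (val w'))"
      using trace_approximately_inner[OF \<phi> val_closed[OF w(1)] t] g \<Theta>_trace_conj[OF g(1) val_closed[OF w(2)], of t]
      by simp
    then show "t \<in> {t. poly (trace_poly w - trace_poly w') t = 0}"
      using w by (simp add: poly_trace_poly \<Theta>_val)
  qed
  moreover have "infinite (range (\<lambda>j::nat. int p * int j))"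
    by (rule range_inj_infinite) (use prime_gt_0_nat[OF prime_p] in \<open>auto simp: inj_on_def\<close>)
  ultimately show False using finite_subset by blast
qed

end

section \<open>What approximately inner automorphisms do to lengths of closed walks\<close>

locale residual_graph_prod = graph_prod V E G
  for V :: "'v set" and E :: "'v set set" and G :: "'v \<Rightarrow> ('a, 'b) monoid_scheme" +
  fixes p :: nat
  assumes prime_p: "Factorial_Ring.prime p" and finite_vertices: "finite V"
    and residual: "v \<in> V \<Longrightarrow> residually_p_finite p (G v)"
begin

lemma choose_p_normal:
  assumes "\<And>v. v \<in> V \<Longrightarrow> finite (A v)" "\<And>v. v \<in> V \<Longrightarrow> A v \<subseteq> carrier (G v) - {\<one>\<^bsub>G v\<^esub>}"
  obtains N where "\<And>v. v \<in> V \<Longrightarrow> p_normal p (N v) (G v)" "\<And>v. v \<in> V \<Longrightarrow> N v \<inter> A v = {}"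
proof -
  have "\<exists>N. p_normal p N (G v) \<and> N \<inter> A v = {}" if "v \<in> V" for v
    by (rule group.residually_p_finite_avoid[OF groups[OF that] prime_p residual[OF that]
          assms(1)[OF that] assms(2)[OF that]])
  then have "\<exists>N. \<forall>v\<in>V. p_normal p (N v) (G v) \<and> N v \<inter> A v = {}"
    by (intro bchoice) simp
  then show ?thesis using that by blast
qed

text \<open>The polynomial of \<open>w\<close> has degree at most \<open>length w\<close>, whereas a
  longer proper subword would give the equal polynomial of \<open>w'\<close> a positive coefficient
  above that degree. The subgroups \<open>N v\<close> are chosen to avoid the letters of
  \<open>w'\<close>.\<close>

lemma approximately_inner_length:
  assumes \<phi>: "approximately_inner p GP \<phi>" and w: "w \<in> W" "w' \<in> W"
    and g: "g \<in> carrier GP" "\<phi> (val w) = g \<otimes>\<^bsub>GP\<^esub> val w' \<otimes>\<^bsub>GP\<^esub> inv\<^bsub>GP\<^esub> g"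
    and w': "cyclically_reduced w'" "\<And>v x. (v, x) \<in> set w' \<Longrightarrow> x \<noteq> \<one>\<^bsub>G v\<^esub>"
    and s: "subseq s w'" "proper s"
  shows "length s \<le> length w"
proof (rule ccontr)
  assume len: "\<not> length s \<le> length w"
  have inW: "v \<in> V \<and> x \<in> carrier (G v)" if "(v, x) \<in> set w'" for v x
    using w(2) that by (auto simp: free_words_def)
  define A where "A v = {x. (v, x) \<in> set w'}" for v
  have "A v \<subseteq> snd ` set w'" for v by (force simp: A_def)
  then have "finite (A v)" for v by (rule finite_subset) simp
  moreover have "A v \<subseteq> carrier (G v) - {\<one>\<^bsub>G v\<^esub>}" for v
    using inW w'(2) by (auto simp: A_def)
  ultimately obtain N where NN: "\<And>v. v \<in> V \<Longrightarrow> p_normal p (N v) (G v)" "\<And>v. v \<in> V \<Longrightarrow> N v \<inter> A v = {}"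
    using choose_p_normal[of A] by blast
  \<comment> \<open>The form is the indicator of the nontrivial cosets, so every letter of
    \<open>w'\<close> has weight one.\<close>
  interpret graph_rep V E G p N "\<lambda>v C. if C = N v then 0 else 1"
    by unfold_locales (simp_all add: prime_p finite_vertices NN(1))
  have "letter_weight l > 0" if l: "l \<in> set w'" for l
  proof -
    obtain v x where vx: "l = (v, x)" by (cases l)
    have v: "v \<in> V" and x: "x \<in> carrier (G v)" using inW l vx by auto
    interpret Nv: normal "N v" "G v" by (rule normal_N[OF v])
    have "x \<notin> N v" using NN(2)[OF v] l vx by (auto simp: A_def)
    then show ?thesis
      using Nv.rcos_eq_self_iff[OF x] acts_base[OF v x] by (simp add: letter_weight_def vx)
  qed
  moreover have "set w' \<subseteq> (SIGMA v:V. carrier (G v))" using inW by auto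
  ultimately obtain d where d: "d \<ge> length s" "Polynomial.coeff (trace_poly w') d > 0"
    using coeff_trace_poly_pos[OF _ w'(1) _ s] by blast
  moreover have "Polynomial.coeff (trace_poly w) d = 0"
    using len d(1) by (intro coeff_trace_poly_zero) simp
  ultimately show False using trace_poly_approximately_inner[OF \<phi> w g] by simp
qed

text \<open>The quadratic coefficient of a product of two letters with \<open>nc\<close> types is
  the product of their weights. With the indicator of the coset of \<open>x\<close> as the form at
  \<open>u\<close> it tests whether the first letter lies in that coset: it is one for the source
  and would be zero for the image.\<close>

lemma approximately_inner_pair:
  assumes \<phi>: "approximately_inner p GP \<phi>" and uv: "u \<in> V" "v \<in> V" "nc u v"
    and x: "x \<in> carrier (G u)" "x \<noteq> \<one>\<^bsub>G u\<^esub>" "x' \<in> carrier (G u)"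
    and y: "y \<in> carrier (G v)" "y \<noteq> \<one>\<^bsub>G v\<^esub>" "y' \<in> carrier (G v)"
    and eq: "\<phi> (incl u x \<otimes>\<^bsub>GP\<^esub> incl v y) = incl u x' \<otimes>\<^bsub>GP\<^esub> incl v y'"
  shows "x' = x"
proof (rule ccontr)
  assume ne: "x' \<noteq> x"
  interpret Gu: group "G u" by (rule groups[OF uv(1)])
  interpret Gv: group "G v" by (rule groups[OF uv(2)])
  have "u \<noteq> v" using uv(3) by auto
  have ne1: "x' \<otimes>\<^bsub>G u\<^esub> inv\<^bsub>G u\<^esub> x \<noteq> \<one>\<^bsub>G u\<^esub>"
  proof
    assume "x' \<otimes>\<^bsub>G u\<^esub> inv\<^bsub>G u\<^esub> x = \<one>\<^bsub>G u\<^esub>"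
    then have "x' \<otimes>\<^bsub>G u\<^esub> inv\<^bsub>G u\<^esub> x \<otimes>\<^bsub>G u\<^esub> x = x" using x by simp
    then show False using ne x by (simp add: Gu.m_assoc)
  qed
  \<comment> \<open>\<open>N u\<close> has to avoid \<open>x\<close>, so that the indicator of its
    coset vanishes at the base point, and also the quotient of \<open>x'\<close> by
    \<open>x\<close>, so that the two cosets differ.\<close>
  define A where "A t = (if t = u then {x, x' \<otimes>\<^bsub>G u\<^esub> inv\<^bsub>G u\<^esub> x} else if t = v then {y} else {})" for t
  have finA: "finite (A t)" for t by (simp add: A_def)
  have subA: "A t \<subseteq> carrier (G t) - {\<one>\<^bsub>G t\<^esub>}" for t
    using x y ne1 by (auto simp: A_def)
  obtain N where NN: "\<And>t. t \<in> V \<Longrightarrow> p_normal p (N t) (G t)" "\<And>t. t \<in> V \<Longrightarrow> N t \<inter> A t = {}"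
    by (rule choose_p_normal[of A, OF finA subA]) blast
  have Nu: "N u \<lhd> G u" and Nv: "N v \<lhd> G v" using NN(1) uv by (auto simp: p_normal_def)
  interpret Nu: normal "N u" "G u" by (rule Nu)
  interpret Nv: normal "N v" "G v" by (rule Nv)
  have xN: "N u #>\<^bsub>G u\<^esub> x \<noteq> N u" using NN(2)[OF uv(1)] Nu.rcos_eq_self_iff[OF x(1)] by (auto simp: A_def)
  have yN: "N v #>\<^bsub>G v\<^esub> y \<noteq> N v"
    using NN(2)[OF uv(2)] Nv.rcos_eq_self_iff[OF y(1)] \<open>u \<noteq> v\<close> by (auto simp: A_def)
  have x'N: "N u #>\<^bsub>G u\<^esub> x' \<noteq> N u #>\<^bsub>G u\<^esub> x"
    using NN(2)[OF uv(1)] Nu.rcos_eq_iff[OF x(3) x(1)] by (auto simp: A_def)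
  define F :: "'v \<Rightarrow> 'a set \<Rightarrow> int"
    where "F t C = (if t = u then of_bool (C = N u #>\<^bsub>G u\<^esub> x) else if C = N t then 0 else 1)" for t C
  interpret graph_rep V E G p N F
    using xN by unfold_locales (simp_all add: prime_p finite_vertices NN(1) F_def)
  let ?w = "[(u, x), (v, y)]" and ?w' = "[(u, x'), (v, y')]"
  have W: "?w \<in> W" "?w' \<in> W" using uv x y by auto
  have "\<phi> (val ?w) = \<one>\<^bsub>GP\<^esub> \<otimes>\<^bsub>GP\<^esub> val ?w' \<otimes>\<^bsub>GP\<^esub> inv\<^bsub>GP\<^esub> \<one>\<^bsub>GP\<^esub>"
    using eq uv x y by simp
  then have "trace_poly ?w = trace_poly ?w'"
    by (rule trace_poly_approximately_inner[OF \<phi> W GP.one_closed])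
  moreover have "Polynomial.coeff (trace_poly ?w) (length ?w) = 1"
    using coeff_trace_poly_length[of ?w] uv x y nc_sym[OF uv(3)] yN \<open>u \<noteq> v\<close>
    by (simp add: proper_def cyc_def letter_weight_def acts_base F_def)
  moreover have "Polynomial.coeff (trace_poly ?w') (length ?w') = 0"
    using coeff_trace_poly_length[of ?w'] uv x y nc_sym[OF uv(3)] x'N
    by (simp add: proper_def cyc_def letter_weight_def acts_base F_def)
  ultimately show False by simp
qed

end

lemma (in group) approximately_inner_conj:
  assumes \<phi>: "approximately_inner p G \<phi>" and g: "g \<in> carrier G"
  shows "approximately_inner p G (\<lambda>x\<in>carrier G. inv g \<otimes> \<phi> x \<otimes> g)"
proof -
  have \<phi>a: "\<phi> \<in> auto G" using \<phi> unfolding approximately_inner_def by blast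
  note a = autoD[OF \<phi>a]
  have c: "\<phi> x \<in> carrier G" if "x \<in> carrier G" for x using a(1) that by (auto simp: hom_def)
  have "compose (carrier G) (\<lambda>x\<in>carrier G. inv g \<otimes> x \<otimes> inv (inv g)) \<phi> \<in> auto G"
  proof (rule autoI)
    let ?i = "\<lambda>x\<in>carrier G. inv g \<otimes> x \<otimes> inv (inv g)"
    have i: "?i \<in> auto G" by (rule inner_in_auto) (simp add: g)
    show "compose (carrier G) ?i \<phi> \<in> hom G G"
      using group.hom_compose[OF is_group a(1) autoD(1)[OF i]] .
    show "bij_betw (compose (carrier G) ?i \<phi>) (carrier G) (carrier G)"
      using bij_betw_compose[OF a(2) autoD(2)[OF i]] .
  qed (simp add: compose_def)
  moreover have "compose (carrier G) (\<lambda>x\<in>carrier G. inv g \<otimes> x \<otimes> inv (inv g)) \<phi>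
      = (\<lambda>x\<in>carrier G. inv g \<otimes> \<phi> x \<otimes> g)"
    using g c by (auto simp: compose_def)
  ultimately have au: "(\<lambda>x\<in>carrier G. inv g \<otimes> \<phi> x \<otimes> g) \<in> auto G" by simp
  show ?thesis
    unfolding approximately_inner_def
  proof (intro conjI allI impI au)
    fix N assume N: "p_normal p N G"
    then obtain k where k: "k \<in> carrier G" "\<forall>x\<in>carrier G. \<phi> x \<otimes> inv (k \<otimes> x \<otimes> inv k) \<in> N"
      using \<phi> unfolding approximately_inner_def by blast
    interpret N: normal N G using p_normalD(1)[OF N] .
    show "\<exists>h\<in>carrier G. \<forall>x\<in>carrier G. (\<lambda>x\<in>carrier G. inv g \<otimes> \<phi> x \<otimes> g) x \<otimes> inv (h \<otimes> x \<otimes> inv h) \<in> N"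
    proof (intro bexI ballI)
      fix x assume x: "x \<in> carrier G"
      have "inv g \<otimes> (\<phi> x \<otimes> inv (k \<otimes> x \<otimes> inv k)) \<otimes> g \<in> N"
        using N.inv_op_closed1[OF g bspec[OF k(2) x]] .
      moreover have "inv g \<otimes> (\<phi> x \<otimes> inv (k \<otimes> x \<otimes> inv k)) \<otimes> g
          = (inv g \<otimes> \<phi> x \<otimes> g) \<otimes> inv ((inv g \<otimes> k) \<otimes> x \<otimes> inv (inv g \<otimes> k))"
        using g k(1) x c[OF x] by (simp add: inv_mult_group m_assoc mult_inv_cancel)
      ultimately show "(\<lambda>x\<in>carrier G. inv g \<otimes> \<phi> x \<otimes> g) x \<otimes> inv ((inv g \<otimes> k) \<otimes> x \<otimes> inv (inv g \<otimes> k)) \<in> N"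
        using x by simp
    qed (use g k in simp)
  qed
qed

text \<open>If \<open>\<phi>\<close> is conjugation by \<open>k\<close> modulo \<open>N\<close>,
  then \<open>\<psi>\<close> is conjugation by \<open>inv k\<close>: substitute
  \<open>\<psi> x\<close> into the relation for \<open>\<phi>\<close> and conjugate back.\<close>

lemma (in group) approximately_inner_inverse:
  assumes \<phi>: "approximately_inner p G \<phi>" and \<psi>: "\<psi> \<in> auto G" "\<And>x. x \<in> carrier G \<Longrightarrow> \<phi> (\<psi> x) = x"
  shows "approximately_inner p G \<psi>"
  unfolding approximately_inner_def
proof (intro conjI allI impI \<psi>(1))
  fix N assume N: "p_normal p N G"
  then obtain k where k: "k \<in> carrier G" "\<forall>x\<in>carrier G. \<phi> x \<otimes> inv (k \<otimes> x \<otimes> inv k) \<in> N"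
    using \<phi> unfolding approximately_inner_def by blast
  interpret N: normal N G using p_normalD(1)[OF N] .
  show "\<exists>h\<in>carrier G. \<forall>x\<in>carrier G. \<psi> x \<otimes> inv (h \<otimes> x \<otimes> inv h) \<in> N"
  proof (intro bexI ballI)
    fix x assume x: "x \<in> carrier G"
    have c: "\<psi> x \<in> carrier G" using autoD(1)[OF \<psi>(1)] x by (auto simp: hom_def)
    have "x \<otimes> inv (k \<otimes> \<psi> x \<otimes> inv k) \<in> N" using bspec[OF k(2) c] \<psi>(2)[OF x] by simp
    then have "inv k \<otimes> inv (x \<otimes> inv (k \<otimes> \<psi> x \<otimes> inv k)) \<otimes> k \<in> N"
      using N.inv_op_closed1[OF k(1)] N.m_inv_closed by blast
    moreover have "inv k \<otimes> inv (x \<otimes> inv (k \<otimes> \<psi> x \<otimes> inv k)) \<otimes> k = \<psi> x \<otimes> inv (inv k \<otimes> x \<otimes> inv (inv k))"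
      using k(1) x c by (simp add: inv_mult_group m_assoc inv_mult_cancel)
    ultimately show "\<psi> x \<otimes> inv (inv k \<otimes> x \<otimes> inv (inv k)) \<in> N" by simp
  qed (use k in simp)
qed

lemma (in group) approximately_inner_hom:
  assumes "approximately_inner p G \<phi>"
  shows "\<phi> \<in> hom G G" "\<And>x. x \<in> carrier G \<Longrightarrow> \<phi> x \<in> carrier G"
    "\<And>x y. x \<in> carrier G \<Longrightarrow> y \<in> carrier G \<Longrightarrow> \<phi> (x \<otimes> y) = \<phi> x \<otimes> \<phi> y" "\<phi> \<one> = \<one>"
    "\<And>x y. x \<in> carrier G \<Longrightarrow> y \<in> carrier G \<Longrightarrow> \<phi> x = \<phi> y \<Longrightarrow> x = y"
proof -
  have \<phi>a: "\<phi> \<in> auto G" using assms unfolding approximately_inner_def by blast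
  show h: "\<phi> \<in> hom G G" by (rule autoD(1)[OF \<phi>a])
  show "\<And>x. x \<in> carrier G \<Longrightarrow> \<phi> x \<in> carrier G"
    "\<And>x y. x \<in> carrier G \<Longrightarrow> y \<in> carrier G \<Longrightarrow> \<phi> (x \<otimes> y) = \<phi> x \<otimes> \<phi> y"
    using h by (auto simp: hom_def)
  show "\<phi> \<one> = \<one>" by (rule hom_one[OF h is_group is_group])
  show "\<And>x y. x \<in> carrier G \<Longrightarrow> y \<in> carrier G \<Longrightarrow> \<phi> x = \<phi> y \<Longrightarrow> x = y"
    using autoD(2)[OF \<phi>a] by (auto simp: bij_betw_def inj_on_def)
qed

lemma (in group) conj_cancel:
  assumes "g \<in> carrier G" "x \<in> carrier G" "y \<in> carrier G"
  shows "x = g \<otimes> y \<otimes> inv g \<longleftrightarrow> inv g \<otimes> x \<otimes> g = y"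
proof
  assume "x = g \<otimes> y \<otimes> inv g"
  then show "inv g \<otimes> x \<otimes> g = y" using assms by (simp add: m_assoc inv_mult_cancel)
next
  assume "inv g \<otimes> x \<otimes> g = y"
  then show "x = g \<otimes> y \<otimes> inv g" using assms by (auto simp: m_assoc mult_inv_cancel)
qed

lemma subseq_rev: "subseq xs ys \<Longrightarrow> subseq (rev xs) (rev ys)"
proof (induction rule: list_emb.induct)
  case (list_emb_Cons xs ys y)
  then show ?case by (simp add: subseq_rev_drop_many)
next
  case (list_emb_Cons2 x y xs ys)
  then show ?case by (auto intro: list_emb_append_mono)
qed simp

lemma subseq_pair:
  assumes "a \<in> set w" "b \<in> set w" "a \<noteq> b"
  shows "subseq [a, b] w \<or> subseq [b, a] w"
proof -
  obtain w1 w2 where w: "w = w1 @ a # w2" using assms(1) by (auto simp: in_set_conv_decomp)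
  then have "b \<in> set w1 \<or> b \<in> set w2" using assms by auto
  then show ?thesis
  proof
    assume "b \<in> set w1"
    then have "subseq ([b] @ [a]) (w1 @ a # w2)"
      by (intro list_emb_append_mono) (auto simp: subseq_singleton_left)
    then show ?thesis using w by simp
  next
    assume "b \<in> set w2"
    then have "subseq ([] @ [a] @ [b]) (w1 @ [a] @ w2)"
      by (intro list_emb_append_mono) (auto simp: subseq_singleton_left)
    then show ?thesis using w by simp
  qed
qed

section \<open>Type patterns of conjugated words\<close>

context simplicial
begin

text \<open>Positions instead of splittings allow the mirror symmetry of a word to be used by
  reflecting indices.\<close>

lemma cyclically_reduced_indexI:
  assumes "\<And>i j. i < j \<Longrightarrow> j < length w \<Longrightarrow> fst (w ! i) = fst (w ! j) \<Longrightarrow>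
      (\<exists>k. i < k \<and> k < j \<and> nc (fst (w ! k)) (fst (w ! i))) \<and>
      (\<exists>k<length w. (k < i \<or> j < k) \<and> nc (fst (w ! k)) (fst (w ! i)))"
  shows "cyclically_reduced w"
  unfolding cyclically_reduced_def
proof (intro allI impI)
  fix W1 a W2 b W3 assume w: "w = W1 @ a # W2 @ b # W3" and ab: "fst a = fst b"
  let ?i = "length W1" and ?j = "length W1 + 1 + length W2"
  have i: "w ! ?i = a" and j: "w ! ?j = b" by (simp_all add: w nth_append)
  obtain k where k: "?i < k" "k < ?j" "nc (fst (w ! k)) (fst a)"
    using assms[of ?i ?j] ab i j by (auto simp: w)
  obtain l where l: "l < length w" "l < ?i \<or> ?j < l" "nc (fst (w ! l)) (fst a)"
    using assms[of ?i ?j] ab i j by (auto simp: w)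
  have "w ! k \<in> set W2"
    using k(1,2) by (auto simp: w nth_append nth_Cons' intro!: nth_mem)
  moreover have "w ! l \<in> set W1 \<union> set W3"
    using l(1,2) by (auto simp: w nth_append nth_Cons' intro!: nth_mem)
  ultimately show "(\<exists>m\<in>set W2. nc (fst m) (fst a)) \<and> (\<exists>m\<in>set W1 \<union> set W3. nc (fst m) (fst a))"
    using k(3) l(3) by blast
qed

text \<open>The conditions on \<open>h\<close> say that it is reduced, that no letter of type in the star of
  \<open>w\<close> can be moved to its right end, and that no letter whose type is in the star of every
  element of \<open>S\<close> can be moved to its left end.\<close>

definition trimmed :: "'v set \<Rightarrow> 'v \<Rightarrow> ('v \<times> 'a) list \<Rightarrow> bool" where
  "trimmed S w h \<longleftrightarrow>
    (\<forall>W1 a W2 b W3. h = W1 @ a # W2 @ b # W3 \<longrightarrow> fst a = fst b \<longrightarrow> (\<exists>m\<in>set W2. nc (fst m) (fst a))) \<and>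
    (\<forall>W1 c W2. h = W1 @ c # W2 \<longrightarrow> \<not> nc (fst c) w \<longrightarrow> (\<exists>m\<in>set W2. nc (fst m) (fst c))) \<and>
    (\<forall>W1 c W2. h = W1 @ c # W2 \<longrightarrow> (\<forall>a\<in>S. \<not> nc (fst c) a) \<longrightarrow> (\<exists>m\<in>set W1. nc (fst m) (fst c)))"

lemma trimmed_index:
  assumes "trimmed S w h"
  shows "\<And>i j. i < j \<Longrightarrow> j < length h \<Longrightarrow> fst (h ! i) = fst (h ! j) \<Longrightarrow>
      \<exists>k. i < k \<and> k < j \<and> nc (fst (h ! k)) (fst (h ! i))"
    and "\<And>i. i < length h \<Longrightarrow> \<not> nc (fst (h ! i)) w \<Longrightarrow>
      \<exists>k. i < k \<and> k < length h \<and> nc (fst (h ! k)) (fst (h ! i))"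
    and "\<And>i. i < length h \<Longrightarrow> \<forall>a\<in>S. \<not> nc (fst (h ! i)) a \<Longrightarrow>
      \<exists>k. k < i \<and> nc (fst (h ! k)) (fst (h ! i))"
proof -
  fix i j assume ij: "i < j" "j < length h" and eq: "fst (h ! i) = fst (h ! j)"
  have "h = take i h @ h ! i # drop (Suc i) h" using ij by (intro id_take_nth_drop) simp
  moreover have "drop (Suc i) h = take (j - Suc i) (drop (Suc i) h) @ h ! j # drop (Suc (j - Suc i)) (drop (Suc i) h)"
    using id_take_nth_drop[of "j - Suc i" "drop (Suc i) h"] ij by simp
  ultimately have "h = take i h @ h ! i # take (j - Suc i) (drop (Suc i) h) @ h ! j # drop (Suc (j - Suc i)) (drop (Suc i) h)"
    by metis
  then obtain m where m: "m \<in> set (take (j - Suc i) (drop (Suc i) h))" "nc (fst m) (fst (h ! i))"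
    using assms eq unfolding trimmed_def by metis
  then obtain t where "t < j - Suc i" "m = h ! (Suc i + t)"
    using ij by (auto simp: in_set_conv_nth)
  then show "\<exists>k. i < k \<and> k < j \<and> nc (fst (h ! k)) (fst (h ! i))"
    using m ij by (intro exI[of _ "Suc i + t"]) auto
next
  fix i assume i: "i < length h" and n: "\<not> nc (fst (h ! i)) w"
  obtain m where m: "m \<in> set (drop (Suc i) h)" "nc (fst m) (fst (h ! i))"
    using assms n id_take_nth_drop[OF i] unfolding trimmed_def by metis
  then obtain t where "t < length h - Suc i" "m = h ! (Suc i + t)"
    using i by (auto simp: in_set_conv_nth)
  then show "\<exists>k. i < k \<and> k < length h \<and> nc (fst (h ! k)) (fst (h ! i))"
    using m by (intro exI[of _ "Suc i + t"]) auto
next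
  fix i assume i: "i < length h" and n: "\<forall>a\<in>S. \<not> nc (fst (h ! i)) a"
  obtain m where m: "m \<in> set (take i h)" "nc (fst m) (fst (h ! i))"
    using assms n id_take_nth_drop[OF i] unfolding trimmed_def by metis
  then obtain t where "t < i" "m = h ! t"
    using i by (auto simp: in_set_conv_nth)
  then show "\<exists>k. k < i \<and> nc (fst (h ! k)) (fst (h ! i))"
    using m by auto
qed

text \<open>The types of \<open>h @ z # h'\<close> are symmetric about \<open>z\<close>, which
  reduces letters of \<open>h'\<close> to letters of \<open>h\<close>. Inside \<open>h\<close>,
  equal types are separated because \<open>h\<close> is reduced; across \<open>z\<close> they are
  separated by \<open>z\<close> or by a letter that keeps them from reaching it; around the ends the
  blocker is a letter of the walk or comes from the third condition of
  \<open>trimmed\<close>.\<close>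

lemma cyclically_reduced_conjugate_word:
  assumes vs: "successively nc (map fst s)" "s \<noteq> []" "fst (hd s) = a" "fst (last s) = a" "fst ` set s = S"
    and h: "trimmed S (fst z) h" "h \<noteq> []" "nc (fst (hd h)) a"
    and h': "map fst h' = rev (map fst h)"
  shows "cyclically_reduced (s @ h @ z # h')"
proof (rule cyclically_reduced_indexI)
  let ?u = "s @ h @ z # h'"
  \<comment> \<open>The walk \<open>s\<close> occupies the positions below \<open>n\<close>,
    \<open>h\<close> those from \<open>n\<close> on, \<open>z\<close> the position
    \<open>n + m\<close>, and \<open>h'\<close> the rest. Reflection at \<open>z\<close> sends
    \<open>k\<close> to \<open>2 * (n + m) - k\<close>.\<close>
  define n m where "n = length s" and "m = length h"
  define U where "U i = fst (?u ! i)" for i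
  note T = trimmed_index[OF h(1)]
  have m0: "m > 0" and n0: "n > 0" using h(2) vs(2) by (auto simp: m_def n_def)
  have m': "length h' = m" using arg_cong[OF h', of length] by (simp add: m_def)
  have len: "length ?u = n + 2 * m + 1" using m' by (simp add: n_def m_def)
  have Us: "U i = fst (s ! i)" if "i < n" for i using that by (simp add: U_def nth_append n_def)
  have Uh: "U (n + i) = fst (h ! i)" if "i < m" for i
    using that by (simp add: U_def nth_append n_def m_def)
  have Uz: "U (n + m) = fst z" by (simp add: U_def nth_append n_def m_def)
  have Uh': "U (n + m + 1 + t) = fst (h ! (m - 1 - t))" if "t < m" for t
  proof -
    have "U (n + m + 1 + t) = map fst h' ! t" using that m' by (simp add: U_def nth_append n_def m_def)
    also have "\<dots> = fst (h ! (m - 1 - t))"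
      unfolding h' using that by (simp add: rev_nth m_def)
    finally show ?thesis .
  qed
  have mirror: "U (2 * (n + m) - k) = U k" if "n \<le> k" "k < n + m" for k
  proof -
    have "2 * (n + m) - k = n + m + 1 + (n + m - k - 1)" using that by simp
    then have "U (2 * (n + m) - k) = fst (h ! (m - 1 - (n + m - k - 1)))"
      using Uh'[of "n + m - k - 1"] that by simp
    also have "m - 1 - (n + m - k - 1) = k - n" using that by simp
    finally show ?thesis using Uh[of "k - n"] that by simp
  qed
  have step: "nc (U i) (U (Suc i))" "nc (U (Suc i)) (U i)" if "Suc i < n" for i
  proof -
    show "nc (U i) (U (Suc i))"
      using vs(1) that Us[of i] Us[of "Suc i"] by (auto simp: successively_conv_nth n_def)
    then show "nc (U (Suc i)) (U i)" by (rule nc_sym)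
  qed
  have U0: "U 0 = a" using Us[of 0] n0 vs(2,3) by (simp add: hd_conv_nth)
  have Ul: "U (n - 1) = a" using Us[of "n - 1"] n0 vs(2,4) by (simp add: last_conv_nth n_def)
  have Un: "nc (U n) a" using Uh[of 0] m0 h(2,3) by (simp add: hd_conv_nth)
  \<comment> \<open>The word ends with the type of \<open>hd h\<close>, which separates the first
    letter of the walk from the other occurrences of \<open>a\<close> around the end.\<close>
  have Ue: "U (n + 2 * m) = U n" using mirror[of n] m0 by (simp add: mult_2)
  have H1: "\<exists>k. i < k \<and> k < j \<and> nc (U k) (U i)" if ij: "n \<le> i" "i < j" "j < n + m" "U i = U j" for i j
  proof -
    have "fst (h ! (i - n)) = fst (h ! (j - n))" using Uh[of "i - n"] Uh[of "j - n"] ij by simp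
    moreover have "i - n < j - n" "j - n < length h" using ij by (auto simp: m_def)
    ultimately obtain k where k: "i - n < k" "k < j - n" "nc (fst (h ! k)) (fst (h ! (i - n)))"
      using T(1) by blast
    then show ?thesis using Uh[of k] Uh[of "i - n"] ij by (intro exI[of _ "n + k"]) auto
  qed
  \<comment> \<open>A letter in the star of \<open>z\<close> cannot move to the right end of
    \<open>h\<close>, so its blocker lies before \<open>z\<close>.\<close>
  have H2: "\<exists>k. i < k \<and> k < n + m \<and> nc (U k) (U i)" if i: "n \<le> i" "i < n + m" "\<not> nc (U i) (fst z)" for i
  proof -
    have "i - n < length h" "i - n < m" using i by (auto simp: m_def)
    moreover from this have "\<not> nc (fst (h ! (i - n))) (fst z)" using Uh[of "i - n"] i by simp
    ultimately obtain k where k: "i - n < k" "k < m" "nc (fst (h ! k)) (fst (h ! (i - n)))"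
      using T(2) unfolding m_def by blast
    then show ?thesis using Uh[of k] Uh[of "i - n"] i by (intro exI[of _ "n + k"]) auto
  qed
  \<comment> \<open>Either the walk, whose types are all of \<open>S\<close>, contains a blocker, or
    \<open>trimmed\<close> provides one further left in \<open>h\<close>.\<close>
  have H3: "\<exists>k<i. nc (U k) (U i)" if i: "n \<le> i" "i < n + m" for i
  proof (cases "\<forall>a\<in>S. \<not> nc (U i) a")
    case True
    have "i - n < length h" "i - n < m" using i by (auto simp: m_def)
    moreover from this have "\<forall>a\<in>S. \<not> nc (fst (h ! (i - n))) a" using Uh[of "i - n"] i True by simp
    ultimately obtain k where k: "k < i - n" "nc (fst (h ! k)) (fst (h ! (i - n)))"
      using T(3) by blast
    then show ?thesis using Uh[of k] Uh[of "i - n"] i by (intro exI[of _ "n + k"]) auto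
  next
    case False
    then obtain b where "b \<in> set s" "nc (U i) (fst b)" using vs(5) by auto
    then obtain k where "k < n" "nc (U i) (U k)" using Us by (auto simp: in_set_conv_nth n_def)
    then show ?thesis using i nc_sym by (intro exI[of _ k]) auto
  qed
  fix i j assume ij: "i < j" "j < length ?u" and eq: "fst (?u ! i) = fst (?u ! j)"
  have eqU: "U i = U j" using eq by (simp add: U_def)
  have inner: "\<exists>k. i < k \<and> k < j \<and> nc (U k) (U i)"
  proof (cases "i < n")
    case True
    show ?thesis
    proof (cases "Suc i < n")
      case True
      then have "j \<noteq> Suc i" using step[of i] eqU by auto
      then show ?thesis using step(2)[OF True] ij by (intro exI[of _ "Suc i"]) auto
    next
      case False
      then have i: "i = n - 1" using True by simp
      then have "U i = a" using Ul by simp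
      moreover have "j \<noteq> n" using Un eqU \<open>U i = a\<close> by auto
      ultimately show ?thesis using Un ij i n0 by (intro exI[of _ n]) auto
    qed
  next
    case ni: False
    show ?thesis
    proof (cases "j < n + m")
      case True
      then show ?thesis using H1[of i j] ij eqU ni by auto
    next
      case False
      show ?thesis
      proof (cases "i < n + m")
        case True
        show ?thesis
        proof (cases "nc (U i) (fst z)")
          case nz: True
          then have "j \<noteq> n + m" using eqU Uz by auto
          then show ?thesis using nz False True Uz nc_sym by (intro exI[of _ "n + m"]) auto
        next
          case False
          then obtain k where "i < k" "k < n + m" "nc (U k) (U i)" using H2[of i] ni True by auto
          then show ?thesis using \<open>\<not> j < n + m\<close> by (intro exI[of _ k]) auto
        qed
      next
        \<comment> \<open>Both positions are at or beyond \<open>z\<close>; a blocker is found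
          between their mirror images and reflected back.\<close>
        case i2: False
        let ?j = "2 * (n + m) - j"
        have j': "n \<le> ?j" "?j < n + m" using ij len i2 by auto
        have Uj: "U ?j = U j" using mirror[of ?j] j' ij len i2 by auto
        have "\<exists>k. ?j < k \<and> k < 2 * (n + m) - i \<and> k < n + m \<and> nc (U k) (U i)"
        proof (cases "i = n + m")
          case True
          then have "\<not> nc (U ?j) (fst z)" using Uj eqU Uz by auto
          then show ?thesis using H2[of ?j] j' Uj eqU True by auto
        next
          case False
          let ?i = "2 * (n + m) - i"
          have i': "?j < ?i" "?i < n + m" using ij False i2 len by auto
          have Ui: "U ?i = U i" using mirror[of ?i] i' j' ij len i2 by auto
          have "\<exists>k. ?j < k \<and> k < ?i \<and> nc (U k) (U ?j)"
            using H1[of ?j ?i] i' j' Ui Uj eqU by auto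
          then show ?thesis using i' Uj eqU by auto
        qed
        then obtain k where k: "?j < k" "k < 2 * (n + m) - i" "k < n + m" "nc (U k) (U i)" by blast
        have "U (2 * (n + m) - k) = U k" using mirror[of k] k j' by auto
        then show ?thesis using k ij len by (intro exI[of _ "2 * (n + m) - k"]) auto
      qed
    qed
  qed
  have outer: "\<exists>k<length ?u. (k < i \<or> j < k) \<and> nc (U k) (U i)"
  proof (cases "i < n")
    case True
    show ?thesis
    proof (cases "i = 0")
      case False
      then have "nc (U (i - 1)) (U i)" using step(1)[of "i - 1"] True by simp
      then show ?thesis using False ij by (intro exI[of _ "i - 1"]) auto
    next
      case i0: True
      show ?thesis
      proof (cases "Suc j < n")
        case True
        then show ?thesis using step(2)[of j] eqU len by (intro exI[of _ "Suc j"]) auto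
      next
        case False
        have "U j = a" using U0 i0 eqU by simp
        then have "j \<noteq> n + 2 * m" using Ue Un by auto
        then have "j < n + 2 * m" using ij len by auto
        then show ?thesis using Ue Un U0 i0 len by (intro exI[of _ "n + 2 * m"]) auto
      qed
    qed
  next
    case ni: False
    show ?thesis
    proof (cases "i < n + m")
      case im: True
      then obtain k where "k < i" "nc (U k) (U i)" using H3[of i] ni by auto
      then show ?thesis using ij by (intro exI[of _ k]) auto
    next
      \<comment> \<open>The mirror image of \<open>j\<close> lies in \<open>h\<close>, and a blocker
        to its left is also to the left of \<open>i\<close>.\<close>
      case im: False
      let ?j = "2 * (n + m) - j"
      have j': "n \<le> ?j" "?j < n + m" using ij len im by auto
      have Uj: "U ?j = U j" using mirror[of ?j] j' ij len im by auto
      obtain k where "k < ?j" "nc (U k) (U ?j)" using H3[of ?j] j' by auto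
      then show ?thesis using Uj eqU ij j' im by (intro exI[of _ k]) auto
    qed
  qed
  show "(\<exists>k. i < k \<and> k < j \<and> nc (fst (?u ! k)) (fst (?u ! i))) \<and>
      (\<exists>k<length ?u. (k < i \<or> j < k) \<and> nc (fst (?u ! k)) (fst (?u ! i)))"
    using inner outer by (simp add: U_def)
qed

text \<open>If the first letter lies in the star of \<open>w\<close>, the hypothesis supplies a
  later letter blocking it. Passing to that letter and continuing with the suffix builds a walk in
  the complement graph from the head of \<open>h\<close> to a neighbour of \<open>w\<close>
  there.\<close>

lemma chain_to:
  assumes "h \<noteq> []"
    and "\<And>W1 c W2. h = W1 @ c # W2 \<Longrightarrow> \<not> nc (fst c) w \<Longrightarrow> \<exists>m\<in>set W2. nc (fst m) (fst c)"
  shows "\<exists>c. subseq c h \<and> c \<noteq> [] \<and> hd c = hd h \<and> successively nc (map fst c) \<and> nc (fst (last c)) w"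
  using assms
proof (induction "length h" arbitrary: h rule: less_induct)
  case less
  obtain x h1 where h: "h = x # h1" using less.prems(1) by (cases h) auto
  show ?case
  proof (cases "nc (fst x) w")
    case True
    then show ?thesis using h by (intro exI[of _ "[x]"]) auto
  next
    case False
    have "h = [] @ x # h1" using h by simp
    then obtain m where m: "m \<in> set h1" "nc (fst m) (fst x)" using less.prems(2) False by blast
    then obtain A B where AB: "h1 = A @ m # B" by (auto simp: in_set_conv_decomp)
    have "\<exists>m\<in>set W2. nc (fst m) (fst c)" if "m # B = W1 @ c # W2" "\<not> nc (fst c) w" for W1 c W2
      using less.prems(2)[of "x # A @ W1" c W2] that h AB by simp
    then obtain c where c: "subseq c (m # B)" "c \<noteq> []" "hd c = m" "successively nc (map fst c)" "nc (fst (last c)) w"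
      using less.hyps[of "m # B"] h AB by auto
    have "subseq (x # c) h" using c(1) h AB by (simp add: subseq_drop_many)
    moreover have "successively nc (map fst (x # c))"
      using c m nc_sym[OF m(2)] by (cases c) auto
    ultimately show ?thesis using c h by (intro exI[of _ "x # c"]) auto
  qed
qed

text \<open>The closed walk goes around \<open>s\<close>, out along a chain in \<open>h\<close> to
  \<open>z\<close>, and back along the same chain. The chain has at least one letter and is used
  twice, and \<open>z\<close> adds one more: this is the surplus of three.\<close>

lemma proper_conjugate_word:
  assumes s: "successively nc (map fst s)" "s \<noteq> []" "fst (hd s) = a" "fst (last s) = a"
    and h: "trimmed S (fst z) h" "h \<noteq> []" "nc (fst (hd h)) a"
    and f: "\<And>l. fst (f l) = fst l"
  shows "\<exists>t. subseq t (s @ h @ z # rev (map f h)) \<and> proper t \<and> length t \<ge> length s + 3"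
proof -
  have "\<And>W1 c W2. h = W1 @ c # W2 \<Longrightarrow> \<not> nc (fst c) (fst z) \<Longrightarrow> \<exists>m\<in>set W2. nc (fst m) (fst c)"
    using h(1) unfolding trimmed_def by blast
  then obtain c where c: "subseq c h" "c \<noteq> []" "hd c = hd h" "successively nc (map fst c)" "nc (fst (last c)) (fst z)"
    using chain_to[OF h(2), of "fst z"] by blast
  let ?t = "s @ c @ z # rev (map f c)"
  have "subseq (map f c) (map f h)" by (rule subseq_map[OF c(1)])
  then have "subseq (rev (map f c)) (rev (map f h))" by (rule subseq_rev)
  then have sub: "subseq ?t (s @ h @ z # rev (map f h))"
    using c(1) by (intro list_emb_append_mono) auto
  have mf: "map fst (rev (map f c)) = rev (map fst c)" using f by (simp add: rev_map o_def)
  have r: "successively nc (rev (map fst c))"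
    unfolding successively_rev using c(4) by (rule successively_mono) (rule nc_sym)
  have "successively nc (map fst s @ map fst c @ fst z # rev (map fst c) @ [a])"
    using s c h(3) r nc_sym[OF c(5)] nc_sym[OF h(3)]
    by (simp add: successively_append_iff successively_Cons last_map hd_map hd_append last_rev hd_rev)
  then have "proper ?t"
    using s(2,3) mf by (simp add: proper_def cyc_def)
  moreover have "length ?t \<ge> length s + 3" using c(2) by (cases c) auto
  ultimately show ?thesis using sub by blast
qed

end

section \<open>Normal forms\<close>

context graph_prod
begin

text \<open>In the same group the passed letter is conjugated, at a neighbour it commutes; in both
  cases it keeps its type.\<close>

lemma star_conj_letter:
  assumes c: "c \<in> V" "x \<in> carrier (G c)" and v: "v \<in> V" "y \<in> carrier (G v)" and cv: "\<not> nc c v"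
  shows "\<exists>y'\<in>carrier (G v). incl c x \<otimes>\<^bsub>GP\<^esub> incl v y = incl v y' \<otimes>\<^bsub>GP\<^esub> incl c x"
proof (cases "c = v")
  case True
  interpret Gc: group "G c" by (rule groups[OF c(1)])
  let ?y = "x \<otimes>\<^bsub>G c\<^esub> y \<otimes>\<^bsub>G c\<^esub> inv\<^bsub>G c\<^esub> x"
  have y: "y \<in> carrier (G c)" using v(2) True by simp
  have yc: "?y \<in> carrier (G c)" using c y by simp
  have "incl c ?y \<otimes>\<^bsub>GP\<^esub> incl c x = incl c (?y \<otimes>\<^bsub>G c\<^esub> x)"
    by (rule incl_mult[OF c(1) yc c(2), symmetric])
  also have "?y \<otimes>\<^bsub>G c\<^esub> x = x \<otimes>\<^bsub>G c\<^esub> y" using c(2) y by (simp add: Gc.m_assoc)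
  also have "incl c (x \<otimes>\<^bsub>G c\<^esub> y) = incl c x \<otimes>\<^bsub>GP\<^esub> incl c y" by (rule incl_mult[OF c y])
  finally show ?thesis using yc True by (intro bexI[of _ ?y]) auto
next
  case False
  then have "{c, v} \<in> E" using cv by (simp add: nc_def)
  then show ?thesis using incl_commute[of c v x y] c v by blast
qed

lemma push_left:
  assumes c: "c \<in> V" "x \<in> carrier (G c)" and w: "w \<in> W" "\<And>m. m \<in> set w \<Longrightarrow> \<not> nc (fst m) c"
  shows "\<exists>w'\<in>W. length w' = length w \<and> incl c x \<otimes>\<^bsub>GP\<^esub> val w = val w' \<otimes>\<^bsub>GP\<^esub> incl c x"
  using w
proof (induction w)
  case Nil
  then show ?case using c by (intro bexI[of _ "[]"]) auto
next
  case (Cons l w)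
  have l: "fst l \<in> V" "snd l \<in> carrier (G (fst l))" and w: "w \<in> W" using Cons.prems by auto
  have "\<not> nc c (fst l)" using Cons.prems(2)[of l] nc_sym by auto
  then obtain y where y: "y \<in> carrier (G (fst l))"
    "incl c x \<otimes>\<^bsub>GP\<^esub> incl (fst l) (snd l) = incl (fst l) y \<otimes>\<^bsub>GP\<^esub> incl c x"
    using star_conj_letter[OF c l] by blast
  obtain w' where w': "w' \<in> W" "length w' = length w" "incl c x \<otimes>\<^bsub>GP\<^esub> val w = val w' \<otimes>\<^bsub>GP\<^esub> incl c x"
    using Cons.IH[OF w] Cons.prems(2) by auto
  have "incl c x \<otimes>\<^bsub>GP\<^esub> val (l # w) = (incl c x \<otimes>\<^bsub>GP\<^esub> incl (fst l) (snd l)) \<otimes>\<^bsub>GP\<^esub> val w"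
    using c l w by (simp add: GP.m_assoc)
  also have "\<dots> = incl (fst l) y \<otimes>\<^bsub>GP\<^esub> (incl c x \<otimes>\<^bsub>GP\<^esub> val w)"
    unfolding y(2) using c l w y(1) by (simp add: GP.m_assoc)
  also have "\<dots> = val ((fst l, y) # w') \<otimes>\<^bsub>GP\<^esub> incl c x"
    unfolding w'(3) using c l w' y(1) by (simp add: GP.m_assoc)
  finally show ?case using l y(1) w' by (intro bexI[of _ "(fst l, y) # w'"]) auto
qed

text \<open>Apply \<open>push_left\<close> to the inverse letter and multiply by the letter on both
  sides.\<close>

lemma push_right:
  assumes c: "c \<in> V" "x \<in> carrier (G c)" and w: "w \<in> W" "\<And>m. m \<in> set w \<Longrightarrow> \<not> nc (fst m) c"
  shows "\<exists>w'\<in>W. length w' = length w \<and> val w \<otimes>\<^bsub>GP\<^esub> incl c x = incl c x \<otimes>\<^bsub>GP\<^esub> val w'"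
proof -
  interpret Gc: group "G c" by (rule groups[OF c(1)])
  let ?X = "incl c x"
  have X: "?X \<in> carrier GP" using c by simp
  have xi: "inv\<^bsub>G c\<^esub> x \<in> carrier (G c)" using c by simp
  obtain w' where w': "w' \<in> W" "length w' = length w"
    "incl c (inv\<^bsub>G c\<^esub> x) \<otimes>\<^bsub>GP\<^esub> val w = val w' \<otimes>\<^bsub>GP\<^esub> incl c (inv\<^bsub>G c\<^esub> x)"
    using push_left[OF c(1) xi w] by blast
  have "inv\<^bsub>GP\<^esub> ?X \<otimes>\<^bsub>GP\<^esub> val w = val w' \<otimes>\<^bsub>GP\<^esub> inv\<^bsub>GP\<^esub> ?X" using w'(3) incl_inv[OF c] by simp
  then have "?X \<otimes>\<^bsub>GP\<^esub> (inv\<^bsub>GP\<^esub> ?X \<otimes>\<^bsub>GP\<^esub> val w) \<otimes>\<^bsub>GP\<^esub> ?X = ?X \<otimes>\<^bsub>GP\<^esub> (val w' \<otimes>\<^bsub>GP\<^esub> inv\<^bsub>GP\<^esub> ?X) \<otimes>\<^bsub>GP\<^esub> ?X"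
    by simp
  then have "val w \<otimes>\<^bsub>GP\<^esub> ?X = ?X \<otimes>\<^bsub>GP\<^esub> val w'"
    using X w(1) w'(1) by (simp add: GP.mult_inv_cancel GP.m_assoc)
  then show ?thesis using w' by blast
qed

text \<open>The letter \<open>a\<close> moves through \<open>W2\<close>, whose types all lie in its
  star, and is then multiplied with \<open>b\<close>.\<close>

lemma merge_letters:
  assumes w: "W1 @ a # W2 @ b # W3 \<in> W" and ab: "fst a = fst b"
    and W2: "\<And>m. m \<in> set W2 \<Longrightarrow> \<not> nc (fst m) (fst a)"
  shows "\<exists>w'\<in>W. length w' < length (W1 @ a # W2 @ b # W3) \<and> val w' = val (W1 @ a # W2 @ b # W3)"
proof -
  have a: "fst a \<in> V" "snd a \<in> carrier (G (fst a))" and b: "snd b \<in> carrier (G (fst a))"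
    and Ws: "W1 \<in> W" "W2 \<in> W" "W3 \<in> W"
    using w ab by auto
  interpret Ga: group "G (fst a)" by (rule groups[OF a(1)])
  obtain w2 where w2: "w2 \<in> W" "length w2 = length W2"
    "incl (fst a) (snd a) \<otimes>\<^bsub>GP\<^esub> val W2 = val w2 \<otimes>\<^bsub>GP\<^esub> incl (fst a) (snd a)"
    using push_left[OF a Ws(2) W2] by blast
  let ?c = "(fst a, snd a \<otimes>\<^bsub>G (fst a)\<^esub> snd b)"
  let ?w = "W1 @ w2 @ ?c # W3"
  have "val (a # W2 @ b # W3) = (incl (fst a) (snd a) \<otimes>\<^bsub>GP\<^esub> val W2) \<otimes>\<^bsub>GP\<^esub> (incl (fst a) (snd b) \<otimes>\<^bsub>GP\<^esub> val W3)"
    using a b Ws ab by (simp add: val_append GP.m_assoc)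
  also have "\<dots> = val (w2 @ ?c # W3)"
    unfolding w2(3) using a b Ws w2(1) by (simp add: val_append GP.m_assoc incl_mult)
  finally have eq: "val (a # W2 @ b # W3) = val (w2 @ ?c # W3)" .
  have "snd a \<otimes>\<^bsub>G (fst a)\<^esub> snd b \<in> carrier (G (fst a))" using a b by simp
  then have mem: "w2 @ ?c # W3 \<in> W" "a # W2 @ b # W3 \<in> W" using a b Ws w2(1) ab by auto
  have "val ?w = val (W1 @ a # W2 @ b # W3)"
    unfolding val_append[OF Ws(1) mem(1)] val_append[OF Ws(1) mem(2)] eq ..
  then show ?thesis using a b Ws w2 by (intro bexI[of _ ?w]) auto
qed

lemma drop_trivial_letter:
  assumes "W1 @ (v, \<one>\<^bsub>G v\<^esub>) # W2 \<in> W"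
  shows "W1 @ W2 \<in> W" "val (W1 @ W2) = val (W1 @ (v, \<one>\<^bsub>G v\<^esub>) # W2)"
  using assms by (auto simp: val_append)

definition inv_letter :: "'v \<times> 'a \<Rightarrow> 'v \<times> 'a" where
  "inv_letter l = (fst l, inv\<^bsub>G (fst l)\<^esub> snd l)"

lemma fst_inv_letter [simp]: "fst (inv_letter l) = fst l"
  by (simp add: inv_letter_def)

lemma inv_word_W: "w \<in> W \<Longrightarrow> rev (map inv_letter w) \<in> W"
  by (induction w) (auto simp: inv_letter_def groups group.inv_closed)

lemma val_inv_word: "w \<in> W \<Longrightarrow> val (rev (map inv_letter w)) = inv\<^bsub>GP\<^esub> (val w)"
proof (induction w)
  case (Cons l w)
  then have l: "fst l \<in> V" "snd l \<in> carrier (G (fst l))" and w: "w \<in> W" by auto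
  have "inv\<^bsub>G (fst l)\<^esub> snd l \<in> carrier (G (fst l))" using l groups by (simp add: group.inv_closed)
  then have L: "[inv_letter l] \<in> W" "val [inv_letter l] = inv\<^bsub>GP\<^esub> (incl (fst l) (snd l))"
    using l by (simp_all add: inv_letter_def incl_inv)
  have "val (rev (map inv_letter (l # w))) = val (rev (map inv_letter w)) \<otimes>\<^bsub>GP\<^esub> val [inv_letter l]"
    using val_append[OF inv_word_W[OF w] L(1)] by simp
  then show ?case unfolding Cons.IH[OF w] L(2) using l w by (simp add: GP.inv_mult_group)
qed simp

lemma inv_letter_nontrivial:
  "v \<in> V \<Longrightarrow> x \<in> carrier (G v) \<Longrightarrow> inv\<^bsub>G v\<^esub> x = \<one>\<^bsub>G v\<^esub> \<longleftrightarrow> x = \<one>\<^bsub>G v\<^esub>"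
  using groups[of v] by (simp add: group.inv_eq_1_iff)

text \<open>If \<open>W2\<close> does not separate the two letters, they merge in place. If
  \<open>W3\<close> and \<open>W1\<close> do not, they merge after a rotation of the word, which is
  a conjugation.\<close>

lemma minimal_conjugate_cyclically_reduced:
  assumes w: "w \<in> W"
    and min: "\<And>w' g. w' \<in> W \<Longrightarrow> g \<in> carrier GP \<Longrightarrow> val w = g \<otimes>\<^bsub>GP\<^esub> val w' \<otimes>\<^bsub>GP\<^esub> inv\<^bsub>GP\<^esub> g \<Longrightarrow> length w \<le> length w'"
  shows "cyclically_reduced w"
  unfolding cyclically_reduced_def
proof (intro allI impI conjI)
  fix W1 a W2 b W3 assume eq: "w = W1 @ a # W2 @ b # W3" and ab: "fst a = fst b"
  have Ws: "W1 \<in> W" "W2 \<in> W" "W3 \<in> W" "fst a \<in> V" "snd a \<in> carrier (G (fst a))"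
    "snd b \<in> carrier (G (fst a))" using w eq ab by auto
  show "\<exists>m\<in>set W2. nc (fst m) (fst a)"
  proof (rule ccontr)
    assume "\<not> ?thesis"
    then obtain w' where "w' \<in> W" "length w' < length w" "val w' = val w"
      using merge_letters[of W1 a W2 b W3] w eq ab by blast
    then show False using min[of w' "\<one>\<^bsub>GP\<^esub>"] w by simp
  qed
  show "\<exists>m\<in>set W1 \<union> set W3. nc (fst m) (fst a)"
  proof (rule ccontr)
    assume n: "\<not> ?thesis"
    \<comment> \<open>The rotation of \<open>w\<close> that starts at \<open>b\<close>; the
      conjugator back to \<open>w\<close> is the value of \<open>W1 @ a # W2\<close>.\<close>
    let ?v = "[] @ b # (W3 @ W1) @ a # W2"
    have v: "?v \<in> W" using Ws ab by auto
    obtain w' where w': "w' \<in> W" "length w' < length ?v" "val w' = val ?v"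
      using merge_letters[OF v] ab n by auto
    let ?g = "val (W1 @ a # W2)"
    have g: "?g \<in> carrier GP" using Ws by simp
    have "val w \<otimes>\<^bsub>GP\<^esub> ?g = ?g \<otimes>\<^bsub>GP\<^esub> val ?v"
      using Ws ab by (simp add: eq val_append GP.m_assoc)
    then have "val w = ?g \<otimes>\<^bsub>GP\<^esub> val w' \<otimes>\<^bsub>GP\<^esub> inv\<^bsub>GP\<^esub> ?g"
      using w'(3) GP.inv_solve_right[of "val w" "?g \<otimes>\<^bsub>GP\<^esub> val ?v" ?g] g w v by simp
    then have "length w \<le> length w'" using min[OF w'(1) g] by blast
    then show False using w'(2) eq by simp
  qed
qed

text \<open>Both directions are recorded, since in an infinite group the inclusion under conjugation
  by \<open>k\<close> does not imply the one for its inverse.\<close>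

definition normalizes :: "'v set \<Rightarrow> ('v \<times> 'a) list set set \<Rightarrow> bool" where
  "normalizes S k \<longleftrightarrow> k \<in> carrier GP \<and> (\<forall>a\<in>S. \<forall>x\<in>carrier (G a).
     (\<exists>x'\<in>carrier (G a). inv\<^bsub>GP\<^esub> k \<otimes>\<^bsub>GP\<^esub> incl a x \<otimes>\<^bsub>GP\<^esub> k = incl a x') \<and>
     (\<exists>x'\<in>carrier (G a). k \<otimes>\<^bsub>GP\<^esub> incl a x \<otimes>\<^bsub>GP\<^esub> inv\<^bsub>GP\<^esub> k = incl a x'))"

lemma normalizes_one: "S \<subseteq> V \<Longrightarrow> normalizes S \<one>\<^bsub>GP\<^esub>"
  by (auto simp: normalizes_def intro!: bexI)

lemma star_conj:
  assumes c: "c \<in> V" "x \<in> carrier (G c)" and v: "v \<in> V" "y \<in> carrier (G v)" and cv: "\<not> nc c v"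
  shows "\<exists>y'\<in>carrier (G v). incl c x \<otimes>\<^bsub>GP\<^esub> incl v y \<otimes>\<^bsub>GP\<^esub> inv\<^bsub>GP\<^esub> (incl c x) = incl v y'"
    and "\<exists>y'\<in>carrier (G v). inv\<^bsub>GP\<^esub> (incl c x) \<otimes>\<^bsub>GP\<^esub> incl v y \<otimes>\<^bsub>GP\<^esub> incl c x = incl v y'"
proof -
  have *: "\<exists>y'\<in>carrier (G v). incl c x \<otimes>\<^bsub>GP\<^esub> incl v y \<otimes>\<^bsub>GP\<^esub> inv\<^bsub>GP\<^esub> (incl c x) = incl v y'"
    if x: "x \<in> carrier (G c)" for x
  proof -
    obtain y' where y': "y' \<in> carrier (G v)" "incl c x \<otimes>\<^bsub>GP\<^esub> incl v y = incl v y' \<otimes>\<^bsub>GP\<^esub> incl c x"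
      using star_conj_letter[OF c(1) x v cv] by blast
    then show ?thesis using c(1) x v(1) by (intro bexI[of _ y']) (simp_all add: GP.m_assoc)
  qed
  show "\<exists>y'\<in>carrier (G v). incl c x \<otimes>\<^bsub>GP\<^esub> incl v y \<otimes>\<^bsub>GP\<^esub> inv\<^bsub>GP\<^esub> (incl c x) = incl v y'" by (rule *[OF c(2)])
  have "inv\<^bsub>G c\<^esub> x \<in> carrier (G c)" using c groups by (simp add: group.inv_closed)
  from *[OF this] show "\<exists>y'\<in>carrier (G v). inv\<^bsub>GP\<^esub> (incl c x) \<otimes>\<^bsub>GP\<^esub> incl v y \<otimes>\<^bsub>GP\<^esub> incl c x = incl v y'"
    using c by (simp add: incl_inv)
qed

lemma normalizes_mult_letter:
  assumes S: "S \<subseteq> V" and k: "normalizes S k" and c: "c \<in> V" "x \<in> carrier (G c)" "\<And>a. a \<in> S \<Longrightarrow> \<not> nc c a"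
  shows "normalizes S (k \<otimes>\<^bsub>GP\<^esub> incl c x)"
  unfolding normalizes_def
proof (intro conjI ballI)
  let ?X = "incl c x"
  have kc: "k \<in> carrier GP" using k by (simp add: normalizes_def)
  have X: "?X \<in> carrier GP" using c by simp
  show "k \<otimes>\<^bsub>GP\<^esub> ?X \<in> carrier GP" using kc X by simp
  fix a y assume a: "a \<in> S" and y: "y \<in> carrier (G a)"
  have aV: "a \<in> V" using a S by blast
  have Y: "incl a y \<in> carrier GP" using aV y by simp
  obtain y1 where y1: "y1 \<in> carrier (G a)" "inv\<^bsub>GP\<^esub> k \<otimes>\<^bsub>GP\<^esub> incl a y \<otimes>\<^bsub>GP\<^esub> k = incl a y1"
    using k a y unfolding normalizes_def by blast
  obtain y2 where y2: "y2 \<in> carrier (G a)" "inv\<^bsub>GP\<^esub> ?X \<otimes>\<^bsub>GP\<^esub> incl a y1 \<otimes>\<^bsub>GP\<^esub> ?X = incl a y2"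
    using star_conj(2)[OF c(1,2) aV y1(1) c(3)[OF a]] by blast
  have "inv\<^bsub>GP\<^esub> (k \<otimes>\<^bsub>GP\<^esub> ?X) \<otimes>\<^bsub>GP\<^esub> incl a y \<otimes>\<^bsub>GP\<^esub> (k \<otimes>\<^bsub>GP\<^esub> ?X)
      = inv\<^bsub>GP\<^esub> ?X \<otimes>\<^bsub>GP\<^esub> (inv\<^bsub>GP\<^esub> k \<otimes>\<^bsub>GP\<^esub> incl a y \<otimes>\<^bsub>GP\<^esub> k) \<otimes>\<^bsub>GP\<^esub> ?X"
    using kc X Y by (simp add: GP.inv_mult_group GP.m_assoc)
  then show "\<exists>x'\<in>carrier (G a). inv\<^bsub>GP\<^esub> (k \<otimes>\<^bsub>GP\<^esub> ?X) \<otimes>\<^bsub>GP\<^esub> incl a y \<otimes>\<^bsub>GP\<^esub> (k \<otimes>\<^bsub>GP\<^esub> ?X) = incl a x'"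
    using y1 y2 by auto
  obtain y3 where y3: "y3 \<in> carrier (G a)" "?X \<otimes>\<^bsub>GP\<^esub> incl a y \<otimes>\<^bsub>GP\<^esub> inv\<^bsub>GP\<^esub> ?X = incl a y3"
    using star_conj(1)[OF c(1,2) aV y c(3)[OF a]] by blast
  obtain y4 where y4: "y4 \<in> carrier (G a)" "k \<otimes>\<^bsub>GP\<^esub> incl a y3 \<otimes>\<^bsub>GP\<^esub> inv\<^bsub>GP\<^esub> k = incl a y4"
    using k a y3 unfolding normalizes_def by blast
  have "(k \<otimes>\<^bsub>GP\<^esub> ?X) \<otimes>\<^bsub>GP\<^esub> incl a y \<otimes>\<^bsub>GP\<^esub> inv\<^bsub>GP\<^esub> (k \<otimes>\<^bsub>GP\<^esub> ?X)
      = k \<otimes>\<^bsub>GP\<^esub> (?X \<otimes>\<^bsub>GP\<^esub> incl a y \<otimes>\<^bsub>GP\<^esub> inv\<^bsub>GP\<^esub> ?X) \<otimes>\<^bsub>GP\<^esub> inv\<^bsub>GP\<^esub> k"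
    using kc X Y by (simp add: GP.inv_mult_group GP.m_assoc)
  then show "\<exists>x'\<in>carrier (G a). (k \<otimes>\<^bsub>GP\<^esub> ?X) \<otimes>\<^bsub>GP\<^esub> incl a y \<otimes>\<^bsub>GP\<^esub> inv\<^bsub>GP\<^esub> (k \<otimes>\<^bsub>GP\<^esub> ?X) = incl a x'"
    using y3 y4 by auto
qed

text \<open>Among all pairs with \<open>k\<close> normalising the vertex groups of \<open>S\<close>
  and \<open>P\<close> true of \<open>k\<close> times the value of \<open>h\<close>, take one with
  \<open>h\<close> shortest. A letter in the star of \<open>w\<close> that reaches the right end is
  cancelled by the closure of \<open>P\<close>; one in the star of all of \<open>S\<close> that
  reaches the left end is absorbed into \<open>k\<close>; letters of one type that meet are merged.
  Minimality forbids all three.\<close>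

lemma exists_trimmed:
  assumes S: "S \<subseteq> V" and g: "g \<in> carrier GP" "P g"
    and closed: "\<And>g c x. g \<in> carrier GP \<Longrightarrow> P g \<Longrightarrow> c \<in> V \<Longrightarrow> \<not> nc c w \<Longrightarrow> x \<in> carrier (G c) \<Longrightarrow>
      P (g \<otimes>\<^bsub>GP\<^esub> incl c x)"
  obtains k h where "normalizes S k" "h \<in> W" "P (k \<otimes>\<^bsub>GP\<^esub> val h)"
    "\<And>v x. (v, x) \<in> set h \<Longrightarrow> x \<noteq> \<one>\<^bsub>G v\<^esub>" "trimmed S w h"
proof -
  define Q where "Q kh \<longleftrightarrow> normalizes S (fst kh) \<and> snd kh \<in> W \<and> P (fst kh \<otimes>\<^bsub>GP\<^esub> val (snd kh))" for kh
  obtain h0 where "h0 \<in> W" "g = val h0" using g carrier_GP by blast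
  then have "Q (\<one>\<^bsub>GP\<^esub>, h0)" using normalizes_one[OF S] g by (simp add: Q_def)
  then obtain kh where kh: "Q kh" and min: "\<And>kh'. Q kh' \<Longrightarrow> length (snd kh) \<le> length (snd kh')"
    using ex_has_least_nat[of Q "(\<one>\<^bsub>GP\<^esub>, h0)" "\<lambda>kh. length (snd kh)"] by blast
  obtain k h where "kh = (k, h)" by (cases kh)
  then have k: "normalizes S k" and h: "h \<in> W" and P: "P (k \<otimes>\<^bsub>GP\<^esub> val h)"
    and min: "\<And>k' h'. normalizes S k' \<Longrightarrow> h' \<in> W \<Longrightarrow> P (k' \<otimes>\<^bsub>GP\<^esub> val h') \<Longrightarrow> length h \<le> length h'"
    using kh min unfolding Q_def by auto
  have kc: "k \<in> carrier GP" using k by (simp add: normalizes_def)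
  have "x \<noteq> \<one>\<^bsub>G v\<^esub>" if vx: "(v, x) \<in> set h" for v x
  proof
    assume "x = \<one>\<^bsub>G v\<^esub>"
    then obtain W1 W2 where eq: "h = W1 @ (v, \<one>\<^bsub>G v\<^esub>) # W2" using vx by (auto simp: in_set_conv_decomp)
    note d = drop_trivial_letter[OF h[unfolded eq]]
    have "P (k \<otimes>\<^bsub>GP\<^esub> val (W1 @ W2))" using P unfolding eq d(2) .
    then have "length h \<le> length (W1 @ W2)" by (rule min[OF k d(1)])
    then show False using eq by simp
  qed
  moreover have "trimmed S w h"
    unfolding trimmed_def
  proof (intro conjI allI impI)
    fix W1 a W2 b W3 assume eq: "h = W1 @ a # W2 @ b # W3" and ab: "fst a = fst b"
    show "\<exists>m\<in>set W2. nc (fst m) (fst a)"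
    proof (rule ccontr)
      assume "\<not> ?thesis"
      then obtain w' where "w' \<in> W" "length w' < length h" "val w' = val h"
        using merge_letters[of W1 a W2 b W3] h eq ab by blast
      then show False using min[OF k, of w'] P by simp
    qed
  next
    fix W1 c W2 assume eq: "h = W1 @ c # W2" and n: "\<not> nc (fst c) w"
    have c: "fst c \<in> V" "snd c \<in> carrier (G (fst c))" and Ws: "W1 \<in> W" "W2 \<in> W" using h eq by auto
    show "\<exists>m\<in>set W2. nc (fst m) (fst c)"
    proof (rule ccontr)
      assume n2: "\<not> ?thesis"
      obtain w2 where w2: "w2 \<in> W" "length w2 = length W2"
        "incl (fst c) (snd c) \<otimes>\<^bsub>GP\<^esub> val W2 = val w2 \<otimes>\<^bsub>GP\<^esub> incl (fst c) (snd c)"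
        using push_left[OF c Ws(2)] n2 by blast
      let ?X = "incl (fst c) (snd c)"
      have X: "?X \<in> carrier GP" using c by simp
      have e: "k \<otimes>\<^bsub>GP\<^esub> val (W1 @ w2) = (k \<otimes>\<^bsub>GP\<^esub> val h) \<otimes>\<^bsub>GP\<^esub> incl (fst c) (inv\<^bsub>G (fst c)\<^esub> snd c)"
      proof -
        have "val h = val (W1 @ w2) \<otimes>\<^bsub>GP\<^esub> ?X"
          using Ws w2 c by (simp add: eq val_append GP.m_assoc)
        then show ?thesis using Ws w2(1) c kc X by (simp add: incl_inv GP.m_assoc)
      qed
      have "inv\<^bsub>G (fst c)\<^esub> snd c \<in> carrier (G (fst c))" using c groups by (simp add: group.inv_closed)
      then have "P (k \<otimes>\<^bsub>GP\<^esub> val (W1 @ w2))"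
        unfolding e using closed[OF _ P c(1) n] kc h by simp
      moreover have "W1 @ w2 \<in> W" using Ws w2 by simp
      ultimately have "length h \<le> length (W1 @ w2)" using min[OF k] by blast
      then show False using eq w2(2) by simp
    qed
  next
    fix W1 c W2 assume eq: "h = W1 @ c # W2" and n: "\<forall>a\<in>S. \<not> nc (fst c) a"
    have c: "fst c \<in> V" "snd c \<in> carrier (G (fst c))" and Ws: "W1 \<in> W" "W2 \<in> W" using h eq by auto
    show "\<exists>m\<in>set W1. nc (fst m) (fst c)"
    proof (rule ccontr)
      assume n2: "\<not> ?thesis"
      obtain w1 where w1: "w1 \<in> W" "length w1 = length W1"
        "val W1 \<otimes>\<^bsub>GP\<^esub> incl (fst c) (snd c) = incl (fst c) (snd c) \<otimes>\<^bsub>GP\<^esub> val w1"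
        using push_right[OF c Ws(1)] n2 by blast
      let ?X = "incl (fst c) (snd c)"
      have X: "?X \<in> carrier GP" using c by simp
      have "val h = (val W1 \<otimes>\<^bsub>GP\<^esub> ?X) \<otimes>\<^bsub>GP\<^esub> val W2" using Ws c by (simp add: eq val_append GP.m_assoc)
      then have "k \<otimes>\<^bsub>GP\<^esub> val h = (k \<otimes>\<^bsub>GP\<^esub> ?X) \<otimes>\<^bsub>GP\<^esub> val (w1 @ W2)"
        unfolding w1(3) using Ws w1(1) X kc by (simp add: val_append GP.m_assoc)
      then have "P ((k \<otimes>\<^bsub>GP\<^esub> ?X) \<otimes>\<^bsub>GP\<^esub> val (w1 @ W2))" using P by simp
      moreover have "normalizes S (k \<otimes>\<^bsub>GP\<^esub> ?X)" using normalizes_mult_letter[OF S k c] n by blast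
      moreover have "w1 @ W2 \<in> W" using Ws w1 by simp
      ultimately have "length h \<le> length (w1 @ W2)" using min by blast
      then show False using eq w1(2) by simp
    qed
  qed
  ultimately show ?thesis using that k h P by blast
qed

lemma retr_val_avoid:
  assumes u: "u \<in> V" and w: "w \<in> W" "\<And>l. l \<in> set w \<Longrightarrow> fst l \<noteq> u"
  shows "retr u (val w) = \<one>\<^bsub>G u\<^esub>"
proof -
  interpret r: group_hom GP "G u" "retr u" by (rule retr_group_hom[OF u])
  show ?thesis
    using w
  proof (induction w)
    case (Cons l w)
    then have l: "fst l \<in> V" "snd l \<in> carrier (G (fst l))" "w \<in> W" "fst l \<noteq> u" by auto
    then show ?case using Cons.IH Cons.prems(2) retr_incl[OF u l(1,2)] by simp
  qed simp
qed

end

section \<open>Images of vertex groups\<close>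

context residual_graph_prod
begin

text \<open>Subgroups with finite \<open>p\<close>-quotient pull back along \<open>retr u\<close> to
  such subgroups. Modulo any of them \<open>retr u (\<phi> x)\<close> is a conjugate of the
  identity, so it is trivial by residual \<open>p\<close>-finiteness of \<open>G u\<close>.\<close>

lemma retr_kernel_preserved:
  assumes \<phi>: "approximately_inner p GP \<phi>" and u: "u \<in> V" and x: "x \<in> carrier GP" "retr u x = \<one>\<^bsub>G u\<^esub>"
  shows "retr u (\<phi> x) = \<one>\<^bsub>G u\<^esub>"
proof (rule ccontr)
  assume ne: "retr u (\<phi> x) \<noteq> \<one>\<^bsub>G u\<^esub>"
  interpret r: group_hom GP "G u" "retr u" by (rule retr_group_hom[OF u])
  have \<phi>x: "\<phi> x \<in> carrier GP" by (rule GP.approximately_inner_hom(2)[OF \<phi> x(1)])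
  have "{retr u (\<phi> x)} \<subseteq> carrier (G u) - {\<one>\<^bsub>G u\<^esub>}" using ne \<phi>x by simp
  then obtain N where N: "p_normal p N (G u)" "N \<inter> {retr u (\<phi> x)} = {}"
    using r.H.residually_p_finite_avoid[OF prime_p residual[OF u], of "{retr u (\<phi> x)}"] by blast
  obtain g where g: "g \<in> carrier GP"
    "\<phi> x \<otimes>\<^bsub>GP\<^esub> inv\<^bsub>GP\<^esub> (g \<otimes>\<^bsub>GP\<^esub> x \<otimes>\<^bsub>GP\<^esub> inv\<^bsub>GP\<^esub> g) \<in> {x \<in> carrier GP. retr u x \<in> N}"
    using \<phi> r.p_normal_vimage[OF prime_p N(1)] x(1) unfolding approximately_inner_def by blast
  have "retr u (\<phi> x \<otimes>\<^bsub>GP\<^esub> inv\<^bsub>GP\<^esub> (g \<otimes>\<^bsub>GP\<^esub> x \<otimes>\<^bsub>GP\<^esub> inv\<^bsub>GP\<^esub> g)) = retr u (\<phi> x)"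
    using g(1) x \<phi>x by simp
  then show False using g(2) N(2) by auto
qed

text \<open>Let \<open>w\<close> be a shortest word conjugate to the image. Two letters with
  \<open>nc\<close> types would form a closed walk of length two, longer than the one-letter source.
  So the types of \<open>w\<close> are pairwise adjacent and distinct; as the retraction to any type
  other than \<open>v\<close> kills the image, \<open>w\<close> has at most one letter, of type
  \<open>v\<close>.\<close>

lemma vertex_element_image:
  assumes \<phi>: "approximately_inner p GP \<phi>" and v: "v \<in> V" and x: "x \<in> carrier (G v)"
  shows "\<exists>g\<in>carrier GP. \<exists>x'\<in>carrier (G v). \<phi> (incl v x) = g \<otimes>\<^bsub>GP\<^esub> incl v x' \<otimes>\<^bsub>GP\<^esub> inv\<^bsub>GP\<^esub> g"
proof -
  let ?y = "\<phi> (incl v x)"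
  have y: "?y \<in> carrier GP" using GP.approximately_inner_hom(2)[OF \<phi>] v x by simp
  define Q where "Q w \<longleftrightarrow> w \<in> W \<and> (\<exists>g\<in>carrier GP. ?y = g \<otimes>\<^bsub>GP\<^esub> val w \<otimes>\<^bsub>GP\<^esub> inv\<^bsub>GP\<^esub> g)" for w
  obtain w0 where w0: "w0 \<in> W" "?y = val w0" using y carrier_GP by blast
  have "?y = \<one>\<^bsub>GP\<^esub> \<otimes>\<^bsub>GP\<^esub> val w0 \<otimes>\<^bsub>GP\<^esub> inv\<^bsub>GP\<^esub> \<one>\<^bsub>GP\<^esub>"
    unfolding w0(2) using w0(1) by simp
  then have "Q w0" unfolding Q_def using w0(1) GP.one_closed by blast
  then obtain w where Qw: "Q w" and min: "\<And>w'. Q w' \<Longrightarrow> length w \<le> length w'"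
    using ex_has_least_nat[of Q w0 length] by blast
  obtain g where w: "w \<in> W" and g: "g \<in> carrier GP" "?y = g \<otimes>\<^bsub>GP\<^esub> val w \<otimes>\<^bsub>GP\<^esub> inv\<^bsub>GP\<^esub> g"
    using Qw unfolding Q_def by blast
  have cr: "cyclically_reduced w"
  proof (rule minimal_conjugate_cyclically_reduced[OF w])
    fix w' h assume w': "w' \<in> W" and h: "h \<in> carrier GP" "val w = h \<otimes>\<^bsub>GP\<^esub> val w' \<otimes>\<^bsub>GP\<^esub> inv\<^bsub>GP\<^esub> h"
    have "?y = (g \<otimes>\<^bsub>GP\<^esub> h) \<otimes>\<^bsub>GP\<^esub> val w' \<otimes>\<^bsub>GP\<^esub> inv\<^bsub>GP\<^esub> (g \<otimes>\<^bsub>GP\<^esub> h)"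
      unfolding g(2) h(2) using g(1) h(1) w' by (simp add: GP.inv_mult_group GP.m_assoc)
    then have "Q w'" unfolding Q_def using w' g(1) h(1) by blast
    then show "length w \<le> length w'" by (rule min)
  qed
  have nt: "x \<noteq> \<one>\<^bsub>G u\<^esub>" if ux: "(u, x) \<in> set w" for u x
  proof
    assume "x = \<one>\<^bsub>G u\<^esub>"
    then obtain W1 W2 where eq: "w = W1 @ (u, \<one>\<^bsub>G u\<^esub>) # W2" using ux by (auto simp: in_set_conv_decomp)
    note d = drop_trivial_letter[OF w[unfolded eq]]
    have "Q (W1 @ W2)" using Qw d unfolding Q_def eq by simp
    then show False using min[of "W1 @ W2"] eq by simp
  qed
  have clique: "\<not> nc (fst a) (fst b)" if ab: "a \<in> set w" "b \<in> set w" for a b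
  proof
    assume n: "nc (fst a) (fst b)"
    then have "a \<noteq> b" by auto
    then have "subseq [a, b] w \<or> subseq [b, a] w" by (rule subseq_pair[OF ab])
    then obtain s where s: "subseq s w" "proper s" "length s = 2"
      using n nc_sym[OF n] by (auto simp: proper_def cyc_def)
    have "[(v, x)] \<in> W" using v x by simp
    moreover have "\<phi> (val [(v, x)]) = g \<otimes>\<^bsub>GP\<^esub> val w \<otimes>\<^bsub>GP\<^esub> inv\<^bsub>GP\<^esub> g" using g v x by simp
    ultimately have "length s \<le> length [(v, x)]"
      using approximately_inner_length[OF \<phi> _ w g(1) _ cr _ s(1,2)] nt by blast
    then show False using s(3) by simp
  qed
  have uniq: "fst a \<noteq> fst b" if eq: "w = W1 @ a # W2 @ b # W3" for W1 a W2 b W3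
  proof
    assume "fst a = fst b"
    then obtain m where m: "m \<in> set W2" "nc (fst m) (fst a)"
      using cr eq unfolding cyclically_reduced_def by blast
    then show False using clique[of m a] eq by simp
  qed
  have only_v: "fst l = v" if l: "l \<in> set w" for l
  proof (rule ccontr)
    assume ne: "fst l \<noteq> v"
    obtain W1 W2 where eq: "w = W1 @ l # W2" using l by (auto simp: in_set_conv_decomp)
    have lV: "fst l \<in> V" "snd l \<in> carrier (G (fst l))" and Ws: "W1 \<in> W" "W2 \<in> W" using w eq by auto
    interpret r: group_hom GP "G (fst l)" "retr (fst l)" by (rule retr_group_hom[OF lV(1)])
    have 1: "fst m \<noteq> fst l" if m: "m \<in> set W1" for m
    proof -
      obtain A B where "W1 = A @ m # B" using m by (auto simp: in_set_conv_decomp)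
      then show ?thesis using uniq[of A m B l W2] eq by simp
    qed
    have 2: "fst m \<noteq> fst l" if m: "m \<in> set W2" for m
    proof -
      obtain A B where "W2 = A @ m # B" using m by (auto simp: in_set_conv_decomp)
      then show ?thesis using uniq[of W1 l A m B] eq by metis
    qed
    \<comment> \<open>No other letter of \<open>w\<close> has this type, so the retraction reads off
      \<open>snd l\<close>.\<close>
    have "retr (fst l) (val w) = snd l"
      using retr_val_avoid[OF lV(1) Ws(1) 1] retr_val_avoid[OF lV(1) Ws(2) 2] Ws lV retr_incl[OF lV(1) lV]
      by (simp add: eq val_append)
    moreover have "retr (fst l) ?y = \<one>\<^bsub>G (fst l)\<^esub>"
      using retr_kernel_preserved[OF \<phi> lV(1), of "incl v x"] retr_incl[OF lV(1) v x] ne v x by auto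
    moreover have "val w = inv\<^bsub>GP\<^esub> g \<otimes>\<^bsub>GP\<^esub> ?y \<otimes>\<^bsub>GP\<^esub> g"
      using GP.conj_cancel[OF g(1) y val_closed[OF w]] g(2) by simp
    ultimately have "snd l = \<one>\<^bsub>G (fst l)\<^esub>" using g(1) y by simp
    then show False using nt[of "fst l" "snd l"] l by simp
  qed
  show ?thesis
  proof (cases w)
    case Nil
    have "\<one>\<^bsub>G v\<^esub> \<in> carrier (G v)" using groups[OF v] by (simp add: group.is_monoid monoid.one_closed)
    then show ?thesis using g v Nil by (intro bexI[of _ g] bexI[of _ "\<one>\<^bsub>G v\<^esub>"]) auto
  next
    case (Cons l w')
    have "w' = []"
    proof (rule ccontr)
      assume "w' \<noteq> []"
      then obtain m w'' where "w' = m # w''" by (cases w') auto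
      then have "w = [] @ l # [] @ m # w''" using Cons by simp
      then show False using uniq[of "[]" l "[]" m w''] only_v Cons \<open>w' = m # w''\<close> by simp
    qed
    then have "val w = incl v (snd l)" "snd l \<in> carrier (G v)" using Cons w only_v[of l] by auto
    then show ?thesis using g by (intro bexI[of _ g] bexI[of _ "snd l"]) auto
  qed
qed

definition maps_into :: "(('v \<times> 'a) list set set \<Rightarrow> ('v \<times> 'a) list set set) \<Rightarrow> 'v \<Rightarrow> ('v \<times> 'a) list set set \<Rightarrow> 'a \<Rightarrow> bool" where
  "maps_into \<phi> v g x \<longleftrightarrow> (\<exists>x'\<in>carrier (G v). \<phi> (incl v x) = g \<otimes>\<^bsub>GP\<^esub> incl v x' \<otimes>\<^bsub>GP\<^esub> inv\<^bsub>GP\<^esub> g)"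

lemma maps_into_one:
  "v \<in> V \<Longrightarrow> maps_into \<phi> v \<one>\<^bsub>GP\<^esub> x \<longleftrightarrow> (\<exists>x'\<in>carrier (G v). \<phi> (incl v x) = incl v x')"
  unfolding maps_into_def by (rule bex_cong[OF HOL.refl]) simp

text \<open>Letters in the star of \<open>v\<close> normalise the image of \<open>G v\<close>, so
  they can be appended to the conjugator; this is the closure property that
  \<open>exists_trimmed\<close> asks for.\<close>

lemma maps_into_mult_letter:
  assumes v: "v \<in> V" and g: "g \<in> carrier GP" "maps_into \<phi> v g x" and c: "c \<in> V" "\<not> nc c v" "y \<in> carrier (G c)"
  shows "maps_into \<phi> v (g \<otimes>\<^bsub>GP\<^esub> incl c y) x"
proof -
  obtain x' where x': "x' \<in> carrier (G v)" "\<phi> (incl v x) = g \<otimes>\<^bsub>GP\<^esub> incl v x' \<otimes>\<^bsub>GP\<^esub> inv\<^bsub>GP\<^esub> g"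
    using g(2) unfolding maps_into_def by blast
  obtain x'' where x'': "x'' \<in> carrier (G v)" "inv\<^bsub>GP\<^esub> (incl c y) \<otimes>\<^bsub>GP\<^esub> incl v x' \<otimes>\<^bsub>GP\<^esub> incl c y = incl v x''"
    using star_conj(2)[OF c(1,3) v x'(1) c(2)] by blast
  have "incl v x' = incl c y \<otimes>\<^bsub>GP\<^esub> incl v x'' \<otimes>\<^bsub>GP\<^esub> inv\<^bsub>GP\<^esub> (incl c y)"
    using GP.conj_cancel[of "incl c y" "incl v x'" "incl v x''"] x'' x'(1) c v by simp
  then have "\<phi> (incl v x) = (g \<otimes>\<^bsub>GP\<^esub> incl c y) \<otimes>\<^bsub>GP\<^esub> incl v x'' \<otimes>\<^bsub>GP\<^esub> inv\<^bsub>GP\<^esub> (g \<otimes>\<^bsub>GP\<^esub> incl c y)"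
    unfolding x'(2) using g(1) c v x''(1) by (simp add: GP.inv_mult_group GP.m_assoc)
  then show ?thesis using x''(1) unfolding maps_into_def by blast
qed

lemma hom_val_image:
  assumes \<phi>: "approximately_inner p GP \<phi>" and k: "k \<in> carrier GP"
    and y: "\<And>a. a \<in> set vs \<Longrightarrow> a \<in> V \<and> x a \<in> carrier (G a) \<and> y a \<in> carrier (G a) \<and>
      \<phi> (incl a (x a)) = k \<otimes>\<^bsub>GP\<^esub> incl a (y a) \<otimes>\<^bsub>GP\<^esub> inv\<^bsub>GP\<^esub> k"
  shows "\<phi> (val (map (\<lambda>a. (a, x a)) vs)) = k \<otimes>\<^bsub>GP\<^esub> val (map (\<lambda>a. (a, y a)) vs) \<otimes>\<^bsub>GP\<^esub> inv\<^bsub>GP\<^esub> k"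
  using y
proof (induction vs)
  case Nil
  then show ?case using GP.approximately_inner_hom(4)[OF \<phi>] k by simp
next
  case (Cons a vs)
  note a = Cons.prems[of a, simplified]
  have W: "map (\<lambda>a. (a, x a)) vs \<in> W" "map (\<lambda>a. (a, y a)) vs \<in> W"
    using Cons.prems by (auto simp: free_words_def)
  have "\<phi> (val (map (\<lambda>a. (a, x a)) (a # vs))) = \<phi> (incl a (x a)) \<otimes>\<^bsub>GP\<^esub> \<phi> (val (map (\<lambda>a. (a, x a)) vs))"
    using GP.approximately_inner_hom(3)[OF \<phi>] a W by simp
  also have "\<dots> = (k \<otimes>\<^bsub>GP\<^esub> incl a (y a) \<otimes>\<^bsub>GP\<^esub> inv\<^bsub>GP\<^esub> k) \<otimes>\<^bsub>GP\<^esub> (k \<otimes>\<^bsub>GP\<^esub> val (map (\<lambda>a. (a, y a)) vs) \<otimes>\<^bsub>GP\<^esub> inv\<^bsub>GP\<^esub> k)"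
    using a Cons.IH Cons.prems by simp
  also have "\<dots> = k \<otimes>\<^bsub>GP\<^esub> val (map (\<lambda>a. (a, y a)) (a # vs)) \<otimes>\<^bsub>GP\<^esub> inv\<^bsub>GP\<^esub> k"
    using a W k by (simp add: GP.m_assoc GP.inv_mult_cancel)
  finally show ?case .
qed

definition closed_walk :: "'v set \<Rightarrow> 'v \<Rightarrow> 'v list \<Rightarrow> bool" where
  "closed_walk S a vs \<longleftrightarrow> vs \<noteq> [] \<and> hd vs = a \<and> last vs = a \<and> set vs = S \<and> successively nc vs"

text \<open>Trim the conjugator to \<open>k\<close> times \<open>h\<close>. If \<open>h\<close> is
  not empty, its first letter is joined in the complement graph to some \<open>a\<close> in
  \<open>S\<close>. For a closed walk \<open>s\<close> at \<open>a\<close> through \<open>S\<close>,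
  the source \<open>s z\<close> has \<open>length s + 1\<close> letters, while its image is
  conjugate to a cyclically reduced word with a proper subword of at least
  \<open>length s + 3\<close> letters, contrary to \<open>approximately_inner_length\<close>. So
  \<open>h\<close> is empty and \<open>k\<close> itself is the conjugator.\<close>

lemma normalizing_conjugator:
  assumes \<phi>: "approximately_inner p GP \<phi>" and S: "S \<subseteq> V" "\<And>a. a \<in> S \<Longrightarrow> \<exists>vs. closed_walk S a vs"
    and img: "\<And>a. a \<in> S \<Longrightarrow> \<exists>x\<in>carrier (G a) - {\<one>\<^bsub>G a\<^esub>}. maps_into \<phi> a \<one>\<^bsub>GP\<^esub> x"
    and w: "w \<in> V" and Z: "Z \<subseteq> carrier (G w)" "\<exists>z\<in>Z. z \<noteq> \<one>\<^bsub>G w\<^esub>"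
    and g: "g \<in> carrier GP" "\<And>z. z \<in> Z \<Longrightarrow> maps_into \<phi> w g z"
  shows "\<exists>k. normalizes S k \<and> (\<forall>z\<in>Z. maps_into \<phi> w k z)"
proof -
  define P where "P g \<longleftrightarrow> (\<forall>z\<in>Z. maps_into \<phi> w g z)" for g
  have Pg: "P g" using g(2) by (simp add: P_def)
  have closed: "P (g \<otimes>\<^bsub>GP\<^esub> incl c x)" if "g \<in> carrier GP" "P g" "c \<in> V" "\<not> nc c w" "x \<in> carrier (G c)" for g c x
    using that maps_into_mult_letter[OF w] unfolding P_def by blast
  obtain k h where k: "normalizes S k" and h: "h \<in> W" and P: "P (k \<otimes>\<^bsub>GP\<^esub> val h)"
    and nt: "\<And>v x. (v, x) \<in> set h \<Longrightarrow> x \<noteq> \<one>\<^bsub>G v\<^esub>" and tr: "trimmed S w h"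
    using exists_trimmed[where P = P, OF S(1) g(1) Pg closed] by blast
  have kc: "k \<in> carrier GP" using k by (simp add: normalizes_def)
  show ?thesis
  proof (cases "h = []")
    case True
    then show ?thesis using P k kc unfolding P_def by auto
  next
    case False
    obtain l h1 where lh: "h = l # h1" using False by (cases h) auto
    \<comment> \<open>Nothing stands to the left of the first letter of \<open>h\<close>, so by
      \<open>trimmed\<close> it is not in the star of all of \<open>S\<close>.\<close>
    have "\<exists>a\<in>S. nc (fst l) a"
    proof (rule ccontr)
      assume n: "\<not> ?thesis"
      have "\<And>W1 c W2. h = W1 @ c # W2 \<Longrightarrow> \<forall>a\<in>S. \<not> nc (fst c) a \<Longrightarrow> \<exists>m\<in>set W1. nc (fst m) (fst c)"
        using tr unfolding trimmed_def by blast
      from this[of "[]" l h1] show False using n lh by simp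
    qed
    then obtain a where a: "a \<in> S" "nc (fst (hd h)) a" using lh by auto
    obtain vs where vs: "closed_walk S a vs" using S(2)[OF a(1)] by blast
    \<comment> \<open>One nontrivial element per vertex of the walk is enough; its image stays
      nontrivial because \<open>\<phi>\<close> is injective.\<close>
    have "\<exists>x y. x \<in> carrier (G b) \<and> x \<noteq> \<one>\<^bsub>G b\<^esub> \<and> y \<in> carrier (G b) \<and> y \<noteq> \<one>\<^bsub>G b\<^esub> \<and>
        \<phi> (incl b x) = k \<otimes>\<^bsub>GP\<^esub> incl b y \<otimes>\<^bsub>GP\<^esub> inv\<^bsub>GP\<^esub> k" if b: "b \<in> S" for b
    proof -
      have bV: "b \<in> V" using b S(1) by blast
      obtain x x' where x: "x \<in> carrier (G b)" "x \<noteq> \<one>\<^bsub>G b\<^esub>" and x': "x' \<in> carrier (G b)" "\<phi> (incl b x) = incl b x'"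
        using img[OF b] maps_into_one[OF bV] by blast
      obtain y where y: "y \<in> carrier (G b)" "inv\<^bsub>GP\<^esub> k \<otimes>\<^bsub>GP\<^esub> incl b x' \<otimes>\<^bsub>GP\<^esub> k = incl b y"
        using k b x'(1) unfolding normalizes_def by blast
      have eq: "incl b x' = k \<otimes>\<^bsub>GP\<^esub> incl b y \<otimes>\<^bsub>GP\<^esub> inv\<^bsub>GP\<^esub> k"
        using GP.conj_cancel[OF kc, of "incl b x'" "incl b y"] y x'(1) bV by simp
      have "y \<noteq> \<one>\<^bsub>G b\<^esub>"
      proof
        assume "y = \<one>\<^bsub>G b\<^esub>"
        then have "\<phi> (incl b x) = \<one>\<^bsub>GP\<^esub>" using x'(2) eq bV kc by simp
        then have "\<phi> (incl b x) = \<phi> \<one>\<^bsub>GP\<^esub>" using GP.approximately_inner_hom(4)[OF \<phi>] by simp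
        then have "incl b x = \<one>\<^bsub>GP\<^esub>"
          using GP.approximately_inner_hom(5)[OF \<phi>, of "incl b x" "\<one>\<^bsub>GP\<^esub>"] bV x(1) by simp
        then have "incl b x = incl b \<one>\<^bsub>G b\<^esub>" using bV by simp
        moreover have "\<one>\<^bsub>G b\<^esub> \<in> carrier (G b)" using groups[OF bV] by (simp add: group.is_monoid monoid.one_closed)
        ultimately have "x = \<one>\<^bsub>G b\<^esub>" using incl_inj[OF bV x(1)] by blast
        then show False using x(2) by simp
      qed
      then show ?thesis using x x' y(1) eq by metis
    qed
    then obtain x y where xy: "\<And>b. b \<in> S \<Longrightarrow> x b \<in> carrier (G b) \<and> x b \<noteq> \<one>\<^bsub>G b\<^esub> \<and> y b \<in> carrier (G b) \<and>
        y b \<noteq> \<one>\<^bsub>G b\<^esub> \<and> \<phi> (incl b (x b)) = k \<otimes>\<^bsub>GP\<^esub> incl b (y b) \<otimes>\<^bsub>GP\<^esub> inv\<^bsub>GP\<^esub> k"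
      by metis
    obtain z where z: "z \<in> Z" "z \<noteq> \<one>\<^bsub>G w\<^esub>" using Z(2) by blast
    have zw: "z \<in> carrier (G w)" using z Z(1) by blast
    obtain z' where z': "z' \<in> carrier (G w)"
      "\<phi> (incl w z) = (k \<otimes>\<^bsub>GP\<^esub> val h) \<otimes>\<^bsub>GP\<^esub> incl w z' \<otimes>\<^bsub>GP\<^esub> inv\<^bsub>GP\<^esub> (k \<otimes>\<^bsub>GP\<^esub> val h)"
      using P z(1) unfolding P_def maps_into_def by blast
    have onew: "\<one>\<^bsub>G w\<^esub> \<in> carrier (G w)" using groups[OF w] by (simp add: group.is_monoid monoid.one_closed)
    have z'nt: "z' \<noteq> \<one>\<^bsub>G w\<^esub>"
    proof
      assume "z' = \<one>\<^bsub>G w\<^esub>"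
      then have "\<phi> (incl w z) = \<phi> \<one>\<^bsub>GP\<^esub>"
        using z'(2) w kc h GP.approximately_inner_hom(4)[OF \<phi>] by simp
      then have "incl w z = incl w \<one>\<^bsub>G w\<^esub>"
        using GP.approximately_inner_hom(5)[OF \<phi>, of "incl w z" "\<one>\<^bsub>GP\<^esub>"] w zw by simp
      then show False using incl_inj[OF w zw onew] z(2) by blast
    qed
    let ?s = "map (\<lambda>b. (b, x b)) vs" and ?t = "map (\<lambda>b. (b, y b)) vs"
    let ?hi = "rev (map inv_letter h)"
    let ?u = "?t @ h @ (w, z') # ?hi"
    have setvs: "set vs = S" using vs by (simp add: closed_walk_def)
    have sW: "?s \<in> W" and tW: "?t \<in> W" using xy S(1) setvs by (auto simp: free_words_def)
    have uW: "?u \<in> W" and zhW: "h @ (w, z') # ?hi \<in> W" using tW h w z'(1) inv_word_W[OF h] by auto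
    have szW: "?s @ [(w, z)] \<in> W" using sW w zw by simp
    have "\<phi> (val ?s) = k \<otimes>\<^bsub>GP\<^esub> val ?t \<otimes>\<^bsub>GP\<^esub> inv\<^bsub>GP\<^esub> k"
      using xy S(1) setvs by (intro hom_val_image[OF \<phi> kc]) auto
    moreover have "val (?s @ [(w, z)]) = val ?s \<otimes>\<^bsub>GP\<^esub> incl w z" using sW w zw by (simp add: val_append)
    ultimately have "\<phi> (val (?s @ [(w, z)])) = (k \<otimes>\<^bsub>GP\<^esub> val ?t \<otimes>\<^bsub>GP\<^esub> inv\<^bsub>GP\<^esub> k) \<otimes>\<^bsub>GP\<^esub>
        ((k \<otimes>\<^bsub>GP\<^esub> val h) \<otimes>\<^bsub>GP\<^esub> incl w z' \<otimes>\<^bsub>GP\<^esub> inv\<^bsub>GP\<^esub> (k \<otimes>\<^bsub>GP\<^esub> val h))"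
      using GP.approximately_inner_hom(3)[OF \<phi>] sW w zw z'(2) by simp
    also have "\<dots> = k \<otimes>\<^bsub>GP\<^esub> (val ?t \<otimes>\<^bsub>GP\<^esub> (val h \<otimes>\<^bsub>GP\<^esub> (incl w z' \<otimes>\<^bsub>GP\<^esub> inv\<^bsub>GP\<^esub> (val h)))) \<otimes>\<^bsub>GP\<^esub> inv\<^bsub>GP\<^esub> k"
      using kc tW h w z'(1) by (simp add: GP.m_assoc GP.inv_mult_group GP.inv_mult_cancel)
    also have "val ?t \<otimes>\<^bsub>GP\<^esub> (val h \<otimes>\<^bsub>GP\<^esub> (incl w z' \<otimes>\<^bsub>GP\<^esub> inv\<^bsub>GP\<^esub> (val h))) = val ?u"
      using val_append[OF tW zhW] val_append[OF h, of "(w, z') # ?hi"] val_inv_word[OF h] inv_word_W[OF h] w z'(1)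
      by simp
    finally have eq: "\<phi> (val (?s @ [(w, z)])) = k \<otimes>\<^bsub>GP\<^esub> val ?u \<otimes>\<^bsub>GP\<^esub> inv\<^bsub>GP\<^esub> k" .
    have mt: "map fst ?t = vs" by (simp add: o_def)
    have vs': "vs \<noteq> []" "hd vs = a" "last vs = a" "successively nc vs" using vs by (auto simp: closed_walk_def)
    have t: "successively nc (map fst ?t)" "?t \<noteq> []" "fst (hd ?t) = a" "fst (last ?t) = a" "fst ` set ?t = S"
      using vs' setvs mt by (auto simp: hd_map last_map image_image)
    have cr: "cyclically_reduced ?u"
      using tr by (intro cyclically_reduced_conjugate_word[OF t _ False a(2)]) (simp_all add: rev_map o_def)
    obtain c where c: "subseq c ?u" "proper c" "length c \<ge> length ?t + 3"
      using proper_conjugate_word[OF t(1-4), where z = "(w, z')" and h = h and f = inv_letter] tr False a(2) by auto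
    have unt: "b \<noteq> \<one>\<^bsub>G v\<^esub>" if vb: "(v, b) \<in> set ?u" for v b
    proof -
      have "(v, b) \<in> set ?hi \<Longrightarrow> b \<noteq> \<one>\<^bsub>G v\<^esub>"
      proof -
        assume "(v, b) \<in> set ?hi"
        then obtain b' where b': "(v, b') \<in> set h" "b = inv\<^bsub>G v\<^esub> b'" by (auto simp: inv_letter_def)
        then have "v \<in> V" "b' \<in> carrier (G v)" using h by (auto simp: free_words_def)
        then show ?thesis using inv_letter_nontrivial[of v b'] nt[OF b'(1)] b'(2) by simp
      qed
      moreover have "(v, b) \<in> set ?t \<Longrightarrow> b \<noteq> \<one>\<^bsub>G v\<^esub>"
      proof -
        assume "(v, b) \<in> set ?t"
        then have "v \<in> S" "b = y v" using setvs by auto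
        then show ?thesis using xy[of v] by simp
      qed
      moreover have "(v, b) = (w, z') \<Longrightarrow> b \<noteq> \<one>\<^bsub>G v\<^esub>" using z'nt by blast
      ultimately show ?thesis using vb nt[of v b] by auto
    qed
    have "length c \<le> length (?s @ [(w, z)])"
      using approximately_inner_length[OF \<phi> szW uW kc eq cr _ c(1,2)] unt by blast
    then show ?thesis using c(3) by simp
  qed
qed

end

section \<open>One conjugator for a component of the complement graph\<close>

context residual_graph_prod
begin

lemma maps_into_conj:
  assumes v: "v \<in> V" "x \<in> carrier (G v)" and \<phi>: "\<phi> (incl v x) \<in> carrier GP" and g: "g \<in> carrier GP" "k \<in> carrier GP"
  shows "maps_into (\<lambda>x\<in>carrier GP. inv\<^bsub>GP\<^esub> g \<otimes>\<^bsub>GP\<^esub> \<phi> x \<otimes>\<^bsub>GP\<^esub> g) v k x \<longleftrightarrow> maps_into \<phi> v (g \<otimes>\<^bsub>GP\<^esub> k) x"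
  unfolding maps_into_def
proof (rule bex_cong[OF HOL.refl])
  fix x' assume x': "x' \<in> carrier (G v)"
  let ?Y = "k \<otimes>\<^bsub>GP\<^esub> incl v x' \<otimes>\<^bsub>GP\<^esub> inv\<^bsub>GP\<^esub> k"
  have Y: "?Y \<in> carrier GP" using g v x' by simp
  have "(g \<otimes>\<^bsub>GP\<^esub> k) \<otimes>\<^bsub>GP\<^esub> incl v x' \<otimes>\<^bsub>GP\<^esub> inv\<^bsub>GP\<^esub> (g \<otimes>\<^bsub>GP\<^esub> k) = g \<otimes>\<^bsub>GP\<^esub> ?Y \<otimes>\<^bsub>GP\<^esub> inv\<^bsub>GP\<^esub> g"
    using g v x' by (simp add: GP.inv_mult_group GP.m_assoc)
  then show "(\<lambda>x\<in>carrier GP. inv\<^bsub>GP\<^esub> g \<otimes>\<^bsub>GP\<^esub> \<phi> x \<otimes>\<^bsub>GP\<^esub> g) (incl v x) = ?Y \<longleftrightarrow>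
      \<phi> (incl v x) = (g \<otimes>\<^bsub>GP\<^esub> k) \<otimes>\<^bsub>GP\<^esub> incl v x' \<otimes>\<^bsub>GP\<^esub> inv\<^bsub>GP\<^esub> (g \<otimes>\<^bsub>GP\<^esub> k)"
    using GP.conj_cancel[OF g(1) \<phi> Y] v by simp
qed

text \<open>Conjugate so that one nontrivial element \<open>x0\<close> is mapped into
  \<open>G v\<close>. For any other \<open>z\<close>, \<open>normalizing_conjugator\<close> with the
  one-vertex walk at \<open>v\<close> gives a conjugator that normalises \<open>G v\<close>, so the
  image of \<open>z\<close> lies in \<open>G v\<close> as well: the conjugator found for
  \<open>x0\<close> serves them all.\<close>

lemma vertex_group_image:
  assumes \<phi>: "approximately_inner p GP \<phi>" and v: "v \<in> V" and nt: "carrier (G v) \<noteq> {\<one>\<^bsub>G v\<^esub>}"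
  shows "\<exists>g\<in>carrier GP. \<forall>z\<in>carrier (G v). maps_into \<phi> v g z"
proof -
  have one: "\<one>\<^bsub>G v\<^esub> \<in> carrier (G v)" using groups[OF v] by (simp add: group.is_monoid monoid.one_closed)
  obtain x0 where x0: "x0 \<in> carrier (G v)" "x0 \<noteq> \<one>\<^bsub>G v\<^esub>" using nt one by blast
  obtain g where g: "g \<in> carrier GP" "maps_into \<phi> v g x0"
    using vertex_element_image[OF \<phi> v x0(1)] unfolding maps_into_def by blast
  let ?\<psi> = "\<lambda>x\<in>carrier GP. inv\<^bsub>GP\<^esub> g \<otimes>\<^bsub>GP\<^esub> \<phi> x \<otimes>\<^bsub>GP\<^esub> g"
  have \<psi>: "approximately_inner p GP ?\<psi>" by (rule GP.approximately_inner_conj[OF \<phi> g(1)])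
  have conj: "maps_into ?\<psi> v k x \<longleftrightarrow> maps_into \<phi> v (g \<otimes>\<^bsub>GP\<^esub> k) x"
    if "x \<in> carrier (G v)" "k \<in> carrier GP" for k x
    using maps_into_conj[OF v that(1) _ g(1) that(2)] GP.approximately_inner_hom(2)[OF \<phi>] v that(1) by simp
  have base: "maps_into ?\<psi> v \<one>\<^bsub>GP\<^esub> x0" using conj[OF x0(1)] g by simp
  have "maps_into ?\<psi> v \<one>\<^bsub>GP\<^esub> z" if z: "z \<in> carrier (G v)" for z
  proof (cases "z = \<one>\<^bsub>G v\<^esub>")
    case True
    have "?\<psi> (incl v z) = incl v \<one>\<^bsub>G v\<^esub>" using GP.approximately_inner_hom(4)[OF \<psi>] True v by simp
    then show ?thesis using one maps_into_one[OF v] by blast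
  next
    case False
    obtain h where h: "h \<in> carrier GP" "maps_into ?\<psi> v h z"
      using vertex_element_image[OF \<psi> v z] unfolding maps_into_def by blast
    have "\<exists>k. normalizes {v} k \<and> (\<forall>z\<in>{z}. maps_into ?\<psi> v k z)"
    proof (rule normalizing_conjugator[OF \<psi> _ _ _ v _ _ h(1)])
      show "\<exists>vs. closed_walk {v} a vs" if "a \<in> {v}" for a
        using that by (intro exI[of _ "[v]"]) (auto simp: closed_walk_def)
    qed (use v z False h base x0 in auto)
    then obtain k where k: "normalizes {v} k" "maps_into ?\<psi> v k z" by blast
    then obtain z' where z': "z' \<in> carrier (G v)" "?\<psi> (incl v z) = k \<otimes>\<^bsub>GP\<^esub> incl v z' \<otimes>\<^bsub>GP\<^esub> inv\<^bsub>GP\<^esub> k"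
      unfolding maps_into_def by blast
    then obtain z'' where "z'' \<in> carrier (G v)" "?\<psi> (incl v z) = incl v z''"
      using k(1) unfolding normalizes_def by (metis singletonI)
    then show ?thesis using maps_into_one[OF v] by blast
  qed
  then have "\<forall>z\<in>carrier (G v). maps_into \<phi> v g z" using conj g(1) by simp
  then show ?thesis using g(1) by blast
qed

text \<open>Walks can be retraced: a new last vertex \<open>w\<close> is reached by a detour from
  \<open>last L\<close> and back, or \<open>w\<close> itself becomes the base point.\<close>

lemma closed_walks:
  assumes "successively nc L" "L \<noteq> []" "a \<in> set L"
  shows "\<exists>vs. closed_walk (set L) a vs"
  using assms(2,1,3)
proof (induction L arbitrary: a rule: rev_nonempty_induct)
  case (single x)
  then show ?case by (intro exI[of _ "[x]"]) (auto simp: closed_walk_def)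
next
  case (snoc w L)
  have L: "successively nc L" "nc (last L) w" using snoc by (auto simp: successively_append_iff)
  note IH = snoc.IH[OF L(1)]
  show ?case
  proof (cases "a \<in> set L")
    case True
    then obtain vs where vs: "closed_walk (set L) a vs" using IH by blast
    have "last L \<in> set vs" using vs snoc.hyps by (simp add: closed_walk_def)
    then obtain s1 s2 where s: "vs = s1 @ last L # s2" by (auto simp: in_set_conv_decomp)
    have "closed_walk (set (L @ [w])) a (s1 @ [last L, w] @ last L # s2)"
      using vs L(2) nc_sym[OF L(2)] unfolding closed_walk_def s
      by (auto simp: successively_append_iff successively_Cons hd_append)
    then show ?thesis by blast
  next
    case False
    then have a: "a = w" using snoc.prems by simp
    obtain vs where vs: "closed_walk (set L) (last L) vs" using IH[of "last L"] snoc.hyps by auto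
    then have "closed_walk (set (L @ [w])) w (w # vs @ [w])"
      using L(2) nc_sym[OF L(2)] by (auto simp: closed_walk_def successively_append_iff successively_Cons)
    then show ?thesis using a by blast
  qed
qed

text \<open>Induction along the walk. After a conjugation the earlier vertex groups are mapped into
  themselves, and the conjugator for the next one can be chosen to normalise all of them, so it
  serves the longer walk.\<close>

lemma walk_groups_image:
  assumes \<phi>: "approximately_inner p GP \<phi>" and nt: "\<And>v. v \<in> V \<Longrightarrow> carrier (G v) \<noteq> {\<one>\<^bsub>G v\<^esub>}"
    and L: "successively nc L" "L \<noteq> []" "set L \<subseteq> V"
  shows "\<exists>g\<in>carrier GP. \<forall>a\<in>set L. \<forall>x\<in>carrier (G a). maps_into \<phi> a g x"
  using L(2,1,3)
proof (induction L rule: rev_nonempty_induct)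
  case (single v)
  then show ?case using vertex_group_image[OF \<phi> _ nt] by auto
next
  case (snoc w L)
  have L: "successively nc L" "set L \<subseteq> V" and w: "w \<in> V" using snoc by (auto simp: successively_append_iff)
  obtain g where g: "g \<in> carrier GP" "\<forall>a\<in>set L. \<forall>x\<in>carrier (G a). maps_into \<phi> a g x"
    using snoc.IH[OF L] by blast
  let ?\<psi> = "\<lambda>x\<in>carrier GP. inv\<^bsub>GP\<^esub> g \<otimes>\<^bsub>GP\<^esub> \<phi> x \<otimes>\<^bsub>GP\<^esub> g"
  have \<psi>: "approximately_inner p GP ?\<psi>" by (rule GP.approximately_inner_conj[OF \<phi> g(1)])
  have conj: "maps_into ?\<psi> v k x \<longleftrightarrow> maps_into \<phi> v (g \<otimes>\<^bsub>GP\<^esub> k) x"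
    if "v \<in> V" "x \<in> carrier (G v)" "k \<in> carrier GP" for v k x
    using maps_into_conj[OF that(1,2) _ g(1) that(3)] GP.approximately_inner_hom(2)[OF \<phi>] that by simp
  have base: "maps_into ?\<psi> a \<one>\<^bsub>GP\<^esub> x" if "a \<in> set L" "x \<in> carrier (G a)" for a x
    using conj[of a x "\<one>\<^bsub>GP\<^esub>"] that L(2) g by auto
  obtain h where h: "h \<in> carrier GP" "\<forall>z\<in>carrier (G w). maps_into ?\<psi> w h z"
    using vertex_group_image[OF \<psi> w nt[OF w]] by blast
  have ex: "\<exists>x\<in>carrier (G a) - {\<one>\<^bsub>G a\<^esub>}. True" if "a \<in> V" for a
  proof -
    have "\<one>\<^bsub>G a\<^esub> \<in> carrier (G a)" using groups[OF that] by (simp add: group.is_monoid monoid.one_closed)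
    then show ?thesis using nt[OF that] by blast
  qed
  have "\<exists>k. normalizes (set L) k \<and> (\<forall>z\<in>carrier (G w). maps_into ?\<psi> w k z)"
  proof (rule normalizing_conjugator[OF \<psi> L(2) _ _ w _ _ h(1)])
    show "\<exists>vs. closed_walk (set L) a vs" if "a \<in> set L" for a
      by (rule closed_walks[OF L(1) snoc.hyps that])
    show "\<exists>x\<in>carrier (G a) - {\<one>\<^bsub>G a\<^esub>}. maps_into ?\<psi> a \<one>\<^bsub>GP\<^esub> x" if "a \<in> set L" for a
      using base[OF that] ex[of a] that L(2) by blast
    show "\<exists>z\<in>carrier (G w). z \<noteq> \<one>\<^bsub>G w\<^esub>" using ex[OF w] by blast
  qed (use h in auto)
  then obtain k where k: "normalizes (set L) k" "\<forall>z\<in>carrier (G w). maps_into ?\<psi> w k z" by blast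
  have kc: "k \<in> carrier GP" using k by (simp add: normalizes_def)
  have "maps_into ?\<psi> a k x" if a: "a \<in> set L" and x: "x \<in> carrier (G a)" for a x
  proof -
    have aV: "a \<in> V" using a L(2) by blast
    obtain x' where x': "x' \<in> carrier (G a)" "?\<psi> (incl a x) = incl a x'"
      using base[OF a x] maps_into_one[OF aV] by blast
    obtain y where y: "y \<in> carrier (G a)" "inv\<^bsub>GP\<^esub> k \<otimes>\<^bsub>GP\<^esub> incl a x' \<otimes>\<^bsub>GP\<^esub> k = incl a y"
      using k(1) a x'(1) unfolding normalizes_def by blast
    have "incl a x' = k \<otimes>\<^bsub>GP\<^esub> incl a y \<otimes>\<^bsub>GP\<^esub> inv\<^bsub>GP\<^esub> k"
      using GP.conj_cancel[OF kc, of "incl a x'" "incl a y"] y x'(1) aV by simp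
    then show ?thesis using x'(2) y(1) unfolding maps_into_def by auto
  qed
  then have "\<forall>a\<in>set (L @ [w]). \<forall>x\<in>carrier (G a). maps_into ?\<psi> a k x" using k(2) by auto
  then have "\<forall>a\<in>set (L @ [w]). \<forall>x\<in>carrier (G a). maps_into \<phi> a (g \<otimes>\<^bsub>GP\<^esub> k) x"
  proof (intro ballI)
    fix a x assume a: "a \<in> set (L @ [w])" and x: "x \<in> carrier (G a)"
    then have aV: "a \<in> V" using L(2) w by auto
    show "maps_into \<phi> a (g \<otimes>\<^bsub>GP\<^esub> k) x"
      using conj[OF aV x kc] \<open>\<forall>a\<in>set (L @ [w]). _ a\<close> a x by blast
  qed
  then show ?case using g(1) kc by blast
qed

definition inner_on :: "(('v \<times> 'a) list set set \<Rightarrow> ('v \<times> 'a) list set set) \<Rightarrow> 'v set \<Rightarrow> ('v \<times> 'a) list set set \<Rightarrow> bool" where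
  "inner_on \<phi> S g \<longleftrightarrow> g \<in> carrier GP \<and> (\<forall>a\<in>S. \<forall>x\<in>carrier (G a). \<phi> (incl a x) = g \<otimes>\<^bsub>GP\<^esub> incl a x \<otimes>\<^bsub>GP\<^esub> inv\<^bsub>GP\<^esub> g)"

text \<open>Once the vertex groups are mapped into themselves, each element is compared with a
  nontrivial element at a complement neighbour by \<open>approximately_inner_pair\<close> and found
  to be fixed.\<close>

lemma inner_on_walk:
  assumes \<phi>: "approximately_inner p GP \<phi>" and nt: "\<And>v. v \<in> V \<Longrightarrow> carrier (G v) \<noteq> {\<one>\<^bsub>G v\<^esub>}"
    and L: "successively nc L" "L \<noteq> []" "set L \<subseteq> V" and nb: "\<And>a. a \<in> set L \<Longrightarrow> \<exists>b\<in>set L. nc a b"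
  shows "\<exists>g. inner_on \<phi> (set L) g"
proof -
  obtain g where g: "g \<in> carrier GP" "\<forall>a\<in>set L. \<forall>x\<in>carrier (G a). maps_into \<phi> a g x"
    using walk_groups_image[OF \<phi> nt L] by blast
  let ?\<psi> = "\<lambda>x\<in>carrier GP. inv\<^bsub>GP\<^esub> g \<otimes>\<^bsub>GP\<^esub> \<phi> x \<otimes>\<^bsub>GP\<^esub> g"
  have \<psi>: "approximately_inner p GP ?\<psi>" by (rule GP.approximately_inner_conj[OF \<phi> g(1)])
  have base: "\<exists>x'\<in>carrier (G a). ?\<psi> (incl a x) = incl a x'" if "a \<in> set L" "x \<in> carrier (G a)" for a x
  proof -
    have aV: "a \<in> V" using that L(3) by blast
    have "maps_into ?\<psi> a \<one>\<^bsub>GP\<^esub> x"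
      using maps_into_conj[OF aV that(2) _ g(1) GP.one_closed] GP.approximately_inner_hom(2)[OF \<phi>] aV that g by simp
    then show ?thesis using maps_into_one[OF aV] by blast
  qed
  have id: "?\<psi> (incl a x) = incl a x" if a: "a \<in> set L" and x: "x \<in> carrier (G a)" for a x
  proof (cases "x = \<one>\<^bsub>G a\<^esub>")
    case True
    have "a \<in> V" using a L(3) by blast
    then show ?thesis using GP.approximately_inner_hom(4)[OF \<psi>] True by simp
  next
    case False
    obtain b where b: "b \<in> set L" "nc a b" using nb[OF a] by blast
    have V: "a \<in> V" "b \<in> V" using a b L(3) by auto
    have "\<one>\<^bsub>G b\<^esub> \<in> carrier (G b)" using groups[OF V(2)] by (simp add: group.is_monoid monoid.one_closed)
    then obtain y where y: "y \<in> carrier (G b)" "y \<noteq> \<one>\<^bsub>G b\<^esub>" using nt[OF V(2)] by blast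
    obtain x' where x': "x' \<in> carrier (G a)" "?\<psi> (incl a x) = incl a x'" using base[OF a x] by blast
    obtain y' where y': "y' \<in> carrier (G b)" "?\<psi> (incl b y) = incl b y'" using base[OF b(1) y(1)] by blast
    have "?\<psi> (incl a x \<otimes>\<^bsub>GP\<^esub> incl b y) = incl a x' \<otimes>\<^bsub>GP\<^esub> incl b y'"
      using GP.approximately_inner_hom(3)[OF \<psi>, of "incl a x" "incl b y"] V x y x'(2) y'(2) by (simp only: incl_closed)
    then have "x' = x"
      by (rule approximately_inner_pair[OF \<psi> V b(2) x False x'(1) y y'(1)])
    then show ?thesis using x'(2) by simp
  qed
  have "\<phi> (incl a x) = g \<otimes>\<^bsub>GP\<^esub> incl a x \<otimes>\<^bsub>GP\<^esub> inv\<^bsub>GP\<^esub> g" if a: "a \<in> set L" and x: "x \<in> carrier (G a)" for a x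
  proof -
    have X: "incl a x \<in> carrier GP" using a x L(3) by auto
    have "\<phi> (incl a x) \<in> carrier GP" by (rule GP.approximately_inner_hom(2)[OF \<phi> X])
    then show ?thesis using GP.conj_cancel[OF g(1) _ X] id[OF a x] X by simp
  qed
  then show ?thesis using g(1) unfolding inner_on_def by blast
qed

end

section \<open>Inner on all vertex groups\<close>

context residual_graph_prod
begin

lemma inner_on_conj:
  assumes \<phi>: "approximately_inner p GP \<phi>" and S: "S \<subseteq> V" and g: "g \<in> carrier GP"
    and k: "inner_on (\<lambda>x\<in>carrier GP. inv\<^bsub>GP\<^esub> g \<otimes>\<^bsub>GP\<^esub> \<phi> x \<otimes>\<^bsub>GP\<^esub> g) S k"
  shows "inner_on \<phi> S (g \<otimes>\<^bsub>GP\<^esub> k)"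
  unfolding inner_on_def
proof (intro conjI ballI)
  have kc: "k \<in> carrier GP" using k by (simp add: inner_on_def)
  then show "g \<otimes>\<^bsub>GP\<^esub> k \<in> carrier GP" using g by simp
  fix a x assume a: "a \<in> S" and x: "x \<in> carrier (G a)"
  have X: "incl a x \<in> carrier GP" using a x S by auto
  have Y: "k \<otimes>\<^bsub>GP\<^esub> incl a x \<otimes>\<^bsub>GP\<^esub> inv\<^bsub>GP\<^esub> k \<in> carrier GP" using kc X by simp
  have "(\<lambda>x\<in>carrier GP. inv\<^bsub>GP\<^esub> g \<otimes>\<^bsub>GP\<^esub> \<phi> x \<otimes>\<^bsub>GP\<^esub> g) (incl a x) = k \<otimes>\<^bsub>GP\<^esub> incl a x \<otimes>\<^bsub>GP\<^esub> inv\<^bsub>GP\<^esub> k"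
    using k a x unfolding inner_on_def by blast
  then have "inv\<^bsub>GP\<^esub> g \<otimes>\<^bsub>GP\<^esub> \<phi> (incl a x) \<otimes>\<^bsub>GP\<^esub> g = k \<otimes>\<^bsub>GP\<^esub> incl a x \<otimes>\<^bsub>GP\<^esub> inv\<^bsub>GP\<^esub> k" using X by simp
  then have "\<phi> (incl a x) = g \<otimes>\<^bsub>GP\<^esub> (k \<otimes>\<^bsub>GP\<^esub> incl a x \<otimes>\<^bsub>GP\<^esub> inv\<^bsub>GP\<^esub> k) \<otimes>\<^bsub>GP\<^esub> inv\<^bsub>GP\<^esub> g"
    using GP.conj_cancel[OF g GP.approximately_inner_hom(2)[OF \<phi> X] Y] by simp
  then show "\<phi> (incl a x) = (g \<otimes>\<^bsub>GP\<^esub> k) \<otimes>\<^bsub>GP\<^esub> incl a x \<otimes>\<^bsub>GP\<^esub> inv\<^bsub>GP\<^esub> (g \<otimes>\<^bsub>GP\<^esub> k)"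
    using g kc X by (simp add: GP.inv_mult_group GP.m_assoc)
qed

text \<open>Every type lies in the star of a central vertex, so each letter of a word for
  \<open>k\<close> normalises its group.\<close>

lemma central_normalized:
  assumes v: "central_vertex V E v" and k: "k \<in> carrier GP"
  shows "normalizes {v} k"
proof -
  have vV: "v \<in> V" using v by (simp add: central_vertex_def)
  obtain w where w: "w \<in> W" "k = val w" using k carrier_GP by blast
  have "normalizes {v} (val w)"
    using w(1)
  proof (induction w rule: rev_induct)
    case Nil
    then show ?case using normalizes_one vV by simp
  next
    case (snoc l w)
    then have l: "fst l \<in> V" "snd l \<in> carrier (G (fst l))" and w: "w \<in> W" by auto
    have "\<not> nc (fst l) a" if "a \<in> {v}" for a
      using v l(1) that by (auto simp: nc_def central_vertex_def)
    then have "normalizes {v} (val w \<otimes>\<^bsub>GP\<^esub> incl (fst l) (snd l))"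
      using normalizes_mult_letter[OF _ snoc.IH[OF w] l] vV by blast
    then show ?case using l w by (simp add: val_append)
  qed
  then show ?thesis using w(2) by simp
qed

text \<open>A central vertex has no complement neighbour to compare with. Instead
  \<open>\<phi>\<close> restricts to an automorphism of \<open>G v\<close>, which is approximately
  inner by pulling subgroups back along the retraction, so that \<open>p_IAS\<close> applies.
  Surjectivity of the restriction comes from the inverse of \<open>\<phi>\<close>, which is
  approximately inner too.\<close>

lemma inner_on_central:
  assumes \<phi>: "approximately_inner p GP \<phi>" and nt: "carrier (G v) \<noteq> {\<one>\<^bsub>G v\<^esub>}"
    and v: "central_vertex V E v" and ias: "p_IAS p (G v)"
  shows "\<exists>g. inner_on \<phi> {v} g"
proof -
  have vV: "v \<in> V" using v by (simp add: central_vertex_def)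
  interpret r: group_hom GP "G v" "retr v" by (rule retr_group_hom[OF vV])
  have stays: "\<exists>x'\<in>carrier (G v). \<psi> (incl v x) = incl v x'"
    if \<psi>: "approximately_inner p GP \<psi>" and x: "x \<in> carrier (G v)" for \<psi> x
  proof -
    obtain g where g: "g \<in> carrier GP" "maps_into \<psi> v g x"
      using vertex_group_image[OF \<psi> vV nt] x by blast
    then obtain y where y: "y \<in> carrier (G v)" "\<psi> (incl v x) = g \<otimes>\<^bsub>GP\<^esub> incl v y \<otimes>\<^bsub>GP\<^esub> inv\<^bsub>GP\<^esub> g"
      unfolding maps_into_def by blast
    then show ?thesis using central_normalized[OF v g(1)] unfolding normalizes_def by simp
  qed
  have \<phi>a: "\<phi> \<in> auto GP" using \<phi> unfolding approximately_inner_def by blast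
  obtain \<phi>' where \<phi>': "\<phi>' \<in> auto GP" "\<And>x. x \<in> carrier GP \<Longrightarrow> \<phi> (\<phi>' x) = x"
  proof (rule GP.auto_inverse[OF \<phi>a])
    fix \<psi> assume "\<psi> \<in> auto GP" "\<And>x. x \<in> carrier GP \<Longrightarrow> \<phi> (\<psi> x) = x"
    then show ?thesis by (rule that)
  qed
  have ap': "approximately_inner p GP \<phi>'" by (rule GP.approximately_inner_inverse[OF \<phi> \<phi>'])
  define f where "f = (\<lambda>x\<in>carrier (G v). retr v (\<phi> (incl v x)))"
  have f: "f x \<in> carrier (G v)" "\<phi> (incl v x) = incl v (f x)" if x: "x \<in> carrier (G v)" for x
  proof -
    obtain x' where "x' \<in> carrier (G v)" "\<phi> (incl v x) = incl v x'" using stays[OF \<phi> x] by blast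
    then show "f x \<in> carrier (G v)" "\<phi> (incl v x) = incl v (f x)"
      using x retr_incl[OF vV vV] by (simp_all add: f_def)
  qed
  have fh: "f \<in> hom (G v) (G v)"
  proof (rule homI)
    fix x y assume x: "x \<in> carrier (G v)" and y: "y \<in> carrier (G v)"
    have "incl v (f (x \<otimes>\<^bsub>G v\<^esub> y)) = \<phi> (incl v (x \<otimes>\<^bsub>G v\<^esub> y))" using f(2) x y by simp
    also have "\<dots> = incl v (f x \<otimes>\<^bsub>G v\<^esub> f y)"
      using GP.approximately_inner_hom(3)[OF \<phi>] f x y vV by (simp add: incl_mult)
    finally show "f (x \<otimes>\<^bsub>G v\<^esub> y) = f x \<otimes>\<^bsub>G v\<^esub> f y"
      using incl_inj[OF vV f(1)[OF r.H.m_closed[OF x y]]] f(1) x y by simp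
  qed (rule f(1))
  have "bij_betw f (carrier (G v)) (carrier (G v))"
    unfolding bij_betw_def
  proof
    show "inj_on f (carrier (G v))"
    proof (rule inj_onI)
      fix x y assume x: "x \<in> carrier (G v)" and y: "y \<in> carrier (G v)" and e: "f x = f y"
      have "\<phi> (incl v x) = \<phi> (incl v y)" using f(2) x y e by simp
      then have "incl v x = incl v y" using GP.approximately_inner_hom(5)[OF \<phi>] x y vV by simp
      then show "x = y" by (rule incl_inj[OF vV x y])
    qed
    show "f ` carrier (G v) = carrier (G v)"
    proof
      show "carrier (G v) \<subseteq> f ` carrier (G v)"
      proof
        fix y assume y: "y \<in> carrier (G v)"
        obtain x where x: "x \<in> carrier (G v)" "\<phi>' (incl v y) = incl v x" using stays[OF ap' y] by blast
        have "incl v y = incl v (f x)" using \<phi>'(2)[of "incl v y"] x y f(2)[OF x(1)] vV by simp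
        then have "y = f x" by (rule incl_inj[OF vV y f(1)[OF x(1)]])
        then show "y \<in> f ` carrier (G v)" using x(1) by blast
      qed
    qed (use f(1) in blast)
  qed
  then have fa: "f \<in> auto (G v)" using fh by (intro r.H.autoI) (simp_all add: f_def)
  have "approximately_inner p (G v) f"
    unfolding approximately_inner_def
  proof (intro conjI allI impI fa)
    fix N assume N: "p_normal p N (G v)"
    obtain g where g: "g \<in> carrier GP" "\<forall>x\<in>carrier GP.
        \<phi> x \<otimes>\<^bsub>GP\<^esub> inv\<^bsub>GP\<^esub> (g \<otimes>\<^bsub>GP\<^esub> x \<otimes>\<^bsub>GP\<^esub> inv\<^bsub>GP\<^esub> g) \<in> {x \<in> carrier GP. retr v x \<in> N}"
      using \<phi> r.p_normal_vimage[OF prime_p N] unfolding approximately_inner_def by blast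
    show "\<exists>g\<in>carrier (G v). \<forall>x\<in>carrier (G v). f x \<otimes>\<^bsub>G v\<^esub> inv\<^bsub>G v\<^esub> (g \<otimes>\<^bsub>G v\<^esub> x \<otimes>\<^bsub>G v\<^esub> inv\<^bsub>G v\<^esub> g) \<in> N"
    proof (intro bexI ballI)
      fix x assume x: "x \<in> carrier (G v)"
      have X: "incl v x \<in> carrier GP" using vV x by simp
      have "retr v (\<phi> (incl v x) \<otimes>\<^bsub>GP\<^esub> inv\<^bsub>GP\<^esub> (g \<otimes>\<^bsub>GP\<^esub> incl v x \<otimes>\<^bsub>GP\<^esub> inv\<^bsub>GP\<^esub> g)) \<in> N"
        using bspec[OF g(2) X] by simp
      then show "f x \<otimes>\<^bsub>G v\<^esub> inv\<^bsub>G v\<^esub> (retr v g \<otimes>\<^bsub>G v\<^esub> x \<otimes>\<^bsub>G v\<^esub> inv\<^bsub>G v\<^esub> retr v g) \<in> N"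
        using f[OF x] g(1) X retr_incl[OF vV vV] x vV by simp
    qed (use g in simp)
  qed
  then have "f \<in> Inn (G v)" by (rule r.H.p_IAS_approximately_inner[OF ias])
  then obtain y where y: "y \<in> carrier (G v)" "f = (\<lambda>x\<in>carrier (G v). y \<otimes>\<^bsub>G v\<^esub> x \<otimes>\<^bsub>G v\<^esub> inv\<^bsub>G v\<^esub> y)"
    unfolding Inn_def by blast
  have "inner_on \<phi> {v} (incl v y)"
    unfolding inner_on_def
  proof (intro conjI ballI)
    fix a x assume "a \<in> {v}" "x \<in> carrier (G a)"
    then have a: "a = v" and x: "x \<in> carrier (G v)" by auto
    have "\<phi> (incl v x) = incl v (y \<otimes>\<^bsub>G v\<^esub> x \<otimes>\<^bsub>G v\<^esub> inv\<^bsub>G v\<^esub> y)"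
      using f(2)[OF x] fun_cong[OF y(2), of x] x by simp
    then show "\<phi> (incl a x) = incl v y \<otimes>\<^bsub>GP\<^esub> incl a x \<otimes>\<^bsub>GP\<^esub> inv\<^bsub>GP\<^esub> (incl v y)"
      using a x y(1) vV by (simp add: incl_mult incl_inv)
  qed (use vV y in simp)
  then show ?thesis by blast
qed

text \<open>These sets are the unions of components of the complement graph.\<close>

definition joined :: "'v set \<Rightarrow> bool" where
  "joined C \<longleftrightarrow> C \<subseteq> V \<and> (\<forall>a\<in>C. \<forall>u\<in>V - C. {u, a} \<in> E)"

text \<open>A walk in the complement graph through \<open>v\<close> that visits as many vertices as
  possible covers the component of \<open>v\<close>. If this is \<open>v\<close> alone, then
  \<open>v\<close> is central; otherwise each of its vertices has a complement neighbour in
  it.\<close>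

lemma inner_on_joined_part:
  assumes \<phi>: "approximately_inner p GP \<phi>" and nt: "\<And>v. v \<in> V \<Longrightarrow> carrier (G v) \<noteq> {\<one>\<^bsub>G v\<^esub>}"
    and ias: "\<And>v. central_vertex V E v \<Longrightarrow> p_IAS p (G v)" and v: "v \<in> V"
  shows "\<exists>C. v \<in> C \<and> joined C \<and> (\<exists>g. inner_on \<phi> C g)"
proof -
  define Q where "Q L \<longleftrightarrow> successively nc L \<and> L \<noteq> [] \<and> v \<in> set L \<and> set L \<subseteq> V" for L
  have Q0: "Q [v]" using v by (simp add: Q_def)
  have "card (set L) < Suc (card V)" if "Q L" for L
    using that finite_vertices by (simp add: Q_def card_mono le_imp_less_Suc)
  then obtain L where L: "Q L" and max: "\<And>L'. Q L' \<Longrightarrow> card (set L') \<le> card (set L)"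
    using ex_has_greatest_nat[of Q "[v]" "\<lambda>L. card (set L)" "Suc (card V)"] Q0 by blast
  have LQ: "successively nc L" "L \<noteq> []" "v \<in> set L" "set L \<subseteq> V" using L by (auto simp: Q_def)
  have edge: "{u, a} \<in> E" if a: "a \<in> set L" and u: "u \<in> V - set L" for a u
  proof (rule ccontr)
    assume "{u, a} \<notin> E"
    then have "nc a u" using a u by (auto simp: nc_def insert_commute)
    \<comment> \<open>A closed walk back to \<open>a\<close> could be continued to \<open>u\<close>
      and would visit one vertex more.\<close>
    obtain vs where vs: "closed_walk (set L) a vs" using closed_walks[OF LQ(1,2) a] by blast
    then have "Q (vs @ [u])"
      using \<open>nc a u\<close> u LQ by (auto simp: Q_def closed_walk_def successively_append_iff)
    then have "card (set (vs @ [u])) \<le> card (set L)" by (rule max)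
    then show False using vs u by (simp add: closed_walk_def)
  qed
  then have J: "joined (set L)" using LQ(4) by (simp add: joined_def)
  show ?thesis
  proof (cases "set L = {v}")
    case True
    then have "central_vertex V E v" using edge v by (simp add: central_vertex_def)
    then have "\<exists>g. inner_on \<phi> (set L) g" using inner_on_central[OF \<phi> nt[OF v]] ias True by simp
    then show ?thesis using J LQ(3) by blast
  next
    case False
    have "\<exists>b\<in>set L. nc a b" if a: "a \<in> set L" for a
    proof -
      obtain vs where vs: "closed_walk (set L) a vs" using closed_walks[OF LQ(1,2) a] by blast
      then obtain ws where ws: "vs = a # ws" by (cases vs) (auto simp: closed_walk_def)
      have "ws \<noteq> []"
      proof
        assume "ws = []"
        then have "set L = {a}" using vs ws by (simp add: closed_walk_def)
        then show False using False LQ(3) by auto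
      qed
      then obtain b us where "ws = b # us" by (cases ws) auto
      then show ?thesis using vs ws by (auto simp: closed_walk_def)
    qed
    then have "\<exists>g. inner_on \<phi> (set L) g" using inner_on_walk[OF \<phi> nt LQ(1,2,4)] by blast
    then show ?thesis using J LQ(3) by blast
  qed
qed

lemma val_commute:
  assumes w: "w \<in> W" "\<And>l. l \<in> set w \<Longrightarrow> {fst l, a} \<in> E" and x: "a \<in> V" "x \<in> carrier (G a)"
  shows "val w \<otimes>\<^bsub>GP\<^esub> incl a x = incl a x \<otimes>\<^bsub>GP\<^esub> val w"
  using w
proof (induction w)
  case (Cons l w)
  then have l: "fst l \<in> V" "snd l \<in> carrier (G (fst l))" "w \<in> W" by auto
  have e: "incl (fst l) (snd l) \<otimes>\<^bsub>GP\<^esub> incl a x = incl a x \<otimes>\<^bsub>GP\<^esub> incl (fst l) (snd l)"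
    using incl_commute Cons.prems(2)[of l] l x by simp
  have "val (l # w) \<otimes>\<^bsub>GP\<^esub> incl a x = incl (fst l) (snd l) \<otimes>\<^bsub>GP\<^esub> (val w \<otimes>\<^bsub>GP\<^esub> incl a x)"
    using l x by (simp add: GP.m_assoc)
  also have "\<dots> = (incl (fst l) (snd l) \<otimes>\<^bsub>GP\<^esub> incl a x) \<otimes>\<^bsub>GP\<^esub> val w"
    using Cons l x by (simp add: GP.m_assoc)
  finally show ?case unfolding e using l x by (simp add: GP.m_assoc)
qed (use x in simp)

text \<open>Letters outside \<open>C\<close> commute with those inside, so they can be sorted to the
  right.\<close>

lemma joined_decomposition:
  assumes C: "joined C" and w: "w \<in> W"
  shows "\<exists>w1\<in>W. \<exists>w2\<in>W. fst ` set w1 \<subseteq> C \<and> fst ` set w2 \<subseteq> V - C \<and> val w = val w1 \<otimes>\<^bsub>GP\<^esub> val w2"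
  using w
proof (induction w)
  case Nil
  then show ?case by (intro bexI[of _ "[]"]) auto
next
  case (Cons l w)
  then have l: "fst l \<in> V" "snd l \<in> carrier (G (fst l))" and "w \<in> W" by auto
  then obtain w1 w2 where ws: "w1 \<in> W" "w2 \<in> W" "fst ` set w1 \<subseteq> C" "fst ` set w2 \<subseteq> V - C"
    "val w = val w1 \<otimes>\<^bsub>GP\<^esub> val w2" using Cons.IH by blast
  show ?case
  proof (cases "fst l \<in> C")
    case True
    then show ?thesis using l ws by (intro bexI[of _ "l # w1"] bexI[of _ w2]) (auto simp: GP.m_assoc)
  next
    case False
    have "{fst m, fst l} \<in> E" if "m \<in> set w1" for m
    proof -
      have "fst m \<in> C" using ws(3) that by auto
      then show ?thesis using C l(1) False unfolding joined_def by (metis DiffI insert_commute)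
    qed
    then have "val w1 \<otimes>\<^bsub>GP\<^esub> incl (fst l) (snd l) = incl (fst l) (snd l) \<otimes>\<^bsub>GP\<^esub> val w1"
      using val_commute[OF ws(1) _ l] by blast
    then have "val (l # w) = val w1 \<otimes>\<^bsub>GP\<^esub> val (l # w2)"
      using l ws by (simp add: GP.m_assoc[symmetric])
    then show ?thesis using l ws False by (intro bexI[of _ w1] bexI[of _ "l # w2"]) auto
  qed
qed

text \<open>A maximal \<open>joined\<close> set \<open>J\<close> is enlarged by a new component.
  After the conjugation on \<open>J\<close> is undone, only those letters of the new conjugator
  count whose types lie in the new part: the others commute with that part, and the kept ones
  commute with \<open>J\<close>, so a single conjugator serves both.\<close>

lemma inner_on_all:
  assumes \<phi>: "approximately_inner p GP \<phi>" and nt: "\<And>v. v \<in> V \<Longrightarrow> carrier (G v) \<noteq> {\<one>\<^bsub>G v\<^esub>}"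
    and ias: "\<And>v. central_vertex V E v \<Longrightarrow> p_IAS p (G v)"
  shows "\<exists>g. inner_on \<phi> V g"
proof -
  define Q where "Q J \<longleftrightarrow> joined J \<and> (\<exists>g. inner_on \<phi> J g)" for J
  have Q0: "Q {}" by (auto simp: Q_def joined_def inner_on_def)
  have "card J < Suc (card V)" if "Q J" for J
    using that finite_vertices by (simp add: Q_def joined_def card_mono le_imp_less_Suc)
  then obtain J where J: "Q J" and max: "\<And>J'. Q J' \<Longrightarrow> card J' \<le> card J"
    using ex_has_greatest_nat[of Q "{}" card "Suc (card V)"] Q0 by blast
  obtain g where g: "inner_on \<phi> J g" and Jj: "joined J" using J by (auto simp: Q_def)
  have JV: "J \<subseteq> V" and gc: "g \<in> carrier GP" using Jj g by (auto simp: joined_def inner_on_def)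
  have "J = V"
  proof (rule ccontr)
    assume "J \<noteq> V"
    then obtain v where v: "v \<in> V" "v \<notin> J" using JV by blast
    let ?\<psi> = "\<lambda>x\<in>carrier GP. inv\<^bsub>GP\<^esub> g \<otimes>\<^bsub>GP\<^esub> \<phi> x \<otimes>\<^bsub>GP\<^esub> g"
    have \<psi>: "approximately_inner p GP ?\<psi>" by (rule GP.approximately_inner_conj[OF \<phi> gc])
    obtain C h where C: "v \<in> C" "joined C" "inner_on ?\<psi> C h"
      using inner_on_joined_part[OF \<psi> nt ias v(1)] by blast
    \<comment> \<open>The difference of two unions of components is again one.\<close>
    let ?C = "C - J"
    have e1: "{u, a} \<in> E" if "a \<in> ?C" "u \<in> V - ?C" for a u
    proof (cases "u \<in> C")
      case True
      then have "{a, u} \<in> E" using that Jj C(2) unfolding joined_def by blast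
      then show ?thesis by (simp add: insert_commute)
    next
      case False
      then show ?thesis using that C(2) unfolding joined_def by blast
    qed
    have jC: "joined ?C" using e1 C(2) unfolding joined_def by blast
    have jU: "joined (J \<union> ?C)" using C(2) Jj unfolding joined_def by blast
    have hc: "h \<in> carrier GP" using C(3) by (simp add: inner_on_def)
    obtain w where w: "w \<in> W" "h = val w" using hc carrier_GP by blast
    obtain w1 w2 where ws: "w1 \<in> W" "w2 \<in> W" "fst ` set w1 \<subseteq> ?C" "fst ` set w2 \<subseteq> V - ?C"
      "h = val w1 \<otimes>\<^bsub>GP\<^esub> val w2" using joined_decomposition[OF jC w(1)] w(2) by blast
    have "inner_on ?\<psi> (J \<union> ?C) (val w1)"
      unfolding inner_on_def
    proof (intro conjI ballI val_closed ws(1))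
      fix a x assume a: "a \<in> J \<union> ?C" and x: "x \<in> carrier (G a)"
      have aV: "a \<in> V" using a jU by (auto simp: joined_def)
      have X: "incl a x \<in> carrier GP" using aV x by simp
      show "?\<psi> (incl a x) = val w1 \<otimes>\<^bsub>GP\<^esub> incl a x \<otimes>\<^bsub>GP\<^esub> inv\<^bsub>GP\<^esub> (val w1)"
      proof (cases "a \<in> J")
        case True
        have "\<phi> (incl a x) = g \<otimes>\<^bsub>GP\<^esub> incl a x \<otimes>\<^bsub>GP\<^esub> inv\<^bsub>GP\<^esub> g"
          using g True x unfolding inner_on_def by blast
        then have 1: "?\<psi> (incl a x) = incl a x"
          using GP.conj_cancel[OF gc GP.approximately_inner_hom(2)[OF \<phi> X] X] X by simp
        have "{fst l, a} \<in> E" if "l \<in> set w1" for l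
        proof -
          have "fst l \<in> ?C" using that ws(3) by auto
          then show ?thesis using Jj True C(2) unfolding joined_def by blast
        qed
        then have "val w1 \<otimes>\<^bsub>GP\<^esub> incl a x = incl a x \<otimes>\<^bsub>GP\<^esub> val w1"
          using val_commute[OF ws(1) _ aV x] by blast
        then show ?thesis unfolding 1 using X ws(1) by (simp add: GP.m_assoc)
      next
        case False
        then have aC: "a \<in> ?C" using a by blast
        have 1: "?\<psi> (incl a x) = h \<otimes>\<^bsub>GP\<^esub> incl a x \<otimes>\<^bsub>GP\<^esub> inv\<^bsub>GP\<^esub> h"
          using C(3) aC x unfolding inner_on_def by blast
        have "{fst l, a} \<in> E" if "l \<in> set w2" for l
          using e1[OF aC, of "fst l"] ws(4) that by auto
        then have c: "val w2 \<otimes>\<^bsub>GP\<^esub> incl a x = incl a x \<otimes>\<^bsub>GP\<^esub> val w2"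
          using val_commute[OF ws(2) _ aV x] by blast
        have "h \<otimes>\<^bsub>GP\<^esub> incl a x \<otimes>\<^bsub>GP\<^esub> inv\<^bsub>GP\<^esub> h
            = val w1 \<otimes>\<^bsub>GP\<^esub> ((val w2 \<otimes>\<^bsub>GP\<^esub> incl a x) \<otimes>\<^bsub>GP\<^esub> (inv\<^bsub>GP\<^esub> (val w2) \<otimes>\<^bsub>GP\<^esub> inv\<^bsub>GP\<^esub> (val w1)))"
          unfolding ws(5) using ws(1,2) X by (simp add: GP.m_assoc GP.inv_mult_group)
        also have "\<dots> = val w1 \<otimes>\<^bsub>GP\<^esub> incl a x \<otimes>\<^bsub>GP\<^esub> inv\<^bsub>GP\<^esub> (val w1)"
          unfolding c using ws(1,2) X by (simp add: GP.m_assoc GP.mult_inv_cancel)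
        finally show ?thesis unfolding 1 .
      qed
    qed
    then have "inner_on \<phi> (J \<union> ?C) (g \<otimes>\<^bsub>GP\<^esub> val w1)"
      using inner_on_conj[OF \<phi> _ gc] jU by (simp add: joined_def)
    then have "Q (J \<union> ?C)" using jU by (auto simp: Q_def)
    then have "card (J \<union> ?C) \<le> card J" by (rule max)
    moreover have "card J < card (J \<union> ?C)"
      using v C(1) jU finite_vertices by (intro psubset_card_mono) (auto simp: joined_def intro: finite_subset)
    ultimately show False by simp
  qed
  then show ?thesis using g by blast
qed

lemma approximately_inner_imp_inner:
  assumes \<phi>: "approximately_inner p GP \<phi>" and nt: "\<And>v. v \<in> V \<Longrightarrow> carrier (G v) \<noteq> {\<one>\<^bsub>G v\<^esub>}"
    and ias: "\<And>v. central_vertex V E v \<Longrightarrow> p_IAS p (G v)"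
  shows "\<phi> \<in> Inn GP"
proof -
  obtain g where g: "inner_on \<phi> V g" using inner_on_all[OF assms] by blast
  have gc: "g \<in> carrier GP" using g by (simp add: inner_on_def)
  have "\<phi> (val w) = g \<otimes>\<^bsub>GP\<^esub> val w \<otimes>\<^bsub>GP\<^esub> inv\<^bsub>GP\<^esub> g" if "w \<in> W" for w
    using that
  proof (induction w)
    case Nil
    then show ?case using GP.approximately_inner_hom(4)[OF \<phi>] gc by simp
  next
    case (Cons l w)
    then have l: "fst l \<in> V" "snd l \<in> carrier (G (fst l))" and w: "w \<in> W" by auto
    have L: "\<phi> (incl (fst l) (snd l)) = g \<otimes>\<^bsub>GP\<^esub> incl (fst l) (snd l) \<otimes>\<^bsub>GP\<^esub> inv\<^bsub>GP\<^esub> g"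
      using g l unfolding inner_on_def by blast
    have "\<phi> (val (l # w)) = \<phi> (incl (fst l) (snd l)) \<otimes>\<^bsub>GP\<^esub> \<phi> (val w)"
      using GP.approximately_inner_hom(3)[OF \<phi>] l w by simp
    then show ?case
      unfolding L Cons.IH[OF w] using gc l w by (simp add: GP.m_assoc GP.inv_mult_cancel)
  qed
  then have *: "\<phi> x = g \<otimes>\<^bsub>GP\<^esub> x \<otimes>\<^bsub>GP\<^esub> inv\<^bsub>GP\<^esub> g" if "x \<in> carrier GP" for x
    using that carrier_GP by auto
  have "\<phi> \<in> auto GP" using \<phi> unfolding approximately_inner_def by blast
  then have "\<phi> \<in> extensional (carrier GP)" by (rule autoD(3))
  then have "\<phi> = (\<lambda>x\<in>carrier GP. g \<otimes>\<^bsub>GP\<^esub> x \<otimes>\<^bsub>GP\<^esub> inv\<^bsub>GP\<^esub> g)"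
    using * by (intro extensionalityI[of _ "carrier GP"]) auto
  then show ?thesis unfolding Inn_def using gc by blast
qed

end

lemma (in graph_prod) finitely_generated_graph_product:
  assumes fin: "finite V" and fg: "\<And>v. v \<in> V \<Longrightarrow> finitely_generated_group (G v)"
  shows "finitely_generated_group GP"
proof -
  have "\<forall>v\<in>V. \<exists>S. finite S \<and> S \<subseteq> carrier (G v) \<and> generate (G v) S = carrier (G v)"
    using fg by (simp add: finitely_generated_group_def)
  then obtain S where S: "\<And>v. v \<in> V \<Longrightarrow> finite (S v) \<and> S v \<subseteq> carrier (G v) \<and> generate (G v) (S v) = carrier (G v)"
    by metis
  let ?S = "\<Union>v\<in>V. incl v ` S v"
  have sub: "?S \<subseteq> carrier GP" using S by fastforce
  have finS: "finite ?S" using fin S by blast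
  have gen: "incl v x \<in> generate GP ?S" if v: "v \<in> V" and x: "x \<in> carrier (G v)" for v x
  proof -
    interpret i: group_hom "G v" GP "incl v" by (rule incl_group_hom[OF v])
    have "incl v x \<in> incl v ` generate (G v) (S v)" using S[OF v] x by blast
    also have "\<dots> = generate GP (incl v ` S v)" using i.generate_img[of "S v"] S[OF v] by simp
    also have "\<dots> \<subseteq> generate GP ?S" using v by (intro GP.mono_generate) blast
    finally show ?thesis .
  qed
  interpret T: subgroup "generate GP ?S" GP by (rule GP.generate_is_subgroup[OF sub])
  have "val w \<in> generate GP ?S" if "w \<in> W" for w
    using that by (induction w) (auto intro: gen)
  then have "carrier GP \<subseteq> generate GP ?S" using carrier_GP by auto
  then have "generate GP ?S = carrier GP" using T.subset by blast
  then show ?thesis unfolding finitely_generated_group_def using finS sub GP.is_group by blast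
qed

section \<open>Finite p-groups\<close>

text \<open>Orbits have \<open>q\<close>-power size, so those that are not single fixed points
  contribute multiples of \<open>q\<close>.\<close>

lemma (in group) card_fixed_points_mod:
  fixes act :: "'a \<Rightarrow> 'x \<Rightarrow> 'x"
  assumes q: "Factorial_Ring.prime q" and ord: "Coset.order G = q ^ n" and E: "finite E"
    and closed: "\<And>g x. g \<in> carrier G \<Longrightarrow> x \<in> E \<Longrightarrow> act g x \<in> E"
    and one: "\<And>x. x \<in> E \<Longrightarrow> act \<one> x = x"
    and mult: "\<And>g h x. g \<in> carrier G \<Longrightarrow> h \<in> carrier G \<Longrightarrow> x \<in> E \<Longrightarrow> act (g \<otimes> h) x = act g (act h x)"
  shows "card {x\<in>E. \<forall>g\<in>carrier G. act g x = x} mod q = card E mod q"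
proof -
  define \<phi> where "\<phi> g = restrict (act g) E" for g
  have bij: "\<phi> g \<in> Bij E" if g: "g \<in> carrier G" for g
  proof -
    have "bij_betw (act g) E E"
    proof (rule bij_betwI[where g = "act (inv g)"])
      show "act g \<in> E \<rightarrow> E" "act (inv g) \<in> E \<rightarrow> E" using closed g by auto
      show "act (inv g) (act g x) = x" "act g (act (inv g) x) = x" if "x \<in> E" for x
        using mult[of "inv g" g x] mult[of g "inv g" x] one[of x] g that by simp_all
    qed
    then show ?thesis by (auto simp: \<phi>_def Bij_def bij_betw_restrict_eq)
  qed
  have "\<phi> \<in> hom G (BijGroup E)"
  proof (rule homI)
    show "\<phi> g \<in> carrier (BijGroup E)" if "g \<in> carrier G" for g using bij[OF that] by (simp add: BijGroup_def)
    show "\<phi> (g \<otimes> h) = \<phi> g \<otimes>\<^bsub>BijGroup E\<^esub> \<phi> h" if "g \<in> carrier G" "h \<in> carrier G" for g h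
      using bij[OF that(1)] bij[OF that(2)] mult[OF that] closed[OF that(2)]
      by (auto simp: BijGroup_def \<phi>_def compose_def)
  qed
  then interpret A: group_action G E \<phi>
    by (simp add: group_action_def group_hom_def group_hom_axioms_def is_group group_BijGroup)
  define F where "F = {x\<in>E. \<forall>g\<in>carrier G. act g x = x}"
  \<comment> \<open>The indicator of the points that are not fixed, to be summed orbit by
    orbit.\<close>
  define f where "f x = (if x \<in> F then 0 else 1::nat)" for x
  have "q dvd (\<Sum>x\<in>orb. f x)" if orb: "orb \<in> orbits G E \<phi>" for orb
  proof -
    obtain y where y: "y \<in> E" "orb = orbit G \<phi> y" using orb by (auto simp: orbits_def)
    have orbE: "orb \<subseteq> E" using y closed by (auto simp: orbit_def \<phi>_def)
    have sub: "x \<in> orb \<Longrightarrow> act g x \<in> orb" if "g \<in> carrier G" for g x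
    proof -
      assume x: "x \<in> orb"
      then have xE: "x \<in> E" using orbE by blast
      have "act g x \<in> orbit G \<phi> x" using that xE by (force simp: orbit_def \<phi>_def)
      then show "act g x \<in> orb"
        using A.orbit_trans[OF y(1) xE closed[OF that xE]] x y(2) by blast
    qed
    have "card orb * card (stabilizer G \<phi> y) = q ^ n"
      using A.orbit_stabilizer_theorem[OF y(1)] ord y(2) by simp
    then have "card orb dvd q ^ n" by (metis dvd_triv_left)
    then obtain i where i: "card orb = q ^ i" using divides_primepow_nat[OF q] by blast
    show ?thesis
    proof (cases "orb \<inter> F = {}")
      case True
      have "(\<Sum>x\<in>orb. f x) = card orb" using True by (simp add: f_def disjoint_iff)
      moreover have "i \<noteq> 0"
      proof
        assume "i = 0"
        then have "card orb = 1" using i by simp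
        then obtain z where z: "orb = {z}" by (rule card_1_singletonE)
        then have "z \<in> F" using sub orbE by (auto simp: F_def)
        then show False using True z by blast
      qed
      ultimately show ?thesis using i by (simp add: dvd_power)
    next
      case False
      then obtain x where x: "x \<in> orb" "x \<in> F" by blast
      then have xE: "x \<in> E" using orbE by blast
      have "y \<in> orbit G \<phi> x" using A.orbit_sym[OF y(1) xE] x(1) y(2) by blast
      then have "y = x" using x(2) xE by (auto simp: orbit_def \<phi>_def F_def)
      then have "orb \<subseteq> F" using x(2) y by (auto simp: orbit_def \<phi>_def F_def)
      then have "(\<Sum>x\<in>orb. f x) = 0" by (intro sum.neutral) (auto simp: f_def)
      then show ?thesis by simp
    qed
  qed
  then have "q dvd (\<Sum>orb\<in>orbits G E \<phi>. \<Sum>x\<in>orb. f x)" by (rule dvd_sum)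
  then have "q dvd (\<Sum>x\<in>E. f x)" using A.disjoint_sum[OF E, of f] by simp
  moreover have "(\<Sum>x\<in>E. f x) = card (E - F)"
  proof -
    have "(\<Sum>x\<in>E. f x) = (\<Sum>x\<in>E - F. 1)"
      using E by (intro sum.mono_neutral_cong_right) (auto simp: f_def)
    then show ?thesis by simp
  qed
  moreover have "card E = card F + card (E - F)"
    using E card_Int_Diff[of E F] by (auto simp: F_def Int_def)
  ultimately show ?thesis unfolding F_def[symmetric] by (metis mod_add_right_eq add.right_neutral dvd_imp_mod_0)
qed

text \<open>A maximal proper subgroup \<open>M\<close> above \<open>H\<close> will do. Acting on its
  own cosets, \<open>M\<close> fixes one besides itself, as their number is divisible by
  \<open>p\<close>; so the normaliser of \<open>M\<close> is larger than \<open>M\<close>, and by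
  maximality \<open>M\<close> is normal. By maximality again the quotient is generated by an element
  of order \<open>p\<close>, so it is abelian of exponent \<open>p\<close>.\<close>

lemma (in group) proper_subgroup_of_p_group:
  assumes p: "Factorial_Ring.prime p" and G: "finite_p_group p G" and H: "subgroup H G" "H \<noteq> carrier G"
  shows "\<exists>M. subgroup M G \<and> H \<subseteq> M \<and> M \<noteq> carrier G \<and>
    (\<forall>x\<in>carrier G. \<forall>y\<in>carrier G. x \<otimes> y \<otimes> inv x \<otimes> inv y \<in> M) \<and> (\<forall>x\<in>carrier G. x [^] p \<in> M)"
proof -
  have fin: "finite (carrier G)" using G by (simp add: finite_p_group_def)
  obtain n where n: "Coset.order G = p ^ n" using G by (auto simp: finite_p_group_def)
  define Q where "Q M \<longleftrightarrow> subgroup M G \<and> H \<subseteq> M \<and> M \<noteq> carrier G" for M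
  have QH: "Q H" using H by (simp add: Q_def)
  have "card M < Suc (card (carrier G))" if "Q M" for M
    using that fin by (simp add: Q_def card_mono le_imp_less_Suc subgroup.subset)
  then obtain M where QM: "Q M" and max: "\<And>M'. Q M' \<Longrightarrow> card M' \<le> card M"
    using ex_has_greatest_nat[of Q H card "Suc (card (carrier G))"] QH by blast
  have sub: "subgroup M G" and HM: "H \<subseteq> M" and ne: "M \<noteq> carrier G" using QM by (auto simp: Q_def)
  interpret M: subgroup M G by (rule sub)
  have finM: "finite M" using M.subset fin finite_subset by blast
  have maximal: "M' = carrier G" if M': "subgroup M' G" "M \<subseteq> M'" "x \<in> M'" "x \<notin> M" for M' x
  proof (rule ccontr)
    assume "M' \<noteq> carrier G"
    then have "Q M'" using M' HM by (auto simp: Q_def)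
    then have "card M' \<le> card M" by (rule max)
    moreover have "finite M'" using M'(1) fin finite_subset subgroup.subset by blast
    then have "card M < card M'" using M' by (intro psubset_card_mono) auto
    ultimately show False by simp
  qed
  have lag: "card (rcosets M) * card M = p ^ n" using lagrange_finite[OF fin sub] n by simp
  then obtain k where k: "card M = p ^ k" using divides_primepow_nat[OF p] by (metis dvd_triv_right)
  obtain j where j: "card (rcosets M) = p ^ j" using lag divides_primepow_nat[OF p] by (metis dvd_triv_left)
  have "card M < card (carrier G)" using ne M.subset fin by (intro psubset_card_mono) auto
  then have "card M < p ^ n" using n by (simp add: Coset.order_def)
  have "j \<noteq> 0"
  proof
    assume "j = 0"
    then have "card M = p ^ n" using lag j by simp
    then show False using \<open>card M < p ^ n\<close> by simp
  qed
  then have pdvd: "p dvd card (rcosets M)" using j by (simp add: dvd_power)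
  have finE: "finite (rcosets M)" using fin by (simp add: RCOSETS_def)
  interpret MG: group "G\<lparr>carrier := M\<rparr>" by (rule M.subgroup_is_group) (rule is_group)
  let ?act = "\<lambda>m C. C #> inv m"
  let ?F = "{C \<in> rcosets M. \<forall>m\<in>carrier (G\<lparr>carrier := M\<rparr>). ?act m C = C}"
  have rep: "\<exists>x\<in>carrier G. C = M #> x" if "C \<in> rcosets M" for C using that by (auto simp: RCOSETS_def)
  have assoc: "(M #> x) #> y = M #> (x \<otimes> y)" if "x \<in> carrier G" "y \<in> carrier G" for x y
    using coset_mult_assoc[OF M.subset that] .
  have "card ?F mod p = card (rcosets M) mod p"
  proof (rule MG.card_fixed_points_mod[OF p, of k])
    show "Coset.order (G\<lparr>carrier := M\<rparr>) = p ^ k" using k by (simp add: Coset.order_def)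
    show "finite (rcosets M)" by (rule finE)
    show "C #> inv m \<in> rcosets M" if "m \<in> carrier (G\<lparr>carrier := M\<rparr>)" "C \<in> rcosets M" for m C
      using rep[OF that(2)] that(1) M.subset assoc by (auto intro!: rcosetsI)
    show "C #> inv \<one>\<^bsub>G\<lparr>carrier := M\<rparr>\<^esub> = C" if "C \<in> rcosets M" for C
      using rep[OF that] assoc by auto
    show "C #> inv (m \<otimes>\<^bsub>G\<lparr>carrier := M\<rparr>\<^esub> m') = C #> inv m' #> inv m"
      if "m \<in> carrier (G\<lparr>carrier := M\<rparr>)" "m' \<in> carrier (G\<lparr>carrier := M\<rparr>)" "C \<in> rcosets M" for m m' C
    proof -
      have "m \<in> carrier G" "m' \<in> carrier G" using that(1,2) M.subset by auto
      then show ?thesis using rep[OF that(3)] assoc by (auto simp: inv_mult_group m_assoc)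
    qed
  qed
  then have Fp: "p dvd card ?F" using pdvd by (simp add: dvd_eq_mod_eq_0)
  have "M #> inv m = M" if "m \<in> M" for m using that M.subset by (intro coset_join2[OF _ sub]) auto
  moreover have "M \<in> rcosets M" using M.subgroup_in_rcosets[OF is_group] .
  ultimately have MF: "M \<in> ?F" by simp
  moreover have finF: "finite ?F" using finE by simp
  ultimately have "card ?F > 0" by (auto simp: card_gt_0_iff)
  then have "card ?F \<ge> p" using Fp by (simp add: dvd_imp_le)
  then have "card ?F > 1" using prime_gt_1_nat[OF p] by simp
  moreover have "card ?F \<le> 1" if "?F \<subseteq> {M}" using card_mono[OF _ that] by simp
  ultimately have "\<not> ?F \<subseteq> {M}" by linarith
  then obtain C where C: "C \<in> ?F" "C \<noteq> M" by blast
  then obtain x where x: "x \<in> carrier G" "C = M #> x" using rep by blast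
  have xM: "x \<notin> M" using C(2) x coset_join2[OF x(1) sub] by blast
  have conjM: "x \<otimes> m \<otimes> inv x \<in> M" if m: "m \<in> M" for m
  proof -
    have "inv m \<in> M" "m \<in> carrier G" using m M.subset by auto
    then have "(M #> x) #> inv (inv m) = M #> x" using C(1) x(2) by auto
    then have "M #> (x \<otimes> m) = M #> x" using assoc x(1) \<open>m \<in> carrier G\<close> by simp
    then have "x \<otimes> m \<in> M #> x" using rcos_self[OF _ sub, of "x \<otimes> m"] x(1) \<open>m \<in> carrier G\<close> by simp
    then obtain m' where "m' \<in> M" "x \<otimes> m = m' \<otimes> x" by (auto simp: r_coset_def)
    then show ?thesis using x(1) subsetD[OF M.subset, of m'] by (simp add: m_assoc)
  qed
  \<comment> \<open>As \<open>M\<close> is finite, the inclusion just shown is an equality, which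
    yields the inverse direction.\<close>
  have conjM': "inv x \<otimes> m \<otimes> x \<in> M" if m: "m \<in> M" for m
  proof -
    let ?c = "\<lambda>m. x \<otimes> m \<otimes> inv x"
    have "inj_on ?c M" using x(1) M.subset by (intro inj_onI) (simp add: subsetD[OF M.subset])
    moreover have "?c ` M \<subseteq> M" by (rule image_subsetI) (rule conjM)
    ultimately have "?c ` M = M" using endo_inj_surj[OF finM, of ?c] by blast
    then obtain m' where m': "m' \<in> M" "m = x \<otimes> m' \<otimes> inv x" using m by blast
    then have "m' \<in> carrier G" using M.subset by blast
    then have "inv x \<otimes> m \<otimes> x = m'" unfolding m'(2) using x(1) by (simp add: m_assoc inv_mult_cancel)
    then show ?thesis using m'(1) by simp
  qed
  define N where "N = {y \<in> carrier G. \<forall>m\<in>M. y \<otimes> m \<otimes> inv y \<in> M \<and> inv y \<otimes> m \<otimes> y \<in> M}"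
  have "subgroup N G"
  proof (rule subgroupI)
    show "N \<subseteq> carrier G" by (auto simp: N_def)
    have "\<one> \<in> N" using M.subset by (auto simp: N_def)
    then show "N \<noteq> {}" by blast
    show "inv y \<in> N" if "y \<in> N" for y using that by (auto simp: N_def)
    show "y \<otimes> z \<in> N" if "y \<in> N" "z \<in> N" for y z
    proof -
      have yz: "y \<in> carrier G" "z \<in> carrier G" using that by (auto simp: N_def)
      have "y \<otimes> z \<otimes> m \<otimes> inv (y \<otimes> z) \<in> M \<and> inv (y \<otimes> z) \<otimes> m \<otimes> (y \<otimes> z) \<in> M" if m: "m \<in> M" for m
      proof -
        have mc: "m \<in> carrier G" using m M.subset by blast
        have "y \<otimes> z \<otimes> m \<otimes> inv (y \<otimes> z) = y \<otimes> (z \<otimes> m \<otimes> inv z) \<otimes> inv y"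
          "inv (y \<otimes> z) \<otimes> m \<otimes> (y \<otimes> z) = inv z \<otimes> (inv y \<otimes> m \<otimes> y) \<otimes> z"
          using yz mc by (simp_all add: inv_mult_group m_assoc)
        then show ?thesis using \<open>y \<in> N\<close> \<open>z \<in> N\<close> m by (simp add: N_def)
      qed
      then show ?thesis using yz by (simp add: N_def)
    qed
  qed
  moreover have "M \<subseteq> N" using M.subset by (auto simp: N_def)
  moreover have "x \<in> N" using conjM conjM' x(1) by (simp add: N_def)
  ultimately have "N = carrier G" using maximal xM by blast
  then have nor: "M \<lhd> G" unfolding normal_inv_iff using sub by (auto simp: N_def)
  interpret Mn: normal M G by (rule nor)
  let ?Q = "G Mod M"
  interpret Q: group ?Q by (rule Mn.factorgroup_is_group)
  interpret q: group_hom G ?Q "\<lambda>a. M #> a"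
    using Mn.r_coset_hom_Mod Q.is_group is_group by (simp add: group_hom_def group_hom_axioms_def)
  have finQ: "finite (carrier ?Q)" using finE by (simp add: FactGroup_def)
  have "p dvd Coset.order ?Q" using pdvd by (simp add: Coset.order_def FactGroup_def)
  then obtain D where D: "D \<in> carrier ?Q" "D \<noteq> \<one>\<^bsub>?Q\<^esub>" "D [^]\<^bsub>?Q\<^esub> p = \<one>\<^bsub>?Q\<^esub>"
    using Q.exists_element_of_prime_order[OF finQ p] by blast
  obtain d where d: "d \<in> carrier G" "D = M #> d" using D(1) unfolding carrier_FactGroup by blast
  have dM: "d \<notin> M" using D(2) d Mn.rcos_eq_self_iff[OF d(1)] by simp
  have gen: "subgroup (generate ?Q {D}) ?Q" using D(1) by (intro Q.generate_is_subgroup) simp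
  interpret gen: subgroup "generate ?Q {D}" ?Q by (rule gen)
  \<comment> \<open>The preimage of the cyclic subgroup generated by \<open>D\<close> properly
    contains \<open>M\<close>, so it is everything.\<close>
  define S where "S = {y \<in> carrier G. M #> y \<in> generate ?Q {D}}"
  have "subgroup S G"
  proof (rule subgroupI)
    show "S \<subseteq> carrier G" by (auto simp: S_def)
    have "M #> \<one> = \<one>\<^bsub>?Q\<^esub>" by (rule q.hom_one)
    then have "\<one> \<in> S" using gen.one_closed unfolding S_def by (metis (mono_tags, lifting) mem_Collect_eq one_closed)
    then show "S \<noteq> {}" by blast
    show "inv y \<in> S" if "y \<in> S" for y
      using that gen.m_inv_closed[of "M #> y"] q.hom_inv[of y] unfolding S_def
      by (metis (mono_tags, lifting) inv_closed mem_Collect_eq)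
    show "y \<otimes> z \<in> S" if "y \<in> S" "z \<in> S" for y z
      using that gen.m_closed[of "M #> y" "M #> z"] q.hom_mult[of y z] unfolding S_def
      by (metis (mono_tags, lifting) m_closed mem_Collect_eq)
  qed
  moreover have "M \<subseteq> S"
  proof
    fix m assume m: "m \<in> M"
    have mc: "m \<in> carrier G" using m M.subset by blast
    have "M #> m = \<one>\<^bsub>?Q\<^esub>" using Mn.rcos_eq_self_iff[OF mc] m by simp
    then show "m \<in> S" using mc gen.one_closed unfolding S_def by (metis (mono_tags, lifting) mem_Collect_eq)
  qed
  moreover have "d \<in> S"
    unfolding S_def using d generate.incl[of D "{D}" ?Q] by simp
  ultimately have "S = carrier G" using maximal dM by blast
  then have pow: "\<exists>k::int. M #> y = D [^]\<^bsub>?Q\<^esub> k" if "y \<in> carrier G" for y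
    using that Q.generate_pow[OF D(1)] unfolding S_def by blast
  have comm: "x \<otimes> y \<otimes> inv x \<otimes> inv y \<in> M" if x: "x \<in> carrier G" and y: "y \<in> carrier G" for x y
  proof -
    obtain a where a: "M #> x = D [^]\<^bsub>?Q\<^esub> (a::int)" using pow[OF x] by blast
    obtain b where b: "M #> y = D [^]\<^bsub>?Q\<^esub> (b::int)" using pow[OF y] by blast
    have "M #> (x \<otimes> y) = D [^]\<^bsub>?Q\<^esub> (a + b)"
      unfolding q.hom_mult[OF x y] a b by (rule Q.int_pow_mult[OF D(1), symmetric])
    also have "\<dots> = M #> (y \<otimes> x)"
      unfolding q.hom_mult[OF y x] a b using Q.int_pow_mult[OF D(1), of b a] by (simp only: add.commute)
    finally have "(x \<otimes> y) \<otimes> inv (y \<otimes> x) \<in> M" using Mn.rcos_eq_iff[of "x \<otimes> y" "y \<otimes> x"] x y by blast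
    then show ?thesis using x y by (simp add: inv_mult_group m_assoc)
  qed
  have ppow: "x [^] p \<in> M" if x: "x \<in> carrier G" for x
  proof -
    obtain a where a: "M #> x = D [^]\<^bsub>?Q\<^esub> (a::int)" using pow[OF x] by blast
    have "M #> (x [^] p) = (M #> x) [^]\<^bsub>?Q\<^esub> p" by (rule Mn.FactGroup_pow[OF x, symmetric])
    also have "\<dots> = (D [^]\<^bsub>?Q\<^esub> a) [^]\<^bsub>?Q\<^esub> (int p)" unfolding a by (rule int_pow_int[symmetric])
    also have "\<dots> = (D [^]\<^bsub>?Q\<^esub> (int p)) [^]\<^bsub>?Q\<^esub> a"
      unfolding Q.int_pow_pow[OF D(1)] by (simp only: mult.commute)
    also have "\<dots> = \<one>\<^bsub>?Q\<^esub>" unfolding int_pow_int D(3) by (rule Q.int_pow_one)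
    finally have "M #> (x [^] p) = M" by simp
    then show ?thesis using Mn.rcos_eq_self_iff[of "x [^] p"] x by simp
  qed
  show ?thesis by (intro exI[of _ M] conjI ballI sub HM ne comm ppow)
qed

lemma (in group) pow_conj:
  assumes "g \<in> carrier G" "x \<in> carrier G"
  shows "(g \<otimes> x \<otimes> inv g) [^] (n::nat) = g \<otimes> x [^] n \<otimes> inv g"
proof (induction n)
  case (Suc n)
  then show ?case using assms by (simp add: m_assoc inv_mult_cancel)
qed (use assms in simp)

lemma (in group) K_p_subgroup: "subgroup (K_p p G) G" "K_p p G \<lhd> G"
proof -
  have P: "{g [^] p |g. g \<in> carrier G} \<subseteq> carrier G" by auto
  have D: "derived G (carrier G) \<lhd> G" by (rule derived_is_normal[OF normal_self])
  have Pn: "generate G {g [^] p |g. g \<in> carrier G} \<lhd> G"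
  proof (rule normal_generateI[OF P])
    fix h g assume "h \<in> {g [^] p |g. g \<in> carrier G}" and g: "g \<in> carrier G"
    then obtain x where x: "x \<in> carrier G" "h = x [^] p" by blast
    then show "g \<otimes> h \<otimes> inv g \<in> {g [^] p |g. g \<in> carrier G}"
      using pow_conj[OF g x(1), of p] g by (intro CollectI exI[of _ "g \<otimes> x \<otimes> inv g"]) auto
  qed
  show sub: "subgroup (K_p p G) G"
    unfolding K_p_def by (rule mult_norm_subgroup[OF D normal_imp_subgroup[OF Pn]])
  show "K_p p G \<lhd> G"
    unfolding normal_inv_iff
  proof (intro conjI sub ballI)
    fix g h assume g: "g \<in> carrier G" and "h \<in> K_p p G"
    then obtain a b where ab: "a \<in> derived G (carrier G)" "b \<in> generate G {g [^] p |g. g \<in> carrier G}" "h = a \<otimes> b"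
      by (auto simp: K_p_def set_mult_def)
    have c: "a \<in> carrier G" "b \<in> carrier G"
      using subgroup.mem_carrier[OF normal_imp_subgroup[OF D] ab(1)]
        subgroup.mem_carrier[OF normal_imp_subgroup[OF Pn] ab(2)] .
    have "g \<otimes> h \<otimes> inv g = (g \<otimes> a \<otimes> inv g) \<otimes> (g \<otimes> b \<otimes> inv g)"
      using g c ab(3) by (simp add: m_assoc inv_mult_cancel)
    then show "g \<otimes> h \<otimes> inv g \<in> K_p p G"
      unfolding K_p_def set_mult_def
      by (auto intro!: bexI[OF _ normal.inv_op_closed2[OF D g ab(1)]] bexI[OF _ normal.inv_op_closed2[OF Pn g ab(2)]] simp del: UN_simps)
  qed
qed

lemma (in group) K_p_contains:
  "x \<in> carrier G \<Longrightarrow> y \<in> carrier G \<Longrightarrow> x \<otimes> y \<otimes> inv x \<otimes> inv y \<in> K_p p G"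
  "x \<in> carrier G \<Longrightarrow> x [^] p \<in> K_p p G"
proof -
  have 1: "\<one> \<in> generate G A" for A by (rule generate.one)
  show "x \<otimes> y \<otimes> inv x \<otimes> inv y \<in> K_p p G" if xy: "x \<in> carrier G" "y \<in> carrier G"
  proof -
    have "x \<otimes> y \<otimes> inv x \<otimes> inv y \<in> derived G (carrier G)"
      unfolding derived_def using xy by (intro generate.incl) blast
    then have "x \<otimes> y \<otimes> inv x \<otimes> inv y \<otimes> \<one> \<in> K_p p G" unfolding K_p_def set_mult_def using 1 by blast
    then show ?thesis using xy by simp
  qed
  show "x [^] p \<in> K_p p G" if x: "x \<in> carrier G"
  proof -
    have "x [^] p \<in> generate G {g [^] p |g. g \<in> carrier G}" using x by (intro generate.incl) blast
    moreover have "\<one> \<in> derived G (carrier G)" unfolding derived_def by (rule 1)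
    ultimately have "\<one> \<otimes> x [^] p \<in> K_p p G" unfolding K_p_def set_mult_def by blast
    then show ?thesis using x by simp
  qed
qed

lemma (in group) K_p_minimal:
  assumes M: "subgroup M G" and "\<And>x y. x \<in> carrier G \<Longrightarrow> y \<in> carrier G \<Longrightarrow> x \<otimes> y \<otimes> inv x \<otimes> inv y \<in> M"
    and "\<And>x. x \<in> carrier G \<Longrightarrow> x [^] p \<in> M"
  shows "K_p p G \<subseteq> M"
proof -
  have "derived G (carrier G) \<subseteq> M"
    unfolding derived_def using assms(2) by (intro generate_subgroup_incl[OF _ M]) auto
  moreover have "generate G {g [^] p |g. g \<in> carrier G} \<subseteq> M"
    using assms(3) by (intro generate_subgroup_incl[OF _ M]) auto
  ultimately show ?thesis using subgroup.m_closed[OF M] by (fastforce simp: K_p_def set_mult_def)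
qed

text \<open>A proper \<open>H\<close> would lie in a proper subgroup that contains all commutators
  and \<open>p\<close>-th powers, hence also \<open>K_p\<close>, and the two could not generate the
  group.\<close>

lemma (in group) frattini_nongenerating:
  assumes p: "Factorial_Ring.prime p" and G: "finite_p_group p G" and H: "subgroup H G"
    and gen: "\<And>x. x \<in> carrier G \<Longrightarrow> \<exists>k\<in>K_p p G. \<exists>h\<in>H. x = k \<otimes> h"
  shows "H = carrier G"
proof (rule ccontr)
  assume "H \<noteq> carrier G"
  then obtain M where M: "subgroup M G" "H \<subseteq> M" "M \<noteq> carrier G"
    "\<forall>x\<in>carrier G. \<forall>y\<in>carrier G. x \<otimes> y \<otimes> inv x \<otimes> inv y \<in> M" "\<forall>x\<in>carrier G. x [^] p \<in> M"
    using proper_subgroup_of_p_group[OF p G H] by blast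
  have "K_p p G \<subseteq> M" using M by (intro K_p_minimal) auto
  then have "carrier G \<subseteq> M" using gen M(2) subgroup.m_closed[OF M(1)] by (metis subsetD subsetI)
  then show False using M(1,3) subgroup.subset by blast
qed

text \<open>Counting modulo \<open>q\<close> gives a fixed point in every coset of \<open>K_p\<close>; as \<open>K_p\<close> lies in the
  Frattini subgroup, the fixed points are everything.\<close>

lemma (in group) coprime_automorphism_trivial:
  assumes p: "Factorial_Ring.prime p" and G: "finite_p_group p G" and \<alpha>: "\<alpha> \<in> auto G"
    and q: "Factorial_Ring.prime q" "q \<noteq> p" and ord: "\<And>x. x \<in> carrier G \<Longrightarrow> (\<alpha> ^^ q) x = x"
    and triv: "\<And>x. x \<in> carrier G \<Longrightarrow> \<alpha> x \<otimes> inv x \<in> K_p p G" and x: "x \<in> carrier G"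
  shows "\<alpha> x = x"
proof -
  interpret \<alpha>: group_hom G G \<alpha> by (rule auto_group_hom[OF \<alpha>])
  have fin: "finite (carrier G)" using G by (simp add: finite_p_group_def)
  obtain n where n: "Coset.order G = p ^ n" using G by (auto simp: finite_p_group_def)
  interpret K: normal "K_p p G" G by (rule K_p_subgroup(2))
  let ?K = "K_p p G"
  have finK: "finite ?K" using K.subset fin finite_subset by blast
  have "card ?K dvd p ^ n" using lagrange_finite[OF fin K.subgroup_axioms] n by (metis dvd_triv_right)
  then obtain j where j: "card ?K = p ^ j" using divides_primepow_nat[OF p] by blast
  define H where "H = {x \<in> carrier G. \<alpha> x = x}"
  have H: "subgroup H G"
    by (rule subgroupI) (auto simp: H_def intro!: exI[of _ \<one>])
  have "\<exists>k\<in>?K. \<exists>h\<in>H. y = k \<otimes> h" if y: "y \<in> carrier G" for y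
  proof -
    let ?E = "?K #> y"
    \<comment> \<open>The cyclic group of order \<open>q\<close> acts on the coset through the
      iterates of \<open>\<alpha>\<close>, since the \<open>q\<close>-th iterate is the
      identity.\<close>
    let ?Z = "integer_mod_group q"
    have E: "?E \<subseteq> carrier G" using y K.subset by (auto simp: r_coset_def)
    have finE: "finite ?E" using E fin finite_subset by blast
    have "card ?E = p ^ j"
      using card_rcosets_equal[of ?E ?K] y K.subset j by (simp add: rcosetsI)
    have \<alpha>E: "\<alpha> z \<in> ?E" if "z \<in> ?E" for z
    proof -
      have zc: "z \<in> carrier G" using that E by blast
      have "z \<otimes> inv y \<in> ?K" using K.rcos_module[OF is_group y zc] that by blast
      then have "(\<alpha> z \<otimes> inv z) \<otimes> (z \<otimes> inv y) \<in> ?K" using triv[OF zc] by simp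
      moreover have "(\<alpha> z \<otimes> inv z) \<otimes> (z \<otimes> inv y) = \<alpha> z \<otimes> inv y"
        using zc y by (simp add: m_assoc inv_mult_cancel)
      ultimately show ?thesis using K.rcos_module[OF is_group y, of "\<alpha> z"] zc by simp
    qed
    then have pow_E: "(\<alpha> ^^ i) z \<in> ?E" if "z \<in> ?E" for i z
      using that by (induction i) auto
    have q0: "q > 0" using q(1) prime_gt_0_nat by blast
    interpret Z: group ?Z by simp
    have "card {z\<in>?E. \<forall>i\<in>carrier ?Z. (\<alpha> ^^ nat i) z = z} mod q = card ?E mod q"
    proof (rule Z.card_fixed_points_mod[OF q(1), of 1])
      show "Coset.order ?Z = q ^ 1" using q0 by (simp add: Coset.order_def carrier_integer_mod_group)
      show "finite ?E" by (rule finE)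
      show "(\<alpha> ^^ nat i) z \<in> ?E" if "z \<in> ?E" for i z by (rule pow_E[OF that])
      show "(\<alpha> ^^ nat \<one>\<^bsub>?Z\<^esub>) z = z" for z by simp
      show "(\<alpha> ^^ nat (i \<otimes>\<^bsub>?Z\<^esub> k)) z = (\<alpha> ^^ nat i) ((\<alpha> ^^ nat k) z)"
        if "i \<in> carrier ?Z" "k \<in> carrier ?Z" "z \<in> ?E" for i k z
      proof -
        have ik: "0 \<le> i" "0 \<le> k" using that(1,2) q0 by (auto simp: carrier_integer_mod_group)
        have "nat (i \<otimes>\<^bsub>?Z\<^esub> k) = (nat i + nat k) mod q"
          using ik by (simp add: nat_mod_distrib nat_add_distrib)
        moreover have "(\<alpha> ^^ q) z = z" using ord that(3) E by blast
        ultimately show ?thesis by (simp add: funpow_mod_eq funpow_add)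
      qed
    qed
    moreover have "card ?E mod q \<noteq> 0"
    proof
      assume "card ?E mod q = 0"
      then have "q dvd p ^ j" using \<open>card ?E = p ^ j\<close> by auto
      then have "q dvd p" using q(1) prime_dvd_power by blast
      then show False using q p primes_dvd_imp_eq by blast
    qed
    ultimately have "{z\<in>?E. \<forall>i\<in>carrier ?Z. (\<alpha> ^^ nat i) z = z} \<noteq> {}" by (metis card.empty mod_0)
    then obtain z where z: "z \<in> ?E" "\<forall>i\<in>carrier ?Z. (\<alpha> ^^ nat i) z = z" by blast
    have "1 \<in> carrier ?Z" using prime_gt_1_nat[OF q(1)] by (simp add: carrier_integer_mod_group)
    then have "\<alpha> z = z" using z(2) by fastforce
    then have zH: "z \<in> H" using z(1) E by (auto simp: H_def)
    obtain k where k: "k \<in> ?K" "z = k \<otimes> y" using z(1) by (auto simp: r_coset_def)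
    then have "y = inv k \<otimes> z" using y K.subset by (simp add: inv_mult_cancel subsetD)
    then show ?thesis using k(1) zH K.m_inv_closed by blast
  qed
  then have "H = carrier G" by (rule frattini_nongenerating[OF p G H])
  then show ?thesis using x by (auto simp: H_def)
qed

section \<open>Outer automorphisms\<close>

lemma carrier_AutoGroup [simp]: "carrier (AutoGroup G) = auto G"
  by (simp add: AutoGroup_def)

lemma one_AutoGroup: "\<one>\<^bsub>AutoGroup G\<^esub> = (\<lambda>x\<in>carrier G. x)"
  by (simp add: AutoGroup_def BijGroup_def)

lemma mult_AutoGroup:
  "f \<in> auto G \<Longrightarrow> g \<in> auto G \<Longrightarrow> x \<in> carrier G \<Longrightarrow> (f \<otimes>\<^bsub>AutoGroup G\<^esub> g) x = f (g x)"
  by (simp add: AutoGroup_def BijGroup_def auto_def compose_def)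

lemma auto_closed: "f \<in> auto G \<Longrightarrow> x \<in> carrier G \<Longrightarrow> f x \<in> carrier G"
  by (auto simp: auto_def hom_def)

lemma auto_eqI:
  "f \<in> auto G \<Longrightarrow> g \<in> auto G \<Longrightarrow> (\<And>x. x \<in> carrier G \<Longrightarrow> f x = g x) \<Longrightarrow> f = g"
  using extensionalityI[OF autoD(3) autoD(3)] by blast

lemma (in group) pow_AutoGroup:
  assumes f: "f \<in> auto G" and x: "x \<in> carrier G"
  shows "(f [^]\<^bsub>AutoGroup G\<^esub> (n :: nat)) x = (f ^^ n) x"
  using x
proof (induction n arbitrary: x)
  case 0
  then show ?case by (simp add: one_AutoGroup)
next
  case (Suc n)
  interpret A: group "AutoGroup G" by (rule AutoGroup)
  have "f [^]\<^bsub>AutoGroup G\<^esub> n \<in> auto G" using A.nat_pow_closed[of f n] f by simp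
  then show ?case
    using Suc f by (simp add: mult_AutoGroup auto_closed funpow_swap1)
qed

lemma (in group) inv_AutoGroup:
  assumes f: "f \<in> auto G" and x: "x \<in> carrier G"
  shows "f ((inv\<^bsub>AutoGroup G\<^esub> f) x) = x" "(inv\<^bsub>AutoGroup G\<^esub> f) (f x) = x"
proof -
  interpret A: group "AutoGroup G" by (rule AutoGroup)
  have i: "inv\<^bsub>AutoGroup G\<^esub> f \<in> auto G" using A.inv_closed[of f] f by simp
  show "f ((inv\<^bsub>AutoGroup G\<^esub> f) x) = x"
    using mult_AutoGroup[OF f i x] A.r_inv[of f] f x by (simp add: one_AutoGroup)
  show "(inv\<^bsub>AutoGroup G\<^esub> f) (f x) = x"
    using mult_AutoGroup[OF i f x] A.l_inv[of f] f x by (simp add: one_AutoGroup)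
qed

lemma finite_auto:
  assumes "finite (carrier G)"
  shows "finite (auto G)"
proof (rule finite_subset)
  show "auto G \<subseteq> carrier G \<rightarrow>\<^sub>E carrier G" by (auto simp: auto_def hom_def PiE_def Bij_def)
  show "finite (carrier G \<rightarrow>\<^sub>E carrier G)" using assms by (intro finite_PiE)
qed

text \<open>If a prime \<open>q \<noteq> p\<close> divided the order \<open>d\<close> of
  \<open>\<alpha>\<close>, the power of \<open>\<alpha>\<close> with exponent \<open>d / q\<close>
  would have order \<open>q\<close> and be trivial modulo \<open>K_p\<close>;
  \<open>coprime_automorphism_trivial\<close> makes it the identity, a contradiction.\<close>

lemma (in group) auto_p_power:
  assumes p: "Factorial_Ring.prime p" and G: "finite_p_group p G" and \<alpha>: "\<alpha> \<in> auto G"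
    and triv: "\<And>x. x \<in> carrier G \<Longrightarrow> \<alpha> x \<otimes> inv x \<in> K_p p G"
  shows "\<exists>m. \<alpha> [^]\<^bsub>AutoGroup G\<^esub> (p ^ m :: nat) = \<one>\<^bsub>AutoGroup G\<^esub>"
proof -
  interpret A: group "AutoGroup G" by (rule AutoGroup)
  interpret K: normal "K_p p G" G by (rule K_p_subgroup(2))
  have \<alpha>A: "\<alpha> \<in> carrier (AutoGroup G)" using \<alpha> by simp
  have finA: "finite (carrier (AutoGroup G))"
    using G by (simp add: finite_p_group_def finite_auto)
  have triv_pow: "(\<alpha> ^^ n) x \<in> carrier G \<and> (\<alpha> ^^ n) x \<otimes> inv x \<in> K_p p G" if x: "x \<in> carrier G" for n x
  proof (induction n)
    case (Suc n)
    let ?y = "(\<alpha> ^^ n) x"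
    have y: "?y \<in> carrier G" using Suc by blast
    have ay: "\<alpha> ?y \<in> carrier G" using auto_closed[OF \<alpha> y] .
    have "(\<alpha> ?y \<otimes> inv ?y) \<otimes> (?y \<otimes> inv x) \<in> K_p p G"
      using K.m_closed[OF triv[OF y]] Suc by blast
    moreover have "(\<alpha> ?y \<otimes> inv ?y) \<otimes> (?y \<otimes> inv x) = \<alpha> ?y \<otimes> inv x"
      using x y ay by (simp add: m_assoc inv_mult_cancel)
    ultimately show ?case using ay by simp
  qed (use x in simp)
  define d where "d = A.ord \<alpha>"
  have d0: "d \<noteq> 0" using A.ord_ge_1[OF finA \<alpha>A] by (simp add: d_def)
  obtain r where r: "d = p ^ multiplicity p d * r" "\<not> p dvd r"
    using multiplicity_decompose'[of d p] d0 p by (metis not_prime_unit)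
  have "r = 1"
  proof (rule ccontr)
    assume "r \<noteq> 1"
    then obtain q where q: "Factorial_Ring.prime q" "q dvd r" using prime_factor_nat by blast
    have qp: "q \<noteq> p" using q(2) r(2) by blast
    obtain e where e: "d = q * e" using q(2) r(1) by (metis dvd_def dvd_mult)
    let ?\<delta> = "\<alpha> [^]\<^bsub>AutoGroup G\<^esub> e"
    have \<delta>: "?\<delta> \<in> auto G" using A.nat_pow_closed[OF \<alpha>A, of e] by simp
    have "?\<delta> = \<one>\<^bsub>AutoGroup G\<^esub>"
    proof (rule auto_eqI[OF \<delta>])
      show "\<one>\<^bsub>AutoGroup G\<^esub> \<in> auto G" using A.one_closed by simp
      fix x assume x: "x \<in> carrier G"
      have "?\<delta> x = x"
      proof (rule coprime_automorphism_trivial[OF p G \<delta> q(1) qp _ _ x])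
        fix y assume y: "y \<in> carrier G"
        have "?\<delta> [^]\<^bsub>AutoGroup G\<^esub> q = \<alpha> [^]\<^bsub>AutoGroup G\<^esub> d"
          using A.nat_pow_pow[OF \<alpha>A, of e q] e by (simp add: mult.commute)
        also have "\<dots> = \<one>\<^bsub>AutoGroup G\<^esub>" unfolding d_def by (rule A.pow_ord_eq_1[OF \<alpha>A])
        finally show "(?\<delta> ^^ q) y = y"
          using pow_AutoGroup[OF \<delta> y, of q] y by (simp add: one_AutoGroup)
        show "?\<delta> y \<otimes> inv y \<in> K_p p G"
          using triv_pow[OF y] pow_AutoGroup[OF \<alpha> y] by simp
      qed
      then show "?\<delta> x = \<one>\<^bsub>AutoGroup G\<^esub> x" using x by (simp add: one_AutoGroup)
    qed
    then have "d dvd e" using A.pow_eq_id[OF \<alpha>A] by (simp add: d_def)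
    moreover have "0 < e" "e < q * e" using d0 e prime_gt_1_nat[OF q(1)] by auto
    ultimately show False using e by (metis dvd_imp_le not_le)
  qed
  then have "A.ord \<alpha> = p ^ multiplicity p d" using r(1) by (simp add: d_def)
  then show ?thesis using A.pow_ord_eq_1[OF \<alpha>A] by metis
qed

lemma (in group) p_normal_trivial:
  assumes p: "Factorial_Ring.prime p" and G: "finite_p_group p G"
  shows "p_normal p {\<one>} G"
proof (rule p_normalI[OF p one_is_normal, where \<kappa> = id])
  show "finite (id ` carrier G)" using G by (simp add: finite_p_group_def)
  obtain n where n: "Coset.order G = p ^ n" using G by (auto simp: finite_p_group_def)
  show "\<exists>m. x [^] (p ^ m :: nat) \<in> {\<one>}" if "x \<in> carrier G" for x
    using pow_order_eq_1[OF that] n by auto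
qed auto

text \<open>Take for \<open>N\<close> the kernel of the map from \<open>G Mod I\<close> to
  \<open>G Mod M\<close>, which exists because \<open>I \<subseteq> M\<close>.\<close>

lemma (in group) p_normal_quotient:
  assumes p: "Factorial_Ring.prime p" and I: "I \<lhd> G" and M: "p_normal p M G" "I \<subseteq> M"
    and f: "f \<in> carrier G" "f \<notin> M"
  shows "\<exists>N. p_normal p N (G Mod I) \<and> I #> f \<notin> N"
proof -
  interpret I: normal I G by (rule I)
  interpret M: normal M G by (rule p_normalD(1)[OF M(1)])
  interpret QM: group "G Mod M" by (rule M.factorgroup_is_group)
  interpret QI: group "G Mod I" by (rule I.factorgroup_is_group)
  interpret m: group_hom G "G Mod M" "\<lambda>x. M #> x"
    using M.r_coset_hom_Mod QM.is_group is_group by (simp add: group_hom_def group_hom_axioms_def)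
  have "I \<subseteq> kernel G (G Mod M) (\<lambda>x. M #> x)"
  proof
    fix x assume x: "x \<in> I"
    then have xc: "x \<in> carrier G" using I.subset by blast
    have "M #> x = M" using M.rcos_eq_self_iff[OF xc] x M(2) by blast
    then show "x \<in> kernel G (G Mod M) (\<lambda>x. M #> x)" using xc by (simp add: kernel_def)
  qed
  then obtain g where g: "g \<in> hom (G Mod I) (G Mod M)" "\<And>x. x \<in> carrier G \<Longrightarrow> g (I #> x) = M #> x"
    using m.FactGroup_universal_kernel[OF I] by blast
  interpret g: group_hom "G Mod I" "G Mod M" g
    using g(1) QM.is_group QI.is_group by (simp add: group_hom_def group_hom_axioms_def)
  have "p_normal p {\<one>\<^bsub>G Mod M\<^esub>} (G Mod M)"
    using QM.p_normal_trivial[OF p] M(1) by (simp add: p_normal_def)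
  then have "p_normal p {C \<in> carrier (G Mod I). g C \<in> {\<one>\<^bsub>G Mod M\<^esub>}} (G Mod I)"
    by (rule g.p_normal_vimage[OF p])
  moreover have "M #> f \<noteq> M" using M.rcos_eq_self_iff[OF f(1)] f(2) by blast
  then have "I #> f \<notin> {C \<in> carrier (G Mod I). g C \<in> {\<one>\<^bsub>G Mod M\<^esub>}}" using g(2)[OF f(1)] by simp
  ultimately show ?thesis by blast
qed

lemma (in group_hom) K_p_image:
  assumes "x \<in> K_p p G"
  shows "h x \<in> K_p p H"
proof -
  interpret K: subgroup "K_p p H" H by (rule H.K_p_subgroup(1))
  have "subgroup {x \<in> carrier G. h x \<in> K_p p H} G"
    by (intro G.subgroupI) (auto intro: exI[of _ "\<one>\<^bsub>G\<^esub>"])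
  then have "K_p p G \<subseteq> {x \<in> carrier G. h x \<in> K_p p H}"
  proof (rule G.K_p_minimal)
    fix x y assume "x \<in> carrier G" "y \<in> carrier G"
    then show "x \<otimes> y \<otimes> inv x \<otimes> inv y \<in> {x \<in> carrier G. h x \<in> K_p p H}"
      using H.K_p_contains(1)[of "h x" "h y" p] by simp
  next
    fix x assume "x \<in> carrier G"
    then show "x [^] p \<in> {x \<in> carrier G. h x \<in> K_p p H}"
      using H.K_p_contains(2)[of "h x" p] by (simp add: hom_nat_pow)
  qed
  then show ?thesis using assms by blast
qed

lemma (in group) K_p_characteristic: "characteristic_subgroup (K_p p G) G"
  unfolding characteristic_subgroup_def
proof (intro conjI ballI K_p_subgroup(1))
  fix \<phi> assume \<phi>: "\<phi> \<in> auto G"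
  interpret \<phi>: group_hom G G \<phi> by (rule auto_group_hom[OF \<phi>])
  obtain \<psi> where \<psi>: "\<psi> \<in> auto G" "\<And>x. x \<in> carrier G \<Longrightarrow> \<phi> (\<psi> x) = x"
  proof (rule auto_inverse[OF \<phi>])
    fix \<psi> assume "\<psi> \<in> auto G" "\<And>x. x \<in> carrier G \<Longrightarrow> \<phi> (\<psi> x) = x"
    then show ?thesis by (rule that)
  qed
  interpret \<psi>: group_hom G G \<psi> by (rule auto_group_hom[OF \<psi>(1)])
  show "\<phi> ` K_p p G = K_p p G"
  proof
    show "\<phi> ` K_p p G \<subseteq> K_p p G" using \<phi>.K_p_image by blast
    show "K_p p G \<subseteq> \<phi> ` K_p p G"
    proof
      fix x assume x: "x \<in> K_p p G"
      then have "\<phi> (\<psi> x) = x" using \<psi>(2) subgroup.mem_carrier[OF K_p_subgroup(1)] by blast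
      then show "x \<in> \<phi> ` K_p p G" using \<psi>.K_p_image[OF x] by (metis imageI)
    qed
  qed
qed

lemma (in group) induced_auto_hom:
  assumes K: "characteristic_subgroup K G"
  shows "group_hom (AutoGroup G) (AutoGroup (G Mod K)) (induced_auto G K)"
proof -
  interpret K: normal K G by (rule characteristic_normal[OF K])
  interpret Q: group "G Mod K" by (rule K.factorgroup_is_group)
  interpret A: group "AutoGroup G" by (rule AutoGroup)
  have rep: "\<exists>x\<in>carrier G. C = K #> x" if "C \<in> carrier (G Mod K)" for C
    using that unfolding carrier_FactGroup by blast
  have coset: "K #> x \<in> carrier (G Mod K)" if "x \<in> carrier G" for x
    using that unfolding carrier_FactGroup by blast
  note ind = induced_auto_coset[OF K]
  have ext: "induced_auto G K \<phi> \<in> extensional (carrier (G Mod K))" for \<phi>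
    by (simp add: induced_auto_def)
  have closed: "induced_auto G K \<phi> C \<in> carrier (G Mod K)" if \<phi>: "\<phi> \<in> auto G" and C: "C \<in> carrier (G Mod K)" for \<phi> C
  proof -
    obtain x where x: "x \<in> carrier G" "C = K #> x" using rep[OF C] by blast
    show ?thesis unfolding x(2) ind[OF \<phi> x(1)] by (rule coset[OF auto_closed[OF \<phi> x(1)]])
  qed
  have comp: "induced_auto G K \<phi> (induced_auto G K \<psi> C) = induced_auto G K (\<phi> \<otimes>\<^bsub>AutoGroup G\<^esub> \<psi>) C"
    if \<phi>: "\<phi> \<in> auto G" and \<psi>: "\<psi> \<in> auto G" and C: "C \<in> carrier (G Mod K)" for \<phi> \<psi> C
  proof -
    obtain x where x: "x \<in> carrier G" "C = K #> x" using rep[OF C] by blast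
    have m: "\<phi> \<otimes>\<^bsub>AutoGroup G\<^esub> \<psi> \<in> auto G" using A.m_closed[of \<phi> \<psi>] \<phi> \<psi> by simp
    show ?thesis
      unfolding x(2) ind[OF \<psi> x(1)] ind[OF \<phi> auto_closed[OF \<psi> x(1)]] ind[OF m x(1)]
      by (simp only: mult_AutoGroup[OF \<phi> \<psi> x(1)])
  qed
  have one: "induced_auto G K \<one>\<^bsub>AutoGroup G\<^esub> C = C" if C: "C \<in> carrier (G Mod K)" for C
  proof -
    obtain x where x: "x \<in> carrier G" "C = K #> x" using rep[OF C] by blast
    have m: "\<one>\<^bsub>AutoGroup G\<^esub> \<in> auto G" using A.one_closed by simp
    show ?thesis unfolding x(2) ind[OF m x(1)] using x(1) by (simp add: one_AutoGroup)
  qed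
  have mem: "induced_auto G K \<phi> \<in> auto (G Mod K)" if \<phi>: "\<phi> \<in> auto G" for \<phi>
  proof (rule Q.autoI)
    show "induced_auto G K \<phi> \<in> hom (G Mod K) (G Mod K)"
    proof (rule homI)
      fix C D assume C: "C \<in> carrier (G Mod K)" and D: "D \<in> carrier (G Mod K)"
      show "induced_auto G K \<phi> C \<in> carrier (G Mod K)" by (rule closed[OF \<phi> C])
      obtain x where x: "x \<in> carrier G" "C = K #> x" using rep[OF C] by blast
      obtain y where y: "y \<in> carrier G" "D = K #> y" using rep[OF D] by blast
      interpret \<phi>: group_hom G G \<phi> by (rule auto_group_hom[OF \<phi>])
      show "induced_auto G K \<phi> (C \<otimes>\<^bsub>G Mod K\<^esub> D) = induced_auto G K \<phi> C \<otimes>\<^bsub>G Mod K\<^esub> induced_auto G K \<phi> D"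
        unfolding x(2) y(2) ind[OF \<phi> x(1)] ind[OF \<phi> y(1)] mult_FactGroup K.rcos_sum[OF x(1) y(1)]
          K.rcos_sum[OF \<phi>.hom_closed[OF x(1)] \<phi>.hom_closed[OF y(1)]] ind[OF \<phi> m_closed[OF x(1) y(1)]]
          \<phi>.hom_mult[OF x(1) y(1)] by (rule HOL.refl)
    qed
    let ?\<psi> = "inv\<^bsub>AutoGroup G\<^esub> \<phi>"
    have \<psi>: "?\<psi> \<in> auto G" using A.inv_closed[of \<phi>] \<phi> by simp
    have i: "\<phi> \<otimes>\<^bsub>AutoGroup G\<^esub> ?\<psi> = \<one>\<^bsub>AutoGroup G\<^esub>" "?\<psi> \<otimes>\<^bsub>AutoGroup G\<^esub> \<phi> = \<one>\<^bsub>AutoGroup G\<^esub>"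
      using A.r_inv[of \<phi>] A.l_inv[of \<phi>] \<phi> by simp_all
    show "bij_betw (induced_auto G K \<phi>) (carrier (G Mod K)) (carrier (G Mod K))"
    proof (rule bij_betwI[where g = "induced_auto G K ?\<psi>"])
      show "induced_auto G K \<phi> \<in> carrier (G Mod K) \<rightarrow> carrier (G Mod K)"
        using closed[OF \<phi>] by (intro funcsetI)
      show "induced_auto G K ?\<psi> \<in> carrier (G Mod K) \<rightarrow> carrier (G Mod K)"
        using closed[OF \<psi>] by (intro funcsetI)
      show "induced_auto G K ?\<psi> (induced_auto G K \<phi> C) = C" if "C \<in> carrier (G Mod K)" for C
        unfolding comp[OF \<psi> \<phi> that] i(2) by (rule one[OF that])
      show "induced_auto G K \<phi> (induced_auto G K ?\<psi> C) = C" if "C \<in> carrier (G Mod K)" for C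
        unfolding comp[OF \<phi> \<psi> that] i(1) by (rule one[OF that])
    qed
  qed (rule ext)
  have "induced_auto G K \<in> hom (AutoGroup G) (AutoGroup (G Mod K))"
  proof (rule homI)
    fix \<phi> assume "\<phi> \<in> carrier (AutoGroup G)"
    then have \<phi>: "\<phi> \<in> auto G" by simp
    then show "induced_auto G K \<phi> \<in> carrier (AutoGroup (G Mod K))" using mem by simp
    fix \<psi> assume "\<psi> \<in> carrier (AutoGroup G)"
    then have \<psi>: "\<psi> \<in> auto G" by simp
    interpret B: group "AutoGroup (G Mod K)" by (rule Q.AutoGroup)
    have m: "\<phi> \<otimes>\<^bsub>AutoGroup G\<^esub> \<psi> \<in> auto G" using A.m_closed[of \<phi> \<psi>] \<phi> \<psi> by simp
    show "induced_auto G K (\<phi> \<otimes>\<^bsub>AutoGroup G\<^esub> \<psi>) =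
      induced_auto G K \<phi> \<otimes>\<^bsub>AutoGroup (G Mod K)\<^esub> induced_auto G K \<psi>"
    proof (rule auto_eqI[OF mem[OF m]])
      show "induced_auto G K \<phi> \<otimes>\<^bsub>AutoGroup (G Mod K)\<^esub> induced_auto G K \<psi> \<in> auto (G Mod K)"
        using B.m_closed[of "induced_auto G K \<phi>" "induced_auto G K \<psi>"] mem[OF \<phi>] mem[OF \<psi>] by simp
      show "induced_auto G K (\<phi> \<otimes>\<^bsub>AutoGroup G\<^esub> \<psi>) C =
        (induced_auto G K \<phi> \<otimes>\<^bsub>AutoGroup (G Mod K)\<^esub> induced_auto G K \<psi>) C" if C: "C \<in> carrier (G Mod K)" for C
        unfolding mult_AutoGroup[OF mem[OF \<phi>] mem[OF \<psi>] C] by (rule comp[OF \<phi> \<psi> C, symmetric])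
    qed
  qed
  then show ?thesis
    using A.is_group Q.AutoGroup by (simp add: group_hom_def group_hom_axioms_def)
qed

lemma (in group) Aut_p_iff:
  "\<phi> \<in> Aut_p p G \<longleftrightarrow> \<phi> \<in> auto G \<and> (\<forall>x\<in>carrier G. \<phi> x \<otimes> inv x \<in> K_p p G)"
proof (cases "\<phi> \<in> auto G")
  case \<phi>: True
  let ?K = "K_p p G"
  interpret K: normal ?K G by (rule K_p_subgroup(2))
  interpret Q: group "G Mod ?K" by (rule K.factorgroup_is_group)
  interpret i: group_hom "AutoGroup G" "AutoGroup (G Mod ?K)" "induced_auto G ?K"
    by (rule induced_auto_hom[OF K_p_characteristic])
  have mem: "induced_auto G ?K \<phi> \<in> auto (G Mod ?K)" using i.hom_closed[of \<phi>] \<phi> by simp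
  have one: "\<one>\<^bsub>AutoGroup (G Mod ?K)\<^esub> \<in> auto (G Mod ?K)" using i.H.one_closed by simp
  have "induced_auto G ?K \<phi> = \<one>\<^bsub>AutoGroup (G Mod ?K)\<^esub> \<longleftrightarrow>
    (\<forall>C\<in>carrier (G Mod ?K). induced_auto G ?K \<phi> C = C)"
    using auto_eqI[OF mem one] by (auto simp: one_AutoGroup simp del: mult_FactGroup)
  also have "\<dots> \<longleftrightarrow> (\<forall>x\<in>carrier G. induced_auto G ?K \<phi> (?K #> x) = ?K #> x)"
    unfolding carrier_FactGroup by blast
  also have "\<dots> \<longleftrightarrow> (\<forall>x\<in>carrier G. \<phi> x \<otimes> inv x \<in> ?K)"
    using induced_auto_coset[OF K_p_characteristic \<phi>] K.rcos_eq_iff[OF auto_closed[OF \<phi>]] by simp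
  finally show ?thesis using \<phi> by (simp add: Aut_p_def kernel_def)
qed (simp add: Aut_p_def kernel_def)

lemma (in group) Aut_p_subgroup: "subgroup (Aut_p p G) (AutoGroup G)"
proof -
  interpret i: group_hom "AutoGroup G" "AutoGroup (G Mod K_p p G)" "induced_auto G (K_p p G)"
    by (rule induced_auto_hom[OF K_p_characteristic])
  show ?thesis unfolding Aut_p_def by (rule i.subgroup_kernel)
qed

lemma (in group) Inn_subset_Aut_p: "Inn G \<subseteq> Aut_p p G"
proof
  fix \<phi> assume "\<phi> \<in> Inn G"
  then obtain g where g: "g \<in> carrier G" "\<phi> = (\<lambda>x\<in>carrier G. g \<otimes> x \<otimes> inv g)" by (auto simp: Inn_def)
  have "\<phi> \<in> auto G" unfolding g(2) by (rule inner_in_auto[OF g(1)])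
  then show "\<phi> \<in> Aut_p p G" using g K_p_contains(1)[OF g(1)] by (simp add: Aut_p_iff)
qed

text \<open>Conjugation is a homomorphism from \<open>G\<close> onto \<open>Inn G\<close>, and an
  automorphism \<open>\<phi>\<close> carries conjugation by \<open>g\<close> to conjugation by
  \<open>\<phi> g\<close>.\<close>

lemma (in group) Inn_normal: "Inn G \<lhd> AutoGroup G"
proof -
  interpret A: group "AutoGroup G" by (rule AutoGroup)
  let ?c = "\<lambda>g. \<lambda>x\<in>carrier G. g \<otimes> x \<otimes> inv g"
  have c: "?c g \<in> auto G" if "g \<in> carrier G" for g by (rule inner_in_auto[OF that])
  have hom: "?c (g \<otimes> h) = ?c g \<otimes>\<^bsub>AutoGroup G\<^esub> ?c h" if g: "g \<in> carrier G" and h: "h \<in> carrier G" for g h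
  proof (rule auto_eqI[OF c])
    show "?c g \<otimes>\<^bsub>AutoGroup G\<^esub> ?c h \<in> auto G" using A.m_closed[of "?c g" "?c h"] c[OF g] c[OF h] by simp
    show "?c (g \<otimes> h) x = (?c g \<otimes>\<^bsub>AutoGroup G\<^esub> ?c h) x" if x: "x \<in> carrier G" for x
      unfolding mult_AutoGroup[OF c[OF g] c[OF h] x] using g h x by (simp add: inv_mult_group m_assoc)
  qed (use g h in simp)
  interpret c: group_hom G "AutoGroup G" ?c
    using hom c is_group A.is_group by (auto simp: group_hom_def group_hom_axioms_def intro!: homI)
  have "subgroup (?c ` carrier G) (AutoGroup G)" by (rule c.img_is_subgroup)
  then have sub: "subgroup (Inn G) (AutoGroup G)" by (simp add: Inn_def)
  show ?thesis
    unfolding A.normal_inv_iff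
  proof (intro conjI ballI sub)
    fix \<phi> \<iota> assume "\<phi> \<in> carrier (AutoGroup G)" and "\<iota> \<in> Inn G"
    then obtain g where \<phi>: "\<phi> \<in> auto G" and g: "g \<in> carrier G" "\<iota> = ?c g" by (auto simp: Inn_def)
    interpret \<phi>: group_hom G G \<phi> by (rule auto_group_hom[OF \<phi>])
    let ?\<psi> = "inv\<^bsub>AutoGroup G\<^esub> \<phi>"
    have \<psi>: "?\<psi> \<in> auto G" using A.inv_closed[of \<phi>] \<phi> by simp
    have m: "\<phi> \<otimes>\<^bsub>AutoGroup G\<^esub> \<iota> \<in> auto G" using A.m_closed[of \<phi> \<iota>] \<phi> c[OF g(1)] g(2) by simp
    have "\<phi> \<otimes>\<^bsub>AutoGroup G\<^esub> \<iota> \<otimes>\<^bsub>AutoGroup G\<^esub> ?\<psi> = ?c (\<phi> g)"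
    proof (rule auto_eqI)
      show "\<phi> \<otimes>\<^bsub>AutoGroup G\<^esub> \<iota> \<otimes>\<^bsub>AutoGroup G\<^esub> ?\<psi> \<in> auto G" using A.m_closed[of _ ?\<psi>] m \<psi> by simp
      show "?c (\<phi> g) \<in> auto G" using g by (intro c) simp
      fix x assume x: "x \<in> carrier G"
      have "(\<phi> \<otimes>\<^bsub>AutoGroup G\<^esub> \<iota> \<otimes>\<^bsub>AutoGroup G\<^esub> ?\<psi>) x = \<phi> (\<iota> (?\<psi> x))"
        using mult_AutoGroup[OF m \<psi> x] mult_AutoGroup[OF \<phi> _ auto_closed[OF \<psi> x], of \<iota>] c[OF g(1)] g(2) by simp
      also have "\<dots> = \<phi> (g \<otimes> ?\<psi> x \<otimes> inv g)" using g auto_closed[OF \<psi> x] by simp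
      also have "\<dots> = \<phi> g \<otimes> \<phi> (?\<psi> x) \<otimes> inv (\<phi> g)" using g auto_closed[OF \<psi> x] by simp
      also have "\<dots> = ?c (\<phi> g) x" using inv_AutoGroup(1)[OF \<phi> x] x by simp
      finally show "(\<phi> \<otimes>\<^bsub>AutoGroup G\<^esub> \<iota> \<otimes>\<^bsub>AutoGroup G\<^esub> ?\<psi>) x = ?c (\<phi> g) x" .
    qed
    then show "\<phi> \<otimes>\<^bsub>AutoGroup G\<^esub> \<iota> \<otimes>\<^bsub>AutoGroup G\<^esub> ?\<psi> \<in> Inn G" using g(1) by (simp add: Inn_def)
  qed
qed

lemma (in group) Inn_normal_Aut_p: "Inn G \<lhd> (AutoGroup G)\<lparr>carrier := Aut_p p G\<rparr>"
proof -
  interpret A: group "AutoGroup G" by (rule AutoGroup)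
  interpret I: normal "Inn G" "AutoGroup G" by (rule Inn_normal)
  have A': "group ((AutoGroup G)\<lparr>carrier := Aut_p p G\<rparr>)" by (rule A.subgroup_imp_group[OF Aut_p_subgroup])
  interpret A': group "(AutoGroup G)\<lparr>carrier := Aut_p p G\<rparr>" by (rule A')
  have sub: "subgroup (Inn G) ((AutoGroup G)\<lparr>carrier := Aut_p p G\<rparr>)"
    by (rule A.subgroup_incl[OF I.subgroup_axioms Aut_p_subgroup Inn_subset_Aut_p])
  show ?thesis
    unfolding A'.normal_inv_iff
  proof (intro conjI sub ballI)
    fix x h assume x: "x \<in> carrier ((AutoGroup G)\<lparr>carrier := Aut_p p G\<rparr>)" and h: "h \<in> Inn G"
    then have xp: "x \<in> Aut_p p G" by simp
    then have "x \<in> carrier (AutoGroup G)" using subgroup.mem_carrier[OF Aut_p_subgroup] by blast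
    then have "x \<otimes>\<^bsub>AutoGroup G\<^esub> h \<otimes>\<^bsub>AutoGroup G\<^esub> inv\<^bsub>AutoGroup G\<^esub> x \<in> Inn G" by (rule I.inv_op_closed2[OF _ h])
    then show "x \<otimes>\<^bsub>(AutoGroup G)\<lparr>carrier := Aut_p p G\<rparr>\<^esub> h \<otimes>\<^bsub>(AutoGroup G)\<lparr>carrier := Aut_p p G\<rparr>\<^esub>
        inv\<^bsub>(AutoGroup G)\<lparr>carrier := Aut_p p G\<rparr>\<^esub> x \<in> Inn G"
      using A.m_inv_consistent[OF Aut_p_subgroup xp] by simp
  qed
qed

text \<open>By \<open>auto_p_power\<close> every element of the finite group \<open>Aut_p\<close>
  already has \<open>p\<close>-power order. This makes \<open>Out_p\<close> of each finite
  \<open>p\<close>-quotient a finite \<open>p\<close>-group.\<close>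

lemma (in group) Inn_p_normal_Aut_p:
  assumes p: "Factorial_Ring.prime p" and G: "finite_p_group p G"
  shows "p_normal p (Inn G) ((AutoGroup G)\<lparr>carrier := Aut_p p G\<rparr>)"
proof -
  interpret A: group "AutoGroup G" by (rule AutoGroup)
  have A': "group ((AutoGroup G)\<lparr>carrier := Aut_p p G\<rparr>)" by (rule A.subgroup_imp_group[OF Aut_p_subgroup])
  interpret A': group "(AutoGroup G)\<lparr>carrier := Aut_p p G\<rparr>" by (rule A')
  interpret I: normal "Inn G" "(AutoGroup G)\<lparr>carrier := Aut_p p G\<rparr>" by (rule Inn_normal_Aut_p)
  show ?thesis
  proof (rule A'.p_normalI[OF p Inn_normal_Aut_p, where \<kappa> = id])
    have "Aut_p p G \<subseteq> auto G" by (auto simp: Aut_p_iff)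
    then show "finite (id ` carrier ((AutoGroup G)\<lparr>carrier := Aut_p p G\<rparr>))"
      using finite_auto[of G] G finite_subset by (auto simp: finite_p_group_def)
    show "x \<otimes>\<^bsub>(AutoGroup G)\<lparr>carrier := Aut_p p G\<rparr>\<^esub> inv\<^bsub>(AutoGroup G)\<lparr>carrier := Aut_p p G\<rparr>\<^esub> y \<in> Inn G"
      if "x \<in> carrier ((AutoGroup G)\<lparr>carrier := Aut_p p G\<rparr>)" "y \<in> carrier ((AutoGroup G)\<lparr>carrier := Aut_p p G\<rparr>)"
        "id x = id y" for x y
      using A'.r_inv[OF that(2)] that(3) I.one_closed by simp
    fix \<alpha> assume "\<alpha> \<in> carrier ((AutoGroup G)\<lparr>carrier := Aut_p p G\<rparr>)"
    then have \<alpha>: "\<alpha> \<in> auto G" "\<And>x. x \<in> carrier G \<Longrightarrow> \<alpha> x \<otimes> inv x \<in> K_p p G" by (auto simp: Aut_p_iff)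
    obtain m where "\<alpha> [^]\<^bsub>AutoGroup G\<^esub> (p ^ m :: nat) = \<one>\<^bsub>AutoGroup G\<^esub>"
      using auto_p_power[OF p G \<alpha>] by blast
    then have "\<alpha> [^]\<^bsub>(AutoGroup G)\<lparr>carrier := Aut_p p G\<rparr>\<^esub> (p ^ m :: nat) \<in> Inn G"
      using I.one_closed by (simp add: A.nat_pow_consistent[symmetric])
    then show "\<exists>m. \<alpha> [^]\<^bsub>(AutoGroup G)\<lparr>carrier := Aut_p p G\<rparr>\<^esub> (p ^ m :: nat) \<in> Inn G" by blast
  qed
qed

lemma (in group) induced_auto_Aut_p_hom:
  assumes K: "characteristic_subgroup K G"
  shows "group_hom ((AutoGroup G)\<lparr>carrier := Aut_p p G\<rparr>)
    ((AutoGroup (G Mod K))\<lparr>carrier := Aut_p p (G Mod K)\<rparr>) (induced_auto G K)"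
proof -
  interpret K: normal K G by (rule characteristic_normal[OF K])
  interpret Q: group "G Mod K" by (rule K.factorgroup_is_group)
  interpret q: group_hom G "G Mod K" "\<lambda>x. K #> x"
    using K.r_coset_hom_Mod Q.is_group is_group by (simp add: group_hom_def group_hom_axioms_def)
  interpret i: group_hom "AutoGroup G" "AutoGroup (G Mod K)" "induced_auto G K"
    by (rule induced_auto_hom[OF K])
  have "induced_auto G K \<phi> \<in> Aut_p p (G Mod K)" if "\<phi> \<in> Aut_p p G" for \<phi>
  proof -
    have \<phi>: "\<phi> \<in> auto G" "\<And>x. x \<in> carrier G \<Longrightarrow> \<phi> x \<otimes> inv x \<in> K_p p G"
      using that by (auto simp: Aut_p_iff)
    have "induced_auto G K \<phi> C \<otimes>\<^bsub>G Mod K\<^esub> inv\<^bsub>G Mod K\<^esub> C \<in> K_p p (G Mod K)" if C: "C \<in> carrier (G Mod K)" for C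
    proof -
      obtain x where x: "x \<in> carrier G" "C = K #> x" using C unfolding carrier_FactGroup by blast
      have "K #> (\<phi> x \<otimes> inv x) \<in> K_p p (G Mod K)" by (rule q.K_p_image[OF \<phi>(2)[OF x(1)]])
      moreover have "K #> (\<phi> x \<otimes> inv x) = (K #> \<phi> x) \<otimes>\<^bsub>G Mod K\<^esub> inv\<^bsub>G Mod K\<^esub> (K #> x)"
        by (simp only: q.hom_mult[OF auto_closed[OF \<phi>(1) x(1)] inv_closed[OF x(1)]] q.hom_inv[OF x(1)])
      ultimately show ?thesis unfolding x(2) induced_auto_coset[OF K \<phi>(1) x(1)] by (simp only:)
    qed
    moreover have "induced_auto G K \<phi> \<in> auto (G Mod K)" using i.hom_closed[of \<phi>] \<phi>(1) by simp
    ultimately show ?thesis unfolding Q.Aut_p_iff by blast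
  qed
  moreover have "Aut_p p G \<subseteq> auto G" by (auto simp: Aut_p_iff)
  then have "\<phi> \<in> carrier (AutoGroup G)" if "\<phi> \<in> Aut_p p G" for \<phi> using that by auto
  ultimately have "induced_auto G K \<in> hom ((AutoGroup G)\<lparr>carrier := Aut_p p G\<rparr>)
    ((AutoGroup (G Mod K))\<lparr>carrier := Aut_p p (G Mod K)\<rparr>)"
    by (intro homI) (simp_all add: i.hom_mult)
  moreover have "group ((AutoGroup G)\<lparr>carrier := Aut_p p G\<rparr>)"
    by (rule i.G.subgroup_imp_group[OF Aut_p_subgroup])
  moreover have "group ((AutoGroup (G Mod K))\<lparr>carrier := Aut_p p (G Mod K)\<rparr>)"
    by (rule i.H.subgroup_imp_group[OF Q.Aut_p_subgroup])
  ultimately show ?thesis by (simp add: group_hom_def group_hom_axioms_def)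
qed

text \<open>A characteristic \<open>K\<close> that detects \<open>\<phi>\<close> yields the preimage
  of \<open>Inn (G Mod K)\<close> in \<open>Aut_p\<close>. It misses \<open>\<phi>\<close>, contains
  \<open>Inn G\<close>, and has a finite \<open>p\<close>-quotient by
  \<open>Inn_p_normal_Aut_p\<close>, so it descends to \<open>Out_p\<close>.\<close>

lemma (in group) p_IAS_imp_residually_p_finite_Out_p:
  assumes p: "Factorial_Ring.prime p" and ias: "p_IAS p G"
  shows "residually_p_finite p (Out_p p G)"
proof -
  let ?A = "(AutoGroup G)\<lparr>carrier := Aut_p p G\<rparr>"
  interpret A0: group "AutoGroup G" by (rule AutoGroup)
  have A': "group ?A" by (rule A0.subgroup_imp_group[OF Aut_p_subgroup])
  interpret A: group ?A by (rule A')
  interpret I: normal "Inn G" ?A by (rule Inn_normal_Aut_p)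
  have grp: "group (?A Mod Inn G)" by (rule I.factorgroup_is_group)
  have "\<exists>N. p_normal p N (?A Mod Inn G) \<and> C \<notin> N"
    if C: "C \<in> carrier (?A Mod Inn G)" "C \<noteq> \<one>\<^bsub>?A Mod Inn G\<^esub>" for C
  proof -
    obtain \<phi> where \<phi>: "\<phi> \<in> carrier ?A" "C = Inn G #>\<^bsub>?A\<^esub> \<phi>" using C(1) unfolding carrier_FactGroup by blast
    then have \<phi>a: "\<phi> \<in> auto G" by (simp add: Aut_p_iff)
    have "\<phi> \<notin> Inn G" using C(2) \<phi> I.rcos_eq_self_iff[OF \<phi>(1)] by (metis one_FactGroup)
    then obtain K where K: "characteristic_subgroup K G" "finite_p_group p (G Mod K)"
      "induced_auto G K \<phi> \<notin> Inn (G Mod K)"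
      using ias \<phi>a unfolding p_IAS_def by blast
    interpret K: normal K G by (rule characteristic_normal[OF K(1)])
    interpret Q: group "G Mod K" by (rule K.factorgroup_is_group)
    let ?B = "(AutoGroup (G Mod K))\<lparr>carrier := Aut_p p (G Mod K)\<rparr>"
    interpret i: group_hom ?A ?B "induced_auto G K" by (rule induced_auto_Aut_p_hom[OF K(1)])
    let ?M = "{\<psi> \<in> carrier ?A. induced_auto G K \<psi> \<in> Inn (G Mod K)}"
    have M: "p_normal p ?M ?A" by (rule i.p_normal_vimage[OF p Q.Inn_p_normal_Aut_p[OF p K(2)]])
    have IM: "Inn G \<subseteq> ?M"
    proof
      fix \<iota> assume \<iota>: "\<iota> \<in> Inn G"
      then obtain g where g: "g \<in> carrier G" "\<iota> = (\<lambda>x\<in>carrier G. g \<otimes> x \<otimes> inv g)" by (auto simp: Inn_def)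
      have "\<iota> \<in> auto G" using \<iota> Inn_subset_auto by blast
      then have "induced_auto G K \<iota> \<in> Inn (G Mod K)"
        using induced_inner_iff[OF K(1)] g K.one_closed by (auto intro!: bexI[of _ g])
      then show "\<iota> \<in> ?M" using \<iota> Inn_subset_Aut_p by auto
    qed
    show ?thesis
      unfolding \<phi>(2) using A.p_normal_quotient[OF p Inn_normal_Aut_p M IM \<phi>(1)] K(3) by blast
  qed
  then show ?thesis
    using grp unfolding residually_p_finite_def Out_p_def p_normal_def by blast
qed

text \<open>By commutativity, adjoining a generator only multiplies the group by a cyclic group of
  at most \<open>p\<close> elements.\<close>

lemma (in comm_group) finite_generate_torsion:
  assumes "finite S" "S \<subseteq> carrier G" "0 < p" "\<And>x. x \<in> S \<Longrightarrow> x [^] (p :: nat) = \<one>"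
  shows "finite (generate G S)"
  using assms
proof (induction S)
  case empty
  then show ?case by (simp add: generate_empty)
next
  case (insert a S)
  have a: "a \<in> carrier G" and S: "S \<subseteq> carrier G" using insert.prems by auto
  have fin: "finite (generate G S)" using insert by blast
  let ?H = "generate G {a} <#> generate G S"
  have sub: "subgroup ?H G"
    using a S by (intro mult_subgroups generate_is_subgroup) auto
  have "insert a S \<subseteq> ?H"
  proof
    fix x assume "x \<in> insert a S"
    then consider "x = a" | "x \<in> S" by blast
    then show "x \<in> ?H"
    proof cases
      case 1
      have "a \<otimes> \<one> \<in> ?H" unfolding set_mult_def using generate.incl[of a "{a}" G] generate.one[of G S] by blast
      then show ?thesis using 1 a by simp
    next
      case 2
      have "\<one> \<otimes> x \<in> ?H" unfolding set_mult_def using generate.incl[OF 2, of G] generate.one[of G "{a}"] by blast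
      then show ?thesis using 2 S by auto
    qed
  qed
  then have "generate G (insert a S) \<subseteq> ?H" by (rule generate_subgroup_incl[OF _ sub])
  moreover have "finite (generate G {a})"
  proof (rule finite_subset)
    show "generate G {a} \<subseteq> (\<lambda>k::int. a [^] k) ` {0..<int p}"
    proof
      fix x assume "x \<in> generate G {a}"
      then obtain k :: int where k: "x = a [^] k" using generate_pow[OF a] by blast
      have ap: "a [^] (int p) = \<one>" using insert.prems(3)[of a] by (simp add: int_pow_int)
      have "a [^] k = a [^] (int p * (k div int p) + k mod int p)" by simp
      also have "\<dots> = a [^] (int p * (k div int p)) \<otimes> a [^] (k mod int p)" by (rule int_pow_mult[OF a])
      also have "a [^] (int p * (k div int p)) = \<one>"
        unfolding int_pow_pow[OF a, symmetric] ap by (rule int_pow_one)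
      finally have "x = a [^] (k mod int p)" using k a by simp
      then show "x \<in> (\<lambda>k::int. a [^] k) ` {0..<int p}" using \<open>0 < p\<close> by auto
    qed
  qed simp
  then have "finite ?H" unfolding set_mult_def using fin by blast
  ultimately show ?case by (rule finite_subset)
qed

text \<open>The quotient is abelian and generated by finitely many elements that are killed by
  \<open>p\<close>.\<close>

lemma (in group) finite_quotient_K_p:
  assumes p: "Factorial_Ring.prime p" and fg: "finitely_generated_group G"
  shows "finite (carrier (G Mod K_p p G))"
proof -
  let ?K = "K_p p G"
  interpret K: normal ?K G by (rule K_p_subgroup(2))
  interpret Q: group "G Mod ?K" by (rule K.factorgroup_is_group)
  interpret q: group_hom G "G Mod ?K" "\<lambda>x. ?K #> x"
    using K.r_coset_hom_Mod Q.is_group is_group by (simp add: group_hom_def group_hom_axioms_def)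
  obtain S where S: "finite S" "S \<subseteq> carrier G" "generate G S = carrier G"
    using fg by (auto simp: finitely_generated_group_def)
  have "C \<otimes>\<^bsub>G Mod ?K\<^esub> D = D \<otimes>\<^bsub>G Mod ?K\<^esub> C"
    if C: "C \<in> carrier (G Mod ?K)" and D: "D \<in> carrier (G Mod ?K)" for C D
  proof -
    obtain x where x: "x \<in> carrier G" "C = ?K #> x" using C unfolding carrier_FactGroup by blast
    obtain y where y: "y \<in> carrier G" "D = ?K #> y" using D unfolding carrier_FactGroup by blast
    have "x \<otimes> y \<otimes> inv (y \<otimes> x) \<in> ?K"
      using K_p_contains(1)[OF x(1) y(1), of p] x(1) y(1) by (simp add: inv_mult_group m_assoc)
    then have "?K #> (x \<otimes> y) = ?K #> (y \<otimes> x)"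
      using K.rcos_eq_iff[OF m_closed[OF x(1) y(1)] m_closed[OF y(1) x(1)]] by blast
    then show ?thesis
      unfolding x(2) y(2) q.hom_mult[OF x(1) y(1), symmetric] q.hom_mult[OF y(1) x(1), symmetric] .
  qed
  then interpret Q: comm_group "G Mod ?K" by (rule Q.group_comm_groupI)
  have "generate (G Mod ?K) ((\<lambda>x. ?K #> x) ` S) = (\<lambda>x. ?K #> x) ` carrier G"
    using q.generate_img[OF S(2)] S(3) by (simp only:)
  then have gen: "generate (G Mod ?K) ((\<lambda>x. ?K #> x) ` S) = carrier (G Mod ?K)"
    unfolding carrier_FactGroup .
  have "finite (generate (G Mod ?K) ((\<lambda>x. ?K #> x) ` S))"
  proof (rule Q.finite_generate_torsion)
    show "finite ((\<lambda>x. ?K #> x) ` S)" using S(1) by simp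
    show "(\<lambda>x. ?K #> x) ` S \<subseteq> carrier (G Mod ?K)" using S(2) unfolding carrier_FactGroup by blast
    show "0 < p" using prime_gt_0_nat[OF p] .
    fix C assume "C \<in> (\<lambda>x. ?K #> x) ` S"
    then obtain x where x: "x \<in> carrier G" "C = ?K #> x" using S(2) by blast
    show "C [^]\<^bsub>G Mod ?K\<^esub> p = \<one>\<^bsub>G Mod ?K\<^esub>"
      unfolding x(2) K.FactGroup_pow[OF x(1)]
      using K.rcos_eq_self_iff[of "x [^] p"] K_p_contains(2)[OF x(1)] x(1) by simp
  qed
  then show ?thesis unfolding gen .
qed

text \<open>The finite-index subgroup is \<open>Out_p\<close>, realised as the image
  \<open>H\<close> of \<open>Aut_p\<close>. The coset of an outer class modulo \<open>H\<close>
  depends only on the induced automorphism of the finite group \<open>G Mod K_p\<close>, so there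
  are finitely many cosets.\<close>

lemma (in group) p_IAS_imp_virtually_residually_p_finite_OutGroup:
  assumes p: "Factorial_Ring.prime p" and fg: "finitely_generated_group G" and ias: "p_IAS p G"
  shows "virtually_residually_p_finite p (OutGroup G)"
proof -
  let ?K = "K_p p G"
  interpret A: group "AutoGroup G" by (rule AutoGroup)
  interpret I: normal "Inn G" "AutoGroup G" by (rule Inn_normal)
  interpret O: group "OutGroup G" unfolding OutGroup_def by (rule I.factorgroup_is_group)
  define \<pi> where "\<pi> = (\<lambda>\<phi>. Inn G #>\<^bsub>AutoGroup G\<^esub> \<phi>)"
  interpret \<pi>: group_hom "AutoGroup G" "OutGroup G" \<pi>
    using I.r_coset_hom_Mod O.is_group A.is_group
    by (simp add: group_hom_def group_hom_axioms_def OutGroup_def \<pi>_def)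
  interpret P: subgroup "Aut_p p G" "AutoGroup G" by (rule Aut_p_subgroup)
  interpret i: group_hom "AutoGroup G" "AutoGroup (G Mod ?K)" "induced_auto G ?K"
    by (rule induced_auto_hom[OF K_p_characteristic])
  define H where "H = \<pi> ` Aut_p p G"
  have H: "subgroup H (OutGroup G)" unfolding H_def by (rule \<pi>.subgroup_img_is_subgroup[OF Aut_p_subgroup])
  \<comment> \<open>Cosets of \<open>Inn G\<close> and their products are the same sets whether
    formed in \<open>Aut_p\<close> or in \<open>AutoGroup\<close>, so \<open>Out_p\<close> is
    literally a substructure of \<open>OutGroup\<close>.\<close>
  have "rcosets\<^bsub>(AutoGroup G)\<lparr>carrier := Aut_p p G\<rparr>\<^esub> (Inn G) = H"
    by (auto simp: H_def \<pi>_def RCOSETS_def r_coset_def)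
  moreover have "set_mult ((AutoGroup G)\<lparr>carrier := Aut_p p G\<rparr>) = set_mult (AutoGroup G)"
    by (intro ext) (simp add: set_mult_def)
  ultimately have "Out_p p G = (OutGroup G)\<lparr>carrier := H\<rparr>"
    by (simp add: Out_p_def OutGroup_def FactGroup_def)
  then have res: "residually_p_finite p ((OutGroup G)\<lparr>carrier := H\<rparr>)"
    using p_IAS_imp_residually_p_finite_Out_p[OF p ias] by simp
  let ?F = "\<lambda>\<phi>. H #>\<^bsub>OutGroup G\<^esub> \<pi> \<phi>"
  let ?\<kappa> = "induced_auto G ?K"
  have eq: "?F \<phi> = ?F \<psi>" if \<phi>: "\<phi> \<in> auto G" and \<psi>: "\<psi> \<in> auto G" and e: "?\<kappa> \<phi> = ?\<kappa> \<psi>" for \<phi> \<psi>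
  proof -
    have c: "\<phi> \<in> carrier (AutoGroup G)" "\<psi> \<in> carrier (AutoGroup G)" using \<phi> \<psi> by simp_all
    have "?\<kappa> (\<phi> \<otimes>\<^bsub>AutoGroup G\<^esub> inv\<^bsub>AutoGroup G\<^esub> \<psi>) = \<one>\<^bsub>AutoGroup (G Mod ?K)\<^esub>"
      unfolding i.hom_mult[OF c(1) A.inv_closed[OF c(2)]] i.hom_inv[OF c(2)] e
      by (rule i.H.r_inv[OF i.hom_closed[OF c(2)]])
    then have "\<phi> \<otimes>\<^bsub>AutoGroup G\<^esub> inv\<^bsub>AutoGroup G\<^esub> \<psi> \<in> Aut_p p G"
      using A.m_closed[OF c(1) A.inv_closed[OF c(2)]] by (simp add: Aut_p_def kernel_def)
    then have "\<pi> (\<phi> \<otimes>\<^bsub>AutoGroup G\<^esub> inv\<^bsub>AutoGroup G\<^esub> \<psi>) \<in> H" unfolding H_def by blast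
    then have "\<pi> \<phi> \<otimes>\<^bsub>OutGroup G\<^esub> inv\<^bsub>OutGroup G\<^esub> \<pi> \<psi> \<in> H"
      unfolding \<pi>.hom_mult[OF c(1) A.inv_closed[OF c(2)]] \<pi>.hom_inv[OF c(2)] .
    then have "\<pi> \<phi> \<in> ?F \<psi>"
      using subgroup.rcos_module[OF H O.is_group \<pi>.hom_closed[OF c(2)] \<pi>.hom_closed[OF c(1)]] by blast
    then show ?thesis using O.repr_independence[OF _ \<pi>.hom_closed[OF c(2)] H] by blast
  qed
  have "rcosets\<^bsub>OutGroup G\<^esub> H \<subseteq> (\<lambda>k. ?F (inv_into (auto G) ?\<kappa> k)) ` (?\<kappa> ` auto G)"
  proof
    fix C assume "C \<in> rcosets\<^bsub>OutGroup G\<^esub> H"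
    then obtain \<omega> where "\<omega> \<in> carrier (OutGroup G)" "C = H #>\<^bsub>OutGroup G\<^esub> \<omega>" by (auto simp: RCOSETS_def)
    then obtain \<phi> where \<phi>: "\<phi> \<in> auto G" "C = ?F \<phi>"
      unfolding OutGroup_def carrier_FactGroup \<pi>_def by auto
    have "inv_into (auto G) ?\<kappa> (?\<kappa> \<phi>) \<in> auto G" "?\<kappa> (inv_into (auto G) ?\<kappa> (?\<kappa> \<phi>)) = ?\<kappa> \<phi>"
      using inv_into_into[of "?\<kappa> \<phi>" ?\<kappa> "auto G"] f_inv_into_f[of "?\<kappa> \<phi>" ?\<kappa> "auto G"] \<phi>(1) by blast+
    then have "C = ?F (inv_into (auto G) ?\<kappa> (?\<kappa> \<phi>))" unfolding \<phi>(2) using eq[OF _ \<phi>(1)] by metis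
    then show "C \<in> (\<lambda>k. ?F (inv_into (auto G) ?\<kappa> k)) ` (?\<kappa> ` auto G)" using \<phi>(1) by blast
  qed
  moreover have "?\<kappa> ` auto G \<subseteq> auto (G Mod ?K)" using i.hom_closed by auto
  then have "finite (?\<kappa> ` auto G)"
    using finite_auto[OF finite_quotient_K_p[OF p fg]] finite_subset by blast
  ultimately have "finite (rcosets\<^bsub>OutGroup G\<^esub> H)" using finite_subset by blast
  then show ?thesis
    unfolding virtually_residually_p_finite_def using O.is_group H res by blast
qed

theorem corollary1p7:
  fixes p :: nat
    and V :: "'v set"
    and E :: "'v set set"
    and G :: "'v \<Rightarrow> ('a, 'b) monoid_scheme"
  assumes "Factorial_Ring.prime p"
    and "finite V"
    and "simplicial_graph V E"
    and "\<And>v. v \<in> V \<Longrightarrow> group (G v)"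
    and "\<And>v. v \<in> V \<Longrightarrow> carrier (G v) \<noteq> {\<one>\<^bsub>G v\<^esub>}"
    and "\<And>v. v \<in> V \<Longrightarrow> finitely_generated_group (G v)"
    and "\<And>v. v \<in> V \<Longrightarrow> residually_p_finite p (G v)"
    and "\<And>v. central_vertex V E v \<Longrightarrow> p_IAS p (G v)"
  shows "p_IAS p (graph_product V E G) \<and>
         residually_p_finite p (Out_p p (graph_product V E G)) \<and>
         virtually_residually_p_finite p (OutGroup (graph_product V E G))"
proof -
  interpret residual_graph_prod V E G p
    by (intro residual_graph_prod.intro residual_graph_prod_axioms.intro graph_prod.intro
        graph_prod_axioms.intro simplicial.intro) (fact assms)+
  have fg: "finitely_generated_group (graph_product V E G)"
    by (rule finitely_generated_graph_product[OF assms(2,6)])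
  have ias: "p_IAS p (graph_product V E G)"
    by (rule GP.p_IASI[OF assms(1) fg]) (rule approximately_inner_imp_inner[OF _ assms(5,8)])
  show ?thesis
    using ias GP.p_IAS_imp_residually_p_finite_Out_p[OF assms(1) ias]
      GP.p_IAS_imp_virtually_residually_p_finite_OutGroup[OF assms(1) fg ias] by blast
qed

end
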